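(* Consider the hidden Markov model $(X_k,Y_k)_{k\ge0}$, its nonlinear filter $(\pi_k)_{k\ge0}$, and approximate filters $(\pi^N_k)_{k\ge0}$, $N\in\mathbb N$, as in the context, and suppose the nondegeneracy, ergodicity and approximation assumptions stated there hold. Suppose moreover: (1) (one step convergence) for any bounded continuous $F:E\times\mathcal P(E)\to\mathbb R$ and any $x_N\to x$ in $E$, $\nu_N\Rightarrow\nu$ in $\mathcal P(E)$ as $N\to\infty$, $$\int F(x',\nu')\,\mathsf\Pi_N(x_N,\nu_N,dx',d\nu')\longrightarrow\int F(x',\nu')\,\mathsf\Pi(x,\nu,dx',d\nu')\qquad(N\to\infty),$$ and in addition $M_N\Rightarrow M$ as $N\to\infty$; (2) (tightness) for any sequence $T_N\nearrow\infty$, the family of probability measures $$\Xi_N(A)=\mathbf E\left[\frac1{T_N}\sum_{k=1}^{T_N}\pi^N_k(A)\right],\qquad N\ge1,$$ on $E$ is tight. Then $$\lim_{N\to\infty}\ \sup_{T\ge1}\ \mathbf E\left[\frac1T\sum_{k=1}^T\|\pi^N_k-\pi_k\|_{\rm BL}\right]=0 .$$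
   Context: Model. $E$ and $F$ are Polish spaces with Borel $\sigma$-fields; $P:E\times\mathcal B(E)\to[0,1]$ and $\Phi:E\times\mathcal B(F)\to[0,1]$ are transition probability kernels; $\mu$ is a probability measure on $E$. $(X_k,Y_k)_{k\ge0}$ is a hidden Markov model on $(\Omega,\mathcal F,\mathbf P)$: $(X_k)$ is a Markov chain with initial law $\mu$ and transition kernel $P$, and $(Y_k)$ are conditionally independent given $(X_k)$ with $\mathbf P(Y_n\in A|X_n)=\Phi(X_n,A)$. $\mathcal F^Y_k=\sigma\{Y_0,\dots,Y_k\}$. $\mathcal P(E)$ is the space of probability measures on $E$ with the weak convergence topology ($\Rightarrow$ denotes weak convergence) and its Borel $\sigma$-field. $d$ is a fixed complete metric generating the topology of $E$; $\|\nu-\nu'\|_{\rm BL}=\sup\{|\int f\,d\nu-\int f\,d\nu'|:\|f\|_\infty\le1,\ f\text{ is }1\text{-Lipschitz}\}$ and $\|\nu-\nu'\|_{\rm TV}=\sup_{\|f\|_\infty\le1}|\int f\,d\nu-\int f\,d\nu'|$. $T_N\nearrow\infty$ means a nondecreasing sequence of positive integers tending to infinity. Nondegeneracy assumption: there are a $\sigma$-finite measure $\varphi$ on $F$ and a strictly positive measurable $\Upsilon:E\times F\to(0,\infty)$ with $\Phi(x,A)=\int_A\Upsilon(x,y)\,\varphi(dy)$ for all $x\in E$, $A\in\mathcal B(F)$. Ergodicity assumption: there is a (unique) $P$-invariant $\lambda\in\mathcal P(E)$ such that $\|\nu P^k-\lambda\|_{\rm TV}\to0$ as $k\to\infty$ for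 every $\nu\in\mathcal P(E)$. Exact filter: $\mathsf U(y,\pi)(A)=\int_A\Upsilon(x,y)\,\pi(dx)\big/\int\Upsilon(x,y)\,\pi(dx)$ for $y\in F$, $\pi\in\mathcal P(E)$ (for given $\pi$ the denominator is finite for $\varphi$-a.e. $y$; elsewhere the value is immaterial). The filter is $\pi_0=\mathsf U(Y_0,\mu)$, $\pi_k=\mathsf U(Y_k,\pi_{k-1}P)$; it is a version of the conditional law of $X_k$ given $Y_0,\dots,Y_k$. $\mathsf\Pi$ and $M$ are the transition kernel and initial law on $E\times\mathcal P(E)$ given by $$\int f\,d\mathsf\Pi(x,\pi,\cdot)=\int f(x',\mathsf U(y,\pi P))\,\Upsilon(x',y)\,\varphi(dy)\,P(x,dx'),\qquad \int f\,dM=\int f(x,\mathsf U(y,\mu))\,\Upsilon(x,y)\,\varphi(dy)\,\mu(dx).$$ Approximation assumption: for every $N\in\mathbb N$, (a) $(\pi^N_k)_{k\ge0}$ is a $\mathcal P(E)$-valued process adapted to $\mathcal F^Y_k\vee\mathcal G$, where $\mathcal G$ is a $\sigma$-field independent of $(X_k,Y_k)_{k\ge0}$; (b) $(X_k,\pi^N_k)_{k\ge0}$ is a Markov process with transition kernel $\mathsf\Pi_N$ and initial measure $M_N$ on $E\times\mathcal P(E)$. *)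

theory Defs
  imports "HOL-Probability.Probability"
begin

section \<open>Borel probability measures with the topology of weak convergence\<close>

typedef (overloaded) ('a::topological_space) prob_meas =
    "{\<nu> :: 'a measure. prob_space \<nu> \<and> sets \<nu> = sets borel}"
  morphisms meas_of prob_meas_of
proof
  show "return borel undefined \<in> {\<nu> :: 'a measure. prob_space \<nu> \<and> sets \<nu> = sets borel}"
    by (simp add: prob_space_return)
qed

text \<open>
  The topology is the coarsest one that makes \<open>\<nu> \<mapsto> \<integral>f d\<nu>\<close> continuous for all bounded continuous
  real functions \<open>f\<close>. With this instance, \<open>borel\<close> at type \<open>'a prob_meas\<close> is the Borel
  sigma-field of the weak topology, and \<open>\<nu>s \<longlonglongrightarrow> \<nu>\<close> is weak convergence.
\<close>

instantiation prob_meas :: (topological_space) topological_space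
begin

definition open_prob_meas :: "'a prob_meas set \<Rightarrow> bool" where
  "open_prob_meas = generate_topology
     {{\<nu>. (\<integral>x. f x \<partial>meas_of \<nu>) \<in> U} | (f :: 'a \<Rightarrow> real) U.
        continuous_on UNIV f \<and> bounded (range f) \<and> open U}"

instance
proof
  show "open (UNIV :: 'a prob_meas set)"
    unfolding open_prob_meas_def by (rule generate_topology.UNIV)
  show "open (S \<inter> T)" if "open S" "open T" for S T :: "'a prob_meas set"
    using that unfolding open_prob_meas_def by (rule generate_topology.Int)
  show "open (\<Union>K)" if "\<forall>S\<in>K. open S" for K :: "'a prob_meas set set"
    using that unfolding open_prob_meas_def by (intro generate_topology.UN) blast
qed

end

lemma tendsto_prob_meas_iff:
  fixes \<nu> :: "'a::topological_space prob_meas"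
  shows "(\<nu>s \<longlongrightarrow> \<nu>) F \<longleftrightarrow>
    (\<forall>f :: 'a \<Rightarrow> real. continuous_on UNIV f \<and> bounded (range f) \<longrightarrow>
       ((\<lambda>i. \<integral>x. f x \<partial>meas_of (\<nu>s i)) \<longlongrightarrow> (\<integral>x. f x \<partial>meas_of \<nu>)) F)" (is "_ \<longleftrightarrow> ?R")
proof
  assume L: "(\<nu>s \<longlongrightarrow> \<nu>) F"
  show ?R
  proof (intro allI impI topological_tendstoI)
    fix f :: "'a \<Rightarrow> real" and U
    assume f: "continuous_on UNIV f \<and> bounded (range f)"
      and U: "open U" "(\<integral>x. f x \<partial>meas_of \<nu>) \<in> U"
    have "open {\<nu>. (\<integral>x. f x \<partial>meas_of \<nu>) \<in> U}"
      unfolding open_prob_meas_def using f U(1) by (intro generate_topology.Basis) blast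
    from topological_tendstoD[OF L this] U(2)
    show "\<forall>\<^sub>F i in F. (\<integral>x. f x \<partial>meas_of (\<nu>s i)) \<in> U" by simp
  qed
next
  assume R: ?R
  show "(\<nu>s \<longlongrightarrow> \<nu>) F"
  proof (rule topological_tendstoI)
    fix S :: "'a prob_meas set" assume "open S" "\<nu> \<in> S"
    then show "\<forall>\<^sub>F i in F. \<nu>s i \<in> S"
      unfolding open_prob_meas_def
    proof (induction S rule: generate_topology.induct)
      case (Basis S)
      then obtain f :: "'a \<Rightarrow> real" and U
        where *: "continuous_on UNIV f \<and> bounded (range f)" "open U"
          and S: "S = {\<nu>. (\<integral>x. f x \<partial>meas_of \<nu>) \<in> U}" by blast
      have "(\<integral>x. f x \<partial>meas_of \<nu>) \<in> U" using Basis S by simp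
      with topological_tendstoD[OF R[rule_format, OF *(1)] *(2)]
      show ?case unfolding S by simp
    next
      case (UN K)
      then obtain k where "k \<in> K" "\<nu> \<in> k" by blast
      with UN have "\<forall>\<^sub>F i in F. \<nu>s i \<in> k" by blast
      then show ?case using \<open>k \<in> K\<close> by (auto elim: eventually_mono)
    qed (auto simp: eventually_conj_iff)
  qed
qed

definition tv_dist :: "'a::topological_space prob_meas \<Rightarrow> 'a prob_meas \<Rightarrow> real" where
  "tv_dist \<nu> \<nu>' =
     (SUP f\<in>{f \<in> borel_measurable borel. \<forall>x. \<bar>f x\<bar> \<le> 1}.
        \<bar>(\<integral>x. f x \<partial>meas_of \<nu>) - (\<integral>x. f x \<partial>meas_of \<nu>')\<bar>)"

definition bl_dist :: "'a::metric_space prob_meas \<Rightarrow> 'a prob_meas \<Rightarrow> real" where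
  "bl_dist \<nu> \<nu>' =
     (SUP f\<in>{f. (\<forall>x. \<bar>f x\<bar> \<le> 1) \<and> lipschitz_on 1 UNIV f}.
        \<bar>(\<integral>x. f x \<partial>meas_of \<nu>) - (\<integral>x. f x \<partial>meas_of \<nu>')\<bar>)"

definition tight_family :: "'a::topological_space measure set \<Rightarrow> bool" where
  "tight_family \<K> \<longleftrightarrow> (\<forall>\<epsilon>>0. \<exists>K. compact K \<and> (\<forall>\<nu>\<in>\<K>. measure \<nu> K > 1 - \<epsilon>))"


section \<open>Markov chains and hidden Markov models\<close>

definition sigma_gen :: "'o measure \<Rightarrow> (nat \<Rightarrow> 'o \<Rightarrow> 'a::topological_space) \<Rightarrow> nat set \<Rightarrow> 'o measure" where
  "sigma_gen \<Omega> Z I = sigma (space \<Omega>) (\<Union>i\<in>I. {Z i -` A \<inter> space \<Omega> | A. A \<in> sets borel})"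

definition cprob :: "'o measure \<Rightarrow> 'o measure \<Rightarrow> 'o set \<Rightarrow> 'o \<Rightarrow> real" where
  "cprob \<Omega> \<G> B = real_cond_exp \<Omega> \<G> (indicator B)"

text \<open>The Markov property refers to the natural filtration of the process.\<close>

definition markov_chain ::
    "'o measure \<Rightarrow> 'a::topological_space prob_meas \<Rightarrow> ('a \<Rightarrow> 'a measure) \<Rightarrow> (nat \<Rightarrow> 'o \<Rightarrow> 'a) \<Rightarrow> bool" where
  "markov_chain \<Omega> \<mu> K Z \<longleftrightarrow>
     (\<forall>k. Z k \<in> borel_measurable \<Omega>) \<and>
     distr \<Omega> borel (Z 0) = meas_of \<mu> \<and>
     (\<forall>k. \<forall>A\<in>sets borel. AE \<omega> in \<Omega>.
        cprob \<Omega> (sigma_gen \<Omega> Z {..k}) {\<omega> \<in> space \<Omega>. Z (Suc k) \<omega> \<in> A} \<omega>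
          = measure (K (Z k \<omega>)) A)"

text \<open>
  The conditional law of \<open>Y n\<close> is taken given the whole signal \<open>(X k)\<^sub>k\<close>: conditioning on \<open>X n\<close>
  alone would still allow \<open>Y n\<close> to depend on \<open>X (Suc n)\<close>.
\<close>

definition hidden_markov_model ::
    "'o measure \<Rightarrow> 'e::topological_space prob_meas \<Rightarrow> ('e \<Rightarrow> 'e measure) \<Rightarrow>
     ('e \<Rightarrow> 'f::topological_space measure) \<Rightarrow> (nat \<Rightarrow> 'o \<Rightarrow> 'e) \<Rightarrow> (nat \<Rightarrow> 'o \<Rightarrow> 'f) \<Rightarrow> bool" where
  "hidden_markov_model \<Omega> \<mu> P \<Phi> X Y \<longleftrightarrow>
     markov_chain \<Omega> \<mu> P X \<and>
     (\<forall>k. Y k \<in> borel_measurable \<Omega>) \<and>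
     (\<forall>J A. finite J \<and> (\<forall>i\<in>J. A i \<in> sets borel) \<longrightarrow>
        (AE \<omega> in \<Omega>.
           cprob \<Omega> (sigma_gen \<Omega> X UNIV) {\<omega> \<in> space \<Omega>. \<forall>i\<in>J. Y i \<omega> \<in> A i} \<omega>
             = (\<Prod>i\<in>J. cprob \<Omega> (sigma_gen \<Omega> X UNIV) {\<omega> \<in> space \<Omega>. Y i \<omega> \<in> A i} \<omega>))) \<and>
     (\<forall>n. \<forall>A\<in>sets borel. AE \<omega> in \<Omega>.
        cprob \<Omega> (sigma_gen \<Omega> X UNIV) {\<omega> \<in> space \<Omega>. Y n \<omega> \<in> A} \<omega> = measure (\<Phi> (X n \<omega>)) A)"

definition kernel_step :: "('a::topological_space \<Rightarrow> 'a measure) \<Rightarrow> 'a prob_meas \<Rightarrow> 'a prob_meas" where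
  "kernel_step P \<nu> = prob_meas_of (meas_of \<nu> \<bind> P)"

definition nondegenerate_observations ::
    "('e::topological_space \<Rightarrow> 'f::topological_space measure) \<Rightarrow> 'f measure \<Rightarrow> ('e \<Rightarrow> 'f \<Rightarrow> real) \<Rightarrow> bool" where
  "nondegenerate_observations \<Phi> \<phi> \<Upsilon> \<longleftrightarrow>
     sets \<phi> = sets borel \<and> sigma_finite_measure \<phi> \<and>
     (\<lambda>(x, y). \<Upsilon> x y) \<in> borel_measurable (borel \<Otimes>\<^sub>M borel) \<and>
     (\<forall>x y. \<Upsilon> x y > 0) \<and>
     (\<forall>x. \<forall>A\<in>sets borel. emeasure (\<Phi> x) A = (\<integral>\<^sup>+y\<in>A. ennreal (\<Upsilon> x y) \<partial>\<phi>))"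

text \<open>Uniqueness of the invariant measure is a consequence of the convergence.\<close>

definition ergodic_kernel :: "('a::topological_space \<Rightarrow> 'a measure) \<Rightarrow> bool" where
  "ergodic_kernel P \<longleftrightarrow>
     (\<exists>l. kernel_step P l = l \<and>
        (\<forall>\<nu>. (\<lambda>k. tv_dist ((kernel_step P ^^ k) \<nu>) l) \<longlonglongrightarrow> 0))"


section \<open>The nonlinear filter\<close>

text \<open>Where the normalizing integral is infinite, the value is arbitrarily chosen as \<open>\<pi>\<close>.\<close>

definition bayes_update ::
    "('e::topological_space \<Rightarrow> 'f \<Rightarrow> real) \<Rightarrow> 'f \<Rightarrow> 'e prob_meas \<Rightarrow> 'e prob_meas" where
  "bayes_update \<Upsilon> y \<pi> =
     (let Z = (\<integral>\<^sup>+x. ennreal (\<Upsilon> x y) \<partial>meas_of \<pi>) in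
      if Z < \<infinity> then prob_meas_of (density (meas_of \<pi>) (\<lambda>x. ennreal (\<Upsilon> x y) / Z)) else \<pi>)"

primrec nonlinear_filter ::
    "('e::topological_space \<Rightarrow> 'f \<Rightarrow> real) \<Rightarrow> ('e \<Rightarrow> 'e measure) \<Rightarrow> 'e prob_meas \<Rightarrow>
     (nat \<Rightarrow> 'o \<Rightarrow> 'f) \<Rightarrow> nat \<Rightarrow> 'o \<Rightarrow> 'e prob_meas" where
  "nonlinear_filter \<Upsilon> P \<mu> Y 0 = (\<lambda>\<omega>. bayes_update \<Upsilon> (Y 0 \<omega>) \<mu>)"
| "nonlinear_filter \<Upsilon> P \<mu> Y (Suc k) =
     (\<lambda>\<omega>. bayes_update \<Upsilon> (Y (Suc k) \<omega>) (kernel_step P (nonlinear_filter \<Upsilon> P \<mu> Y k \<omega>)))"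

text \<open>
  The law of \<open>(x, bayes_update \<Upsilon> y \<rho>)\<close> when \<open>(x, y)\<close> has law \<open>\<Upsilon> x y \<phi>(dy) \<nu>(dx)\<close>.
\<close>

definition update_law ::
    "('e::topological_space \<Rightarrow> 'f \<Rightarrow> real) \<Rightarrow> 'f measure \<Rightarrow> 'e measure \<Rightarrow> 'e prob_meas \<Rightarrow>
     ('e \<times> 'e prob_meas) measure" where
  "update_law \<Upsilon> \<phi> \<nu> \<rho> =
     distr (density (\<nu> \<Otimes>\<^sub>M \<phi>) (\<lambda>(x, y). ennreal (\<Upsilon> x y))) borel
       (\<lambda>(x, y). (x, bayes_update \<Upsilon> y \<rho>))"

definition filter_kernel ::
    "('e::topological_space \<Rightarrow> 'f \<Rightarrow> real) \<Rightarrow> 'f measure \<Rightarrow> ('e \<Rightarrow> 'e measure) \<Rightarrow>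
     'e \<times> 'e prob_meas \<Rightarrow> ('e \<times> 'e prob_meas) measure" where
  "filter_kernel \<Upsilon> \<phi> P = (\<lambda>(x, \<pi>). update_law \<Upsilon> \<phi> (P x) (kernel_step P \<pi>))"

definition filter_init ::
    "('e::topological_space \<Rightarrow> 'f \<Rightarrow> real) \<Rightarrow> 'f measure \<Rightarrow> 'e prob_meas \<Rightarrow>
     ('e \<times> 'e prob_meas) prob_meas" where
  "filter_init \<Upsilon> \<phi> \<mu> = prob_meas_of (update_law \<Upsilon> \<phi> (meas_of \<mu>) \<mu>)"


section \<open>Approximate filters\<close>

definition approximate_filter ::
    "'o measure \<Rightarrow> (nat \<Rightarrow> 'o \<Rightarrow> 'e::topological_space) \<Rightarrow> (nat \<Rightarrow> 'o \<Rightarrow> 'f::topological_space) \<Rightarrow> 'o measure \<Rightarrow>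
     (nat \<Rightarrow> 'o \<Rightarrow> 'e prob_meas) \<Rightarrow> ('e \<times> 'e prob_meas) prob_meas \<Rightarrow>
     ('e \<times> 'e prob_meas \<Rightarrow> ('e \<times> 'e prob_meas) measure) \<Rightarrow> bool" where
  "approximate_filter \<Omega> X Y \<G> p m K \<longleftrightarrow>
     subalgebra \<Omega> \<G> \<and>
     prob_space.indep_set \<Omega> (sets \<G>) (sets (sigma_gen \<Omega> (\<lambda>k \<omega>. (X k \<omega>, Y k \<omega>)) UNIV)) \<and>
     (\<forall>k. p k \<in> borel_measurable
        (sigma (space \<Omega>) (sets (sigma_gen \<Omega> Y {..k}) \<union> sets \<G>))) \<and>
     K \<in> borel \<rightarrow>\<^sub>M prob_algebra borel \<and>
     markov_chain \<Omega> m K (\<lambda>k \<omega>. (X k \<omega>, p k \<omega>))"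

definition mean_occupation ::
    "'o measure \<Rightarrow> (nat \<Rightarrow> 'o \<Rightarrow> 'e::topological_space prob_meas) \<Rightarrow> nat \<Rightarrow> 'e measure" where
  "mean_occupation \<Omega> p T = measure_of UNIV (sets borel)
     (\<lambda>A. ennreal (\<integral>\<omega>. (1 / real T) * (\<Sum>k=1..T. measure (meas_of (p k \<omega>)) A) \<partial>\<Omega>))"

end

theory Submission
  imports Defs
begin

text \<open>
  For a continuous test function \<open>f\<close> with values in \<open>[0, 1]\<close>, conditioning on the observations and on the
  independent randomness of the approximation gives
  \<open>E (\<pi>\<^sup>N\<^sub>k f - \<pi>\<^sub>k f)\<^sup>2 = E F\<^sub>0 (X\<^sub>k, \<pi>\<^sup>N\<^sub>k) + E (\<pi>\<^sub>k f)\<^sup>2\<close> with \<open>F\<^sub>0 (x, \<nu>) = (\<nu> f)\<^sup>2 - 2 f(x) \<nu> f\<close>.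
  Nondegeneracy and total variation ergodicity make the filter forget its initial law: applying the exact
  kernel \<open>m\<close> times to \<open>F\<^sub>0\<close> yields functions \<open>F\<^sub>m\<close> that tend pointwise to \<open>- c\<close>, where \<open>c = lim E (\<pi>\<^sub>k f)\<^sup>2\<close>
  for every initial law. Along \<open>T\<^sub>N \<longlonglongrightarrow> \<infinity>\<close> the occupation laws of \<open>(X\<^sub>k, \<pi>\<^sup>N\<^sub>k)\<close> are tight. The average of
  \<open>E F\<^sub>0\<close> changes by \<open>O(m / T\<^sub>N)\<close> if the \<open>N\<close>-th kernel is applied \<open>m\<close> times, and these iterates converge
  continuously to \<open>F\<^sub>m\<close>; so a limit law \<open>\<Lambda>\<close> of the occupation laws satisfies \<open>lim = \<Lambda> F\<^sub>m\<close> for all \<open>m\<close>, whence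
  the averages tend to \<open>- c\<close> and the mean square errors to \<open>0\<close>. For bounded times the errors vanish by
  continuous convergence alone, and a time at which the error is large must tend to infinity with \<open>N\<close>.
  The bounded Lipschitz distance is controlled by finitely many test functions because the laws of the
  signal are tight.
\<close>

section \<open>Unnormalised filters\<close>

text \<open>The obstacle is forgetting: total variation ergodicity concerns the unobserved chain,
  and passing to the chain given its observations amounts to exchanging an intersection and a
  supremum of sigma-fields. Here filters are unnormalised, and the expected square of an estimate
  becomes the integral of a^2/b, convex and homogeneous in (a, b). \<open>D j m \<mu>\<close> is the
  gain in expected square when the state at time j is revealed. Averaged over the invariant law it
  is a difference of two terms of one convergent sequence, so from some point x it is small along
  infinitely many m, for every j. For large j the law of X_j from x is close to the invariant law,
  and strict positivity of \<Upsilon> allows the first j observations to be dropped at the price of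
  a constant that does not depend on m. Thus the gap closes for the invariant law. Limits of
  expected squares are then proportional to mass, and the defect of subadditivity, which controls
  the distance of two filters, vanishes. On P(E) no metric is chosen: limit passages use a countable
  subbasis and continuous functions approximating indicators of open sets from below.\<close>

definition fmeas :: "'a::topological_space measure \<Rightarrow> bool" where
  "fmeas \<mu> \<longleftrightarrow> finite_measure \<mu> \<and> sets \<mu> = sets borel"

lemma fmeasD:
  assumes "fmeas \<mu>"
  shows "finite_measure \<mu>" "sets \<mu> = sets borel" "space \<mu> = UNIV" "emeasure \<mu> A < \<infinity>"
  using assms sets_eq_imp_space_eq[of \<mu> borel] finite_measure.emeasure_finite[of \<mu> A]
  by (auto simp: fmeas_def less_top[symmetric])

lemma measurable_fmeas:
  assumes "fmeas \<mu>"
  shows "measurable \<mu> N = measurable borel N"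
  using fmeasD[OF assms] by (intro measurable_cong_sets) auto

lemma fmeas_density:
  assumes "fmeas \<mu>" "(\<lambda>x. w x) \<in> borel_measurable borel" "(\<integral>\<^sup>+x. w x \<partial>\<mu>) < \<infinity>"
  shows "fmeas (density \<mu> w)"
  unfolding fmeas_def
proof (intro conjI finite_measureI)
  have [measurable]: "w \<in> borel_measurable \<mu>"
    using assms(2) by (simp add: measurable_fmeas[OF assms(1)])
  have "emeasure (density \<mu> w) (space (density \<mu> w)) = (\<integral>\<^sup>+x. w x \<partial>\<mu>)"
    by (simp add: emeasure_density cong: nn_integral_cong)
  then show "emeasure (density \<mu> w) (space (density \<mu> w)) \<noteq> \<infinity>" using assms(3) by auto
qed (simp add: fmeasD[OF assms(1)])

lemma nn_integral_swap:
  assumes "sigma_finite_measure M" "sigma_finite_measure N"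
    and "case_prod h \<in> borel_measurable (M \<Otimes>\<^sub>M N)"
  shows "(\<integral>\<^sup>+y. (\<integral>\<^sup>+x. h x y \<partial>M) \<partial>N) = (\<integral>\<^sup>+x. (\<integral>\<^sup>+y. h x y \<partial>N) \<partial>M)"
proof -
  interpret pair_sigma_finite M N using assms by (intro pair_sigma_finite.intro)
  show ?thesis by (rule Fubini'[OF assms(3)])
qed

text \<open>\<open>\<phi>\<close> is a probability measure here, so that an i.i.d. sequence of
  observations can serve as reference law. A sigma-finite \<open>\<phi>\<close> is brought to this
  form by \<open>nondegenerate_prob\<close>.\<close>

locale filter_model =
  fixes P :: "'e::polish_space \<Rightarrow> 'e measure"
    and \<phi> :: "'f::polish_space measure"
    and \<Upsilon> :: "'e \<Rightarrow> 'f \<Rightarrow> real"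
  assumes P_kernel: "P \<in> borel \<rightarrow>\<^sub>M prob_algebra borel"
    and prob_phi: "prob_space \<phi>"
    and sets_phi[measurable_cong]: "sets \<phi> = sets borel"
    and Ups_measurable: "(\<lambda>(x, y). \<Upsilon> x y) \<in> borel_measurable (borel \<Otimes>\<^sub>M borel)"
    and Ups_pos: "\<And>x y. \<Upsilon> x y > 0"
    and Ups_norm: "\<And>x. (\<integral>\<^sup>+y. ennreal (\<Upsilon> x y) \<partial>\<phi>) = 1"
begin

text \<open>Reference law of an observation sequence: i.i.d. with law \<open>\<phi>\<close>,
  whatever the signal does. Likelihoods are densities with respect to \<open>S\<close>.\<close>

definition "S = stream_space \<phi>"

lemma P_sub[measurable]: "P \<in> borel \<rightarrow>\<^sub>M subprob_algebra borel"
  by (rule measurable_prob_algebraD[OF P_kernel])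

lemma P_prob: "prob_space (P x)" "sets (P x) = sets borel" "space (P x) = UNIV"
  using measurable_space[OF P_kernel, of x] sets_eq_imp_space_eq[of "P x" borel]
  by (auto simp: space_prob_algebra)

lemma fmeas_P: "fmeas (P x)"
  using P_prob[of x] by (auto simp: fmeas_def intro: prob_space.finite_measure)

lemma Ups_meas'[measurable (raw)]:
  "g \<in> M \<rightarrow>\<^sub>M borel \<Longrightarrow> h \<in> M \<rightarrow>\<^sub>M borel \<Longrightarrow> (\<lambda>z. \<Upsilon> (g z) (h z)) \<in> borel_measurable M"
  using measurable_compose[OF measurable_Pair Ups_measurable, of g M h] by simp

lemma space_phi[simp]: "space \<phi> = UNIV"
  using sets_eq_imp_space_eq[OF sets_phi] by simp

lemma prob_S: "prob_space S"
  unfolding S_def by (rule prob_space.prob_space_stream_space[OF prob_phi])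

lemma space_S[simp]: "space S = UNIV"
  unfolding S_def space_stream_space by simp

lemma shd_measurable[measurable]: "shd \<in> S \<rightarrow>\<^sub>M borel"
  unfolding S_def using measurable_shd[of \<phi>] sets_phi by (simp cong: measurable_cong_sets)

lemma snth_measurable[measurable]: "(\<lambda>s. s !! n) \<in> S \<rightarrow>\<^sub>M borel"
  unfolding S_def using measurable_snth[of n \<phi>] sets_phi by (simp cong: measurable_cong_sets)

lemma stl_measurable[measurable]: "stl \<in> S \<rightarrow>\<^sub>M S"
  unfolding S_def using measurable_stl by simp

lemma Stream_measurable[measurable (raw)]:
  "g \<in> M \<rightarrow>\<^sub>M borel \<Longrightarrow> h \<in> M \<rightarrow>\<^sub>M S \<Longrightarrow> (\<lambda>z. g z ## h z) \<in> M \<rightarrow>\<^sub>M S"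
  unfolding S_def using measurable_Stream[of g M \<phi> h] sets_phi by (simp cong: measurable_cong_sets)

lemma nn_integral_S:
  assumes [measurable]: "f \<in> borel_measurable S"
  shows "(\<integral>\<^sup>+s. f s \<partial>S) = (\<integral>\<^sup>+y. (\<integral>\<^sup>+s. f (y ## s) \<partial>S) \<partial>\<phi>)"
  using prob_space.nn_integral_stream_space[OF prob_phi, of f] assms by (simp add: S_def)

lemma sf_phi: "sigma_finite_measure \<phi>" and sf_S: "sigma_finite_measure S"
  using prob_phi prob_S by (simp_all add: prob_space_imp_sigma_finite)

lemma sf_fmeas: "fmeas \<mu> \<Longrightarrow> sigma_finite_measure \<mu>"
  by (auto simp: fmeas_def finite_measure_def)

lemma swap_phi:
  assumes "fmeas \<mu>" "(\<lambda>(x, y). h x y) \<in> borel_measurable (borel \<Otimes>\<^sub>M borel)"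
  shows "(\<integral>\<^sup>+y. (\<integral>\<^sup>+x. h x y \<partial>\<mu>) \<partial>\<phi>) = (\<integral>\<^sup>+x. (\<integral>\<^sup>+y. h x y \<partial>\<phi>) \<partial>\<mu>)"
proof (rule nn_integral_swap[OF sf_fmeas[OF assms(1)] sf_phi])
  have "sets (\<mu> \<Otimes>\<^sub>M \<phi>) = sets (borel \<Otimes>\<^sub>M borel)"
    by (intro sets_pair_measure_cong fmeasD(2)[OF assms(1)] sets_phi)
  then show "(\<lambda>(x, y). h x y) \<in> borel_measurable (\<mu> \<Otimes>\<^sub>M \<phi>)"
    using assms(2) by (simp cong: measurable_cong_sets)
qed

lemma swap_S:
  assumes "fmeas \<mu>" "(\<lambda>(x, y). h x y) \<in> borel_measurable (borel \<Otimes>\<^sub>M S)"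
  shows "(\<integral>\<^sup>+y. (\<integral>\<^sup>+x. h x y \<partial>\<mu>) \<partial>S) = (\<integral>\<^sup>+x. (\<integral>\<^sup>+y. h x y \<partial>S) \<partial>\<mu>)"
proof (rule nn_integral_swap[OF sf_fmeas[OF assms(1)] sf_S])
  have "sets (\<mu> \<Otimes>\<^sub>M S) = sets (borel \<Otimes>\<^sub>M S)"
    by (intro sets_pair_measure_cong fmeasD(2)[OF assms(1)] refl)
  then show "(\<lambda>(x, y). h x y) \<in> borel_measurable (\<mu> \<Otimes>\<^sub>M S)"
    using assms(2) by (simp cong: measurable_cong_sets)
qed

lemma nn_integral_fmeas_measurable:
  assumes "fmeas \<mu>" "(\<lambda>(y, x). h x y) \<in> borel_measurable (N \<Otimes>\<^sub>M borel)"
  shows "(\<lambda>y. \<integral>\<^sup>+x. h x y \<partial>\<mu>) \<in> borel_measurable N"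
proof -
  have "sets (N \<Otimes>\<^sub>M \<mu>) = sets (N \<Otimes>\<^sub>M borel)"
    by (intro sets_pair_measure_cong fmeasD(2)[OF assms(1)] refl)
  then have "(\<lambda>(y, x). h x y) \<in> borel_measurable (N \<Otimes>\<^sub>M \<mu>)"
    using assms(2) by (simp cong: measurable_cong_sets)
  then show ?thesis
    by (rule sigma_finite_measure.borel_measurable_nn_integral[OF sf_fmeas[OF assms(1)]])
qed

lemma nn_integral_P_measurable[measurable (raw)]:
  assumes [measurable]: "(\<lambda>(z, x). h z x) \<in> borel_measurable (M \<Otimes>\<^sub>M borel)" "g \<in> M \<rightarrow>\<^sub>M borel"
  shows "(\<lambda>z. \<integral>\<^sup>+x. h z x \<partial>P (g z)) \<in> borel_measurable M"
  by (rule nn_integral_measurable_subprob_algebra2[OF assms(1)]) measurable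

text \<open>
  \<open>u m f x s\<close> is the unnormalised \<open>m\<close>-step filter started at the point \<open>x\<close>, tested against \<open>f\<close>,
  when the first \<open>m\<close> observations are those of the stream \<open>s\<close>.
\<close>

primrec u :: "nat \<Rightarrow> ('e \<Rightarrow> ennreal) \<Rightarrow> 'e \<Rightarrow> 'f stream \<Rightarrow> ennreal" where
  "u 0 f = (\<lambda>x s. f x)"
| "u (Suc m) f = (\<lambda>x s. \<integral>\<^sup>+x'. ennreal (\<Upsilon> x' (shd s)) * u m f x' (stl s) \<partial>P x)"

lemma u_measurable_pair:
  assumes [measurable]: "f \<in> borel_measurable borel"
  shows "(\<lambda>(x, s). u m f x s) \<in> borel_measurable (borel \<Otimes>\<^sub>M S)"
proof (induction m)
  case 0
  show ?case by simp
next
  case (Suc m)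
  have [measurable]: "(\<lambda>z. u m f (snd z) (stl (snd (fst z)))) \<in> borel_measurable ((borel \<Otimes>\<^sub>M S) \<Otimes>\<^sub>M borel)"
    using measurable_compose[OF _ Suc, of "\<lambda>z. (snd z, stl (snd (fst z)))" "(borel \<Otimes>\<^sub>M S) \<Otimes>\<^sub>M borel"]
    by simp
  show ?case
    by (simp add: split_beta')
qed

lemma u_measurable[measurable (raw)]:
  assumes [measurable]: "f \<in> borel_measurable borel"
  shows "g \<in> M \<rightarrow>\<^sub>M borel \<Longrightarrow> h \<in> M \<rightarrow>\<^sub>M S \<Longrightarrow> (\<lambda>z. u m f (g z) (h z)) \<in> borel_measurable M"
  using measurable_compose[OF measurable_Pair u_measurable_pair[OF assms], of g M h m] by simp

text \<open>Unnormalised filter from the initial measure \<mu>. With f = 1 it is the likelihood of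
  the first m observations, that is, the density of their law with respect to
  \<open>S\<close>.\<close>

definition U :: "nat \<Rightarrow> ('e \<Rightarrow> ennreal) \<Rightarrow> 'e measure \<Rightarrow> 'f stream \<Rightarrow> ennreal" where
  "U m f \<mu> s = (\<integral>\<^sup>+x. u m f x s \<partial>\<mu>)"

lemma U_measurable:
  assumes [measurable]: "f \<in> borel_measurable borel" "h \<in> M \<rightarrow>\<^sub>M S" and \<mu>: "fmeas \<mu>"
  shows "(\<lambda>z. U m f \<mu> (h z)) \<in> borel_measurable M"
  unfolding U_def by (rule nn_integral_fmeas_measurable[OF \<mu>]) measurable

definition push :: "'e measure \<Rightarrow> 'e measure" where
  "push \<mu> = \<mu> \<bind> P"

text \<open>Prediction precedes correction, so a filter started in \<mu> sees its first observation
  at time 1. The update by the observation at time 0 is kept apart and enters later through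
  \<open>dn\<close>.\<close>

definition step :: "'e measure \<Rightarrow> 'f \<Rightarrow> 'e measure" where
  "step \<mu> y = density (push \<mu>) (\<lambda>x. ennreal (\<Upsilon> x y))"

lemma nn_integral_push:
  assumes "fmeas \<mu>" "g \<in> borel_measurable borel"
  shows "(\<integral>\<^sup>+x. g x \<partial>push \<mu>) = (\<integral>\<^sup>+x. \<integral>\<^sup>+x'. g x' \<partial>P x \<partial>\<mu>)"
  unfolding push_def using assms
  by (intro nn_integral_bind[where B=borel]) (auto simp: measurable_fmeas[OF assms(1)])

lemma fmeas_push:
  assumes \<mu>: "fmeas \<mu>" shows "fmeas (push \<mu>)"
proof -
  have s: "sets (push \<mu>) = sets borel"
    unfolding push_def using fmeasD[OF \<mu>] P_prob by (intro sets_bind) auto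
  then have sp: "space (push \<mu>) = UNIV" using sets_eq_imp_space_eq[OF s] by simp
  have "emeasure (push \<mu>) UNIV = emeasure \<mu> UNIV"
    using nn_integral_push[OF \<mu>, of "\<lambda>_. 1"] sp fmeasD(3)[OF \<mu>] P_prob
    by (simp add: prob_space.emeasure_space_1[OF P_prob(1), unfolded P_prob(3)])
  then show ?thesis
    unfolding fmeas_def using s sp fmeasD(4)[OF \<mu>, of UNIV] by (auto intro!: finite_measureI)
qed

lemma push_UNIV: "fmeas \<mu> \<Longrightarrow> emeasure (push \<mu>) UNIV = emeasure \<mu> UNIV"
  using nn_integral_push[of \<mu> "\<lambda>_. 1"] fmeasD(3)[of \<mu>] fmeasD(3)[OF fmeas_push, of \<mu>] P_prob
  by (simp add: prob_space.emeasure_space_1[OF P_prob(1), unfolded P_prob(3)])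

lemma nn_integral_step:
  assumes "fmeas \<mu>" "g \<in> borel_measurable borel"
  shows "(\<integral>\<^sup>+x. g x \<partial>step \<mu> y) = (\<integral>\<^sup>+x. ennreal (\<Upsilon> x y) * g x \<partial>push \<mu>)"
proof -
  note [measurable] = assms(2)
  show ?thesis
    unfolding step_def using assms(2)
    by (intro nn_integral_density) (auto simp: measurable_fmeas[OF fmeas_push[OF assms(1)]])
qed

lemma sets_step: "fmeas \<mu> \<Longrightarrow> sets (step \<mu> y) = sets borel"
  unfolding step_def using fmeasD[OF fmeas_push] by simp

lemma space_step: "fmeas \<mu> \<Longrightarrow> space (step \<mu> y) = UNIV"
  unfolding step_def using fmeasD[OF fmeas_push] by simp

lemma step_UNIV: "fmeas \<mu> \<Longrightarrow> emeasure (step \<mu> y) UNIV = (\<integral>\<^sup>+x. ennreal (\<Upsilon> x y) \<partial>push \<mu>)"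
  using nn_integral_step[of \<mu> "\<lambda>_. 1" y] space_step[of \<mu> y] by simp

lemma step_UNIV_measurable: "fmeas \<mu> \<Longrightarrow> (\<lambda>y. emeasure (step \<mu> y) UNIV) \<in> borel_measurable borel"
  by (simp add: step_UNIV) (rule nn_integral_fmeas_measurable[OF fmeas_push], assumption, measurable)

text \<open>\<Upsilon> x is a probability density (\<open>Ups_norm\<close>), so averaging over the
  observation undoes the correction and leaves the prediction.\<close>

lemma nn_integral_step_phi:
  assumes \<mu>: "fmeas \<mu>" and [measurable]: "g \<in> borel_measurable borel"
  shows "(\<integral>\<^sup>+y. (\<integral>\<^sup>+x. g x \<partial>step \<mu> y) \<partial>\<phi>) = (\<integral>\<^sup>+x. g x \<partial>push \<mu>)"
proof -
  have "(\<integral>\<^sup>+y. (\<integral>\<^sup>+x. g x \<partial>step \<mu> y) \<partial>\<phi>) = (\<integral>\<^sup>+y. (\<integral>\<^sup>+x. ennreal (\<Upsilon> x y) * g x \<partial>push \<mu>) \<partial>\<phi>)"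
    using \<mu> by (simp add: nn_integral_step)
  also have "\<dots> = (\<integral>\<^sup>+x. (\<integral>\<^sup>+y. ennreal (\<Upsilon> x y) * g x \<partial>\<phi>) \<partial>push \<mu>)"
    by (rule swap_phi[OF fmeas_push[OF \<mu>]]) measurable
  also have "\<dots> = (\<integral>\<^sup>+x. g x \<partial>push \<mu>)"
    by (simp add: nn_integral_multc Ups_norm)
  finally show ?thesis .
qed

lemma step_UNIV_phi: "fmeas \<mu> \<Longrightarrow> (\<integral>\<^sup>+y. emeasure (step \<mu> y) UNIV \<partial>\<phi>) = emeasure \<mu> UNIV"
  using nn_integral_step_phi[of \<mu> "\<lambda>_. 1"] space_step fmeasD(3)[OF fmeas_push] push_UNIV by simp

text \<open>For exceptional y the mass may be infinite, but its \<open>\<phi>\<close>-average is the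
  finite mass of \<mu>. This is why later recursions argue for almost every y only.\<close>

lemma AE_fmeas_step:
  assumes \<mu>: "fmeas \<mu>" shows "AE y in \<phi>. fmeas (step \<mu> y)"
proof -
  have "AE y in \<phi>. emeasure (step \<mu> y) UNIV \<noteq> \<infinity>"
  proof (rule nn_integral_PInf_AE)
    show "(\<lambda>y. emeasure (step \<mu> y) UNIV) \<in> borel_measurable \<phi>"
      using step_UNIV_measurable[OF \<mu>] by measurable
    show "(\<integral>\<^sup>+y. emeasure (step \<mu> y) UNIV \<partial>\<phi>) \<noteq> \<infinity>"
      using step_UNIV_phi[OF \<mu>] fmeasD(4)[OF \<mu>, of UNIV] by auto
  qed
  then show ?thesis
  proof eventually_elim
    case (elim y)
    then show ?case
      unfolding fmeas_def using sets_step[OF \<mu>] space_step[OF \<mu>] by (auto intro!: finite_measureI)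
  qed
qed

text \<open>Consuming the first observation only replaces the initial measure by
  \<open>step \<mu> y\<close>. This makes induction on m with arbitrary \<mu> the standard method
  below.\<close>

lemma U_Suc:
  assumes \<mu>: "fmeas \<mu>" and [measurable]: "f \<in> borel_measurable borel"
  shows "U (Suc m) f \<mu> (y ## s) = U m f (step \<mu> y) s"
proof -
  have "U m f (step \<mu> y) s = (\<integral>\<^sup>+x. ennreal (\<Upsilon> x y) * u m f x s \<partial>push \<mu>)"
    unfolding U_def by (rule nn_integral_step[OF \<mu>]) measurable
  also have "\<dots> = (\<integral>\<^sup>+x. \<integral>\<^sup>+x'. ennreal (\<Upsilon> x' y) * u m f x' s \<partial>P x \<partial>\<mu>)"
    by (rule nn_integral_push[OF \<mu>]) measurable
  finally show ?thesis by (simp add: U_def)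
qed

text \<open>Each step preserves the average mass (\<open>step_UNIV_phi\<close>); almost every
  \<open>step \<mu> y\<close> is finite, so the induction hypothesis applies to it.\<close>

lemma U_mass:
  assumes "fmeas \<mu>"
  shows "(\<integral>\<^sup>+s. U m (\<lambda>_. 1) \<mu> s \<partial>S) = emeasure \<mu> UNIV"
  using assms
proof (induction m arbitrary: \<mu>)
  case 0
  then show ?case
    using prob_space.emeasure_space_1[OF prob_S] fmeasD(3)[OF 0] by (simp add: U_def)
next
  case (Suc m)
  have "(\<integral>\<^sup>+s. U (Suc m) (\<lambda>_. 1) \<mu> s \<partial>S) = (\<integral>\<^sup>+y. \<integral>\<^sup>+s. U m (\<lambda>_. 1) (step \<mu> y) s \<partial>S \<partial>\<phi>)"
    using Suc.prems by (subst nn_integral_S) (auto intro!: U_measurable simp: U_Suc)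
  also have "\<dots> = (\<integral>\<^sup>+y. emeasure (step \<mu> y) UNIV \<partial>\<phi>)"
    using AE_fmeas_step[OF Suc.prems] by (intro nn_integral_cong_AE) (auto simp: Suc.IH)
  finally show ?case using step_UNIV_phi[OF Suc.prems] by simp
qed

lemma AE_U_finite:
  assumes "fmeas \<mu>"
  shows "AE s in S. U m (\<lambda>_. 1) \<mu> s < \<infinity>"
proof -
  have "AE s in S. U m (\<lambda>_. 1) \<mu> s \<noteq> \<infinity>"
    using U_mass[OF assms] fmeasD(4)[OF assms, of UNIV] assms
    by (intro nn_integral_PInf_AE U_measurable) auto
  then show ?thesis by (auto simp: less_top[symmetric])
qed

lemma u_mono: "(\<And>x. f x \<le> g x) \<Longrightarrow> u m f x s \<le> u m g x s"
  by (induction m arbitrary: x s) (auto intro!: nn_integral_mono mult_left_mono)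

lemma U_mono: "(\<And>x. f x \<le> g x) \<Longrightarrow> U m f \<mu> s \<le> U m g \<mu> s"
  unfolding U_def by (auto intro!: nn_integral_mono u_mono)

end

text \<open>The perspective of the square: with a an unnormalised estimate and b the likelihood,
  a^2/b = b (a/b)^2 is the squared filter estimate weighted by the likelihood. It is convex and
  homogeneous of degree 1 on 0 \<le> a \<le> b, where the convention x/0 = 0 gives the right value 0
  at b = 0.\<close>

definition sqr :: "real \<Rightarrow> real \<Rightarrow> real" where
  "sqr a b = a\<^sup>2 / b"

lemma sqr_nonneg: "0 \<le> b \<Longrightarrow> 0 \<le> sqr a b"
  by (simp add: sqr_def)

lemma sqr_le:
  assumes "0 \<le> a" "a \<le> b" shows "sqr a b \<le> b"
proof (cases "b = 0")
  case False
  then have "a\<^sup>2 \<le> b * b" using assms by (auto simp: power2_eq_square intro: mult_mono)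
  then show ?thesis using False assms by (simp add: sqr_def divide_simps)
qed (simp add: sqr_def)

text \<open>Tangent planes of \<open>sqr\<close>: the difference of both sides is (a - t b)^2/b.
  Equality at t = a/b (\<open>sqr_touch\<close>) makes \<open>sqr\<close> a supremum of linear
  functions; subadditivity, Jensen's inequality and the Lipschitz bounds below all come from a
  choice of t.\<close>

lemma sqr_tangent:
  assumes "0 \<le> a" "a \<le> b" shows "2 * t * a - t\<^sup>2 * b \<le> sqr a b"
proof (cases "b = 0")
  case False
  then have b: "b > 0" using assms by simp
  have "0 \<le> (a - t * b)\<^sup>2 / b" using b by simp
  also have "\<dots> = sqr a b - (2 * t * a - t\<^sup>2 * b)"
    using b by (simp add: sqr_def field_simps power2_eq_square)
  finally show ?thesis by simp
qed (use assms in \<open>simp add: sqr_def\<close>)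

lemma sqr_touch: "0 \<le> a \<Longrightarrow> a \<le> b \<Longrightarrow> 2 * (a / b) * a - (a / b)\<^sup>2 * b = sqr a b"
  by (cases "b = 0") (auto simp: sqr_def field_simps power2_eq_square)

lemma sqr_subadd:
  assumes "0 \<le> a" "a \<le> b" "0 \<le> a'" "a' \<le> b'"
  shows "sqr (a + a') (b + b') \<le> sqr a b + sqr a' b'"
proof -
  let ?t = "(a + a') / (b + b')"
  have "sqr (a + a') (b + b') = 2 * ?t * (a + a') - ?t\<^sup>2 * (b + b')"
    using assms by (intro sqr_touch[symmetric]) auto
  also have "\<dots> = (2 * ?t * a - ?t\<^sup>2 * b) + (2 * ?t * a' - ?t\<^sup>2 * b')"
    by (simp only: distrib_left)
  also have "\<dots> \<le> sqr a b + sqr a' b'"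
    using assms by (intro add_mono sqr_tangent)
  finally show ?thesis .
qed

lemma sqr_scale: "sqr (c * a) (c * b) = c * sqr a b"
  by (cases "c = 0") (auto simp: sqr_def power2_eq_square)

lemma ratio_bounds: "0 \<le> a \<Longrightarrow> a \<le> b \<Longrightarrow> 0 \<le> a / b \<and> a / b \<le> (1::real)"
  by (cases "b = 0") (auto simp: divide_le_eq_1)

text \<open>The tangent touching at (a, b) has t = a/b in [0, 1], hence coefficients 2t and t^2 of
  size at most 2 and 1.\<close>

lemma sqr_diff_le:
  assumes "0 \<le> a" "a \<le> b" "0 \<le> a'" "a' \<le> b'"
  shows "sqr a b - sqr a' b' \<le> 2 * \<bar>a - a'\<bar> + \<bar>b - b'\<bar>"
proof -
  define t where "t = a / b"
  have t: "0 \<le> t" "t \<le> 1" using ratio_bounds[of a b] assms by (auto simp: t_def)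
  have "sqr a b = 2 * t * a - t\<^sup>2 * b" using sqr_touch[of a b] assms by (simp add: t_def)
  moreover have "2 * t * a' - t\<^sup>2 * b' \<le> sqr a' b'" using assms by (intro sqr_tangent)
  ultimately have "sqr a b - sqr a' b' \<le> 2 * t * (a - a') + t\<^sup>2 * (b' - b)"
    by (simp add: algebra_simps)
  also have "\<dots> \<le> 2 * \<bar>a - a'\<bar> + \<bar>b - b'\<bar>"
  proof (intro add_mono)
    have "t * (a - a') \<le> \<bar>t * (a - a')\<bar>" by simp
    also have "\<dots> = t * \<bar>a - a'\<bar>" unfolding abs_mult using t by simp
    also have "\<dots> \<le> \<bar>a - a'\<bar>" using t by (intro mult_left_le_one_le) auto
    finally show "2 * t * (a - a') \<le> 2 * \<bar>a - a'\<bar>" by simp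
    have t2: "0 \<le> t\<^sup>2" "t\<^sup>2 \<le> 1" using t by (auto simp: power_le_one)
    have "t\<^sup>2 * (b' - b) \<le> \<bar>t\<^sup>2 * (b' - b)\<bar>" by simp
    also have "\<dots> = t\<^sup>2 * \<bar>b' - b\<bar>" unfolding abs_mult using t2 by simp
    also have "\<dots> \<le> \<bar>b' - b\<bar>" using t2 by (intro mult_left_le_one_le) auto
    finally show "t\<^sup>2 * (b' - b) \<le> \<bar>b - b'\<bar>" by simp
  qed
  finally show ?thesis .
qed

text \<open>Again the tangent touching at (a, b): adding a' only raises it, and adding b' lowers it
  by t^2 b' \<le> b'.\<close>

lemma sqr_lower:
  assumes "0 \<le> a" "a \<le> b" "0 \<le> a'" "a' \<le> b'"
  shows "sqr a b - sqr (a + a') (b + b') \<le> b'"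
proof -
  define t where "t = a / b"
  have t: "0 \<le> t" "t \<le> 1" using ratio_bounds[of a b] assms by (auto simp: t_def)
  have "sqr a b = 2 * t * a - t\<^sup>2 * b" using sqr_touch[of a b] assms by (simp add: t_def)
  moreover have "2 * t * (a + a') - t\<^sup>2 * (b + b') \<le> sqr (a + a') (b + b')"
    using assms by (intro sqr_tangent) auto
  moreover have "0 \<le> t * a'" using t assms by simp
  moreover have "t\<^sup>2 * b' \<le> b'" using t assms by (intro mult_left_le_one_le) (auto simp: power_le_one)
  ultimately show ?thesis by (simp add: algebra_simps)
qed

text \<open>The defect of subadditivity is exactly (a/b - a'/b')^2 b b'/(b + b'), and b \<le> n b'
  gives b'/(b + b') \<ge> 1/(1 + n). Later this turns convergence of expected squares into closeness
  of two filters.\<close>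

lemma sqr_gap:
  assumes "0 \<le> a" "a \<le> b" "0 \<le> a'" "a' \<le> b'" "b \<le> n * b'" "0 \<le> n"
  shows "b * (a / b - a' / b')\<^sup>2 \<le> (1 + n) * (sqr a b + sqr a' b' - sqr (a + a') (b + b'))"
proof (cases "b = 0")
  case True
  have "0 \<le> sqr a b + sqr a' b' - sqr (a + a') (b + b')"
    using sqr_subadd[OF assms(1-4)] by simp
  then have "0 \<le> (1 + n) * (sqr a b + sqr a' b' - sqr (a + a') (b + b'))" using assms(6) by simp
  then show ?thesis using True by simp
next
  case False
  then have b: "b > 0" using assms by simp
  then have b': "b' > 0" using assms by (metis mult_zero_right not_less order.order_iff_strict order.trans)
  have "sqr a b + sqr a' b' - sqr (a + a') (b + b') = b * (a / b - a' / b')\<^sup>2 * (b' / (b + b'))"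
  proof -
    have "a / b = x \<Longrightarrow> a' / b' = y \<Longrightarrow> ?thesis" for x y
    proof -
      assume "a / b = x" "a' / b' = y"
      then have a: "a = x * b" "a' = y * b'" using b b' by auto
      have "sqr a b = x\<^sup>2 * b" "sqr a' b' = y\<^sup>2 * b'"
        using b b' by (simp_all add: a sqr_def power2_eq_square)
      moreover have "x\<^sup>2 * b + y\<^sup>2 * b' - sqr (a + a') (b + b') = b * (x - y)\<^sup>2 * (b' / (b + b'))"
        using b b' by (simp add: a sqr_def divide_simps) algebra
      ultimately show ?thesis using \<open>a / b = x\<close> \<open>a' / b' = y\<close> by simp
    qed
    then show ?thesis by blast
  qed
  moreover have "1 \<le> (1 + n) * (b' / (b + b'))"
    using b b' assms(5) by (simp add: divide_simps algebra_simps)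
  ultimately show ?thesis
    using b mult_left_mono[of 1 "(1 + n) * (b' / (b + b'))" "b * (a / b - a' / b')\<^sup>2"]
    by (simp add: algebra_simps)
qed

text \<open>Jensen's inequality for \<open>sqr\<close>: integrate the tangent whose slope is the
  ratio of the two integrals.\<close>

lemma sqr_integral_le:
  fixes a b :: "'a \<Rightarrow> ennreal"
  assumes [measurable]: "a \<in> borel_measurable M" "b \<in> borel_measurable M"
    and ab: "\<And>x. a x \<le> b x" and fin: "(\<integral>\<^sup>+x. b x \<partial>M) < \<infinity>"
  shows "ennreal (sqr (enn2real (\<integral>\<^sup>+x. a x \<partial>M)) (enn2real (\<integral>\<^sup>+x. b x \<partial>M)))
    \<le> (\<integral>\<^sup>+x. ennreal (sqr (enn2real (a x)) (enn2real (b x))) \<partial>M)"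
proof -
  have fin_a: "(\<integral>\<^sup>+x. a x \<partial>M) < \<infinity>"
    using nn_integral_mono[of M a b] ab fin by (meson order.strict_trans1)
  have AEb: "AE x in M. b x < \<infinity>"
    using nn_integral_PInf_AE[of b M] fin by (auto simp: less_top[symmetric])
  have AEa: "AE x in M. a x < \<infinity>"
    using AEb ab by (auto elim!: eventually_mono intro: order.strict_trans1)
  have nb: "(\<integral>\<^sup>+x. ennreal (enn2real (b x)) \<partial>M) = (\<integral>\<^sup>+x. b x \<partial>M)"
    using AEb by (intro nn_integral_cong_AE) auto
  have na: "(\<integral>\<^sup>+x. ennreal (enn2real (a x)) \<partial>M) = (\<integral>\<^sup>+x. a x \<partial>M)"
    using AEa by (intro nn_integral_cong_AE) auto
  have ib: "integrable M (\<lambda>x. enn2real (b x))"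
    using nb fin by (intro integrableI_nonneg) auto
  have ia: "integrable M (\<lambda>x. enn2real (a x))"
    using na fin_a by (intro integrableI_nonneg) auto
  have ea: "enn2real (\<integral>\<^sup>+x. a x \<partial>M) = (\<integral>x. enn2real (a x) \<partial>M)"
    using na by (simp add: integral_eq_nn_integral)
  have eb: "enn2real (\<integral>\<^sup>+x. b x \<partial>M) = (\<integral>x. enn2real (b x) \<partial>M)"
    using nb by (simp add: integral_eq_nn_integral)
  have le: "AE x in M. 0 \<le> enn2real (a x) \<and> enn2real (a x) \<le> enn2real (b x)"
    using AEb ab by (auto elim!: eventually_mono intro!: enn2real_mono)
  let ?h = "\<lambda>x. sqr (enn2real (a x)) (enn2real (b x))"
  have ih: "integrable M ?h"
  proof (rule Bochner_Integration.integrable_bound[OF ib])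
    show "?h \<in> borel_measurable M" by (simp add: sqr_def)
    show "AE x in M. norm (?h x) \<le> norm (enn2real (b x))"
      using le by eventually_elim (auto simp: sqr_le sqr_nonneg)
  qed
  define A where "A = (\<integral>x. enn2real (a x) \<partial>M)"
  define B where "B = (\<integral>x. enn2real (b x) \<partial>M)"
  have AB: "0 \<le> A" "A \<le> B"
    unfolding A_def B_def using le by (auto intro!: integral_mono_AE ia ib integral_nonneg_AE)
  let ?t = "A / B"
  have "sqr A B = 2 * ?t * A - ?t\<^sup>2 * B" using sqr_touch[OF AB] by simp
  also have "\<dots> = (\<integral>x. 2 * ?t * enn2real (a x) - ?t\<^sup>2 * enn2real (b x) \<partial>M)"
    unfolding A_def B_def using ia ib by (subst Bochner_Integration.integral_diff) auto
  also have "\<dots> \<le> (\<integral>x. ?h x \<partial>M)"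
  proof (rule integral_mono_AE)
    show "AE x in M. 2 * ?t * enn2real (a x) - ?t\<^sup>2 * enn2real (b x) \<le> ?h x"
      using le by eventually_elim (intro sqr_tangent, auto)
  qed (use ia ib ih in auto)
  finally have "ennreal (sqr A B) \<le> ennreal (\<integral>x. ?h x \<partial>M)" by (rule ennreal_leI)
  also have "\<dots> = (\<integral>\<^sup>+x. ennreal (?h x) \<partial>M)"
    using ih by (intro nn_integral_eq_integral[symmetric]) (auto simp: sqr_nonneg)
  finally show ?thesis unfolding ea eb A_def B_def .
qed

text \<open>Sums and multiples of measures are recorded through their integrals, which is all that
  \<open>U\<close>, \<open>Im\<close> and the later functionals see.\<close>

definition is_sum :: "'a::topological_space measure \<Rightarrow> 'a measure \<Rightarrow> 'a measure \<Rightarrow> bool" where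
  "is_sum \<mu> \<mu>1 \<mu>2 \<longleftrightarrow> (\<forall>g\<in>borel_measurable borel. (\<integral>\<^sup>+x. g x \<partial>\<mu>) = (\<integral>\<^sup>+x. g x \<partial>\<mu>1) + (\<integral>\<^sup>+x. g x \<partial>\<mu>2))"

definition is_scaled :: "real \<Rightarrow> 'a::topological_space measure \<Rightarrow> 'a measure \<Rightarrow> bool" where
  "is_scaled c \<mu>' \<mu> \<longleftrightarrow> 0 \<le> c \<and> (\<forall>g\<in>borel_measurable borel. (\<integral>\<^sup>+x. g x \<partial>\<mu>') = ennreal c * (\<integral>\<^sup>+x. g x \<partial>\<mu>))"

abbreviation rt :: "ennreal \<Rightarrow> ennreal \<Rightarrow> real" where
  "rt a b \<equiv> sqr (enn2real a) (enn2real b)"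

lemma rt_measurable[measurable (raw)]:
  assumes [measurable]: "a \<in> borel_measurable M" "b \<in> borel_measurable M"
  shows "(\<lambda>x. rt (a x) (b x)) \<in> borel_measurable M"
  unfolding sqr_def by measurable

section \<open>Expected squares of filter estimates\<close>

locale filter_test = filter_model P \<phi> \<Upsilon>
  for P :: "'e::polish_space \<Rightarrow> 'e measure" and \<phi> :: "'f::polish_space measure"
    and \<Upsilon> :: "'e \<Rightarrow> 'f \<Rightarrow> real" +
  fixes f :: "'e \<Rightarrow> ennreal"
  assumes f_meas[measurable]: "f \<in> borel_measurable borel"
    and f_le_1: "\<And>x. f x \<le> 1"
begin

abbreviation Uf :: "nat \<Rightarrow> 'e measure \<Rightarrow> 'f stream \<Rightarrow> ennreal" where "Uf m \<mu> s \<equiv> U m f \<mu> s"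
abbreviation U1 :: "nat \<Rightarrow> 'e measure \<Rightarrow> 'f stream \<Rightarrow> ennreal" where "U1 m \<mu> s \<equiv> U m (\<lambda>_. 1) \<mu> s"

lemma Uf_le: "Uf m \<mu> s \<le> U1 m \<mu> s"
  by (rule U_mono[OF f_le_1])

lemma Uf_meas[measurable (raw)]: "fmeas \<mu> \<Longrightarrow> h \<in> M \<rightarrow>\<^sub>M S \<Longrightarrow> (\<lambda>z. Uf m \<mu> (h z)) \<in> borel_measurable M"
  and U1_meas[measurable (raw)]: "fmeas \<mu> \<Longrightarrow> h \<in> M \<rightarrow>\<^sub>M S \<Longrightarrow> (\<lambda>z. U1 m \<mu> (h z)) \<in> borel_measurable M"
  by (auto intro!: U_measurable)

lemma AE_Uf_U1:
  assumes "fmeas \<mu>"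
  shows "AE s in S. U1 m \<mu> s < \<infinity> \<and> Uf m \<mu> s < \<infinity> \<and> 0 \<le> enn2real (Uf m \<mu> s) \<and> enn2real (Uf m \<mu> s) \<le> enn2real (U1 m \<mu> s)"
  using AE_U_finite[OF assms, of m]
proof eventually_elim
  case (elim s)
  then show ?case using Uf_le[of m \<mu> s] by (auto intro!: enn2real_mono intro: order.strict_trans1)
qed

lemma
  assumes "fmeas \<mu>"
  shows integrable_U1: "integrable S (\<lambda>s. enn2real (U1 m \<mu> s))"
    and integral_U1: "(\<integral>s. enn2real (U1 m \<mu> s) \<partial>S) = measure \<mu> UNIV"
proof -
  have *: "(\<integral>\<^sup>+s. ennreal (enn2real (U1 m \<mu> s)) \<partial>S) = emeasure \<mu> UNIV"
    unfolding U_mass[OF assms, symmetric, of m]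
    using AE_U_finite[OF assms, of m] by (intro nn_integral_cong_AE) (auto elim!: eventually_mono)
  show "integrable S (\<lambda>s. enn2real (U1 m \<mu> s))"
    using * fmeasD(4)[OF assms, of UNIV] assms by (intro integrableI_nonneg) auto
  show "(\<integral>s. enn2real (U1 m \<mu> s) \<partial>S) = measure \<mu> UNIV"
    using assms by (subst integral_eq_nn_integral) (auto simp: * measure_def)
qed

text \<open>For a probability measure \<mu> this is the expected square of the estimate of f(X_m)
  from the observations at times 1 to m, for the chain started in \<mu>, because \<open>U1\<close>
  is the density of these observations.\<close>

definition Im :: "nat \<Rightarrow> 'e measure \<Rightarrow> real" where
  "Im m \<mu> = (\<integral>s. rt (Uf m \<mu> s) (U1 m \<mu> s) \<partial>S)"

lemma rt_U_bounds:
  assumes "fmeas \<mu>"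
  shows "AE s in S. 0 \<le> rt (Uf m \<mu> s) (U1 m \<mu> s) \<and> rt (Uf m \<mu> s) (U1 m \<mu> s) \<le> enn2real (U1 m \<mu> s)"
  using AE_Uf_U1[OF assms, of m] by eventually_elim (auto simp: sqr_nonneg sqr_le)

lemma integrable_rt:
  assumes "fmeas \<mu>"
  shows "integrable S (\<lambda>s. rt (Uf m \<mu> s) (U1 m \<mu> s))"
proof (rule Bochner_Integration.integrable_bound[OF integrable_U1[OF assms, of m]])
  show "AE s in S. norm (rt (Uf m \<mu> s) (U1 m \<mu> s)) \<le> norm (enn2real (U1 m \<mu> s))"
    using rt_U_bounds[OF assms, of m] by eventually_elim auto
qed (use assms in measurable)

lemma Im_nonneg: "0 \<le> Im m \<mu>"
  unfolding Im_def by (auto intro!: integral_nonneg_AE simp: sqr_nonneg)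

lemma Im_le:
  assumes "fmeas \<mu>" shows "Im m \<mu> \<le> measure \<mu> UNIV"
  unfolding Im_def integral_U1[OF assms, symmetric, of m]
  using rt_U_bounds[OF assms, of m]
  by (intro integral_mono_AE integrable_rt integrable_U1 assms) (auto elim!: eventually_mono)

lemma U_sum:
  assumes "is_sum \<mu> \<mu>1 \<mu>2" "g \<in> borel_measurable borel"
  shows "U m g \<mu> s = U m g \<mu>1 s + U m g \<mu>2 s"
proof -
  note [measurable] = assms(2)
  have "(\<lambda>x. u m g x s) \<in> borel_measurable borel" by measurable
  with assms(1) show ?thesis unfolding U_def is_sum_def by blast
qed

lemma U_scaled:
  assumes "is_scaled c \<mu>' \<mu>" "g \<in> borel_measurable borel"
  shows "U m g \<mu>' s = ennreal c * U m g \<mu> s"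
proof -
  note [measurable] = assms(2)
  have "(\<lambda>x. u m g x s) \<in> borel_measurable borel" by measurable
  with assms(1) show ?thesis unfolding U_def is_scaled_def by blast
qed

lemma AE_enn2real_sum:
  assumes \<mu>: "fmeas \<mu>1" "fmeas \<mu>2" and sum: "is_sum \<mu> \<mu>1 \<mu>2"
  shows "AE s in S. enn2real (Uf m \<mu> s) = enn2real (Uf m \<mu>1 s) + enn2real (Uf m \<mu>2 s) \<and>
      enn2real (U1 m \<mu> s) = enn2real (U1 m \<mu>1 s) + enn2real (U1 m \<mu>2 s)"
  using AE_Uf_U1[OF \<mu>(1), of m] AE_Uf_U1[OF \<mu>(2), of m]
proof eventually_elim
  case (elim s)
  then show ?case by (simp add: U_sum[OF sum] enn2real_plus)
qed

text \<open>Pointwise \<open>sqr_subadd\<close>. In terms of estimation, not knowing which component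
  of a mixture the chain started from loses information.\<close>

lemma Im_subadd:
  assumes \<mu>: "fmeas \<mu>1" "fmeas \<mu>2" "fmeas \<mu>" and sum: "is_sum \<mu> \<mu>1 \<mu>2"
  shows "Im m \<mu> \<le> Im m \<mu>1 + Im m \<mu>2"
proof -
  have "Im m \<mu> \<le> (\<integral>s. rt (Uf m \<mu>1 s) (U1 m \<mu>1 s) + rt (Uf m \<mu>2 s) (U1 m \<mu>2 s) \<partial>S)"
    unfolding Im_def
  proof (rule integral_mono_AE)
    show "AE s in S. rt (Uf m \<mu> s) (U1 m \<mu> s) \<le> rt (Uf m \<mu>1 s) (U1 m \<mu>1 s) + rt (Uf m \<mu>2 s) (U1 m \<mu>2 s)"
      using AE_enn2real_sum[OF \<mu>(1,2) sum, of m] AE_Uf_U1[OF \<mu>(1), of m] AE_Uf_U1[OF \<mu>(2), of m]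
      by eventually_elim (auto intro!: sqr_subadd)
  qed (auto intro!: integrable_rt \<mu>)
  then show ?thesis unfolding Im_def by (simp add: integrable_rt \<mu>)
qed

lemma Im_lower:
  assumes \<mu>: "fmeas \<mu>1" "fmeas \<mu>2" "fmeas \<mu>" and sum: "is_sum \<mu> \<mu>1 \<mu>2"
  shows "Im m \<mu>1 \<le> Im m \<mu> + measure \<mu>2 UNIV"
proof -
  have "Im m \<mu>1 \<le> (\<integral>s. rt (Uf m \<mu> s) (U1 m \<mu> s) + enn2real (U1 m \<mu>2 s) \<partial>S)"
    unfolding Im_def
  proof (rule integral_mono_AE)
    show "AE s in S. rt (Uf m \<mu>1 s) (U1 m \<mu>1 s) \<le> rt (Uf m \<mu> s) (U1 m \<mu> s) + enn2real (U1 m \<mu>2 s)"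
      using AE_enn2real_sum[OF \<mu>(1,2) sum, of m] AE_Uf_U1[OF \<mu>(1), of m] AE_Uf_U1[OF \<mu>(2), of m]
    proof eventually_elim
      case (elim s)
      then show ?case
        using sqr_lower[of "enn2real (Uf m \<mu>1 s)" "enn2real (U1 m \<mu>1 s)" "enn2real (Uf m \<mu>2 s)" "enn2real (U1 m \<mu>2 s)"]
        by auto
    qed
  qed (auto intro!: integrable_rt integrable_U1 \<mu>)
  then show ?thesis
    unfolding integral_U1[OF \<mu>(2), symmetric, of m] unfolding Im_def by (simp add: integrable_rt integrable_U1 \<mu>)
qed

lemma Im_scaled:
  assumes "is_scaled c \<mu>' \<mu>"
  shows "Im m \<mu>' = c * Im m \<mu>"
proof -
  have c: "0 \<le> c" using assms by (simp add: is_scaled_def)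
  show ?thesis
    unfolding Im_def using c by (simp add: U_scaled[OF assms] enn2real_mult sqr_scale)
qed

text \<open>Transfers the disintegration of \<open>S\<close> along its first entry from nonnegative
  to real integrands: \<open>integral_S\<close> follows by Fubini.\<close>

lemma distr_Stream: "distr (\<phi> \<Otimes>\<^sub>M S) S (\<lambda>(y, s). y ## s) = S"
proof (rule measure_eqI)
  fix A assume "A \<in> sets (distr (\<phi> \<Otimes>\<^sub>M S) S (\<lambda>(y, s). y ## s))"
  then have A[measurable]: "A \<in> sets S" by simp
  interpret S: sigma_finite_measure S by (rule sf_S)
  have "emeasure (distr (\<phi> \<Otimes>\<^sub>M S) S (\<lambda>(y, s). y ## s)) A = (\<integral>\<^sup>+s. indicator A s \<partial>distr (\<phi> \<Otimes>\<^sub>M S) S (\<lambda>(y, s). y ## s))"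
    by simp
  also have "\<dots> = (\<integral>\<^sup>+z. indicator A (fst z ## snd z) \<partial>(\<phi> \<Otimes>\<^sub>M S))"
    by (subst nn_integral_distr) (auto simp: split_beta')
  also have "\<dots> = (\<integral>\<^sup>+y. \<integral>\<^sup>+s. indicator A (y ## s) \<partial>S \<partial>\<phi>)"
    by (subst S.nn_integral_fst[symmetric]) auto
  also have "\<dots> = emeasure S A"
    by (subst nn_integral_S[symmetric]) auto
  finally show "emeasure (distr (\<phi> \<Otimes>\<^sub>M S) S (\<lambda>(y, s). y ## s)) A = emeasure S A" .
qed simp

lemma integral_S:
  fixes h :: "'f stream \<Rightarrow> real"
  assumes h: "integrable S h"
  shows "(\<integral>s. h s \<partial>S) = (\<integral>y. (\<integral>s. h (y ## s) \<partial>S) \<partial>\<phi>)"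
    and "integrable \<phi> (\<lambda>y. \<integral>s. h (y ## s) \<partial>S)"
proof -
  interpret pair_sigma_finite \<phi> S using sf_phi sf_S by (intro pair_sigma_finite.intro)
  have [measurable]: "h \<in> borel_measurable S" using h by auto
  have "integrable (distr (\<phi> \<Otimes>\<^sub>M S) S (\<lambda>(y, s). y ## s)) h" using h distr_Stream by simp
  then have i: "integrable (\<phi> \<Otimes>\<^sub>M S) (\<lambda>(y, s). h (y ## s))"
    by (subst (asm) integrable_distr_eq) (auto simp: split_beta')
  have "(\<integral>s. h s \<partial>S) = (\<integral>s. h s \<partial>distr (\<phi> \<Otimes>\<^sub>M S) S (\<lambda>(y, s). y ## s))"
    by (simp add: distr_Stream)
  also have "\<dots> = (\<integral>(y, s). h (y ## s) \<partial>(\<phi> \<Otimes>\<^sub>M S))"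
    by (subst integral_distr) (auto simp: split_beta')
  also have "\<dots> = (\<integral>y. (\<integral>s. h (y ## s) \<partial>S) \<partial>\<phi>)"
    using integral_fst'[OF i] by simp
  finally show "(\<integral>s. h s \<partial>S) = (\<integral>y. (\<integral>s. h (y ## s) \<partial>S) \<partial>\<phi>)" .
  show "integrable \<phi> (\<lambda>y. \<integral>s. h (y ## s) \<partial>S)"
    using integrable_fst'[OF i] by simp
qed

lemma Im_Suc:
  assumes "fmeas \<mu>"
  shows "Im (Suc m) \<mu> = (\<integral>y. Im m (step \<mu> y) \<partial>\<phi>)"
    and "integrable \<phi> (\<lambda>y. Im m (step \<mu> y))"
  using integral_S[OF integrable_rt[OF assms, of "Suc m"]]
  unfolding Im_def by (simp_all add: U_Suc[OF assms])

lemma ennreal_Im: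
  assumes "fmeas \<mu>"
  shows "ennreal (Im m \<mu>) = (\<integral>\<^sup>+s. ennreal (rt (Uf m \<mu> s) (U1 m \<mu> s)) \<partial>S)"
  unfolding Im_def by (rule nn_integral_eq_integral[symmetric, OF integrable_rt[OF assms]]) (simp add: sqr_nonneg)

text \<open>Expected square of the estimate when the initial state is known to be x.\<close>

definition \<alpha> :: "nat \<Rightarrow> 'e \<Rightarrow> real" where
  "\<alpha> m x = Im m (return borel x)"

lemma fmeas_return: "fmeas (return borel x)"
  unfolding fmeas_def using prob_space.finite_measure[OF prob_space_return, of x borel] by simp

lemma U_return: "g \<in> borel_measurable borel \<Longrightarrow> U m g (return borel x) s = u m g x s"
  unfolding U_def by (subst nn_integral_return) auto

lemma alpha_bounds: "0 \<le> \<alpha> m x" "\<alpha> m x \<le> 1"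
  using Im_nonneg Im_le[OF fmeas_return, of m x] by (auto simp: \<alpha>_def measure_return)

lemma alpha_measurable[measurable]: "\<alpha> m \<in> borel_measurable borel"
  unfolding \<alpha>_def Im_def
  by (simp add: U_return)
     (rule sigma_finite_measure.borel_measurable_lebesgue_integral[OF sf_S], simp add: split_beta', measurable)

text \<open>Jensen over the initial state: revealing it cannot decrease the expected square.\<close>

lemma Im_le_alpha:
  assumes \<mu>: "fmeas \<mu>"
  shows "Im m \<mu> \<le> (\<integral>x. \<alpha> m x \<partial>\<mu>)"
proof -
  have "ennreal (Im m \<mu>) = (\<integral>\<^sup>+s. ennreal (rt (Uf m \<mu> s) (U1 m \<mu> s)) \<partial>S)"
    by (rule ennreal_Im[OF \<mu>])
  also have "\<dots> \<le> (\<integral>\<^sup>+s. (\<integral>\<^sup>+x. ennreal (rt (u m f x s) (u m (\<lambda>_. 1) x s)) \<partial>\<mu>) \<partial>S)"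
  proof (rule nn_integral_mono_AE, use AE_U_finite[OF \<mu>, of m] in eventually_elim)
    case (elim s)
    have "(\<lambda>x. u m f x s) \<in> borel_measurable \<mu>" "(\<lambda>x. u m (\<lambda>_. 1) x s) \<in> borel_measurable \<mu>"
      by (simp_all add: measurable_fmeas[OF \<mu>])
    then show ?case
      using elim f_le_1 unfolding U_def by (intro sqr_integral_le) (auto intro: u_mono)
  qed
  also have "\<dots> = (\<integral>\<^sup>+x. (\<integral>\<^sup>+s. ennreal (rt (u m f x s) (u m (\<lambda>_. 1) x s)) \<partial>S) \<partial>\<mu>)"
    by (rule swap_S[OF \<mu>]) measurable
  also have "\<dots> = (\<integral>\<^sup>+x. ennreal (\<alpha> m x) \<partial>\<mu>)"
    unfolding \<alpha>_def by (simp add: ennreal_Im[OF fmeas_return] U_return)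
  also have "\<dots> = ennreal (\<integral>x. \<alpha> m x \<partial>\<mu>)"
    using fmeasD[OF \<mu>] alpha_bounds
    by (intro nn_integral_eq_integral finite_measure.integrable_const_bound[where B=1])
       (auto simp: measurable_fmeas[OF \<mu>])
  finally show ?thesis
    using alpha_bounds by (subst (asm) ennreal_le_iff) (auto intro!: integral_nonneg_AE)
qed

text \<open>\<open>push \<mu>\<close> is the \<open>\<phi>\<close>-average of the measures
  \<open>step \<mu> y\<close>, so Jensen's inequality over y applies: ignoring the observation at
  time 1 cannot increase the expected square.\<close>

lemma Im_push_le:
  assumes \<mu>: "fmeas \<mu>"
  shows "Im m (push \<mu>) \<le> Im (Suc m) \<mu>"
proof -
  have U_eq: "U m g (push \<mu>) s = (\<integral>\<^sup>+y. U m g (step \<mu> y) s \<partial>\<phi>)" if [measurable]: "g \<in> borel_measurable borel" for g s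
    unfolding U_def by (rule nn_integral_step_phi[OF \<mu>, symmetric]) measurable
  have [measurable]: "(\<lambda>(y, s). U m g (step \<mu> y) s) \<in> borel_measurable (\<phi> \<Otimes>\<^sub>M S)"
    if [measurable]: "g \<in> borel_measurable borel" for g
    unfolding U_Suc[OF \<mu> that, symmetric] split_beta'
    by (rule U_measurable[OF that _ \<mu>]) measurable
  have [measurable]: "(\<lambda>y. U m g (step \<mu> y) s) \<in> borel_measurable \<phi>"
    if [measurable]: "g \<in> borel_measurable borel" for g s
    unfolding U_Suc[OF \<mu> that, symmetric] split_beta'
    by (rule U_measurable[OF that _ \<mu>]) measurable
  have "ennreal (Im m (push \<mu>)) = (\<integral>\<^sup>+s. ennreal (rt (Uf m (push \<mu>) s) (U1 m (push \<mu>) s)) \<partial>S)"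
    by (rule ennreal_Im[OF fmeas_push[OF \<mu>]])
  also have "\<dots> \<le> (\<integral>\<^sup>+s. (\<integral>\<^sup>+y. ennreal (rt (Uf m (step \<mu> y) s) (U1 m (step \<mu> y) s)) \<partial>\<phi>) \<partial>S)"
  proof (rule nn_integral_mono_AE, use AE_U_finite[OF fmeas_push[OF \<mu>], of m] in eventually_elim)
    case (elim s)
    then show ?case
      unfolding U_eq[OF f_meas] U_eq[OF borel_measurable_const] by (intro sqr_integral_le) (auto intro: Uf_le)
  qed
  also have "\<dots> = (\<integral>\<^sup>+y. (\<integral>\<^sup>+s. ennreal (rt (Uf m (step \<mu> y) s) (U1 m (step \<mu> y) s)) \<partial>S) \<partial>\<phi>)"
    by (rule nn_integral_swap[OF sf_phi sf_S]) measurable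
  also have "\<dots> = (\<integral>\<^sup>+s. ennreal (rt (Uf (Suc m) \<mu> s) (U1 (Suc m) \<mu> s)) \<partial>S)"
    using \<mu> by (subst nn_integral_S) (auto simp: U_Suc)
  also have "\<dots> = ennreal (Im (Suc m) \<mu>)" by (rule ennreal_Im[OF \<mu>, symmetric])
  finally show ?thesis using Im_nonneg by (simp add: ennreal_le_iff)
qed

end

section \<open>Forgetting of the initial law\<close>

text \<open>A bound with a free \<delta> instead of a supremum. The functions tested later (sections
  of the unnormalised filter, \<open>pj\<close> and indicators) all take values in [0, 1].\<close>

definition tvle :: "real \<Rightarrow> 'a::topological_space measure \<Rightarrow> 'a measure \<Rightarrow> bool" where
  "tvle \<delta> \<mu> \<mu>' \<longleftrightarrow> (\<forall>\<psi>\<in>borel_measurable borel. (\<forall>x. 0 \<le> \<psi> x \<and> \<psi> x \<le> (1::real)) \<longrightarrow> \<bar>(\<integral>x. \<psi> x \<partial>\<mu>) - (\<integral>x. \<psi> x \<partial>\<mu>')\<bar> \<le> \<delta>)"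

lemma is_sum_density:
  assumes "fmeas \<eta>" "w\<^sub>1 \<in> borel_measurable borel" "w\<^sub>2 \<in> borel_measurable borel"
    and "\<And>x. w x = w\<^sub>1 x + w\<^sub>2 x"
  shows "is_sum (density \<eta> w) (density \<eta> w\<^sub>1) (density \<eta> w\<^sub>2)"
  unfolding is_sum_def
proof
  fix g :: "'a \<Rightarrow> ennreal" assume "g \<in> borel_measurable borel"
  note [measurable] = this assms(2,3)
  have w: "w = (\<lambda>x. w\<^sub>1 x + w\<^sub>2 x)" using assms(4) by auto
  have "(\<integral>\<^sup>+x. g x \<partial>density \<eta> w) = (\<integral>\<^sup>+x. w\<^sub>1 x * g x + w\<^sub>2 x * g x \<partial>\<eta>)"
    unfolding w by (subst nn_integral_density) (auto simp: measurable_fmeas[OF assms(1)] distrib_right)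
  also have "\<dots> = (\<integral>\<^sup>+x. g x \<partial>density \<eta> w\<^sub>1) + (\<integral>\<^sup>+x. g x \<partial>density \<eta> w\<^sub>2)"
    by (simp add: nn_integral_add nn_integral_density measurable_fmeas[OF assms(1)])
  finally show "(\<integral>\<^sup>+x. g x \<partial>density \<eta> w) = (\<integral>\<^sup>+x. g x \<partial>density \<eta> w\<^sub>1) + (\<integral>\<^sup>+x. g x \<partial>density \<eta> w\<^sub>2)" .
qed

lemma is_scaled_density:
  assumes "fmeas \<eta>" "w \<in> borel_measurable borel" "0 \<le> c"
  shows "is_scaled c (density \<eta> (\<lambda>x. ennreal c * w x)) (density \<eta> w)"
  unfolding is_scaled_def using assms(2,3)
  by (auto simp: nn_integral_density measurable_fmeas[OF assms(1)] nn_integral_cmult[symmetric] mult.assoc)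

lemma is_sum_restrict:
  assumes "fmeas \<eta>" "B \<in> sets borel"
  shows "is_sum \<eta> (density \<eta> (indicator B)) (density \<eta> (indicator (- B)))"
proof -
  have "is_sum (density \<eta> (\<lambda>_. 1)) (density \<eta> (indicator B)) (density \<eta> (indicator (- B)))"
    using assms by (intro is_sum_density) (auto split: split_indicator)
  then show ?thesis by (simp add: density_1)
qed

lemma fmeas_restrict: "fmeas \<eta> \<Longrightarrow> B \<in> sets borel \<Longrightarrow> fmeas (density \<eta> (indicator B))"
  using fmeasD(4)[of \<eta> B] by (intro fmeas_density) (auto simp: fmeasD)

lemma measure_restrict: "fmeas \<eta> \<Longrightarrow> B \<in> sets borel \<Longrightarrow> measure (density \<eta> (indicator B)) UNIV = measure \<eta> B"
  unfolding measure_def by (subst emeasure_density) (auto simp: fmeasD measurable_fmeas)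

section \<open>The gain from revealing the state at time j\<close>

context filter_test
begin

primrec pj :: "nat \<Rightarrow> ('e \<Rightarrow> ennreal) \<Rightarrow> 'e \<Rightarrow> ennreal" where
  "pj 0 g = g"
| "pj (Suc j) g = (\<lambda>x. \<integral>\<^sup>+x'. pj j g x' \<partial>P x)"

lemma pj_measurable[measurable]: "g \<in> borel_measurable borel \<Longrightarrow> pj j g \<in> borel_measurable borel"
  by (induction j) simp_all

lemma pj_le:
  assumes "\<And>x. g x \<le> 1" shows "pj j g x \<le> 1"
proof (induction j arbitrary: x)
  case (Suc j)
  have "(\<integral>\<^sup>+x'. pj j g x' \<partial>P x) \<le> (\<integral>\<^sup>+x'. 1 \<partial>P x)" by (intro nn_integral_mono Suc)
  also have "\<dots> = 1" using prob_space.emeasure_space_1[OF P_prob(1)[of x]] by simp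
  finally show ?case by simp
qed (use assms in auto)

lemma pj_push:
  "fmeas \<mu> \<Longrightarrow> g \<in> borel_measurable borel \<Longrightarrow> (\<integral>\<^sup>+x. pj (Suc j) g x \<partial>\<mu>) = (\<integral>\<^sup>+x. pj j g x \<partial>push \<mu>)"
  by (simp add: nn_integral_push)

lemma fmeas_push_pow: "fmeas \<mu> \<Longrightarrow> fmeas ((push ^^ j) \<mu>)"
  by (induction j) (auto intro: fmeas_push)

lemma pj_push_pow:
  "fmeas \<mu> \<Longrightarrow> g \<in> borel_measurable borel \<Longrightarrow> (\<integral>\<^sup>+x. pj j g x \<partial>\<mu>) = (\<integral>\<^sup>+x. g x \<partial>(push ^^ j) \<mu>)"
  by (induction j arbitrary: \<mu>) (auto simp: pj_push fmeas_push funpow_swap1 simp del: pj.simps(2))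

text \<open>Expected square when the state at time j is revealed and the next m observations are
  used; by the Markov property the observations at times 1 to j would then add nothing. Only P^j
  acts on \<mu>, so \<open>A\<close> is additive in \<mu>.\<close>

definition A :: "nat \<Rightarrow> nat \<Rightarrow> 'e measure \<Rightarrow> real" where
  "A j m \<mu> = enn2real (\<integral>\<^sup>+x. pj j (\<lambda>x. ennreal (\<alpha> m x)) x \<partial>\<mu>)"

text \<open>The gain from revealing the state at time j in addition to the observations at times 1
  to m + j.\<close>

definition D :: "nat \<Rightarrow> nat \<Rightarrow> 'e measure \<Rightarrow> real" where
  "D j m \<mu> = A j m \<mu> - Im (m + j) \<mu>"

lemma pja_le: "pj j (\<lambda>x. ennreal (\<alpha> m x)) x \<le> 1"
  using alpha_bounds(2)[of m] by (intro pj_le) (metis ennreal_1 ennreal_leI)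

lemma pja_meas: "(\<lambda>x. pj j (\<lambda>x. ennreal (\<alpha> m x)) x) \<in> borel_measurable borel"
  by simp

lemma A_finite: "fmeas \<mu> \<Longrightarrow> (\<integral>\<^sup>+x. pj j (\<lambda>x. ennreal (\<alpha> m x)) x \<partial>\<mu>) \<le> emeasure \<mu> UNIV"
  using nn_integral_mono[of \<mu> "pj j (\<lambda>x. ennreal (\<alpha> m x))" "\<lambda>_. 1"] pja_le fmeasD(3)[of \<mu>] by simp

lemma A_finite': "fmeas \<mu> \<Longrightarrow> (\<integral>\<^sup>+x. pj j (\<lambda>x. ennreal (\<alpha> m x)) x \<partial>\<mu>) < \<infinity>"
  using A_finite[of \<mu> j m] fmeasD(4)[of \<mu> UNIV] by (meson order.strict_trans1)

lemma A_nonneg: "0 \<le> A j m \<mu>" by (simp add: A_def)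

lemma A_le: "fmeas \<mu> \<Longrightarrow> A j m \<mu> \<le> measure \<mu> UNIV"
  unfolding A_def measure_def using fmeasD(4)[of \<mu> UNIV] by (intro enn2real_mono A_finite) auto

lemma A_Suc: "fmeas \<mu> \<Longrightarrow> A (Suc j) m \<mu> = A j m (push \<mu>)"
  unfolding A_def by (subst pj_push) auto

lemma A_pow: "fmeas \<mu> \<Longrightarrow> A j m \<mu> = A 0 m ((push ^^ j) \<mu>)"
  unfolding A_def by (subst pj_push_pow) auto

lemma A_sum: "fmeas \<mu>1 \<Longrightarrow> fmeas \<mu>2 \<Longrightarrow> is_sum \<mu> \<mu>1 \<mu>2 \<Longrightarrow> A j m \<mu> = A j m \<mu>1 + A j m \<mu>2"
  using pja_meas A_finite' unfolding A_def is_sum_def by (simp add: enn2real_plus)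

lemma A_scaled: "is_scaled c \<mu>' \<mu> \<Longrightarrow> A j m \<mu>' = c * A j m \<mu>"
  using pja_meas unfolding A_def is_scaled_def by (simp add: enn2real_mult)

lemma A_step:
  assumes \<mu>: "fmeas \<mu>"
  shows "A j m (push \<mu>) = (\<integral>y. A j m (step \<mu> y) \<partial>\<phi>)" "integrable \<phi> (\<lambda>y. A j m (step \<mu> y))"
proof -
  have eq: "(\<integral>\<^sup>+y. (\<integral>\<^sup>+x. pj j (\<lambda>x. ennreal (\<alpha> m x)) x \<partial>step \<mu> y) \<partial>\<phi>) = (\<integral>\<^sup>+x. pj j (\<lambda>x. ennreal (\<alpha> m x)) x \<partial>push \<mu>)"
    by (rule nn_integral_step_phi[OF \<mu>]) simp
  have [measurable]: "(\<lambda>y. \<integral>\<^sup>+x. pj j (\<lambda>x. ennreal (\<alpha> m x)) x \<partial>step \<mu> y) \<in> borel_measurable \<phi>"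
    unfolding nn_integral_step[OF \<mu> pja_meas] by (rule nn_integral_fmeas_measurable[OF fmeas_push[OF \<mu>]]) measurable
  have nn: "(\<integral>\<^sup>+y. ennreal (A j m (step \<mu> y)) \<partial>\<phi>) = (\<integral>\<^sup>+x. pj j (\<lambda>x. ennreal (\<alpha> m x)) x \<partial>push \<mu>)"
    unfolding eq[symmetric] A_def
    using AE_fmeas_step[OF \<mu>] A_finite' by (intro nn_integral_cong_AE) (auto elim!: eventually_mono)
  show "integrable \<phi> (\<lambda>y. A j m (step \<mu> y))"
    using nn A_finite'[OF fmeas_push[OF \<mu>], of j m]
    by (intro integrableI_nonneg) (auto simp: A_nonneg A_def)
  show "A j m (push \<mu>) = (\<integral>y. A j m (step \<mu> y) \<partial>\<phi>)"
    using nn by (subst integral_eq_nn_integral) (auto simp: A_def)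
qed

lemma D_Suc:
  assumes "fmeas \<mu>"
  shows "D (Suc j) m \<mu> = (\<integral>y. D j m (step \<mu> y) \<partial>\<phi>)" "integrable \<phi> (\<lambda>y. D j m (step \<mu> y))"
  unfolding D_def using A_step[OF assms, of j m] Im_Suc[OF assms, of "m + j"] A_Suc[OF assms, of j m]
  by auto

text \<open>\<open>D_Suc\<close> consumes the observations one by one until j = 0, where the claim
  is \<open>Im_le_alpha\<close>.\<close>

lemma D_nonneg: "fmeas \<mu> \<Longrightarrow> 0 \<le> D j m \<mu>"
proof (induction j arbitrary: \<mu>)
  case 0
  have "(\<integral>x. \<alpha> m x \<partial>\<mu>) = A 0 m \<mu>"
    unfolding A_def using alpha_bounds by (subst integral_eq_nn_integral) (auto simp: measurable_fmeas[OF 0])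
  then show ?case using Im_le_alpha[OF 0, of m] by (simp add: D_def)
next
  case (Suc j)
  show ?case unfolding D_Suc[OF Suc.prems]
    using AE_fmeas_step[OF Suc.prems] Suc.IH by (intro integral_nonneg_AE) (auto elim!: eventually_mono)
qed

text \<open>\<open>A\<close> is additive and \<open>Im\<close> subadditive, so \<open>D\<close> is
  superadditive. In the upper bound the removed component costs its mass once through
  \<open>A\<close> and once through \<open>Im_lower\<close>.\<close>

lemma D_sum:
  assumes "fmeas \<mu>1" "fmeas \<mu>2" "fmeas \<mu>" "is_sum \<mu> \<mu>1 \<mu>2"
  shows "D j m \<mu>1 + D j m \<mu>2 \<le> D j m \<mu>" "D j m \<mu> \<le> D j m \<mu>1 + 2 * measure \<mu>2 UNIV"
  using A_sum[OF assms(1,2,4), of j m] Im_subadd[OF assms, of "m + j"] Im_lower[OF assms, of "m + j"]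
    A_le[OF assms(2), of j m]
  unfolding D_def by linarith+

lemma D_scaled: "is_scaled c \<mu>' \<mu> \<Longrightarrow> D j m \<mu>' = c * D j m \<mu>"
  unfolding D_def by (simp add: A_scaled[of c] Im_scaled[of c] algebra_simps)

text \<open>
  \<open>D\<close> is superadditive and homogeneous, hence a lower bound of the density makes it comparable.
\<close>

lemma D_density_bound:
  assumes \<eta>: "fmeas \<eta>" and [measurable]: "w \<in> borel_measurable borel" and \<eta>w: "fmeas (density \<eta> w)"
    and B[measurable]: "B \<in> sets borel" and n: "0 \<le> n" "\<And>x. x \<in> B \<Longrightarrow> 1 \<le> ennreal n * w x"
  shows "D j m \<eta> \<le> n * D j m (density \<eta> w) + 2 * measure \<eta> (- B)"
proof -
  let ?nw = "density \<eta> (\<lambda>x. ennreal n * w x)" and ?r = "\<lambda>x. ennreal n * w x - indicator B x"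
  have w: "ennreal n * w x = indicator B x + ?r x" for x
    using n(2)[of x] by (auto split: split_indicator simp: ennreal_diff_add_assoc add_diff_inverse_ennreal)
  have wf: "(\<integral>\<^sup>+x. w x \<partial>\<eta>) < \<infinity>"
    using fmeasD(4)[OF \<eta>w, of UNIV] by (auto simp: emeasure_density measurable_fmeas[OF \<eta>] fmeasD(2)[OF \<eta>])
  have nwf: "(\<integral>\<^sup>+x. ennreal n * w x \<partial>\<eta>) < \<infinity>"
    using wf by (subst nn_integral_cmult) (auto simp: measurable_fmeas[OF \<eta>] ennreal_mult_less_top)
  have f1: "fmeas ?nw" using nwf by (intro fmeas_density[OF \<eta>]) auto
  have "(\<integral>\<^sup>+x. ?r x \<partial>\<eta>) \<le> (\<integral>\<^sup>+x. ennreal n * w x \<partial>\<eta>)"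
    by (intro nn_integral_mono) (simp add: diff_le_self_ennreal)
  then have f2: "fmeas (density \<eta> ?r)" using nwf by (intro fmeas_density[OF \<eta>]) (auto intro: order.strict_trans1)
  have "is_sum ?nw (density \<eta> (indicator B)) (density \<eta> ?r)"
    using w by (intro is_sum_density \<eta>) auto
  from D_sum(1)[OF fmeas_restrict[OF \<eta> B] f2 f1 this, of j m]
  have "D j m (density \<eta> (indicator B)) \<le> n * D j m (density \<eta> w)"
    using D_nonneg[OF f2, of j m] D_scaled[OF is_scaled_density[OF \<eta> _ n(1), of w], of j m] by simp
  moreover have "D j m \<eta> \<le> D j m (density \<eta> (indicator B)) + 2 * measure \<eta> (- B)"
    using D_sum(2)[OF fmeas_restrict[OF \<eta> B] fmeas_restrict[OF \<eta>, of "- B"] \<eta> is_sum_restrict[OF \<eta> B], of j m]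
    by (simp add: measure_restrict \<eta>)
  ultimately show ?thesis by simp
qed

text \<open>Here strict positivity of \<Upsilon> enters: the sets of pairs with n \<Upsilon> < 1
  decrease to the empty set, and the product measure is finite.\<close>

lemma bad_set_vanishes:
  assumes \<mu>: "fmeas \<mu>"
  shows "(\<lambda>n. \<integral>\<^sup>+y. emeasure \<mu> {x. real n * \<Upsilon> x y < 1} \<partial>\<phi>) \<longlonglongrightarrow> 0"
proof -
  interpret \<mu>: finite_measure \<mu> by (rule fmeasD(1)[OF \<mu>])
  interpret \<phi>: prob_space \<phi> by (rule prob_phi)
  interpret pair_sigma_finite \<phi> \<mu> ..
  interpret \<phi>\<mu>: finite_measure "\<phi> \<Otimes>\<^sub>M \<mu>"
    by (rule finite_measure_pair_measure) (auto intro: fmeasD(1)[OF \<mu>] \<phi>.finite_measure_axioms)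
  define B where "B n = {z\<in>space (\<phi> \<Otimes>\<^sub>M \<mu>). real n * \<Upsilon> (snd z) (fst z) < 1}" for n
  have sets_eq[measurable_cong]: "sets (\<phi> \<Otimes>\<^sub>M \<mu>) = sets (borel \<Otimes>\<^sub>M borel)"
    by (intro sets_pair_measure_cong sets_phi fmeasD(2)[OF \<mu>])
  have Bm[measurable]: "B n \<in> sets (\<phi> \<Otimes>\<^sub>M \<mu>)" for n
    unfolding B_def by measurable
  have "(\<lambda>n. emeasure (\<phi> \<Otimes>\<^sub>M \<mu>) (B n)) \<longlonglongrightarrow> emeasure (\<phi> \<Otimes>\<^sub>M \<mu>) (\<Inter>n. B n)"
  proof (rule Lim_emeasure_decseq)
    show "decseq B"
    proof (rule decseq_SucI, rule subsetI)
      fix n z assume "z \<in> B (Suc n)"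
      moreover have "real n * \<Upsilon> (snd z) (fst z) \<le> real (Suc n) * \<Upsilon> (snd z) (fst z)"
        using Ups_pos[of "snd z" "fst z"] by (intro mult_right_mono) auto
      ultimately show "z \<in> B n" by (auto simp: B_def)
    qed
  qed (auto)
  moreover have "(\<Inter>n. B n) = {}"
  proof -
    have "\<exists>n. \<not> real n * \<Upsilon> x y < 1" for x y
    proof -
      obtain n where "1 / \<Upsilon> x y < real n" using reals_Archimedean2 by blast
      then show ?thesis using Ups_pos[of x y] by (intro exI[of _ n]) (simp add: field_simps)
    qed
    then show ?thesis by (force simp: B_def)
  qed
  moreover have "emeasure (\<phi> \<Otimes>\<^sub>M \<mu>) (B n) = (\<integral>\<^sup>+y. emeasure \<mu> {x. real n * \<Upsilon> x y < 1} \<partial>\<phi>)" for n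
    by (subst \<mu>.emeasure_pair_measure_alt[OF Bm])
       (auto intro!: nn_integral_cong arg_cong[where f="emeasure \<mu>"] simp: B_def space_pair_measure fmeasD(3)[OF \<mu>])
  ultimately show ?thesis by simp
qed

text \<open>Where n \<Upsilon>(x, y) \<ge> 1, the prediction has density at most n with respect to
  \<open>step \<mu> y\<close>, so dropping the observation y costs a factor n plus twice the mass of
  the complement. The point is that c does not depend on m.\<close>

lemma D_push_bound:
  assumes \<mu>: "fmeas \<mu>" and \<delta>: "0 < \<delta>"
  obtains c where "0 \<le> c" "\<And>m. D j m (push \<mu>) \<le> c * D (Suc j) m \<mu> + \<delta>"
proof -
  interpret \<phi>: prob_space \<phi> by (rule prob_phi)
  let ?e = "\<lambda>n y. emeasure (push \<mu>) {x. real n * \<Upsilon> x y < 1}"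
  note p = fmeas_push[OF \<mu>]
  \<comment> \<open>Half of \<delta>, because the bad mass enters \<open>D_density_bound\<close>
    with factor 2.\<close>
  have "eventually (\<lambda>n. (\<integral>\<^sup>+y. ?e n y \<partial>\<phi>) < ennreal (\<delta> / 2)) sequentially"
    using \<delta> by (intro order_tendstoD(2)[OF bad_set_vanishes[OF p]]) auto
  then obtain n where n: "(\<integral>\<^sup>+y. ?e n y \<partial>\<phi>) < ennreal (\<delta> / 2)" by (auto simp: eventually_sequentially)
  have em: "(\<lambda>y. ?e n y) \<in> borel_measurable \<phi>"
  proof -
    have "(\<lambda>y. \<integral>\<^sup>+x. indicator {z. real n * \<Upsilon> (snd z) (fst z) < 1} (y, x) \<partial>push \<mu>) \<in> borel_measurable \<phi>"
      by (rule nn_integral_fmeas_measurable[OF p]) measurable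
    also have "(\<lambda>y. \<integral>\<^sup>+x. indicator {z. real n * \<Upsilon> (snd z) (fst z) < 1} (y, x) \<partial>push \<mu>) = (\<lambda>y. ?e n y)"
    proof
      fix y
      have [measurable]: "{x. real n * \<Upsilon> x y < 1} \<in> sets borel" by measurable
      have "(\<integral>\<^sup>+x. indicator {z. real n * \<Upsilon> (snd z) (fst z) < 1} (y, x) \<partial>push \<mu>) = (\<integral>\<^sup>+x. indicator {x. real n * \<Upsilon> x y < 1} x \<partial>push \<mu>)"
        by (intro nn_integral_cong) (auto split: split_indicator)
      also have "\<dots> = ?e n y" by (subst nn_integral_indicator) (auto simp: fmeasD(2)[OF p])
      finally show "(\<integral>\<^sup>+x. indicator {z. real n * \<Upsilon> (snd z) (fst z) < 1} (y, x) \<partial>push \<mu>) = ?e n y" .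
    qed
    finally show ?thesis .
  qed
  let ?r = "\<lambda>y. measure (push \<mu>) {x. real n * \<Upsilon> x y < 1}"
  have er: "ennreal (?r y) = ?e n y" for y
    using finite_measure.emeasure_eq_measure[OF fmeasD(1)[OF p]] by simp
  have [measurable]: "?r \<in> borel_measurable \<phi>"
    using borel_measurable_enn2real[OF em] by (simp add: measure_def)
  have ri: "integrable \<phi> ?r"
    using n by (intro integrableI_nonneg) (auto simp: er intro: order.strict_trans)
  have "ennreal (\<integral>y. ?r y \<partial>\<phi>) = (\<integral>\<^sup>+y. ?e n y \<partial>\<phi>)"
    using nn_integral_eq_integral[OF ri] by (simp add: er)
  then have r: "(\<integral>y. ?r y \<partial>\<phi>) \<le> \<delta> / 2"
    using n \<delta> by (metis ennreal_less_iff integral_nonneg_AE less_eq_real_def measure_nonneg AE_I2)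
  have "D j m (push \<mu>) \<le> real n * D (Suc j) m \<mu> + \<delta>" for m
  proof -
    have "D j m (push \<mu>) = (\<integral>y. D j m (push \<mu>) \<partial>\<phi>)" using \<phi>.prob_space by simp
    also have "\<dots> \<le> (\<integral>y. real n * D j m (step \<mu> y) + 2 * ?r y \<partial>\<phi>)"
    proof (rule integral_mono_AE)
      show "AE y in \<phi>. D j m (push \<mu>) \<le> real n * D j m (step \<mu> y) + 2 * ?r y"
        using AE_fmeas_step[OF \<mu>]
      proof eventually_elim
        case (elim y)
        have "- {x. real n * \<Upsilon> x y \<ge> 1} = {x. real n * \<Upsilon> x y < 1}" by auto
        moreover have "1 \<le> ennreal (real n) * ennreal (\<Upsilon> x y)" if "x \<in> {x. real n * \<Upsilon> x y \<ge> 1}" for x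
          using that Ups_pos[of x y] by (simp flip: ennreal_mult)
        moreover have "{x. real n * \<Upsilon> x y \<ge> 1} \<in> sets borel" by measurable
        ultimately show ?case
          using D_density_bound[OF p _ elim[unfolded step_def], of "{x. real n * \<Upsilon> x y \<ge> 1}" "real n" j m]
          by (simp add: step_def)
      qed
    qed (use ri D_Suc(2)[OF \<mu>, of j m] in auto)
    also have "\<dots> = real n * D (Suc j) m \<mu> + 2 * (\<integral>y. ?r y \<partial>\<phi>)"
      using ri D_Suc[OF \<mu>, of j m] by simp
    finally show ?thesis using r by simp
  qed
  then show thesis by (intro that[of "real n"]) auto
qed

text \<open>Drops the first j observations one at a time; the constants multiply and stay
  independent of m.\<close>

lemma D_push_pow_bound:
  assumes \<mu>: "fmeas \<mu>" and \<delta>: "0 < \<delta>"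
  obtains c where "0 \<le> c" "\<And>m. D i m ((push ^^ j) \<mu>) \<le> c * D (i + j) m \<mu> + \<delta>"
proof -
  have "\<exists>c\<ge>0. \<forall>m. D i m ((push ^^ j) \<mu>) \<le> c * D (i + j) m \<mu> + \<delta>"
    using assms
  proof (induction j arbitrary: \<mu> \<delta>)
    case 0
    then show ?case by (intro exI[of _ 1]) auto
  next
    case (Suc j)
    obtain c where c: "0 \<le> c" "\<And>m. D i m ((push ^^ j) (push \<mu>)) \<le> c * D (i + j) m (push \<mu>) + \<delta> / 2"
      using Suc.IH[OF fmeas_push[OF Suc.prems(1)], of "\<delta> / 2"] Suc.prems(2) by auto
    \<comment> \<open>This error will be multiplied by c; the choice keeps the product below
      \<delta>/2.\<close>
    have "0 < \<delta> / (2 * (c + 1))" using c Suc.prems by simp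
    then obtain c' where c': "0 \<le> c'" "\<And>m. D (i + j) m (push \<mu>) \<le> c' * D (Suc (i + j)) m \<mu> + \<delta> / (2 * (c + 1))"
      using D_push_bound[OF Suc.prems(1)] by metis
    have "D i m ((push ^^ Suc j) \<mu>) \<le> (c * c') * D (i + Suc j) m \<mu> + \<delta>" for m
    proof -
      have "D i m ((push ^^ Suc j) \<mu>) \<le> c * D (i + j) m (push \<mu>) + \<delta> / 2"
        using c(2)[of m] by (simp add: funpow_swap1)
      also have "\<dots> \<le> c * (c' * D (Suc (i + j)) m \<mu> + \<delta> / (2 * (c + 1))) + \<delta> / 2"
        using c c' by (intro add_mono mult_left_mono) auto
      also have "\<dots> \<le> (c * c') * D (i + Suc j) m \<mu> + \<delta>"
      proof -
        have "c * (\<delta> / (2 * (c + 1))) \<le> \<delta> / 2" using c Suc.prems by (simp add: divide_simps)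
        moreover have "c * (c' * D (Suc (i + j)) m \<mu> + \<delta> / (2 * (c + 1))) = (c * c') * D (i + Suc j) m \<mu> + c * (\<delta> / (2 * (c + 1)))"
          by (simp only: distrib_left mult.assoc add_Suc_right)
        ultimately show ?thesis by linarith
      qed
      finally show ?thesis .
    qed
    then show ?case using c c' by (intro exI[of _ "c * c'"]) auto
  qed
  then show thesis using that by blast
qed

text \<open>An L1 distance splits into tests on the set where the difference is nonnegative and on
  its complement. By Tonelli each test is the integral of a function \<open>\<psi>\<close> of the
  initial state with values in [0, 1], hence costs at most \<delta>.\<close>

lemma integral_abs_U_diff:
  assumes \<mu>: "fmeas \<mu>" "fmeas \<mu>'" and tv: "tvle \<delta> \<mu> \<mu>'"
    and [measurable]: "g \<in> borel_measurable borel" and g: "\<And>x. g x \<le> 1"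
  shows "integrable S (\<lambda>s. \<bar>enn2real (U m g \<mu> s) - enn2real (U m g \<mu>' s)\<bar>)"
    and "(\<integral>s. \<bar>enn2real (U m g \<mu> s) - enn2real (U m g \<mu>' s)\<bar> \<partial>S) \<le> 2 * \<delta>"
proof -
  let ?u = "\<lambda>\<mu> s. enn2real (U m g \<mu> s)"
  have UL: "U m g \<mu> s \<le> U1 m \<mu> s" for \<mu> s by (rule U_mono[OF g])
  have [measurable]: "(\<lambda>s. U m g \<mu> s) \<in> borel_measurable S" "(\<lambda>s. U m g \<mu>' s) \<in> borel_measurable S"
    by (auto intro!: U_measurable \<mu>)
  have int: "integrable S (?u \<eta>)" if \<eta>: "fmeas \<eta>" for \<eta>
  proof (rule Bochner_Integration.integrable_bound[OF integrable_U1[OF \<eta>, of m]])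
    show "?u \<eta> \<in> borel_measurable S" using \<eta> by (auto intro!: borel_measurable_enn2real U_measurable)
    show "AE s in S. norm (?u \<eta> s) \<le> norm (enn2real (U1 m \<eta> s))"
      using AE_U_finite[OF \<eta>, of m] UL by (auto elim!: eventually_mono intro!: enn2real_mono)
  qed
  show "integrable S (\<lambda>s. \<bar>?u \<mu> s - ?u \<mu>' s\<bar>)" using int \<mu> by auto
  have key: "\<bar>(\<integral>s. indicator C s * ?u \<mu> s \<partial>S) - (\<integral>s. indicator C s * ?u \<mu>' s \<partial>S)\<bar> \<le> \<delta>"
    if C[measurable]: "C \<in> sets S" for C
  proof -
    define \<psi> where "\<psi> x = (\<integral>\<^sup>+s. indicator C s * u m g x s \<partial>S)" for x
    have [measurable]: "\<psi> \<in> borel_measurable borel"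
      unfolding \<psi>_def by (rule sigma_finite_measure.borel_measurable_nn_integral[OF sf_S]) measurable
    have \<psi>1: "\<psi> x \<le> 1" for x
    proof -
      have "\<psi> x \<le> (\<integral>\<^sup>+s. u m (\<lambda>_. 1) x s \<partial>S)"
        unfolding \<psi>_def using g by (intro nn_integral_mono) (auto split: split_indicator intro: u_mono)
      also have "\<dots> = 1" using U_mass[OF fmeas_return, of m x] by (simp add: U_return)
      finally show ?thesis .
    qed
    have eq: "(\<integral>s. indicator C s * ?u \<eta> s \<partial>S) = (\<integral>x. enn2real (\<psi> x) \<partial>\<eta>)" if \<eta>: "fmeas \<eta>" for \<eta>
    proof -
      have [measurable]: "(\<lambda>s. U m g \<eta> s) \<in> borel_measurable S" by (auto intro!: U_measurable \<eta>)
      have "(\<integral>s. indicator C s * ?u \<eta> s \<partial>S) = enn2real (\<integral>\<^sup>+s. ennreal (indicator C s * ?u \<eta> s) \<partial>S)"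
        by (intro integral_eq_nn_integral) auto
      also have "(\<integral>\<^sup>+s. ennreal (indicator C s * ?u \<eta> s) \<partial>S) = (\<integral>\<^sup>+s. (\<integral>\<^sup>+x. indicator C s * u m g x s \<partial>\<eta>) \<partial>S)"
      proof (rule nn_integral_cong_AE, use AE_U_finite[OF \<eta>, of m] in eventually_elim)
        case (elim s)
        then have "U m g \<eta> s < \<top>" using UL[of \<eta> s] by (auto intro: order.strict_trans1)
        then have "ennreal (indicator C s * ?u \<eta> s) = indicator C s * U m g \<eta> s"
          by (simp add: ennreal_mult ennreal_indicator)
        also have "\<dots> = (\<integral>\<^sup>+x. indicator C s * u m g x s \<partial>\<eta>)"
          unfolding U_def by (subst nn_integral_cmult) (auto simp: measurable_fmeas[OF \<eta>])
        finally show ?case .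
      qed
      also have "\<dots> = (\<integral>\<^sup>+x. \<psi> x \<partial>\<eta>)"
        unfolding \<psi>_def by (rule swap_S[OF \<eta>]) measurable
      also have "\<dots> = (\<integral>\<^sup>+x. ennreal (enn2real (\<psi> x)) \<partial>\<eta>)"
        using \<psi>1 by (intro nn_integral_cong) (metis ennreal_enn2real_if ennreal_one_neq_top top.extremum_unique)
      also have "enn2real \<dots> = (\<integral>x. enn2real (\<psi> x) \<partial>\<eta>)"
        by (intro integral_eq_nn_integral[symmetric]) (auto simp: measurable_fmeas[OF \<eta>])
      finally show ?thesis .
    qed
    have "enn2real (\<psi> x) \<le> 1" for x
      using enn2real_mono[OF \<psi>1] by simp
    then show ?thesis
      unfolding eq[OF \<mu>(1)] eq[OF \<mu>(2)] using tv unfolding tvle_def by auto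
  qed
  define C where "C = {s\<in>space S. ?u \<mu> s \<ge> ?u \<mu>' s}"
  have C[measurable]: "C \<in> sets S" unfolding C_def by measurable
  have i1: "integrable S (\<lambda>s. indicator C s * ?u \<eta> s)" "integrable S (\<lambda>s. indicator (- C) s * ?u \<eta> s)" if "fmeas \<eta>" for \<eta>
    using integrable_mult_indicator[OF _ int[OF that], of C] integrable_mult_indicator[OF _ int[OF that], of "- C"] sets.compl_sets[OF C]
    by (auto simp: Compl_eq_Diff_UNIV)
  have "(\<integral>s. \<bar>?u \<mu> s - ?u \<mu>' s\<bar> \<partial>S) = (\<integral>s. (indicator C s * ?u \<mu> s - indicator C s * ?u \<mu>' s) + (indicator (- C) s * ?u \<mu>' s - indicator (- C) s * ?u \<mu> s) \<partial>S)"
    by (intro Bochner_Integration.integral_cong) (auto simp: C_def split: split_indicator)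
  also have "\<dots> = ((\<integral>s. indicator C s * ?u \<mu> s \<partial>S) - (\<integral>s. indicator C s * ?u \<mu>' s \<partial>S)) + ((\<integral>s. indicator (- C) s * ?u \<mu>' s \<partial>S) - (\<integral>s. indicator (- C) s * ?u \<mu> s \<partial>S))"
    using i1 \<mu> by (simp add: Bochner_Integration.integral_add Bochner_Integration.integral_diff Bochner_Integration.integrable_diff)
  also have "\<dots> \<le> 2 * \<delta>"
    using key[OF C] key[of "- C"] sets.compl_sets[OF C] by (simp add: Compl_eq_Diff_UNIV abs_le_iff)
  finally show "(\<integral>s. \<bar>?u \<mu> s - ?u \<mu>' s\<bar> \<partial>S) \<le> 2 * \<delta>" .
qed

text \<open>6 = 2 * 2 + 2: \<open>sqr_diff_le\<close> with both L1 distances at most 2\<delta>.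
  Uniformity in m matters, since j is fixed before m tends to infinity.\<close>

lemma Im_lip:
  assumes \<mu>: "fmeas \<mu>" "fmeas \<mu>'" and tv: "tvle \<delta> \<mu> \<mu>'"
  shows "Im m \<mu> \<le> Im m \<mu>' + 6 * \<delta>"
proof -
  note f = integral_abs_U_diff[OF \<mu> tv f_meas f_le_1, of m]
    and o = integral_abs_U_diff[OF \<mu> tv borel_measurable_const, of 1 m, simplified]
  have "Im m \<mu> \<le> (\<integral>s. rt (Uf m \<mu>' s) (U1 m \<mu>' s) + 2 * \<bar>enn2real (Uf m \<mu> s) - enn2real (Uf m \<mu>' s)\<bar> + \<bar>enn2real (U1 m \<mu> s) - enn2real (U1 m \<mu>' s)\<bar> \<partial>S)"
    unfolding Im_def
  proof (rule integral_mono_AE)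
    show "AE s in S. rt (Uf m \<mu> s) (U1 m \<mu> s) \<le> rt (Uf m \<mu>' s) (U1 m \<mu>' s) + 2 * \<bar>enn2real (Uf m \<mu> s) - enn2real (Uf m \<mu>' s)\<bar> + \<bar>enn2real (U1 m \<mu> s) - enn2real (U1 m \<mu>' s)\<bar>"
      using AE_Uf_U1[OF \<mu>(1), of m] AE_Uf_U1[OF \<mu>(2), of m]
    proof eventually_elim
      case (elim s)
      then show ?case
        using sqr_diff_le[of "enn2real (Uf m \<mu> s)" "enn2real (U1 m \<mu> s)" "enn2real (Uf m \<mu>' s)" "enn2real (U1 m \<mu>' s)"]
        by auto
    qed
  qed (auto intro!: Bochner_Integration.integrable_add integrable_rt \<mu> f(1) o(1) integrable_mult_right)
  also have "\<dots> = Im m \<mu>' + 2 * (\<integral>s. \<bar>enn2real (Uf m \<mu> s) - enn2real (Uf m \<mu>' s)\<bar> \<partial>S) + (\<integral>s. \<bar>enn2real (U1 m \<mu> s) - enn2real (U1 m \<mu>' s)\<bar> \<partial>S)"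
    unfolding Im_def using integrable_rt[OF \<mu>(2), of m] f(1) o(1) by simp
  finally show ?thesis using f(2) o(2) by simp
qed

lemma A_lip:
  assumes \<mu>: "fmeas \<mu>" "fmeas \<mu>'" and tv: "tvle \<delta> \<mu> \<mu>'"
  shows "A j m \<mu> \<le> A j m \<mu>' + \<delta>"
proof -
  let ?a = "\<lambda>x. enn2real (pj j (\<lambda>x. ennreal (\<alpha> m x)) x)"
  have "ennreal (?a x) = pj j (\<lambda>x. ennreal (\<alpha> m x)) x" for x
    using pja_le[of j m x] by (metis ennreal_enn2real_if ennreal_one_neq_top top.extremum_unique)
  then have "A j m \<eta> = (\<integral>x. ?a x \<partial>\<eta>)" if "fmeas \<eta>" for \<eta>
    unfolding A_def by (subst integral_eq_nn_integral) (auto simp: measurable_fmeas[OF that])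
  moreover have "0 \<le> ?a x \<and> ?a x \<le> 1" for x using enn2real_mono[OF pja_le[of j m x]] by simp
  moreover have "?a \<in> borel_measurable borel" by simp
  ultimately show ?thesis using bspec[OF tv[unfolded tvle_def], of ?a] \<mu> by (auto simp: abs_le_iff)
qed

end

lemma sqr_dev:
  assumes "0 \<le> a" "a \<le> b"
  shows "b * (a / b - q)\<^sup>2 = sqr a b - 2 * q * a + q\<^sup>2 * b"
proof (cases "b = 0")
  case False
  then show ?thesis using assms by (simp add: sqr_def field_simps power2_eq_square)
qed (use assms in \<open>simp add: sqr_def\<close>)

lemma dev_le:
  assumes "0 \<le> a" "a \<le> b" "0 \<le> q" "q \<le> (1::real)"
  shows "b * (a / b - q)\<^sup>2 \<le> b"
proof -
  have "\<bar>a / b - q\<bar> \<le> 1" using ratio_bounds[of a b] assms unfolding abs_le_iff by linarith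
  then have "(a / b - q)\<^sup>2 \<le> 1" by (simp add: abs_square_le_1)
  then show ?thesis using assms by (simp add: mult_left_le)
qed

text \<open>Exhaustion: a \<zeta>-null set N of maximal \<eta>-measure carries the singular part of
  \<eta>, since a further null set with positive \<eta>-measure off N could be added to it.\<close>

lemma Lebesgue_null_decomposition:
  assumes "finite_measure \<eta>" "sets \<zeta> = sets \<eta>"
  obtains N where "N \<in> sets \<eta>" "emeasure \<zeta> N = 0"
    "\<And>C. C \<in> sets \<eta> \<Longrightarrow> emeasure \<zeta> C = 0 \<Longrightarrow> emeasure \<eta> (C - N) = 0"
proof -
  interpret \<eta>: finite_measure \<eta> by fact
  define Z where "Z = {N \<in> sets \<eta>. emeasure \<zeta> N = 0}"
  define s where "s = (SUP N\<in>Z. emeasure \<eta> N)"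
  have Z0: "{} \<in> Z" by (simp add: Z_def)
  have "emeasure \<eta> ` Z \<noteq> {}" using Z0 by auto
  from ennreal_Sup_countable_SUP[OF this]
  obtain f :: "nat \<Rightarrow> ennreal" where f1: "range f \<subseteq> emeasure \<eta> ` Z" and f2: "s = (SUP i. f i)"
    unfolding s_def by auto
  have "\<forall>i. \<exists>N. N \<in> Z \<and> f i = emeasure \<eta> N" using f1 by auto
  then obtain N where N: "\<And>i. N i \<in> Z" "\<And>i. f i = emeasure \<eta> (N i)" by metis
  define M where "M = (\<Union>i. N i)"
  have Ni: "N i \<in> sets \<zeta>" "N i \<in> sets \<eta>" for i using N(1) assms(2) by (auto simp: Z_def)
  have "emeasure \<zeta> M = 0"
    unfolding M_def using N(1) Ni by (intro emeasure_UN_eq_0) (auto simp: Z_def)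
  then have MZ: "M \<in> Z"
    unfolding Z_def M_def using Ni by auto
  have "s \<le> emeasure \<eta> M"
    unfolding f2 N(2) M_def using Ni by (intro SUP_least emeasure_mono) auto
  show thesis
  proof (rule that[of M])
    fix C assume C: "C \<in> sets \<eta>" "emeasure \<zeta> C = 0"
    have "M \<in> null_sets \<zeta>" "C \<in> sets \<zeta>" using MZ assms(2) C by (auto simp: Z_def null_sets_def)
    then have "emeasure \<zeta> (C \<union> M) = 0" using C(2) by (simp add: emeasure_Un_null_set)
    then have "C \<union> M \<in> Z" using MZ C by (auto simp: Z_def)
    then have "emeasure \<eta> (C \<union> M) \<le> s" unfolding s_def by (rule SUP_upper)
    then have "emeasure \<eta> (C \<union> M) \<le> emeasure \<eta> M"
      using \<open>s \<le> emeasure \<eta> M\<close> by (rule order.trans)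
    moreover have "emeasure \<eta> (C \<union> M) = emeasure \<eta> M + emeasure \<eta> (C - M)"
    proof -
      have "M \<union> (C - M) = C \<union> M" by auto
      then show ?thesis using C MZ plus_emeasure[of M \<eta> "C - M"] by (auto simp: Z_def)
    qed
    ultimately have "emeasure \<eta> M + emeasure \<eta> (C - M) \<le> emeasure \<eta> M + 0" by simp
    then show "emeasure \<eta> (C - M) = 0"
      by (subst (asm) ennreal_add_left_cancel_le) auto
  qed (use MZ in \<open>auto simp: Z_def\<close>)
qed

section \<open>Limits of expected squares under ergodicity\<close>

locale filter_ergodic = filter_test P \<phi> \<Upsilon> f
  for P :: "'e::polish_space \<Rightarrow> 'e measure" and \<phi> :: "'f::polish_space measure"
    and \<Upsilon> :: "'e \<Rightarrow> 'f \<Rightarrow> real" and f :: "'e \<Rightarrow> ennreal" +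
  fixes lam :: "'e measure"
  assumes lam: "fmeas lam" "measure lam UNIV = 1" "push lam = lam"
    and tv_conv: "\<And>\<rho>. fmeas \<rho> \<Longrightarrow> measure \<rho> UNIV = 1 \<Longrightarrow> \<exists>\<delta>. \<delta> \<longlonglongrightarrow> 0 \<and> (\<forall>j. tvle (\<delta> j) ((push ^^ j) \<rho>) lam)"
begin

lemma push_pow_lam: "(push ^^ j) lam = lam"
  by (induction j) (auto simp: lam(3))

lemma tvle_sym: "tvle \<delta> \<mu> \<mu>' \<Longrightarrow> tvle \<delta> \<mu>' \<mu>"
  unfolding tvle_def by (simp add: abs_minus_commute)

lemma D_return: "D j m (return borel x) = enn2real (pj j (\<lambda>x. ennreal (\<alpha> m x)) x) - \<alpha> (m + j) x"
proof -
  have "(\<integral>\<^sup>+x'. pj j (\<lambda>x. ennreal (\<alpha> m x)) x' \<partial>return borel x) = pj j (\<lambda>x. ennreal (\<alpha> m x)) x"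
    by (rule nn_integral_return) auto
  then show ?thesis by (simp add: D_def A_def \<alpha>_def[of "m + j"])
qed

text \<open>Invariance makes \<open>A j m lam\<close> independent of j, and the average of
  \<open>\<alpha> (m + j)\<close> over \<open>lam\<close> is \<open>A 0 (m + j) lam\<close>. So the
  average of the gain over starting points is \<open>A 0 m lam - A 0 (m + j) lam\<close>: its sign
  gives monotonicity in m, and it tends to 0 because a decreasing nonnegative sequence
  converges.\<close>

lemma A_shift: "A 0 (m + j) lam \<le> A 0 m lam"
  and liminf_D: "(\<lambda>m. \<integral>\<^sup>+x. ennreal (D j m (return borel x)) \<partial>lam) \<longlonglongrightarrow> 0"
proof -
  interpret L: finite_measure lam by (rule fmeasD(1)[OF lam(1)])
  let ?pj = "\<lambda>j m x. enn2real (pj j (\<lambda>x. ennreal (\<alpha> m x)) x)"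
  have pj: "ennreal (?pj j m x) = pj j (\<lambda>x. ennreal (\<alpha> m x)) x" for j m x
    using pja_le[of j m x] by (metis ennreal_enn2real_if ennreal_one_neq_top top.extremum_unique)
  have D: "D j m (return borel x) = ?pj j m x - \<alpha> (m + j) x" for j m x
    by (rule D_return)
  have pj1: "?pj j m x \<le> 1" for j m x
    using enn2real_mono[OF pja_le[of j m x]] by simp
  have i: "integrable lam (?pj j m)" "integrable lam (\<alpha> m)" for j m
    by (rule L.integrable_const_bound[where B=1]; simp add: pj1 alpha_bounds measurable_fmeas[OF lam(1)])+
  have A: "A j m lam = (\<integral>x. ?pj j m x \<partial>lam)" for j m
    unfolding A_def by (subst integral_eq_nn_integral) (auto simp: pj measurable_fmeas[OF lam(1)])
  have A0: "A j m lam = A 0 m lam" for j m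
    unfolding A_pow[OF lam(1), of j] push_pow_lam ..
  have al: "A 0 m lam = (\<integral>x. \<alpha> m x \<partial>lam)" for m
    unfolding A using alpha_bounds by simp
  have I: "(\<integral>x. D j m (return borel x) \<partial>lam) = A 0 m lam - A 0 (m + j) lam" for j m
    unfolding D Bochner_Integration.integral_diff[OF i(1) i(2)] A[symmetric] al[symmetric] by (simp only: A0[of j m])
  have nn: "0 \<le> D j m (return borel x)" for j m x by (rule D_nonneg[OF fmeas_return])
  have le: "A 0 (m + j) lam \<le> A 0 m lam" for m j
  proof -
    have "0 \<le> (\<integral>x. D j m (return borel x) \<partial>lam)" using nn by (intro integral_nonneg_AE AE_I2)
    then show ?thesis using I[of j m] by simp
  qed
  show "A 0 (m + j) lam \<le> A 0 m lam" by (rule le)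
  have "A 0 (Suc m) lam \<le> A 0 m lam" for m using le[of m 1] by simp
  then have "decseq (\<lambda>m. A 0 m lam)" by (rule decseq_SucI)
  then obtain L where L: "(\<lambda>m. A 0 m lam) \<longlonglongrightarrow> L"
    by (rule decseq_convergent[where B=0]) (auto simp: A_nonneg)
  have "(\<lambda>m. A 0 m lam - A 0 (m + j) lam) \<longlonglongrightarrow> L - L"
    by (intro tendsto_diff L LIMSEQ_ignore_initial_segment)
  then have "(\<lambda>m. ennreal (A 0 m lam - A 0 (m + j) lam)) \<longlonglongrightarrow> ennreal 0"
    by (intro tendsto_ennrealI) simp
  moreover have "(\<integral>\<^sup>+x. ennreal (D j m (return borel x)) \<partial>lam) = ennreal (A 0 m lam - A 0 (m + j) lam)" for m
  proof -
    have "integrable lam (\<lambda>x. D j m (return borel x))"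
      unfolding D by (intro Bochner_Integration.integrable_diff i)
    then show ?thesis unfolding I[symmetric] using nn by (intro nn_integral_eq_integral AE_I2)
  qed
  ultimately show "(\<lambda>m. \<integral>\<^sup>+x. ennreal (D j m (return borel x)) \<partial>lam) \<longlonglongrightarrow> 0" by simp
qed

lemma A_lam_convergent:
  obtains L where "(\<lambda>m. A 0 m lam) \<longlonglongrightarrow> L"
proof -
  have "A 0 (Suc m) lam \<le> A 0 m lam" for m using A_shift[of m 1] by simp
  then have "decseq (\<lambda>m. A 0 m lam)" by (rule decseq_SucI)
  then show thesis
    by (rule decseq_convergent[where B=0]) (auto simp: A_nonneg intro: that)
qed

lemma D_return_measurable: "(\<lambda>x. D j m (return borel x)) \<in> borel_measurable borel"
proof -
  have "D j m (return borel x) = enn2real (pj j (\<lambda>x. ennreal (\<alpha> m x)) x) - \<alpha> (m + j) x" for x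
    by (rule D_return)
  then show ?thesis by simp
qed

text \<open>
  The gap \<open>D 0 m lam\<close> compares the filter knowing the initial state with the one not knowing it;
  it vanishes, which is the exchange property behind the uniqueness of the invariant measure.
\<close>

lemma gap_lam: "(\<lambda>m. D 0 m lam) \<longlonglongrightarrow> 0"
proof -
  \<comment> \<open>Fatou turns vanishing averages into a vanishing liminf at almost every x, for
    all j simultaneously; one such x is enough.\<close>
  have "AE x in lam. \<forall>j. liminf (\<lambda>m. ennreal (D j m (return borel x))) = 0"
    unfolding AE_all_countable
  proof
    fix j
    have [measurable]: "(\<lambda>x. ennreal (D j m (return borel x))) \<in> borel_measurable lam" for m
      using D_return_measurable by (simp add: measurable_fmeas[OF lam(1)])
    have "(\<integral>\<^sup>+x. liminf (\<lambda>m. ennreal (D j m (return borel x))) \<partial>lam) \<le> liminf (\<lambda>m. \<integral>\<^sup>+x. ennreal (D j m (return borel x)) \<partial>lam)"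
      by (intro nn_integral_liminf) auto
    also have "\<dots> = 0" using liminf_D[of j] by (intro lim_imp_Liminf) auto
    finally have "(\<integral>\<^sup>+x. liminf (\<lambda>m. ennreal (D j m (return borel x))) \<partial>lam) = 0" by simp
    then show "AE x in lam. liminf (\<lambda>m. ennreal (D j m (return borel x))) = 0"
      by (subst (asm) nn_integral_0_iff_AE) auto
  qed
  moreover have "prob_space lam"
    using fmeasD[OF lam(1)] lam(2) finite_measure.emeasure_eq_measure[of lam UNIV] by (intro prob_spaceI) auto
  ultimately obtain x where x: "\<And>j. liminf (\<lambda>m. ennreal (D j m (return borel x))) = 0"
    using eventually_happens'[OF prob_space.ae_filter_bot] by blast
  \<comment> \<open>A given j has infinitely many good m, perhaps not all large ones. The
    monotonicity \<open>dec\<close> below carries smallness from one m to all later ones.\<close>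
  have freq: "\<exists>m\<ge>k. D j m (return borel x) < \<epsilon>" if "0 < \<epsilon>" for j k \<epsilon>
  proof (rule ccontr)
    assume "\<not> ?thesis"
    then have "\<forall>m\<ge>k. ennreal \<epsilon> \<le> ennreal (D j m (return borel x))" by (auto intro: ennreal_leI simp: not_less)
    then have "ennreal \<epsilon> \<le> liminf (\<lambda>m. ennreal (D j m (return borel x)))"
      by (intro Liminf_bounded) (auto simp: eventually_sequentially)
    then show False using x that by simp
  qed
  \<comment> \<open>As m grows, under \<open>lam\<close> the revealed state becomes older and
    \<open>A\<close> decreases, while the observation record becomes longer and, since
    \<open>push lam = lam\<close>, \<open>Im\<close> increases.\<close>
  have dec: "D 0 m' lam \<le> D 0 m lam" if "m \<le> m'" for m m'
  proof -
    have "D 0 (Suc m) lam \<le> D 0 m lam" for m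
      unfolding D_def using A_shift[of m 1] Im_push_le[OF lam(1), of m] by (simp add: lam(3))
    then have "decseq (\<lambda>m. D 0 m lam)" by (intro decseq_SucI)
    then show ?thesis using that by (auto dest: decseqD)
  qed
  obtain \<delta> where \<delta>: "\<delta> \<longlonglongrightarrow> 0" "\<And>j. tvle (\<delta> j) ((push ^^ j) (return borel x)) lam"
    using tv_conv[OF fmeas_return[of x]] by (auto simp: measure_return)
  show ?thesis
  proof (rule LIMSEQ_I)
    fix r :: real assume "0 < r"
    \<comment> \<open>The bound will be 2\<epsilon> at the good m plus 7 \<delta> j < 7\<epsilon>
      for passing to \<open>lam\<close>: 1 for \<open>A\<close> and 6 for \<open>Im\<close>.\<close>
    define \<epsilon> where "\<epsilon> = r / 10"
    have \<epsilon>: "0 < \<epsilon>" using \<open>0 < r\<close> by (simp add: \<epsilon>_def)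
    obtain j where j: "\<delta> j < \<epsilon>" using order_tendstoD(2)[OF \<delta>(1) \<epsilon>] by (auto simp: eventually_sequentially)
    obtain c where c: "0 \<le> c" "\<And>m. D 0 m ((push ^^ j) (return borel x)) \<le> c * D (0 + j) m (return borel x) + \<epsilon>"
      using D_push_pow_bound[OF fmeas_return \<epsilon>] by blast
    obtain m where m: "D j m (return borel x) < \<epsilon> / (c + 1)" using freq[where j=j and k=0 and \<epsilon>="\<epsilon> / (c + 1)"] \<epsilon> c by auto
    have "c * D j m (return borel x) \<le> (c + 1) * (\<epsilon> / (c + 1))"
      using m c D_nonneg[OF fmeas_return, of j m x] by (intro mult_mono) auto
    then have "c * D j m (return borel x) \<le> \<epsilon>" using c by simp
    then have "D 0 m ((push ^^ j) (return borel x)) \<le> 2 * \<epsilon>" using c(2)[of m] by simp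
    moreover have fp: "fmeas ((push ^^ j) (return borel x))" by (intro fmeas_push_pow fmeas_return)
    have "D 0 m lam \<le> D 0 m ((push ^^ j) (return borel x)) + 7 * \<delta> j"
      unfolding D_def
      using A_lip[OF lam(1) fp tvle_sym[OF \<delta>(2)[of j]], of 0 m] Im_lip[OF fp lam(1) \<delta>(2)[of j], of m] by simp
    ultimately have "D 0 m lam < r" using j \<open>0 < r\<close> by (simp add: \<epsilon>_def)
    then show "\<exists>no. \<forall>n\<ge>no. norm (D 0 n lam - 0) < r"
    proof (intro exI[of _ m] allI impI)
      fix n assume "m \<le> n"
      then have "D 0 n lam \<le> D 0 m lam" by (rule dec)
      then show "norm (D 0 n lam - 0) < r" using \<open>D 0 m lam < r\<close> D_nonneg[OF lam(1), of 0 n] by simp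
    qed
  qed
qed

text \<open>A sandwich: \<open>Im m\<close> of the law at time j is at most
  \<open>Im (m + j) \<rho>\<close>, which is at most \<open>A 0 m\<close> of the law at time j.
  Replacing that law by \<open>lam\<close> puts both ends near one limit, by
  \<open>gap_lam\<close>.\<close>

lemma Im_limit:
  obtains c where "\<And>\<rho>. fmeas \<rho> \<Longrightarrow> measure \<rho> UNIV = 1 \<Longrightarrow> (\<lambda>m. Im m \<rho>) \<longlonglongrightarrow> c"
proof -
  obtain L where L: "(\<lambda>m. A 0 m lam) \<longlonglongrightarrow> L" by (rule A_lam_convergent)
  have I: "(\<lambda>m. Im m lam) \<longlonglongrightarrow> L"
    using tendsto_diff[OF L gap_lam] by (simp add: D_def)
  show thesis
  proof (rule that[of L], rule LIMSEQ_I)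
    fix \<rho> :: "'e measure" and r :: real assume \<rho>: "fmeas \<rho>" "measure \<rho> UNIV = 1" and "0 < r"
    define \<epsilon> where "\<epsilon> = r / 10"
    have \<epsilon>: "0 < \<epsilon>" using \<open>0 < r\<close> by (simp add: \<epsilon>_def)
    obtain \<delta> where \<delta>: "\<delta> \<longlonglongrightarrow> 0" "\<And>j. tvle (\<delta> j) ((push ^^ j) \<rho>) lam"
      using tv_conv[OF \<rho>] by blast
    obtain j where j: "\<delta> j < \<epsilon>" using order_tendstoD(2)[OF \<delta>(1) \<epsilon>] by (auto simp: eventually_sequentially)
    obtain M1 where M1: "\<And>m. m \<ge> M1 \<Longrightarrow> norm (A 0 m lam - L) < \<epsilon>" using LIMSEQ_D[OF L \<epsilon>] by blast
    obtain M2 where M2: "\<And>m. m \<ge> M2 \<Longrightarrow> norm (Im m lam - L) < \<epsilon>" using LIMSEQ_D[OF I \<epsilon>] by blast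
    have fp: "fmeas ((push ^^ j) \<rho>)" by (intro fmeas_push_pow \<rho>)
    have low: "Im m ((push ^^ i) \<rho>) \<le> Im (m + i) \<rho>" for i m
    proof (induction i arbitrary: m)
      case (Suc i)
      show ?case
        using Im_push_le[OF fmeas_push_pow[OF \<rho>(1), of i], of m] Suc[of "Suc m"] by simp
    qed simp
    have "norm (Im n \<rho> - L) < r" if n: "n \<ge> max M1 M2 + j" for n
    proof -
      define m where "m = n - j"
      have m: "n = m + j" "m \<ge> M1" "m \<ge> M2" using n by (auto simp: m_def)
      have "Im n \<rho> \<le> A j m \<rho>" using D_nonneg[OF \<rho>(1), of j m] by (simp add: D_def m(1))
      also have "\<dots> \<le> A 0 m lam + \<delta> j"
        unfolding A_pow[OF \<rho>(1), of j] by (rule A_lip[OF fp lam(1) \<delta>(2)])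
      finally have up: "Im n \<rho> \<le> A 0 m lam + \<delta> j" .
      have "Im m lam \<le> Im m ((push ^^ j) \<rho>) + 6 * \<delta> j"
        by (rule Im_lip[OF lam(1) fp tvle_sym[OF \<delta>(2)]])
      with low[of m j] have "Im m lam \<le> Im n \<rho> + 6 * \<delta> j" by (simp add: m(1))
      with up M1[OF m(2)] M2[OF m(3)] j \<open>0 < r\<close> show ?thesis unfolding \<epsilon>_def real_norm_def by linarith
    qed
    then show "\<exists>no. \<forall>n\<ge>no. norm (Im n \<rho> - L) < r" by blast
  qed
qed

definition c_lim :: real where
  "c_lim = (SOME c. \<forall>\<rho>. fmeas \<rho> \<longrightarrow> measure \<rho> UNIV = 1 \<longrightarrow> (\<lambda>m. Im m \<rho>) \<longlonglongrightarrow> c)"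

text \<open>Homogeneity extends the limit from probability to finite measures. Its linearity in the
  mass says that \<open>Im\<close>, merely subadditive for finite m, is additive in the
  limit.\<close>

lemma Im_tendsto:
  assumes "fmeas \<mu>"
  shows "(\<lambda>m. Im m \<mu>) \<longlonglongrightarrow> c_lim * measure \<mu> UNIV"
proof -
  have "\<exists>c. \<forall>\<rho>. fmeas \<rho> \<longrightarrow> measure \<rho> UNIV = 1 \<longrightarrow> (\<lambda>m. Im m \<rho>) \<longlonglongrightarrow> c"
  proof (rule Im_limit)
    fix c assume "\<And>\<rho>. fmeas \<rho> \<Longrightarrow> measure \<rho> UNIV = 1 \<Longrightarrow> (\<lambda>m. Im m \<rho>) \<longlonglongrightarrow> c"
    then show ?thesis by (intro exI[of _ c]) simp
  qed
  note * = someI_ex[OF this]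
  have *: "(\<lambda>m. Im m \<rho>) \<longlonglongrightarrow> c_lim" if "fmeas \<rho>" "measure \<rho> UNIV = 1" for \<rho>
    using * that unfolding c_lim_def by blast
  interpret finite_measure \<mu> by (rule fmeasD(1)[OF assms])
  show ?thesis
  proof (cases "measure \<mu> UNIV = 0")
    case True
    then have "Im m \<mu> = 0" for m using Im_nonneg[of m \<mu>] Im_le[OF assms, of m] by simp
    then show ?thesis using True by simp
  next
    case False
    define k where "k = measure \<mu> UNIV"
    have k: "0 < k" using False measure_nonneg[of \<mu> UNIV] unfolding k_def by linarith
    define \<rho> where "\<rho> = density \<mu> (\<lambda>_. ennreal (1 / k))"
    have n: "(\<integral>\<^sup>+x. ennreal (1 / k) \<partial>\<mu>) = 1"
    proof -
      have "(\<integral>\<^sup>+x. ennreal (1 / k) \<partial>\<mu>) = ennreal (1 / k) * ennreal k"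
        by (simp add: fmeasD(3)[OF assms] emeasure_eq_measure k_def)
      also have "\<dots> = 1" using k by (subst ennreal_mult[symmetric]) auto
      finally show ?thesis .
    qed
    have \<rho>: "fmeas \<rho>" "measure \<rho> UNIV = 1"
    proof -
      show "fmeas \<rho>" unfolding \<rho>_def by (rule fmeas_density[OF assms]) (simp_all only: n, auto)
      have "emeasure \<rho> UNIV = 1"
        unfolding \<rho>_def using n fmeasD[OF assms] by (subst emeasure_density) auto
      then show "measure \<rho> UNIV = 1" by (simp add: measure_def)
    qed
    have "is_scaled (1 / k) \<rho> \<mu>"
      using is_scaled_density[OF assms, of "\<lambda>_. 1" "1 / k"] k by (simp add: \<rho>_def density_1)
    then have "Im m \<rho> = (1 / k) * Im m \<mu>" for m by (rule Im_scaled)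
    then have "(\<lambda>m. Im m \<rho> * k) = (\<lambda>m. Im m \<mu>)" using k by (intro ext) (simp add: field_simps)
    with tendsto_mult_right[OF *[OF \<rho>], of k] show ?thesis unfolding k_def by simp
  qed
qed

end

section \<open>Distance between filters with different initial laws\<close>

context filter_test
begin

definition q :: "nat \<Rightarrow> 'e measure \<Rightarrow> 'f stream \<Rightarrow> real" where
  "q m \<tau> s = enn2real (Uf m \<tau> s) / enn2real (U1 m \<tau> s)"

text \<open>Expected squared distance between the filter correctly started in \<mu> and the one
  started in \<tau>, when the observations are generated from \<mu>.\<close>

definition G :: "nat \<Rightarrow> 'e measure \<Rightarrow> 'e measure \<Rightarrow> real" where
  "G m \<mu> \<tau> = (\<integral>s. enn2real (U1 m \<mu> s) * (q m \<mu> s - q m \<tau> s)\<^sup>2 \<partial>S)"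

lemma q_measurable[measurable (raw)]:
  assumes \<tau>: "fmeas \<tau>" and [measurable]: "h \<in> M \<rightarrow>\<^sub>M S"
  shows "(\<lambda>z. q m \<tau> (h z)) \<in> borel_measurable M"
proof -
  have [measurable]: "(\<lambda>z. Uf m \<tau> (h z)) \<in> borel_measurable M" "(\<lambda>z. U1 m \<tau> (h z)) \<in> borel_measurable M"
    using \<tau> by measurable
  show ?thesis unfolding q_def by measurable
qed

lemma q_bounds:
  assumes "fmeas \<tau>" shows "AE s in S. 0 \<le> q m \<tau> s \<and> q m \<tau> s \<le> 1"
  using AE_Uf_U1[OF assms, of m]
proof eventually_elim
  case (elim s)
  then show ?case unfolding q_def by (intro ratio_bounds) auto
qed

lemma G_integrand_bounds:
  assumes "fmeas \<mu>" "fmeas \<tau>"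
  shows "AE s in S. 0 \<le> enn2real (U1 m \<mu> s) * (q m \<mu> s - q m \<tau> s)\<^sup>2 \<and>
    enn2real (U1 m \<mu> s) * (q m \<mu> s - q m \<tau> s)\<^sup>2 \<le> enn2real (U1 m \<mu> s)"
  using AE_Uf_U1[OF assms(1), of m] q_bounds[OF assms(2), of m]
proof eventually_elim
  case (elim s)
  then show ?case
    using dev_le[of "enn2real (Uf m \<mu> s)" "enn2real (U1 m \<mu> s)" "q m \<tau> s"] by (auto simp: q_def[of m \<mu>])
qed

lemma integrable_G:
  assumes \<mu>: "fmeas \<mu>" "fmeas \<tau>"
  shows "integrable S (\<lambda>s. enn2real (U1 m \<mu> s) * (q m \<mu> s - q m \<tau> s)\<^sup>2)"
proof (rule Bochner_Integration.integrable_bound[OF integrable_U1[OF \<mu>(1), of m]])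
  show "(\<lambda>s. enn2real (U1 m \<mu> s) * (q m \<mu> s - q m \<tau> s)\<^sup>2) \<in> borel_measurable S"
    using \<mu> by measurable
  show "AE s in S. norm (enn2real (U1 m \<mu> s) * (q m \<mu> s - q m \<tau> s)\<^sup>2) \<le> norm (enn2real (U1 m \<mu> s))"
    using G_integrand_bounds[OF \<mu>, of m] by eventually_elim auto
qed

lemma G_nonneg: "fmeas \<mu> \<Longrightarrow> fmeas \<tau> \<Longrightarrow> 0 \<le> G m \<mu> \<tau>"
  unfolding G_def using G_integrand_bounds[of \<mu> \<tau> m] by (intro integral_nonneg_AE) (auto elim!: eventually_mono)

lemma G_le:
  assumes "fmeas \<mu>" "fmeas \<tau>" shows "G m \<mu> \<tau> \<le> measure \<mu> UNIV"
  unfolding G_def integral_U1[OF assms(1), symmetric, of m]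
  using G_integrand_bounds[OF assms, of m]
  by (intro integral_mono_AE integrable_G integrable_U1 assms) (auto elim!: eventually_mono)

lemma G_Suc:
  assumes "fmeas \<mu>" "fmeas \<tau>"
  shows "G (Suc m) \<mu> \<tau> = (\<integral>y. G m (step \<mu> y) (step \<tau> y) \<partial>\<phi>)"
    and "integrable \<phi> (\<lambda>y. G m (step \<mu> y) (step \<tau> y))"
  using integral_S[OF integrable_G[OF assms, of "Suc m"]]
  unfolding G_def q_def by (simp_all add: U_Suc[OF assms(1)] U_Suc[OF assms(2)])

text \<open>Expanding the weighted square by \<open>sqr_dev\<close> leaves \<open>sqr\<close> plus
  linear terms, so \<open>sqr_subadd\<close> separates the two components; the second contributes at
  most its mass, all estimates lying in [0, 1].\<close>

lemma G_split:
  assumes \<mu>: "fmeas \<mu>1" "fmeas \<mu>2" "fmeas \<mu>" and \<tau>: "fmeas \<tau>" and sum: "is_sum \<mu> \<mu>1 \<mu>2"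
  shows "G m \<mu> \<tau> \<le> G m \<mu>1 \<tau> + measure \<mu>2 UNIV"
proof -
  have "G m \<mu> \<tau> \<le> (\<integral>s. enn2real (U1 m \<mu>1 s) * (q m \<mu>1 s - q m \<tau> s)\<^sup>2 + enn2real (U1 m \<mu>2 s) \<partial>S)"
    unfolding G_def
  proof (rule integral_mono_AE)
    show "AE s in S. enn2real (U1 m \<mu> s) * (q m \<mu> s - q m \<tau> s)\<^sup>2
        \<le> enn2real (U1 m \<mu>1 s) * (q m \<mu>1 s - q m \<tau> s)\<^sup>2 + enn2real (U1 m \<mu>2 s)"
      using AE_enn2real_sum[OF \<mu>(1,2) sum, of m] AE_Uf_U1[OF \<mu>(1), of m] AE_Uf_U1[OF \<mu>(2), of m]
        G_integrand_bounds[OF \<mu>(2) \<tau>, of m]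
    proof eventually_elim
      case (elim s)
      define a1 b1 a2 b2 r where "a1 = enn2real (Uf m \<mu>1 s)" "b1 = enn2real (U1 m \<mu>1 s)"
        "a2 = enn2real (Uf m \<mu>2 s)" "b2 = enn2real (U1 m \<mu>2 s)" "r = q m \<tau> s"
      note d = this
      have e: "0 \<le> a1" "a1 \<le> b1" "0 \<le> a2" "a2 \<le> b2" "b2 * (a2 / b2 - r)\<^sup>2 \<le> b2"
        using elim by (auto simp: d q_def[of m \<mu>2])
      have "(b1 + b2) * ((a1 + a2) / (b1 + b2) - r)\<^sup>2 = sqr (a1 + a2) (b1 + b2) - 2 * r * (a1 + a2) + r\<^sup>2 * (b1 + b2)"
        using e by (intro sqr_dev) auto
      also have "\<dots> \<le> (sqr a1 b1 - 2 * r * a1 + r\<^sup>2 * b1) + (sqr a2 b2 - 2 * r * a2 + r\<^sup>2 * b2)"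
        using sqr_subadd[OF e(1-4)] by (simp add: algebra_simps)
      also have "\<dots> = b1 * (a1 / b1 - r)\<^sup>2 + b2 * (a2 / b2 - r)\<^sup>2"
        using e by (simp add: sqr_dev)
      also have "\<dots> \<le> b1 * (a1 / b1 - r)\<^sup>2 + b2" using e by simp
      finally show ?case using elim by (simp add: d q_def[of m \<mu>1] q_def[of m \<mu>])
    qed
  qed (auto intro!: integrable_G integrable_U1 \<mu> \<tau>)
  also have "\<dots> = G m \<mu>1 \<tau> + measure \<mu>2 UNIV"
    unfolding G_def integral_U1[OF \<mu>(2), symmetric, of m]
    by (intro Bochner_Integration.integral_add integrable_G integrable_U1 \<mu> \<tau>)
  finally show ?thesis .
qed

text \<open>Pointwise \<open>sqr_gap\<close>: domination of \<mu> by n \<tau> passes to the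
  likelihoods.\<close>

lemma G_dominated:
  assumes \<mu>: "fmeas \<mu>" "fmeas \<tau>" "fmeas \<kappa>" and sum: "is_sum \<kappa> \<mu> \<tau>"
    and n: "0 \<le> n" "\<And>g. g \<in> borel_measurable borel \<Longrightarrow> (\<integral>\<^sup>+x. g x \<partial>\<mu>) \<le> ennreal n * (\<integral>\<^sup>+x. g x \<partial>\<tau>)"
  shows "G m \<mu> \<tau> \<le> (1 + n) * (Im m \<mu> + Im m \<tau> - Im m \<kappa>)"
proof -
  have "G m \<mu> \<tau> \<le> (\<integral>s. (1 + n) * (rt (Uf m \<mu> s) (U1 m \<mu> s) + rt (Uf m \<tau> s) (U1 m \<tau> s) - rt (Uf m \<kappa> s) (U1 m \<kappa> s)) \<partial>S)"
    unfolding G_def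
  proof (rule integral_mono_AE)
    show "AE s in S. enn2real (U1 m \<mu> s) * (q m \<mu> s - q m \<tau> s)\<^sup>2 \<le>
        (1 + n) * (rt (Uf m \<mu> s) (U1 m \<mu> s) + rt (Uf m \<tau> s) (U1 m \<tau> s) - rt (Uf m \<kappa> s) (U1 m \<kappa> s))"
      using AE_enn2real_sum[OF \<mu>(1,2) sum, of m] AE_Uf_U1[OF \<mu>(1), of m] AE_Uf_U1[OF \<mu>(2), of m]
    proof eventually_elim
      case (elim s)
      have "U1 m \<mu> s \<le> ennreal n * U1 m \<tau> s" unfolding U_def by (intro n) measurable
      then have "enn2real (U1 m \<mu> s) \<le> enn2real (ennreal n * U1 m \<tau> s)"
        using elim by (intro enn2real_mono) (auto simp: ennreal_mult_less_top)
      also have "\<dots> = n * enn2real (U1 m \<tau> s)" using n(1) by (simp add: enn2real_mult)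
      finally have "enn2real (U1 m \<mu> s) \<le> n * enn2real (U1 m \<tau> s)" .
      then show ?case
        using elim n(1) sqr_gap[of "enn2real (Uf m \<mu> s)" "enn2real (U1 m \<mu> s)" "enn2real (Uf m \<tau> s)" "enn2real (U1 m \<tau> s)" n]
        by (simp add: q_def)
    qed
  qed (auto intro!: integrable_G integrable_rt \<mu> integrable_mult_right)
  also have "\<dots> = (1 + n) * (Im m \<mu> + Im m \<tau> - Im m \<kappa>)"
    unfolding Im_def using \<mu> by (simp add: integrable_rt)
  finally show ?thesis .
qed

end

text \<open>The limits of \<open>Im\<close> are proportional to mass, and mass is additive, so the
  subadditivity defect bounding \<open>G\<close> tends to 0.\<close>

lemma (in filter_ergodic) G_dominated_tendsto:
  assumes \<mu>: "fmeas \<mu>" "fmeas \<tau>" "fmeas \<kappa>" and sum: "is_sum \<kappa> \<mu> \<tau>"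
    and n: "0 \<le> n" "\<And>g. g \<in> borel_measurable borel \<Longrightarrow> (\<integral>\<^sup>+x. g x \<partial>\<mu>) \<le> ennreal n * (\<integral>\<^sup>+x. g x \<partial>\<tau>)"
  shows "(\<lambda>m. G m \<mu> \<tau>) \<longlonglongrightarrow> 0"
proof (rule tendsto_sandwich[OF _ _ tendsto_const])
  show "\<forall>\<^sub>F m in sequentially. 0 \<le> G m \<mu> \<tau>" by (simp add: G_nonneg \<mu>)
  show "\<forall>\<^sub>F m in sequentially. G m \<mu> \<tau> \<le> (1 + n) * (Im m \<mu> + Im m \<tau> - Im m \<kappa>)"
    by (simp add: G_dominated[OF \<mu> sum n])
  have "emeasure \<kappa> UNIV = emeasure \<mu> UNIV + emeasure \<tau> UNIV"
    using bspec[OF sum[unfolded is_sum_def], of "\<lambda>_. 1"] fmeasD(3)[OF \<mu>(1)] fmeasD(3)[OF \<mu>(2)] fmeasD(3)[OF \<mu>(3)] by simp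
  then have "measure \<kappa> UNIV = measure \<mu> UNIV + measure \<tau> UNIV"
    unfolding measure_def using fmeasD(4)[OF \<mu>(1), of UNIV] fmeasD(4)[OF \<mu>(2), of UNIV] by (simp add: enn2real_plus)
  moreover have "(\<lambda>m. (1 + n) * (Im m \<mu> + Im m \<tau> - Im m \<kappa>)) \<longlonglongrightarrow>
     (1 + n) * (c_lim * measure \<mu> UNIV + c_lim * measure \<tau> UNIV - c_lim * measure \<kappa> UNIV)"
    by (intro tendsto_intros Im_tendsto \<mu>)
  ultimately show "(\<lambda>m. (1 + n) * (Im m \<mu> + Im m \<tau> - Im m \<kappa>)) \<longlonglongrightarrow> 0"
    by (simp add: algebra_simps)
qed

text \<open>\<mu> splits into the part on N, a part with density at most n with respect to \<tau>,
  and a remainder of small mass. \<open>G_dominated_tendsto\<close> handles the second;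
  \<open>G_split\<close> pays the mass of the other two.\<close>

lemma (in filter_ergodic) G_base:
  assumes \<mu>: "fmeas \<mu>" "fmeas \<tau>" and N[measurable]: "N \<in> sets borel"
    and ac: "\<And>C. C \<in> sets borel \<Longrightarrow> emeasure \<tau> C = 0 \<Longrightarrow> emeasure \<mu> (C - N) = 0"
  shows "(\<lambda>m. max 0 (G m \<mu> \<tau> - measure \<mu> N)) \<longlonglongrightarrow> 0"
proof -
  define \<mu>1 where "\<mu>1 = density \<mu> (indicator (- N))"
  have f1: "fmeas \<mu>1" unfolding \<mu>1_def by (intro fmeas_restrict \<mu>) measurable
  interpret \<tau>: finite_measure \<tau> by (rule fmeasD(1)[OF \<mu>(2)])
  have "absolutely_continuous \<tau> \<mu>1"
    unfolding absolutely_continuous_def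
  proof
    fix C assume "C \<in> null_sets \<tau>"
    then have C: "C \<in> sets borel" "emeasure \<tau> C = 0" using fmeasD(2)[OF \<mu>(2)] by (auto simp: null_sets_def)
    have "emeasure \<mu>1 C = emeasure \<mu> (C - N)"
      unfolding \<mu>1_def using C fmeasD[OF \<mu>(1)]
      by (subst emeasure_density) (auto simp: measurable_fmeas[OF \<mu>(1)] Diff_eq Int_commute indicator_inter_arith[symmetric] simp del: nn_integral_indicator' intro!: nn_integral_indicator)
    then show "C \<in> null_sets \<mu>1"
      using ac[OF C] C fmeasD(2)[OF f1] by (auto simp: null_sets_def)
  qed
  then obtain h where h: "h \<in> borel_measurable \<tau>" "density \<tau> h = \<mu>1"
    using \<tau>.Radon_Nikodym[of \<mu>1] fmeasD(2)[OF f1] fmeasD(2)[OF \<mu>(2)] by auto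
  have [measurable]: "h \<in> borel_measurable borel" using h(1) by (simp add: measurable_fmeas[OF \<mu>(2)])
  have hf: "(\<integral>\<^sup>+x. h x \<partial>\<tau>) < \<infinity>"
    using fmeasD(4)[OF f1, of UNIV] fmeasD(3)[OF \<mu>(2)] fmeasD(2)[OF \<mu>(2)] unfolding h(2)[symmetric]
    by (subst (asm) emeasure_density) (auto simp: h(1))
  have "(\<lambda>n. \<integral>\<^sup>+x. h x - min (h x) (of_nat n) \<partial>\<tau>) \<longlonglongrightarrow> (\<integral>\<^sup>+x. 0 \<partial>\<tau>)"
  proof (rule nn_integral_dominated_convergence[where w=h])
    show "AE x in \<tau>. (\<lambda>n. h x - min (h x) (of_nat n)) \<longlonglongrightarrow> 0"
    proof -
      have "AE x in \<tau>. h x \<noteq> \<infinity>" using hf h(1) by (intro nn_integral_PInf_AE) auto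
      then show ?thesis
      proof eventually_elim
        case (elim x)
        then obtain k :: nat where k: "h x \<le> of_nat k" using ennreal_Ex_less_of_nat[of "h x"] by (auto simp: less_top intro: less_imp_le)
        have "eventually (\<lambda>n. h x - min (h x) (of_nat n) = 0) sequentially"
          unfolding eventually_sequentially
        proof (intro exI[of _ k] allI impI)
          fix n assume "k \<le> n"
          then have "h x \<le> of_nat n" using k by (meson of_nat_mono order.trans)
          then show "h x - min (h x) (of_nat n) = 0" using elim by (simp add: min_absorb1)
        qed
        then show ?case by (rule tendsto_eventually)
      qed
    qed
  qed (use hf h(1) in \<open>auto simp: diff_le_self_ennreal measurable_fmeas[OF \<mu>(2)]\<close>)
  then have small: "(\<lambda>n. \<integral>\<^sup>+x. h x - min (h x) (of_nat n) \<partial>\<tau>) \<longlonglongrightarrow> 0" by simp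
  have key: "\<exists>M. \<forall>m\<ge>M. G m \<mu> \<tau> - measure \<mu> N < 2 * \<epsilon>" if \<epsilon>: "0 < \<epsilon>" for \<epsilon>
  proof -
    have "eventually (\<lambda>n. (\<integral>\<^sup>+x. h x - min (h x) (of_nat n) \<partial>\<tau>) < ennreal \<epsilon>) sequentially"
      using \<epsilon> by (intro order_tendstoD(2)[OF small]) auto
    then obtain n :: nat where n: "(\<integral>\<^sup>+x. h x - min (h x) (of_nat n) \<partial>\<tau>) < ennreal \<epsilon>"
      by (auto simp: eventually_sequentially)
    define a b where "a = density \<tau> (\<lambda>x. min (h x) (of_nat n))" and "b = density \<tau> (\<lambda>x. h x - min (h x) (of_nat n))"
    have "(\<integral>\<^sup>+x. min (h x) (of_nat n) \<partial>\<tau>) \<le> (\<integral>\<^sup>+x. h x \<partial>\<tau>)" by (intro nn_integral_mono) auto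
    then have amf: "(\<integral>\<^sup>+x. min (h x) (of_nat n) \<partial>\<tau>) < \<infinity>" using hf by (rule order.strict_trans1)
    have fa: "fmeas a" unfolding a_def using amf by (intro fmeas_density \<mu>) auto
    have fb: "fmeas b" unfolding b_def using order.strict_trans[OF n] by (intro fmeas_density \<mu>) auto
    have "is_sum (density \<tau> h) a b"
      unfolding a_def b_def by (intro is_sum_density \<mu>) (auto simp: add_diff_inverse_ennreal add.commute diff_add_cancel_ennreal)
    then have s1: "is_sum \<mu>1 a b" by (simp add: h(2))
    have b_small: "measure b UNIV \<le> \<epsilon>"
    proof -
      have "emeasure b UNIV = (\<integral>\<^sup>+x. h x - min (h x) (of_nat n) \<partial>\<tau>)"
        unfolding b_def using fmeasD[OF \<mu>(2)] by (subst emeasure_density) (auto simp: measurable_fmeas[OF \<mu>(2)])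
      then show ?thesis using n \<epsilon> unfolding measure_def by (metis enn2real_leI less_imp_le)
    qed
    have "fmeas (density \<tau> (\<lambda>x. min (h x) (of_nat n) + 1))"
      using amf fmeasD(4)[OF \<mu>(2), of UNIV] fmeasD(3)[OF \<mu>(2)]
      by (intro fmeas_density \<mu>) (auto simp: nn_integral_add measurable_fmeas[OF \<mu>(2)])
    moreover have "is_sum (density \<tau> (\<lambda>x. min (h x) (of_nat n) + 1)) a (density \<tau> (\<lambda>_. 1))"
      unfolding a_def by (intro is_sum_density \<mu>) auto
    moreover have "(\<integral>\<^sup>+x. g x \<partial>a) \<le> ennreal (real n) * (\<integral>\<^sup>+x. g x \<partial>\<tau>)" if [measurable]: "g \<in> borel_measurable borel" for g
    proof -
      have "(\<integral>\<^sup>+x. g x \<partial>a) = (\<integral>\<^sup>+x. min (h x) (of_nat n) * g x \<partial>\<tau>)"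
        unfolding a_def by (subst nn_integral_density) (auto simp: measurable_fmeas[OF \<mu>(2)])
      also have "\<dots> \<le> (\<integral>\<^sup>+x. of_nat n * g x \<partial>\<tau>)"
        by (intro nn_integral_mono mult_right_mono) auto
      also have "\<dots> = ennreal (real n) * (\<integral>\<^sup>+x. g x \<partial>\<tau>)"
        by (simp add: nn_integral_cmult measurable_fmeas[OF \<mu>(2)] ennreal_of_nat_eq_real_of_nat)
      finally show ?thesis .
    qed
    ultimately have "(\<lambda>m. G m a \<tau>) \<longlonglongrightarrow> 0"
      using G_dominated_tendsto[OF fa \<mu>(2), of _ "real n"] by (simp add: density_1)
    from order_tendstoD(2)[OF this \<epsilon>] obtain M where M: "\<And>m. m \<ge> M \<Longrightarrow> G m a \<tau> < \<epsilon>"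
      by (auto simp: eventually_sequentially)
    have "G m \<mu> \<tau> - measure \<mu> N < 2 * \<epsilon>" if "m \<ge> M" for m
    proof -
      have "is_sum \<mu> (density \<mu> (indicator (- N))) (density \<mu> (indicator (- (- N))))"
        by (intro is_sum_restrict \<mu>) measurable
      then have "G m \<mu> \<tau> \<le> G m \<mu>1 \<tau> + measure \<mu> N"
        using G_split[OF f1 fmeas_restrict[OF \<mu>(1) N] \<mu>(1,2), of m] measure_restrict[OF \<mu>(1) N]
        by (simp add: \<mu>1_def)
      also have "G m \<mu>1 \<tau> \<le> G m a \<tau> + measure b UNIV" by (rule G_split[OF fa fb f1 \<mu>(2) s1])
      finally show ?thesis using M[OF that] b_small by simp
    qed
    then show ?thesis by blast
  qed
  show ?thesis
  proof (rule LIMSEQ_I)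
    fix r :: real assume "0 < r"
    from key[of "r / 2"] this obtain M where M: "\<And>m. m \<ge> M \<Longrightarrow> G m \<mu> \<tau> - measure \<mu> N < r" by auto
    show "\<exists>no. \<forall>n\<ge>no. norm (max 0 (G n \<mu> \<tau> - measure \<mu> N) - 0) < r"
      using M \<open>0 < r\<close> by (intro exI[of _ M]) (auto simp: max_def)
  qed
qed

text \<open>\<open>G_base\<close> with singularity measured at time j instead of time 0. As
  \<Upsilon> > 0, the correction does not alter null sets, so the hypothesis passes to
  \<open>step \<mu> y\<close> and \<open>step \<tau> y\<close> with j lowered by one; dominated
  convergence in y closes the induction.\<close>

lemma (in filter_ergodic) G_claim:
  assumes "fmeas \<mu>" "fmeas \<tau>" and N[measurable]: "N \<in> sets borel"
    and "\<And>C. C \<in> sets borel \<Longrightarrow> (\<integral>\<^sup>+x. pj j (indicator C) x \<partial>\<tau>) = 0 \<Longrightarrow> (\<integral>\<^sup>+x. pj j (indicator (C - N)) x \<partial>\<mu>) = 0"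
  shows "(\<lambda>m. max 0 (G m \<mu> \<tau> - enn2real (\<integral>\<^sup>+x. pj j (indicator N) x \<partial>\<mu>))) \<longlonglongrightarrow> 0"
  using assms(1,2,4)
proof (induction j arbitrary: \<mu> \<tau>)
  case 0
  have "emeasure \<mu> (C - N) = 0" if "C \<in> sets borel" "emeasure \<tau> C = 0" for C
    using 0(3)[of C] that fmeasD(2)[OF 0(1)] fmeasD(2)[OF 0(2)] N by simp
  from G_base[OF 0(1,2) N this] show ?case using fmeasD(2)[OF 0(1)] by (simp add: measure_def)
next
  case (Suc j)
  note \<mu> = Suc.prems(1) and \<tau> = Suc.prems(2)
  note p\<mu> = fmeas_push[OF \<mu>] and p\<tau> = fmeas_push[OF \<tau>]
  let ?n = "\<lambda>y. enn2real (\<integral>\<^sup>+x. pj j (indicator N) x \<partial>step \<mu> y)"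
  let ?m = "enn2real (\<integral>\<^sup>+x. pj (Suc j) (indicator N) x \<partial>\<mu>)"
  have pjN1: "pj j (indicator N) x \<le> 1" for x by (rule pj_le) (auto simp: indicator_def)
  have nn_le: "(\<integral>\<^sup>+x. pj j (indicator N) x \<partial>step \<mu> y) \<le> emeasure (step \<mu> y) UNIV" for y
    using nn_integral_mono[of "step \<mu> y" "pj j (indicator N)" "\<lambda>_. 1"] pjN1 space_step[OF \<mu>] by simp
  have [measurable]: "(\<lambda>y. emeasure (step \<mu> y) UNIV) \<in> borel_measurable \<phi>"
    using step_UNIV_measurable[OF \<mu>] by measurable
  have n_meas[measurable]: "(\<lambda>y. \<integral>\<^sup>+x. pj j (indicator N) x \<partial>step \<mu> y) \<in> borel_measurable \<phi>"
    by (subst nn_integral_step[OF \<mu>]) (auto intro!: nn_integral_fmeas_measurable[OF p\<mu>])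
  have n_tot: "(\<integral>\<^sup>+y. (\<integral>\<^sup>+x. pj j (indicator N) x \<partial>step \<mu> y) \<partial>\<phi>) = (\<integral>\<^sup>+x. pj (Suc j) (indicator N) x \<partial>\<mu>)"
    by (subst nn_integral_step_phi[OF \<mu>]) (auto simp: nn_integral_push[OF \<mu>])
  have mass: "integrable \<phi> (\<lambda>y. measure (step \<mu> y) UNIV)"
  proof (rule integrableI_nonneg)
    have "(\<integral>\<^sup>+y. ennreal (measure (step \<mu> y) UNIV) \<partial>\<phi>) = (\<integral>\<^sup>+y. emeasure (step \<mu> y) UNIV \<partial>\<phi>)"
      using AE_fmeas_step[OF \<mu>] by (intro nn_integral_cong_AE) (auto elim!: eventually_mono simp: finite_measure.emeasure_eq_measure fmeasD(1))
    then show "(\<integral>\<^sup>+y. ennreal (measure (step \<mu> y) UNIV) \<partial>\<phi>) < \<infinity>"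
      using step_UNIV_phi[OF \<mu>] fmeasD(4)[OF \<mu>, of UNIV] by simp
  qed (auto simp: measure_def)
  have n_le: "AE y in \<phi>. 0 \<le> ?n y \<and> ?n y \<le> measure (step \<mu> y) UNIV"
    using AE_fmeas_step[OF \<mu>]
  proof eventually_elim
    case (elim y)
    show ?case using nn_le[of y] fmeasD(4)[OF elim, of UNIV] unfolding measure_def by (auto intro!: enn2real_mono)
  qed
  have n_int: "integrable \<phi> ?n"
    using n_le by (intro Bochner_Integration.integrable_bound[OF mass]) auto
  have n_eq: "(\<integral>y. ?n y \<partial>\<phi>) = ?m"
  proof -
    have "(\<integral>\<^sup>+y. ennreal (?n y) \<partial>\<phi>) = (\<integral>\<^sup>+y. (\<integral>\<^sup>+x. pj j (indicator N) x \<partial>step \<mu> y) \<partial>\<phi>)"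
      using AE_fmeas_step[OF \<mu>]
    proof (intro nn_integral_cong_AE, eventually_elim)
      case (elim y)
      then show ?case using order.strict_trans1[OF nn_le[of y]] fmeasD(4)[OF elim(2), of UNIV] by simp
    qed
    then show ?thesis by (subst integral_eq_nn_integral) (auto simp: n_tot)
  qed
  \<comment> \<open>The excess over the singular mass \<open>?n y\<close> at observation y; these
    masses integrate to \<open>?m\<close>.\<close>
  let ?d = "\<lambda>m y. max 0 (G m (step \<mu> y) (step \<tau> y) - ?n y)"
  have IH: "AE y in \<phi>. (\<lambda>m. ?d m y) \<longlonglongrightarrow> 0"
    using AE_fmeas_step[OF \<mu>] AE_fmeas_step[OF \<tau>]
  proof eventually_elim
    case (elim y)
    show ?case
    proof (rule Suc.IH[OF elim])
      fix C assume C[measurable]: "C \<in> sets borel" and z: "(\<integral>\<^sup>+x. pj j (indicator C) x \<partial>step \<tau> y) = 0"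
      have "AE x in push \<tau>. ennreal (\<Upsilon> x y) * pj j (indicator C) x = 0"
        using z by (subst (asm) nn_integral_step[OF \<tau>]) (auto simp: nn_integral_0_iff_AE measurable_fmeas[OF p\<tau>])
      then have "AE x in push \<tau>. pj j (indicator C) x = 0"
        using Ups_pos by (auto elim!: eventually_mono simp: ennreal_eq_0_iff not_le[symmetric])
      then have "(\<integral>\<^sup>+x. pj j (indicator C) x \<partial>push \<tau>) = 0"
        by (simp add: nn_integral_0_iff_AE measurable_fmeas[OF p\<tau>])
      then have "(\<integral>\<^sup>+x. pj (Suc j) (indicator C) x \<partial>\<tau>) = 0" by (simp add: nn_integral_push[OF \<tau>])
      then have "(\<integral>\<^sup>+x. pj (Suc j) (indicator (C - N)) x \<partial>\<mu>) = 0" using Suc.prems(3)[OF C] by simp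
      then have "(\<integral>\<^sup>+x. pj j (indicator (C - N)) x \<partial>push \<mu>) = 0" by (simp add: nn_integral_push[OF \<mu>])
      then have "AE x in push \<mu>. pj j (indicator (C - N)) x = 0"
        by (simp add: nn_integral_0_iff_AE measurable_fmeas[OF p\<mu>])
      then show "(\<integral>\<^sup>+x. pj j (indicator (C - N)) x \<partial>step \<mu> y) = 0"
        by (subst nn_integral_step[OF \<mu>]) (auto simp: nn_integral_0_iff_AE measurable_fmeas[OF p\<mu>])
    qed
  qed
  have dm: "(\<lambda>y. ?d m y) \<in> borel_measurable \<phi>" for m
    using G_Suc(2)[OF \<mu> \<tau>, of m] n_int by measurable
  have db: "AE y in \<phi>. norm (?d m y) \<le> measure (step \<mu> y) UNIV" for m
    using AE_fmeas_step[OF \<mu>] AE_fmeas_step[OF \<tau>] n_le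
  proof eventually_elim
    case (elim y)
    have "G m (step \<mu> y) (step \<tau> y) - ?n y \<le> measure (step \<mu> y) UNIV"
      using G_le[OF elim(1,2), of m] elim(3) by linarith
    then show ?case by simp
  qed
  have di: "integrable \<phi> (?d m)" for m
    using db by (intro Bochner_Integration.integrable_bound[OF mass dm]) (auto elim!: eventually_mono)
  have lim: "(\<lambda>m. \<integral>y. ?d m y \<partial>\<phi>) \<longlonglongrightarrow> (\<integral>y. 0 \<partial>\<phi>)"
    by (rule integral_dominated_convergence[OF _ dm mass IH db]) simp
  have "max 0 (G (Suc m) \<mu> \<tau> - ?m) \<le> (\<integral>y. ?d m y \<partial>\<phi>)" for m
  proof -
    have "G (Suc m) \<mu> \<tau> - ?m = (\<integral>y. G m (step \<mu> y) (step \<tau> y) - ?n y \<partial>\<phi>)"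
      unfolding G_Suc(1)[OF \<mu> \<tau>] n_eq[symmetric]
      by (rule Bochner_Integration.integral_diff[symmetric, OF G_Suc(2)[OF \<mu> \<tau>] n_int])
    also have "\<dots> \<le> (\<integral>y. ?d m y \<partial>\<phi>)"
      by (intro integral_mono Bochner_Integration.integrable_diff G_Suc(2)[OF \<mu> \<tau>] n_int di) simp
    finally show ?thesis by (auto intro!: integral_nonneg_AE)
  qed
  note bound = this
  have "(\<lambda>m. max 0 (G (Suc m) \<mu> \<tau> - ?m)) \<longlonglongrightarrow> 0"
  proof (rule tendsto_sandwich[OF _ _ tendsto_const])
    show "\<forall>\<^sub>F m in sequentially. 0 \<le> max 0 (G (Suc m) \<mu> \<tau> - ?m)" by simp
    show "\<forall>\<^sub>F m in sequentially. max 0 (G (Suc m) \<mu> \<tau> - ?m) \<le> (\<integral>y. ?d m y \<partial>\<phi>)"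
      by (intro always_eventually allI bound)
    show "(\<lambda>m. \<integral>y. ?d m y \<partial>\<phi>) \<longlonglongrightarrow> 0" using lim by simp
  qed
  then show ?case by (rule LIMSEQ_imp_Suc)
qed

text \<open>Even mutually singular \<mu> and \<tau> have laws close to \<open>lam\<close> at a late
  time j. A set N that is null for the law from \<tau> then has small mass under the law from \<mu>,
  and \<open>G_claim\<close> applies with this N.\<close>

lemma (in filter_ergodic) G_tendsto:
  assumes \<mu>: "fmeas \<mu>" "measure \<mu> UNIV = 1" and \<tau>: "fmeas \<tau>" "measure \<tau> UNIV = 1"
  shows "(\<lambda>m. G m \<mu> \<tau>) \<longlonglongrightarrow> 0"
proof (rule LIMSEQ_I)
  fix r :: real assume r: "0 < r"
  obtain \<delta> where \<delta>: "\<delta> \<longlonglongrightarrow> 0" "\<And>j. tvle (\<delta> j) ((push ^^ j) \<mu>) lam" using tv_conv[OF \<mu>] by blast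
  obtain \<gamma> where \<gamma>: "\<gamma> \<longlonglongrightarrow> 0" "\<And>j. tvle (\<gamma> j) ((push ^^ j) \<tau>) lam" using tv_conv[OF \<tau>] by blast
  have "(\<lambda>j. \<delta> j + \<gamma> j) \<longlonglongrightarrow> 0" using tendsto_add[OF \<delta>(1) \<gamma>(1)] by simp
  then have "eventually (\<lambda>j. \<delta> j + \<gamma> j < r / 2) sequentially" using r by (intro order_tendstoD) auto
  then obtain j where j: "\<delta> j + \<gamma> j < r / 2" by (auto simp: eventually_sequentially)
  let ?s = "(push ^^ j) \<mu>" and ?t = "(push ^^ j) \<tau>"
  have fs: "fmeas ?s" and ft: "fmeas ?t" by (intro fmeas_push_pow \<mu> \<tau>)+
  have "sets ?t = sets ?s" using fmeasD(2)[OF fs] fmeasD(2)[OF ft] by simp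
  from Lebesgue_null_decomposition[OF fmeasD(1)[OF fs] this]
  obtain N where N: "N \<in> sets borel" "emeasure ?t N = 0"
    "\<And>C. C \<in> sets borel \<Longrightarrow> emeasure ?t C = 0 \<Longrightarrow> emeasure ?s (C - N) = 0"
    using fmeasD(2)[OF fs] by metis
  have pjs: "(\<integral>\<^sup>+x. pj j (indicator C) x \<partial>\<mu>) = emeasure ?s C"
    and pjt: "(\<integral>\<^sup>+x. pj j (indicator C) x \<partial>\<tau>) = emeasure ?t C" if "C \<in> sets borel" for C
    using that fmeasD(2)[OF fs] fmeasD(2)[OF ft] by (simp_all add: pj_push_pow \<mu> \<tau>)
  have lim: "(\<lambda>m. max 0 (G m \<mu> \<tau> - enn2real (\<integral>\<^sup>+x. pj j (indicator N) x \<partial>\<mu>))) \<longlonglongrightarrow> 0"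
    using N by (intro G_claim \<mu> \<tau>) (auto simp: pjs pjt)
  have "measure ?s N \<le> measure lam N + \<delta> j" "measure lam N \<le> measure ?t N + \<gamma> j"
    using bspec[OF \<delta>(2)[of j, unfolded tvle_def], of "indicator N"] bspec[OF \<gamma>(2)[of j, unfolded tvle_def], of "indicator N"]
      N(1) fmeasD(2)[OF fs] fmeasD(2)[OF ft] fmeasD(2)[OF lam(1)] fmeasD(3)[OF fs] fmeasD(3)[OF ft] fmeasD(3)[OF lam(1)]
    by (auto simp: abs_le_iff indicator_le_1 split: split_indicator)
  then have "enn2real (\<integral>\<^sup>+x. pj j (indicator N) x \<partial>\<mu>) < r / 2"
    using j N by (simp add: pjs measure_def)
  moreover obtain M where "\<And>m. m \<ge> M \<Longrightarrow> max 0 (G m \<mu> \<tau> - enn2real (\<integral>\<^sup>+x. pj j (indicator N) x \<partial>\<mu>)) < r / 2"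
    using order_tendstoD(2)[OF lim, of "r / 2"] r by (auto simp: eventually_sequentially)
  ultimately have "G m \<mu> \<tau> < r" if "m \<ge> M" for m
    using that by (smt (verit) field_sum_of_halves max.cobounded2)
  then show "\<exists>no. \<forall>n\<ge>no. norm (G n \<mu> \<tau> - 0) < r"
    using G_nonneg[OF \<mu>(1) \<tau>(1)] by (intro exI[of _ M]) auto
qed

context filter_test
begin

text \<open>With X started at x and q the estimate at time m of the filter started in \<nu>, this is
  the expectation of q^2 - 2 f(X_m) q. That it is an iterate of the exact kernel on
  \<open>Fm 0\<close> is \<open>Fp_Suc\<close>.\<close>

definition Fm :: "nat \<Rightarrow> 'e \<Rightarrow> 'e measure \<Rightarrow> real" where
  "Fm m x \<nu> = (\<integral>s. enn2real (u m (\<lambda>_. 1) x s) * (q m \<nu> s)\<^sup>2 - 2 * enn2real (u m f x s) * q m \<nu> s \<partial>S)"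

text \<open>Completing the square: q^2 - 2 p q = (p - q)^2 - p^2, with p the estimate of the filter
  that knows x.\<close>

lemma Fm_eq:
  assumes \<nu>: "fmeas \<nu>"
  shows "Fm m x \<nu> = G m (return borel x) \<nu> - Im m (return borel x)"
proof -
  note r = fmeas_return[of x]
  have "G m (return borel x) \<nu> - Im m (return borel x) =
    (\<integral>s. enn2real (U1 m (return borel x) s) * (q m (return borel x) s - q m \<nu> s)\<^sup>2 - rt (Uf m (return borel x) s) (U1 m (return borel x) s) \<partial>S)"
    unfolding G_def Im_def by (rule Bochner_Integration.integral_diff[symmetric, OF integrable_G[OF r \<nu>] integrable_rt[OF r]])
  also have "\<dots> = (\<integral>s. enn2real (u m (\<lambda>_. 1) x s) * (q m \<nu> s)\<^sup>2 - 2 * enn2real (u m f x s) * q m \<nu> s \<partial>S)"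
  proof (rule integral_cong_AE)
    show "AE s in S. enn2real (U1 m (return borel x) s) * (q m (return borel x) s - q m \<nu> s)\<^sup>2 - rt (Uf m (return borel x) s) (U1 m (return borel x) s) =
        enn2real (u m (\<lambda>_. 1) x s) * (q m \<nu> s)\<^sup>2 - 2 * enn2real (u m f x s) * q m \<nu> s"
      using AE_Uf_U1[OF r, of m]
    proof eventually_elim
      case (elim s)
      then show ?case
        using sqr_dev[of "enn2real (Uf m (return borel x) s)" "enn2real (U1 m (return borel x) s)" "q m \<nu> s"]
        by (simp add: q_def[of m "return borel x"] U_return algebra_simps)
    qed
  qed (use r \<nu> in measurable)
  finally show ?thesis by (simp add: Fm_def)
qed

end

lemma (in filter_ergodic) Fm_tendsto:
  assumes "fmeas \<nu>" "measure \<nu> UNIV = 1"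
  shows "(\<lambda>m. Fm m x \<nu>) \<longlonglongrightarrow> - c_lim"
proof -
  have m: "measure (return borel x) UNIV = 1" by (simp add: measure_return)
  have "(\<lambda>m. G m (return borel x) \<nu> - Im m (return borel x)) \<longlonglongrightarrow> 0 - c_lim * 1"
    using Im_tendsto[OF fmeas_return[of x]] m by (intro tendsto_diff G_tendsto fmeas_return assms) auto
  then show ?thesis by (simp add: Fm_eq[OF assms(1)])
qed

section \<open>Weak convergence and tightness\<close>

text \<open>Takes the place of a metric: portmanteau arguments need indicators of open sets as
  limits from below of continuous functions. The property survives finite intersections, countable
  unions and continuous preimages, so it reaches the weak topology from its generators.\<close>

definition approx_open :: "'a::topological_space set \<Rightarrow> bool" where
  "approx_open A \<longleftrightarrow> (\<exists>g :: nat \<Rightarrow> 'a \<Rightarrow> real.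
     (\<forall>k. continuous_on UNIV (g k)) \<and> (\<forall>k x. 0 \<le> g k x \<and> g k x \<le> indicator A x) \<and>
     (\<forall>x\<in>A. (\<lambda>k. g k x) \<longlonglongrightarrow> 1))"

lemma approx_openE:
  assumes "approx_open A"
  obtains g :: "nat \<Rightarrow> 'a::topological_space \<Rightarrow> real"
  where "\<And>k. continuous_on UNIV (g k)" "\<And>k x. 0 \<le> g k x" "\<And>k x. g k x \<le> indicator A x" "\<And>k x. g k x \<le> 1"
    "\<And>x. (\<lambda>k. g k x) \<longlonglongrightarrow> indicator A x"
proof -
  from assms obtain g :: "nat \<Rightarrow> 'a \<Rightarrow> real"
    where g: "\<And>k. continuous_on UNIV (g k)" "\<And>k x. 0 \<le> g k x" "\<And>k x. g k x \<le> indicator A x"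
      "\<And>x. x \<in> A \<Longrightarrow> (\<lambda>k. g k x) \<longlonglongrightarrow> 1"
    unfolding approx_open_def by blast
  have "(\<lambda>k. g k x) \<longlonglongrightarrow> indicator A x" for x
  proof (cases "x \<in> A")
    case False
    then have "g k x = 0" for k using g(2)[of k x] g(3)[of k x] by simp
    then show ?thesis using False by simp
  qed (use g(4) in simp)
  moreover have "g k x \<le> 1" for k x using g(3)[of k x] by (auto split: split_indicator_asm)
  ultimately show thesis using g by (intro that[of g])
qed

lemma approx_open_UNIV: "approx_open UNIV"
  unfolding approx_open_def by (intro exI[of _ "\<lambda>_ _. 1"]) auto

lemma approx_open_Int:
  assumes "approx_open A" "approx_open B" shows "approx_open (A \<inter> B)"
proof -
  obtain g :: "nat \<Rightarrow> 'a \<Rightarrow> real" where g: "\<And>k. continuous_on UNIV (g k)" "\<And>k x. 0 \<le> g k x"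
    "\<And>k x. g k x \<le> indicator A x" "\<And>k x. g k x \<le> 1" "\<And>x. (\<lambda>k. g k x) \<longlonglongrightarrow> indicator A x"
    using assms(1) by (rule approx_openE) blast
  obtain h :: "nat \<Rightarrow> 'a \<Rightarrow> real" where h: "\<And>k. continuous_on UNIV (h k)" "\<And>k x. 0 \<le> h k x"
    "\<And>k x. h k x \<le> indicator B x" "\<And>k x. h k x \<le> 1" "\<And>x. (\<lambda>k. h k x) \<longlonglongrightarrow> indicator B x"
    using assms(2) by (rule approx_openE) blast
  show ?thesis
    unfolding approx_open_def
  proof (intro exI[of _ "\<lambda>k x. g k x * h k x"] conjI allI ballI)
    fix k x
    show "continuous_on UNIV (\<lambda>x. g k x * h k x)" by (intro continuous_intros g h)
    show "0 \<le> g k x * h k x" using g h by simp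
    show "g k x * h k x \<le> indicator (A \<inter> B) x"
      using mult_mono[OF g(3)[of k x] h(3)[of k x]] h(2)[of k x] by (simp add: indicator_inter_arith)
  next
    fix x assume "x \<in> A \<inter> B"
    then show "(\<lambda>k. g k x * h k x) \<longlonglongrightarrow> 1"
      using tendsto_mult[OF g(5)[of x] h(5)[of x]] by simp
  qed
qed

lemma approx_open_countable_Union:
  assumes "countable K" "\<And>A. A \<in> K \<Longrightarrow> approx_open A"
  shows "approx_open (\<Union>K)"
proof (cases "K = {}")
  case True
  then show ?thesis unfolding approx_open_def by (intro exI[of _ "\<lambda>_ _. 0"]) auto
next
  case False
  define A where "A = from_nat_into K"
  have A: "range A = K" unfolding A_def by (rule range_from_nat_into[OF False assms(1)])
  then have "approx_open (A n)" for n using assms(2) by auto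
  then have "\<forall>n. \<exists>g :: nat \<Rightarrow> 'a \<Rightarrow> real. (\<forall>k. continuous_on UNIV (g k)) \<and> (\<forall>k x. 0 \<le> g k x \<and> g k x \<le> indicator (A n) x) \<and>
     (\<forall>x\<in>A n. (\<lambda>k. g k x) \<longlonglongrightarrow> 1)"
    unfolding approx_open_def by blast
  then obtain g :: "nat \<Rightarrow> nat \<Rightarrow> 'a \<Rightarrow> real"
    where g: "\<And>n k. continuous_on UNIV (g n k)" "\<And>n k x. 0 \<le> g n k x" "\<And>n k x. g n k x \<le> indicator (A n) x"
      "\<And>n x. x \<in> A n \<Longrightarrow> (\<lambda>k. g n k x) \<longlonglongrightarrow> 1"
    by metis
  have g1: "g n k x \<le> 1" for n k x using g(3)[of n k x] by (auto split: split_indicator_asm)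
  \<comment> \<open>A continuous form of the union: at least every g n k with n \<le> k, at most 1,
    and 0 where all g vanish.\<close>
  let ?G = "\<lambda>k x. 1 - (\<Prod>n\<le>k. 1 - g n k x)"
  have pr: "0 \<le> (\<Prod>n\<le>k. 1 - g n k x)" "(\<Prod>n\<le>k. 1 - g n k x) \<le> 1" for k x
    using g(2) g1 by (auto intro!: prod_nonneg prod_le_1)
  show ?thesis
    unfolding approx_open_def
  proof (intro exI[of _ ?G] conjI allI ballI)
    fix k x
    show "continuous_on UNIV (?G k)" by (intro continuous_intros g)
    show "0 \<le> ?G k x" using pr by simp
    show "?G k x \<le> indicator (\<Union>K) x"
    proof (cases "x \<in> \<Union>K")
      case True
      then show ?thesis using pr by simp
    next
      case False
      then have "x \<notin> A n" for n using A by auto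
      then have "g n k x = 0" for n using g(2)[of n k x] g(3)[of n k x] by simp
      then show ?thesis by simp
    qed
  next
    fix x assume "x \<in> \<Union>K"
    then obtain n where n: "x \<in> A n" using A by auto
    show "(\<lambda>k. ?G k x) \<longlonglongrightarrow> 1"
    proof (rule tendsto_sandwich[OF _ _ g(4)[OF n] tendsto_const])
      show "\<forall>\<^sub>F k in sequentially. g n k x \<le> ?G k x"
        unfolding eventually_sequentially
      proof (intro exI[of _ n] allI impI)
        fix k assume "n \<le> k"
        then have "(\<Prod>n\<le>k. 1 - g n k x) = (1 - g n k x) * (\<Prod>i\<in>{..k} - {n}. 1 - g i k x)"
          by (subst prod.remove[of _ n]) auto
        also have "\<dots> \<le> (1 - g n k x) * 1"
          using g(2) g1 by (intro mult_left_mono prod_le_1) auto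
        finally show "g n k x \<le> ?G k x" by simp
      qed
      show "\<forall>\<^sub>F k in sequentially. ?G k x \<le> 1" using pr by simp
    qed
  qed
qed

lemma approx_open_vimage:
  assumes "approx_open A" "continuous_on UNIV h"
  shows "approx_open (h -` A)"
proof -
  obtain g :: "nat \<Rightarrow> _ \<Rightarrow> real" where g: "\<And>k. continuous_on UNIV (g k)" "\<And>k x. 0 \<le> g k x"
    "\<And>k x. g k x \<le> indicator A x" "\<And>k x. g k x \<le> 1" "\<And>x. (\<lambda>k. g k x) \<longlonglongrightarrow> indicator A x"
    using assms(1) by (rule approx_openE) blast
  show ?thesis
    unfolding approx_open_def
  proof (intro exI[of _ "\<lambda>k x. g k (h x)"] conjI allI ballI)
    fix k show "continuous_on UNIV (\<lambda>x. g k (h x))"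
      using continuous_on_compose2[OF g(1) assms(2)] by auto
  next
    fix x assume "x \<in> h -` A"
    then show "(\<lambda>k. g k (h x)) \<longlonglongrightarrow> 1" using g(5)[of "h x"] by simp
  qed (use g in \<open>auto simp: indicator_def\<close>)
qed

lemma approx_open_metric:
  fixes A :: "'a::metric_space set"
  assumes "open A" shows "approx_open A"
proof (cases "A = UNIV")
  case True
  then show ?thesis by (simp add: approx_open_UNIV)
next
  case False
  then have ne: "- A \<noteq> {}" by auto
  show ?thesis
    unfolding approx_open_def
  proof (intro exI[of _ "\<lambda>k x. min 1 (real k * infdist x (- A))"] conjI allI ballI)
    fix k x
    show "continuous_on UNIV (\<lambda>x. min 1 (real k * infdist x (- A)))"
      by (intro continuous_intros)
    show "0 \<le> min 1 (real k * infdist x (- A))" by (simp add: infdist_nonneg)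
    show "min 1 (real k * infdist x (- A)) \<le> indicator A x"
      using infdist_zero[of x "- A"] by (auto split: split_indicator)
  next
    fix x assume "x \<in> A"
    then have p: "0 < infdist x (- A)" using assms ne by (intro infdist_pos_not_in_closed) auto
    obtain n :: nat where n: "1 / infdist x (- A) < real n" using reals_Archimedean2 by blast
    have "min 1 (real k * infdist x (- A)) = 1" if "k \<ge> n" for k
    proof -
      have "1 < real n * infdist x (- A)" using n p by (simp add: field_simps)
      also have "\<dots> \<le> real k * infdist x (- A)" using that p by (intro mult_right_mono) auto
      finally show ?thesis by simp
    qed
    then show "(\<lambda>k. min 1 (real k * infdist x (- A))) \<longlonglongrightarrow> 1"
      by (intro tendsto_eventually) (auto simp: eventually_sequentially)
  qed
qed

lemma bounded_continuous_integrable: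
  fixes g :: "'a::topological_space \<Rightarrow> real"
  assumes "prob_space \<nu>" "sets \<nu> = sets borel" "continuous_on UNIV g" "\<And>x. \<bar>g x\<bar> \<le> B"
  shows "integrable \<nu> g"
proof -
  interpret prob_space \<nu> by fact
  have "g \<in> borel_measurable borel" using assms(3) by (rule borel_measurable_continuous_onI)
  then have "g \<in> borel_measurable \<nu>" using assms(2) by (simp cong: measurable_cong_sets)
  then show ?thesis using assms(4) by (intro integrable_const_bound[where B=B]) auto
qed

lemma integral_approx_open:
  fixes g :: "nat \<Rightarrow> 'a::topological_space \<Rightarrow> real"
  assumes \<nu>: "prob_space \<nu>" "sets \<nu> = sets borel" and A: "A \<in> sets borel"
    and g: "\<And>k. continuous_on UNIV (g k)" "\<And>k x. 0 \<le> g k x"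
    "\<And>k x. g k x \<le> indicator A x" "\<And>k x. g k x \<le> 1" "\<And>x. (\<lambda>k. g k x) \<longlonglongrightarrow> indicator A x"
  shows "(\<lambda>k. \<integral>x. g k x \<partial>\<nu>) \<longlonglongrightarrow> measure \<nu> A" "(\<integral>x. g k x \<partial>\<nu>) \<le> measure \<nu> A"
proof -
  interpret prob_space \<nu> by fact
  have gm: "g k \<in> borel_measurable \<nu>" for k
    using borel_measurable_continuous_onI[OF g(1)] \<nu>(2) by (simp cong: measurable_cong_sets)
  have int: "integrable \<nu> (g k)" for k
    using g(2,4)[of k] by (intro bounded_continuous_integrable[OF \<nu> g(1), where B=1]) auto
  have "(\<lambda>k. \<integral>x. g k x \<partial>\<nu>) \<longlonglongrightarrow> (\<integral>x. indicator A x \<partial>\<nu>)"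
    using A \<nu>(2) g by (intro integral_dominated_convergence[where w="\<lambda>_. 1"]) (auto simp: gm)
  then show "(\<lambda>k. \<integral>x. g k x \<partial>\<nu>) \<longlonglongrightarrow> measure \<nu> A" using A \<nu>(2) by simp
  have "(\<integral>x. g k x \<partial>\<nu>) \<le> (\<integral>x. indicator A x \<partial>\<nu>)"
    using g A \<nu>(2) by (intro integral_mono int integrable_const_bound[where B=1]) auto
  then show "(\<integral>x. g k x \<partial>\<nu>) \<le> measure \<nu> A" using A \<nu>(2) by simp
qed

lemma prob_meas_D:
  "prob_space (meas_of \<nu>)" "sets (meas_of \<nu>) = sets borel" "space (meas_of \<nu>) = UNIV"
  using meas_of[of \<nu>] sets_eq_imp_space_eq[of "meas_of \<nu>" borel] by auto

lemma open_integral_vimage: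
  fixes f :: "'a::topological_space \<Rightarrow> real"
  assumes "continuous_on UNIV f" "\<And>x. \<bar>f x\<bar> \<le> B" "open V"
  shows "open {\<nu>. (\<integral>x. f x \<partial>meas_of \<nu>) \<in> V}"
proof -
  have "bounded (range f)" using assms(2) by (auto intro!: boundedI)
  then show ?thesis unfolding open_prob_meas_def using assms by (intro generate_topology.Basis) blast
qed

lemma continuous_integral:
  fixes f :: "'a::topological_space \<Rightarrow> real"
  assumes "continuous_on UNIV f" "\<And>x. \<bar>f x\<bar> \<le> B"
  shows "continuous_on UNIV (\<lambda>\<nu>. \<integral>x. f x \<partial>meas_of \<nu>)"
  using open_integral_vimage[OF assms] by (simp add: continuous_on_open_vimage vimage_def)

text \<open>The measure of such a set is a supremum of integrals of continuous functions. This lower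
  semicontinuity makes \<open>meas_of\<close> Borel measurable below.\<close>

lemma open_measure_greater:
  assumes "approx_open A" "A \<in> sets borel"
  shows "open {\<nu>. measure (meas_of \<nu>) A > t}"
proof -
  obtain g :: "nat \<Rightarrow> _ \<Rightarrow> real" where g: "\<And>k. continuous_on UNIV (g k)" "\<And>k x. 0 \<le> g k x"
    "\<And>k x. g k x \<le> indicator A x" "\<And>k x. g k x \<le> 1" "\<And>x. (\<lambda>k. g k x) \<longlonglongrightarrow> indicator A x"
    using assms(1) by (rule approx_openE) blast
  have "{\<nu>. measure (meas_of \<nu>) A > t} = (\<Union>k. {\<nu>. (\<integral>x. g k x \<partial>meas_of \<nu>) \<in> {t<..}})"
  proof safe
    fix \<nu> assume "t < measure (meas_of \<nu>) A"
    from order_tendstoD(1)[OF integral_approx_open(1)[OF prob_meas_D(1,2) assms(2) g, of \<nu>] this]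
    show "\<nu> \<in> (\<Union>k. {\<nu>. (\<integral>x. g k x \<partial>meas_of \<nu>) \<in> {t<..}})" by (auto simp: eventually_sequentially)
  next
    fix \<nu> k assume "t < (\<integral>x. g k x \<partial>meas_of \<nu>)"
    then show "t < measure (meas_of \<nu>) A"
      using integral_approx_open(2)[OF prob_meas_D(1,2) assms(2) g, of \<nu> k] by simp
  qed
  moreover have "open \<dots>"
    using g by (intro open_UN ballI open_integral_vimage[where B=1]) auto
  ultimately show ?thesis by simp
qed

section \<open>Countability and separation of the weak topology\<close>

primrec list_sup :: "('i \<Rightarrow> 'a \<Rightarrow> real) \<Rightarrow> 'i list \<Rightarrow> 'a \<Rightarrow> real" where
  "list_sup v [] x = 0"
| "list_sup v (p # ps) x = max (v p x) (list_sup v ps x)"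

lemma list_sup_nonneg: "0 \<le> list_sup v ps x"
  by (induction ps) auto

lemma list_sup_ge: "p \<in> set ps \<Longrightarrow> v p x \<le> list_sup v ps x"
  by (induction ps) auto

lemma list_sup_le: "(\<And>p. p \<in> set ps \<Longrightarrow> v p x \<le> c) \<Longrightarrow> 0 \<le> c \<Longrightarrow> list_sup v ps x \<le> c"
  by (induction ps) auto

lemma list_sup_bounded: "(\<And>p. p \<in> set ps \<Longrightarrow> \<exists>C. \<forall>x. v p x \<le> C) \<Longrightarrow> \<exists>C. \<forall>x. list_sup v ps x \<le> C"
proof (induction ps)
  case (Cons p ps)
  then obtain C C' where "\<And>x. v p x \<le> C" "\<And>x. list_sup v ps x \<le> C'" by auto metis
  then show ?case by (intro exI[of _ "max C C'"]) (auto intro!: max.mono simp del: max.bounded_iff)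
qed auto

lemma list_sup_continuous: "(\<And>p. p \<in> set ps \<Longrightarrow> continuous_on UNIV (v p)) \<Longrightarrow> continuous_on UNIV (list_sup v ps)"
  by (induction ps) (auto intro!: continuous_on_max)

text \<open>Along an enumeration of Q the finite suprema converge to f pointwise from below, so by
  dominated convergence some finite stage already exceeds t.\<close>

lemma list_sup_integral:
  fixes v :: "'i \<Rightarrow> 'a::topological_space \<Rightarrow> real"
  assumes \<nu>: "prob_space \<nu>" "sets \<nu> = sets borel" and Q: "countable Q" "Q \<noteq> {}"
    and v: "\<And>p. p \<in> Q \<Longrightarrow> continuous_on UNIV (v p)" "\<And>p x. p \<in> Q \<Longrightarrow> v p x \<le> f x"
    and f: "f \<in> borel_measurable borel" "\<And>x. 0 \<le> f x" "\<And>x. f x \<le> C"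
    and dense: "\<And>x e. 0 < e \<Longrightarrow> e \<le> f x \<Longrightarrow> \<exists>p\<in>Q. f x - e < v p x" and t: "t < (\<integral>x. f x \<partial>\<nu>)"
  shows "\<exists>ps\<in>lists Q. t < (\<integral>x. list_sup v ps x \<partial>\<nu>)"
proof -
  interpret prob_space \<nu> by fact
  have Qr: "range (from_nat_into Q) = Q" by (rule range_from_nat_into[OF Q(2,1)])
  define h where "h n = list_sup v (map (from_nat_into Q) [0..<n])" for n
  have Qi: "from_nat_into Q i \<in> Q" for i using Qr by auto
  have h: "0 \<le> h n x" "h n x \<le> f x" "continuous_on UNIV (h n)" for n x
    using v Qi f(2) unfolding h_def by (auto intro!: list_sup_nonneg list_sup_le list_sup_continuous)
  have lim: "(\<lambda>n. h n x) \<longlonglongrightarrow> f x" for x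
  proof (rule LIMSEQ_I)
    fix e :: real assume e: "0 < e"
    obtain n0 where n0: "\<And>n. n \<ge> n0 \<Longrightarrow> f x - e < h n x"
    proof (cases "e \<le> f x")
      case True
      then obtain j where "f x - e < v (from_nat_into Q j) x" using dense[OF e True] Qr by (metis imageE)
      then have "f x - e < h n x" if "Suc j \<le> n" for n
        using list_sup_ge[of "from_nat_into Q j" "map (from_nat_into Q) [0..<n]" v x] that unfolding h_def by force
      then show ?thesis by (rule that)
    next
      case False
      then have "f x - e < h n x" for n using h(1)[of n x] by simp
      then show ?thesis by (rule that)
    qed
    then show "\<exists>n0. \<forall>n\<ge>n0. norm (h n x - f x) < e"
      using h(2)[of _ x] by (intro exI[of _ n0] allI impI, unfold real_norm_def) (smt (verit))
  qed
  have "(\<lambda>n. \<integral>x. h n x \<partial>\<nu>) \<longlonglongrightarrow> (\<integral>x. f x \<partial>\<nu>)"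
  proof (rule integral_dominated_convergence[where w="\<lambda>_. C"])
    show "f \<in> borel_measurable \<nu>" "h n \<in> borel_measurable \<nu>" for n
      using f(1) borel_measurable_continuous_onI[OF h(3)] \<nu>(2) by (simp_all cong: measurable_cong_sets)
    show "AE x in \<nu>. norm (h n x) \<le> C" for n using order_trans[OF h(2) f(3)] h(1) by simp
  qed (use lim in auto)
  from order_tendstoD(1)[OF this t] obtain n where "t < (\<integral>x. h n x \<partial>\<nu>)" by (auto simp: eventually_sequentially)
  then show ?thesis using Qi unfolding h_def by (intro bexI[of _ "map (from_nat_into Q) [0..<n]"]) auto
qed

text \<open>
  Integrals of nonnegative continuous functions are suprema of the integrals of the finite suprema
  of a countable family of functions \<open>q * g U k\<close>, where \<open>g U k\<close> tends to the indicator of a basic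
  open set \<open>U\<close> from below.
\<close>

lemma prob_meas_countable_subbasis:
  assumes ap: "\<And>A :: 'a set. open A \<Longrightarrow> approx_open A"
  shows "\<exists>B :: 'a::second_countable_topology prob_meas set set. countable B \<and> open = generate_topology B"
proof -
  obtain B0 :: "'a set set" where B0: "countable B0" "topological_basis B0"
    using ex_countable_basis by auto
  \<comment> \<open>With \<open>UNIV\<close> adjoined, the zero function, obtained with the factor
    0, belongs to every family Q below, which is therefore nonempty.\<close>
  define B where "B = insert UNIV B0"
  have "\<forall>U\<in>B. \<exists>g :: nat \<Rightarrow> 'a \<Rightarrow> real. (\<forall>k. continuous_on UNIV (g k)) \<and> (\<forall>k x. 0 \<le> g k x \<and> g k x \<le> indicator U x) \<and>
     (\<forall>x\<in>U. (\<lambda>k. g k x) \<longlonglongrightarrow> 1)"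
    using ap topological_basis_open[OF B0(2)] unfolding B_def approx_open_def by (metis insertE open_UNIV)
  from bchoice[OF this] obtain g :: "'a set \<Rightarrow> nat \<Rightarrow> 'a \<Rightarrow> real" where
    g: "\<And>U k. U \<in> B \<Longrightarrow> continuous_on UNIV (g U k)" "\<And>U k x. U \<in> B \<Longrightarrow> 0 \<le> g U k x"
      "\<And>U k x. U \<in> B \<Longrightarrow> g U k x \<le> indicator U x" "\<And>U x. U \<in> B \<Longrightarrow> x \<in> U \<Longrightarrow> (\<lambda>k. g U k x) \<longlonglongrightarrow> 1"
    by blast
  define P where "P = B \<times> (UNIV :: nat set) \<times> (\<rat> \<inter> {0..} :: real set)"
  have P: "countable P"
    unfolding P_def B_def using B0(1) countable_rat by (intro countable_SIGMA countable_insert countable_Int1) auto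
  define v where "v = (\<lambda>(U, k, q) x. q * g U k x)"
  have vc: "continuous_on UNIV (v p)" if "p \<in> P" for p
    using that g(1) unfolding P_def v_def by (auto intro!: continuous_intros)
  define I where "I f \<nu> = (\<integral>x. f x \<partial>meas_of \<nu>)" for f :: "'a \<Rightarrow> real" and \<nu>
  define Sub where "Sub = (\<lambda>(ps, q). {\<nu>. q < I (list_sup v ps) \<nu>}) ` (lists P \<times> \<rat>)"
  have Sub: "countable Sub"
    unfolding Sub_def using P countable_rat by (intro countable_image countable_SIGMA countable_lists) auto
  have gU: "generate_topology Sub (\<Union>K)" if "\<And>S. S \<in> K \<Longrightarrow> generate_topology Sub S" for K
    using that by (intro generate_topology.UN) auto
  have lower: "generate_topology Sub {\<nu>. t < I f \<nu>}"
    if f: "continuous_on UNIV f" "\<And>x. 0 \<le> f x" "\<And>x. f x \<le> C" for f :: "'a \<Rightarrow> real" and C t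
  proof -
    let ?K = "{{\<nu>. q < I (list_sup v ps) \<nu>} | ps q. ps \<in> lists P \<and> q \<in> \<rat> \<and> t < q \<and> (\<forall>x. list_sup v ps x \<le> f x)}"
    define Q where "Q = {p\<in>P. \<forall>x. v p x \<le> f x}"
    have Qlists: "ps \<in> lists P" "list_sup v ps x \<le> f x" if "ps \<in> lists Q" for ps x
      using that f(2) by (auto simp: Q_def intro!: list_sup_le)
    have Q: "countable Q" "Q \<noteq> {}"
      using P f(2) unfolding Q_def by (auto intro: countable_subset simp: P_def B_def v_def intro!: exI[of _ UNIV] exI[of _ 0])
    have dense: "\<exists>p\<in>Q. f x - e < v p x" if "0 < e" "e \<le> f x" for e x
    proof -
      obtain c where c: "c \<in> \<rat>" "f x - e < c" "c < f x" using Rats_dense_in_real[of "f x - e" "f x"] \<open>0 < e\<close> by auto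
      have "open {x. c < f x}" by (rule open_Collect_less[OF continuous_on_const f(1)])
      then obtain U where "U \<in> B0" and U': "x \<in> U" "U \<subseteq> {x. c < f x}"
        using c(3) by (metis mem_Collect_eq topological_basisE[OF B0(2)])
      then have U: "U \<in> B" "x \<in> U" "U \<subseteq> {x. c < f x}" by (simp_all add: B_def)
      have "(\<lambda>k. c * g U k x) \<longlonglongrightarrow> c * 1" using U by (intro tendsto_intros g)
      from order_tendstoD(1)[OF this, of "f x - e"] c obtain k where k: "f x - e < c * g U k x"
        by (auto simp: eventually_sequentially)
      have "c * g U k y \<le> f y" for y
      proof (cases "y \<in> U")
        case True
        then have "c * g U k y \<le> c * 1" using g(3)[OF U(1), of k y] c that by (intro mult_left_mono) auto
        then show ?thesis using True U(3) by auto
      next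
        case False
        then show ?thesis using g(2,3)[OF U(1), of k y] f(2)[of y] by simp
      qed
      then have "(U, k, c) \<in> Q" using U c that by (auto simp: Q_def P_def v_def)
      then show ?thesis using k by (intro bexI[of _ "(U, k, c)"]) (auto simp: v_def)
    qed
    have int: "integrable (meas_of \<nu>) k" if "continuous_on UNIV k" "\<And>x. 0 \<le> k x" "\<And>x. k x \<le> f x" for k :: "'a \<Rightarrow> real" and \<nu>
      using that f(3) by (intro bounded_continuous_integrable[where B=C] prob_meas_D) (auto intro: order_trans)
    have "{\<nu>. t < I f \<nu>} = \<Union>?K"
    proof (intro equalityI subsetI)
      fix \<nu> assume "\<nu> \<in> {\<nu>. t < I f \<nu>}"
      then have t: "t < I f \<nu>" by simp
      have "\<exists>ps\<in>lists Q. t < I (list_sup v ps) \<nu>"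
        unfolding I_def
        by (rule list_sup_integral[OF prob_meas_D(1,2) Q _ _ borel_measurable_continuous_onI[OF f(1)] f(2,3) dense t[unfolded I_def]])
           (auto simp: Q_def vc)
      then obtain ps q where "ps \<in> lists Q" "q \<in> \<rat>" "t < q" "q < I (list_sup v ps) \<nu>" using Rats_dense_in_real by blast
      then show "\<nu> \<in> \<Union>?K" using Qlists[of ps] by blast
    next
      fix \<nu> assume "\<nu> \<in> \<Union>?K"
      then obtain ps q where ps: "ps \<in> lists P" "\<And>x. list_sup v ps x \<le> f x" and q: "t < q" "q < I (list_sup v ps) \<nu>" by blast
      have "I (list_sup v ps) \<nu> \<le> I f \<nu>"
        unfolding I_def using ps f vc by (intro integral_mono int list_sup_nonneg list_sup_continuous) auto
      then show "\<nu> \<in> {\<nu>. t < I f \<nu>}" using q by simp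
    qed
    moreover have "generate_topology Sub S" if "S \<in> ?K" for S
      using that by (intro generate_topology.Basis) (force simp: Sub_def)
    ultimately show ?thesis using gU[of ?K] by simp
  qed
  have basis: "generate_topology Sub {\<nu>. I f \<nu> \<in> V}"
    if f: "continuous_on UNIV f" "bounded (range f)" and V: "open V" for f :: "'a \<Rightarrow> real" and V
  proof -
    obtain C where C: "\<And>x. \<bar>f x\<bar> \<le> C" using f(2) unfolding bounded_pos by auto
    have fi: "integrable (meas_of \<nu>) f" for \<nu> using f(1) C by (intro bounded_continuous_integrable[where B=C] prob_meas_D) auto
    have m: "I (\<lambda>x. C + f x) \<nu> = C + I f \<nu>" "I (\<lambda>x. C - f x) \<nu> = C - I f \<nu>" for \<nu>
      using fi[of \<nu>] prob_space.prob_space[OF prob_meas_D(1), of \<nu>] finite_measure.integrable_const[OF prob_space.finite_measure[OF prob_meas_D(1)], of \<nu> C]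
      by (simp_all add: I_def)
    \<comment> \<open>Both C + f and C - f are nonnegative, so an interval condition on the integral
      of f becomes two lower bounds.\<close>
    define W where "W a b = {\<nu>. C + a < I (\<lambda>x. C + f x) \<nu>} \<inter> {\<nu>. C - b < I (\<lambda>x. C - f x) \<nu>}" for a b
    have W: "W a b = {\<nu>. I f \<nu> \<in> {a<..<b}}" for a b by (auto simp: W_def m)
    have "{\<nu>. I f \<nu> \<in> V} = \<Union>{W a b | a b. {a<..<b} \<subseteq> V}"
    proof (intro equalityI subsetI)
      fix \<nu> assume "\<nu> \<in> {\<nu>. I f \<nu> \<in> V}"
      then obtain e where e: "e > 0" "\<And>y. dist y (I f \<nu>) < e \<Longrightarrow> y \<in> V" using V unfolding open_dist by blast
      have "{I f \<nu> - e<..<I f \<nu> + e} \<subseteq> V" using e(2) by (auto simp: dist_real_def abs_less_iff)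
      moreover have "\<nu> \<in> W (I f \<nu> - e) (I f \<nu> + e)" using e(1) by (simp add: W)
      ultimately show "\<nu> \<in> \<Union>{W a b | a b. {a<..<b} \<subseteq> V}" by blast
    qed (auto simp: W)
    moreover have "generate_topology Sub (W a b)" for a b
      unfolding W_def
    proof (intro generate_topology.Int lower[where C="2 * C"])
      show "0 \<le> C + f x" "C + f x \<le> 2 * C" "0 \<le> C - f x" "C - f x \<le> 2 * C" for x using C[of x] by (auto simp: abs_le_iff)
    qed (intro continuous_intros f)+
    ultimately show ?thesis by (smt (verit) gU mem_Collect_eq)
  qed
  have "open S \<longleftrightarrow> generate_topology Sub S" for S :: "'a prob_meas set"
  proof
    assume "open S"
    then show "generate_topology Sub S"
      unfolding open_prob_meas_def
    proof (induction S rule: generate_topology.induct)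
      case (Basis S)
      then show ?case using basis unfolding I_def by auto
    qed (auto intro: generate_topology.intros)
  next
    assume "generate_topology Sub S"
    then show "open S"
    proof (induction S rule: generate_topology.induct)
      case (Basis S)
      then obtain ps q where ps: "ps \<in> lists P" and S: "S = {\<nu>. (\<integral>x. list_sup v ps x \<partial>meas_of \<nu>) \<in> {q<..}}"
        unfolding Sub_def I_def by auto
      have bd: "\<exists>C. \<forall>x. v p x \<le> C" if "p \<in> set ps" for p
      proof -
        obtain U k c where p0: "p = (U, k, c)" by (cases p)
        have "p \<in> P" using \<open>p \<in> set ps\<close> ps by auto
        then have p: "p = (U, k, c)" "U \<in> B" "0 \<le> c" by (auto simp: p0 P_def)
        have "g U k x \<le> 1" for x using g(3)[OF p(2), of k x] by (auto split: split_indicator_asm)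
        then show ?thesis using p(3) by (intro exI[of _ c]) (simp add: p(1) v_def mult_left_le)
      qed
      from list_sup_bounded[of ps v, OF bd] obtain C where "\<And>x. list_sup v ps x \<le> C" by blast
      then show ?case unfolding S
        using vc ps list_sup_nonneg[of v ps] by (intro open_integral_vimage[where B=C] list_sup_continuous) auto
    qed auto
  qed
  then show ?thesis using Sub by (intro exI[of _ Sub]) auto
qed

instance prob_meas :: (polish_space) second_countable_topology
proof
  show "\<exists>B :: 'a prob_meas set set. countable B \<and> open = generate_topology B"
    by (rule prob_meas_countable_subbasis) (rule approx_open_metric)
qed

lemma measure_eqI_open:
  fixes M N :: "'a::topological_space measure"
  assumes "prob_space M" "sets M = sets borel" "sets N = sets borel"
    and "\<And>A. open A \<Longrightarrow> emeasure M A = emeasure N A"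
  shows "M = N"
proof (rule measure_eqI_generator_eq[where E="{S. open S}" and \<Omega>=UNIV and A="\<lambda>_. UNIV"])
  show "emeasure M UNIV \<noteq> \<infinity>"
    using prob_space.emeasure_space_1[OF assms(1)] sets_eq_imp_space_eq[OF assms(2)] by simp
qed (use assms in \<open>auto simp: Int_stable_def borel_def\<close>)

text \<open>Distinct laws differ on an open set, hence in the integral of one of its continuous
  minorants; the real line separates these integrals.\<close>

instance prob_meas :: (polish_space) t2_space
proof
  fix \<nu> \<rho> :: "'a prob_meas" assume ne: "\<nu> \<noteq> \<rho>"
  then have "meas_of \<nu> \<noteq> meas_of \<rho>" by (simp add: meas_of_inject)
  then obtain A where A: "open A" "emeasure (meas_of \<nu>) A \<noteq> emeasure (meas_of \<rho>) A"
    using measure_eqI_open[of "meas_of \<nu>" "meas_of \<rho>"] prob_meas_D by metis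
  then have neq: "measure (meas_of \<nu>) A \<noteq> measure (meas_of \<rho>) A"
    using finite_measure.emeasure_eq_measure[OF prob_space.finite_measure[OF prob_meas_D(1)]] by metis
  obtain g :: "nat \<Rightarrow> 'a \<Rightarrow> real" where g: "\<And>k. continuous_on UNIV (g k)" "\<And>k x. 0 \<le> g k x"
      "\<And>k x. g k x \<le> indicator A x" "\<And>k x. g k x \<le> 1" "\<And>x. (\<lambda>k. g k x) \<longlonglongrightarrow> indicator A x"
    using approx_open_metric[OF A(1)] by (rule approx_openE) blast
  have Ab: "A \<in> sets borel" using A(1) by simp
  note lim = integral_approx_open(1)[OF prob_meas_D(1,2) Ab g]
  have "\<exists>k. (\<integral>x. g k x \<partial>meas_of \<nu>) \<noteq> (\<integral>x. g k x \<partial>meas_of \<rho>)"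
  proof (rule ccontr)
    assume "\<not> ?thesis"
    then have "(\<lambda>k. \<integral>x. g k x \<partial>meas_of \<nu>) = (\<lambda>k. \<integral>x. g k x \<partial>meas_of \<rho>)" by auto
    then show False using LIMSEQ_unique[OF lim[of \<nu>]] lim[of \<rho>] neq by auto
  qed
  then obtain k where "(\<integral>x. g k x \<partial>meas_of \<nu>) \<noteq> (\<integral>x. g k x \<partial>meas_of \<rho>)" by blast
  from hausdorff[OF this] obtain U V where UV: "open U" "open V" "(\<integral>x. g k x \<partial>meas_of \<nu>) \<in> U" "(\<integral>x. g k x \<partial>meas_of \<rho>) \<in> V" "U \<inter> V = {}"
    by blast
  have o: "open {\<nu>. (\<integral>x. g k x \<partial>meas_of \<nu>) \<in> W}" if "open W" for W
    using g that by (intro open_integral_vimage[where B=1]) auto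
  show "\<exists>U V. open U \<and> open V \<and> \<nu> \<in> U \<and> \<rho> \<in> V \<and> U \<inter> V = {}"
    using UV o[OF UV(1)] o[OF UV(2)]
    by (intro exI[of _ "{\<nu>. (\<integral>x. g k x \<partial>meas_of \<nu>) \<in> U}"] exI[of _ "{\<nu>. (\<integral>x. g k x \<partial>meas_of \<nu>) \<in> V}"]) auto
qed

text \<open>Induction over the generation of the topology. Arbitrary unions reduce to countable ones
  by Lindelof, one of the uses of second countability.\<close>

lemma approx_open_prob_meas:
  fixes A :: "'a::polish_space prob_meas set"
  assumes "open A" shows "approx_open A"
  using assms unfolding open_prob_meas_def
proof (induction A rule: generate_topology.induct)
  case UNIV then show ?case by (rule approx_open_UNIV)
next
  case (Int a b) then show ?case by (intro approx_open_Int)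
next
  case (UN K)
  then have "\<And>S. S \<in> K \<Longrightarrow> open S" unfolding open_prob_meas_def by blast
  from Lindelof[OF this] obtain K' where "K' \<subseteq> K" "countable K'" "\<Union>K' = \<Union>K" by metis
  moreover have "approx_open (\<Union>K')"
    using \<open>K' \<subseteq> K\<close> \<open>countable K'\<close> UN.IH by (intro approx_open_countable_Union) auto
  ultimately show ?case by simp
next
  case (Basis S)
  then obtain f :: "'a \<Rightarrow> real" and U where f: "S = {\<nu>. (\<integral>x. f x \<partial>meas_of \<nu>) \<in> U}" "continuous_on UNIV f" "bounded (range f)" "open U"
    by blast
  obtain C where C: "\<And>x. \<bar>f x\<bar> \<le> C" using f(3) unfolding bounded_pos by auto
  have "approx_open ((\<lambda>\<nu>. \<integral>x. f x \<partial>meas_of \<nu>) -` U)"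
    by (intro approx_open_vimage approx_open_metric f continuous_integral[where B=C] C)
  then show ?case by (simp add: f(1) vimage_def)
qed

lemma approx_open_pair:
  fixes A :: "('a::polish_space \<times> 'a prob_meas) set"
  assumes "open A" shows "approx_open A"
proof -
  define K where "K = {U \<times> V | U V. open U \<and> open V \<and> U \<times> V \<subseteq> A}"
  have "A = \<Union>K"
  proof (intro equalityI subsetI)
    fix z assume "z \<in> A"
    from open_prod_elim[OF assms this] obtain U V where "open U" "open V" "z \<in> U \<times> V" "U \<times> V \<subseteq> A" .
    then show "z \<in> \<Union>K" unfolding K_def by blast
  qed (auto simp: K_def)
  have "open S" if "S \<in> K" for S using that by (auto simp: K_def intro: open_Times)
  from Lindelof[OF this] obtain K' where K': "K' \<subseteq> K" "countable K'" "\<Union>K' = \<Union>K" by metis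
  have "approx_open (\<Union>K')"
  proof (rule approx_open_countable_Union[OF K'(2)])
    fix S assume "S \<in> K'"
    then obtain U V where UV: "S = U \<times> V" "open U" "open V" using K'(1) by (auto simp: K_def)
    have "approx_open (fst -` U \<inter> snd -` V :: ('a \<times> 'a prob_meas) set)"
      using UV by (intro approx_open_Int approx_open_vimage approx_open_metric approx_open_prob_meas continuous_on_fst continuous_on_snd continuous_on_id)
    moreover have "fst -` U \<inter> snd -` V = S" by (auto simp: UV(1))
    ultimately show "approx_open S" by simp
  qed
  then show ?thesis using K'(3) \<open>A = \<Union>K\<close> by simp
qed

lemma meas_of_measurable[measurable]:
  "meas_of \<in> borel \<rightarrow>\<^sub>M prob_algebra (borel :: 'a::polish_space measure)"
proof (rule measurable_prob_algebra_generated[where \<Omega>=UNIV and G="{S. open S}"])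
  fix A :: "'a set" assume "A \<in> {S. open S}"
  then have A: "open A" by simp
  have "(\<lambda>\<nu>. measure (meas_of \<nu>) A) \<in> borel_measurable borel"
    using open_measure_greater[OF approx_open_metric[OF A]] A by (intro borel_measurableI_greater) simp
  then have "(\<lambda>\<nu>. ennreal (measure (meas_of \<nu>) A)) \<in> borel_measurable borel" by measurable
  then show "(\<lambda>\<nu>. emeasure (meas_of \<nu>) A) \<in> borel_measurable borel"
    by (simp add: finite_measure.emeasure_eq_measure[OF prob_space.finite_measure[OF prob_meas_D(1)]])
qed (auto simp: prob_meas_D Int_stable_def borel_def)

text \<open>Testing generators suffices although the topology is closed under arbitrary unions,
  again by Lindelof.\<close>

lemma measurable_prob_measI:
  fixes T :: "'o \<Rightarrow> 'a::polish_space prob_meas"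
  assumes "\<And>f :: 'a \<Rightarrow> real. continuous_on UNIV f \<Longrightarrow> bounded (range f) \<Longrightarrow> (\<lambda>w. \<integral>x. f x \<partial>meas_of (T w)) \<in> borel_measurable M"
  shows "T \<in> M \<rightarrow>\<^sub>M borel"
proof (rule borel_measurableI)
  fix S :: "'a prob_meas set" assume "open S"
  then show "T -` S \<inter> space M \<in> sets M"
    unfolding open_prob_meas_def
  proof (induction S rule: generate_topology.induct)
    case UNIV then show ?case by simp
  next
    case (Int a b)
    have "T -` (a \<inter> b) \<inter> space M = (T -` a \<inter> space M) \<inter> (T -` b \<inter> space M)" by auto
    then show ?case using Int by simp
  next
    case (UN K)
    then have "\<And>S. S \<in> K \<Longrightarrow> open S" unfolding open_prob_meas_def by blast
    from Lindelof[OF this] obtain K' where K': "K' \<subseteq> K" "countable K'" "\<Union>K' = \<Union>K" by metis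
    have "T -` (\<Union>K') \<inter> space M = (\<Union>S\<in>K'. T -` S \<inter> space M)" by auto
    moreover have "\<dots> \<in> sets M" using K' UN by (intro sets.countable_UN'') auto
    ultimately show ?case using K' by simp
  next
    case (Basis S)
    then obtain f :: "'a \<Rightarrow> real" and U where f: "S = {\<nu>. (\<integral>x. f x \<partial>meas_of \<nu>) \<in> U}" "continuous_on UNIV f" "bounded (range f)" "open U"
      by blast
    have "T -` S \<inter> space M = (\<lambda>w. \<integral>x. f x \<partial>meas_of (T w)) -` U \<inter> space M" by (auto simp: f(1))
    then show ?case using assms[OF f(2,3)] f(4) by (simp add: measurable_sets_borel measurable_sets)
  qed
qed

section \<open>Limits of integrals under weak and continuous convergence\<close>

definition wconv :: "(nat \<Rightarrow> 'a::topological_space measure) \<Rightarrow> 'a measure \<Rightarrow> bool" where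
  "wconv L l \<longleftrightarrow> (\<forall>f :: 'a \<Rightarrow> real. continuous_on UNIV f \<longrightarrow> bounded (range f) \<longrightarrow> (\<lambda>n. \<integral>x. f x \<partial>L n) \<longlonglongrightarrow> (\<integral>x. f x \<partial>l))"

lemma wconvD:
  fixes f :: "'a::topological_space \<Rightarrow> real"
  assumes "wconv L l" "continuous_on UNIV f" "\<And>x. \<bar>f x\<bar> \<le> B"
  shows "(\<lambda>n. \<integral>x. f x \<partial>L n) \<longlonglongrightarrow> (\<integral>x. f x \<partial>l)"
proof -
  have "bounded (range f)" using assms(3) by (intro boundedI[where B=B]) auto
  then show ?thesis using assms unfolding wconv_def by blast
qed

text \<open>Portmanteau inequality: the indicator of the open complement is approximated from
  below.\<close>

lemma wconv_closed:
  assumes L: "\<And>n. prob_space (L n)" "\<And>n. sets (L n) = sets borel" and l: "prob_space l" "sets l = sets borel"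
    and conv: "wconv L l" and C: "approx_open (- C)" "closed C" and c: "\<And>n. c \<le> measure (L n) C"
  shows "c \<le> measure l C"
proof -
  obtain g :: "nat \<Rightarrow> 'a \<Rightarrow> real" where g: "\<And>k. continuous_on UNIV (g k)" "\<And>k x. 0 \<le> g k x"
      "\<And>k x. g k x \<le> indicator (- C) x" "\<And>k x. g k x \<le> 1" "\<And>x. (\<lambda>k. g k x) \<longlonglongrightarrow> indicator (- C) x"
    using C(1) by (rule approx_openE) blast
  have Cb: "- C \<in> sets borel" using C(2) by auto
  have compl: "measure \<rho> (- C) = 1 - measure \<rho> C" if "prob_space \<rho>" "sets \<rho> = sets borel" for \<rho> :: "'a measure"
    using prob_space.prob_compl[OF that(1), of C] that(2) sets_eq_imp_space_eq[OF that(2)] C(2)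
    by (simp add: Compl_eq_Diff_UNIV borel_closed)
  have "(\<integral>x. g k x \<partial>l) \<le> 1 - c" for k
  proof (rule LIMSEQ_le_const2)
    show "(\<lambda>n. \<integral>x. g k x \<partial>L n) \<longlonglongrightarrow> (\<integral>x. g k x \<partial>l)" using g by (intro wconvD[OF conv, where B=1]) auto
    have "(\<integral>x. g k x \<partial>L n) \<le> 1 - c" for n
      using integral_approx_open(2)[OF L(1,2) Cb g, of n k] compl[OF L] c[of n] by simp
    then show "\<exists>N. \<forall>n\<ge>N. (\<integral>x. g k x \<partial>L n) \<le> 1 - c" by blast
  qed
  then have "measure l (- C) \<le> 1 - c" by (intro LIMSEQ_le_const2[OF integral_approx_open(1)[OF l Cb g]]) blast
  then show ?thesis by (simp add: compl[OF l])
qed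

text \<open>Otherwise every neighbourhood of z contains, for arbitrarily large m, points with h m
  \<le> t. Picking them from a neighbourhood base along increasing m gives a sequence converging to
  z that violates \<open>cc\<close>.\<close>

lemma continuous_convergence_cover:
  fixes h :: "nat \<Rightarrow> 'a::first_countable_topology \<Rightarrow> real"
  assumes cc: "\<And>z zs. zs \<longlonglongrightarrow> z \<Longrightarrow> (\<lambda>n. h n (zs n)) \<longlonglongrightarrow> hl z" and z: "t < hl z"
  shows "\<exists>n. z \<in> interior {z. \<forall>m\<ge>n. t < h m z}"
proof (rule ccontr)
  assume "\<not> ?thesis"
  then have neg: "\<exists>m\<ge>n. \<exists>z'\<in>U. h m z' \<le> t" if "open U" "z \<in> U" for n U
    using that unfolding interior_def by (auto simp: subset_eq not_less) (meson not_less)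
  obtain A where A: "\<And>i::nat. open (A i)" "\<And>i. z \<in> A i"
    "\<And>S. open S \<Longrightarrow> z \<in> S \<Longrightarrow> eventually (\<lambda>i. A i \<subseteq> S) sequentially"
    by (rule countable_basis_at_decseq[of z]) blast
  have "\<exists>f. \<forall>k. (k \<le> fst (f k) \<and> snd (f k) \<in> A k \<and> h (fst (f k)) (snd (f k)) \<le> t) \<and> fst (f k) < fst (f (Suc k))"
  proof (rule dependent_nat_choice)
    show "\<exists>x. 0 \<le> fst x \<and> snd x \<in> A 0 \<and> h (fst x) (snd x) \<le> t"
      using neg[OF A(1)[of 0] A(2)[of 0], of 0] by auto
  next
    fix x :: "nat \<times> 'a" and k
    obtain m z' where "m \<ge> Suc (fst x + k)" "z' \<in> A (Suc k)" "h m z' \<le> t"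
      using neg[OF A(1)[of "Suc k"] A(2)[of "Suc k"], of "Suc (fst x + k)"] by auto
    then show "\<exists>y. (Suc k \<le> fst y \<and> snd y \<in> A (Suc k) \<and> h (fst y) (snd y) \<le> t) \<and> fst x < fst y"
      by (intro exI[of _ "(m, z')"]) auto
  qed
  then obtain f where f: "\<And>k. snd (f k) \<in> A k" "\<And>k. h (fst (f k)) (snd (f k)) \<le> t" "\<And>k. fst (f k) < fst (f (Suc k))" by blast
  define r where "r k = fst (f k)" for k
  have r: "strict_mono r" using f(3) by (simp add: strict_mono_Suc_iff r_def)
  \<comment> \<open>Continuous convergence is available along the full index sequence, so the gaps
    between the chosen indices are filled with z.\<close>
  define zs where "zs m = (if m \<in> range r then snd (f (inv r m)) else z)" for m
  have zr: "zs (r k) = snd (f k)" for k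
    using r by (simp add: zs_def strict_mono_on_imp_inj_on inv_f_f)
  have "zs \<longlonglongrightarrow> z"
  proof (rule topological_tendstoI)
    fix S assume S: "open S" "z \<in> S"
    then obtain k0 where k0: "\<And>k. k \<ge> k0 \<Longrightarrow> A k \<subseteq> S" using A(3) by (auto simp: eventually_sequentially)
    have "zs m \<in> S" if "m \<ge> r k0" for m
    proof (cases "m \<in> range r")
      case True
      then obtain k where "m = r k" by auto
      then have "k \<ge> k0" using that r by (simp add: strict_mono_less_eq)
      then show ?thesis using zr[of k] f(1)[of k] k0 \<open>m = r k\<close> by auto
    qed (use S in \<open>simp add: zs_def\<close>)
    then show "\<forall>\<^sub>F m in sequentially. zs m \<in> S" by (auto simp: eventually_sequentially)
  qed
  then have "(\<lambda>n. h n (zs n)) \<longlonglongrightarrow> hl z" by (rule cc)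
  then have "(\<lambda>k. h (r k) (zs (r k))) \<longlonglongrightarrow> hl z"
    using LIMSEQ_subseq_LIMSEQ[OF _ r] by (force simp: o_def)
  moreover have "h (r k) (zs (r k)) \<le> t" for k using f(2)[of k] by (simp add: zr) (simp add: r_def)
  ultimately have "hl z \<le> t" by (intro LIMSEQ_le_const2) auto
  then show False using z by simp
qed

text \<open>The functions \<open>c * g\<close> below all h m with m \<ge> n are continuous and do
  not change with m, so weak convergence applies to their finite suprema; by
  \<open>continuous_convergence_cover\<close> these suprema approximate hl.\<close>

lemma continuous_convergence_lower:
  fixes h :: "nat \<Rightarrow> 'a::first_countable_topology \<Rightarrow> real"
  assumes ap: "\<And>A :: 'a set. open A \<Longrightarrow> approx_open A"
    and L: "\<And>n. prob_space (L n)" "\<And>n. sets (L n) = sets borel" and l: "prob_space l" "sets l = sets borel"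
    and conv: "wconv L l"
    and h: "\<And>n. h n \<in> borel_measurable borel" "\<And>n x. 0 \<le> h n x" "\<And>n x. h n x \<le> 1"
    and hl: "hl \<in> borel_measurable borel" "\<And>x. 0 \<le> hl x" "\<And>x. hl x \<le> 1"
    and cc: "\<And>z zs. zs \<longlonglongrightarrow> z \<Longrightarrow> (\<lambda>n. h n (zs n)) \<longlonglongrightarrow> hl z"
    and t: "t < (\<integral>x. hl x \<partial>l)"
  shows "eventually (\<lambda>n. t < (\<integral>x. h n x \<partial>L n)) sequentially"
proof -
  define W where "W n c = interior {z. \<forall>m\<ge>n. c < h m z}" for n c
  have Wh: "c < h m z" if "z \<in> W n c" "n \<le> m" for n c m z
    using that interior_subset[of "{z. \<forall>m\<ge>n. c < h m z}"] unfolding W_def by blast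
  have "\<forall>p. \<exists>g :: nat \<Rightarrow> 'a \<Rightarrow> real. (\<forall>k. continuous_on UNIV (g k)) \<and>
     (\<forall>k x. 0 \<le> g k x \<and> g k x \<le> indicator (W (fst p) (snd p)) x) \<and> (\<forall>x\<in>W (fst p) (snd p). (\<lambda>k. g k x) \<longlonglongrightarrow> 1)"
    using ap[OF open_interior] unfolding approx_open_def W_def by blast
  from choice[OF this] obtain g :: "nat \<times> real \<Rightarrow> nat \<Rightarrow> 'a \<Rightarrow> real" where
    "\<forall>p. (\<forall>k. continuous_on UNIV (g p k)) \<and>
     (\<forall>k x. 0 \<le> g p k x \<and> g p k x \<le> indicator (W (fst p) (snd p)) x) \<and> (\<forall>x\<in>W (fst p) (snd p). (\<lambda>k. g p k x) \<longlonglongrightarrow> 1)" ..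
  then have g: "continuous_on UNIV (g (n, c) k)" "0 \<le> g (n, c) k x" "g (n, c) k x \<le> indicator (W n c) x"
    "x \<in> W n c \<Longrightarrow> (\<lambda>k. g (n, c) k x) \<longlonglongrightarrow> 1" for n c k x by simp_all
  define Q where "Q = (UNIV :: nat set) \<times> (\<rat> \<inter> {0..} :: real set) \<times> (UNIV :: nat set)"
  define v where "v = (\<lambda>(n, c, k) x. c * g (n, c) k x)"
  have Q: "countable Q" unfolding Q_def using countable_rat by (intro countable_SIGMA countable_Int1) auto
  have vh: "v p x \<le> h m x" if "p \<in> Q" "fst p \<le> m" for p m x
  proof -
    obtain n c k where p: "p = (n, c, k)" by (cases p)
    have c: "0 \<le> c" "n \<le> m" using that by (auto simp: p Q_def)
    show ?thesis
    proof (cases "x \<in> W n c")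
      case True
      then have "c * g (n, c) k x \<le> c * 1" using g(3)[of n c k x] c(1) by (intro mult_left_mono) auto
      then show ?thesis using Wh[OF True c(2)] by (simp add: p v_def)
    next
      case False
      then show ?thesis using g(2,3)[of n c k x] h(2)[of m x] by (simp add: p v_def)
    qed
  qed
  have vhl: "v p x \<le> hl x" if "p \<in> Q" for p x
    by (rule LIMSEQ_le_const[OF cc[OF tendsto_const]]) (use vh[OF that] in blast)
  have vc: "continuous_on UNIV (v p)" for p
    unfolding v_def by (cases p) (simp add: continuous_intros g(1))
  have dense: "\<exists>p\<in>Q. hl x - e < v p x" if "0 < e" "e \<le> hl x" for x e
  proof -
    obtain c where c: "c \<in> \<rat>" "hl x - e < c" "c < hl x" using Rats_dense_in_real[of "hl x - e" "hl x"] \<open>0 < e\<close> by auto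
    obtain n where n: "x \<in> W n c" using continuous_convergence_cover[of h hl, OF cc c(3)] by (auto simp: W_def)
    have "(\<lambda>k. c * g (n, c) k x) \<longlonglongrightarrow> c * 1" by (intro tendsto_intros g n)
    from order_tendstoD(1)[OF this, of "hl x - e"] c obtain k where "hl x - e < c * g (n, c) k x"
      by (auto simp: eventually_sequentially)
    then show ?thesis using c that by (intro bexI[of _ "(n, c, k)"]) (auto simp: v_def Q_def)
  qed
  have "Q \<noteq> {}" by (auto simp: Q_def intro!: exI[of _ 0])
  then have "\<exists>ps\<in>lists Q. t < (\<integral>x. list_sup v ps x \<partial>l)"
    by (intro list_sup_integral[OF l Q _ vc vhl hl dense t])
  then obtain ps where ps: "ps \<in> lists Q" "t < (\<integral>x. list_sup v ps x \<partial>l)" by blast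
  have ph: "list_sup v ps x \<le> hl x" for x using ps(1) hl(2) vhl by (intro list_sup_le) auto
  have pc: "continuous_on UNIV (list_sup v ps)" using vc by (rule list_sup_continuous)
  have b: "\<bar>list_sup v ps x\<bar> \<le> 1" for x using order_trans[OF ph hl(3)] list_sup_nonneg[of v ps x] by simp
  from order_tendstoD(1)[OF wconvD[OF conv pc b] ps(2)]
  have "eventually (\<lambda>n. t < (\<integral>x. list_sup v ps x \<partial>L n)) sequentially" .
  moreover have "eventually (\<lambda>n. \<forall>p\<in>set ps. fst p \<le> n) sequentially"
    by (intro eventually_ball_finite ballI eventually_ge_at_top) simp
  ultimately show ?thesis
  proof eventually_elim
    case (elim n)
    interpret Ln: prob_space "L n" by (rule L)
    have "h n \<in> borel_measurable (L n)" using h(1) L(2) by (simp cong: measurable_cong_sets)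
    then have "integrable (L n) (h n)" using h by (intro Ln.integrable_const_bound[where B=1]) auto
    moreover have "list_sup v ps x \<le> h n x" for x using ps(1) elim h(2) vh by (intro list_sup_le) auto
    ultimately have "(\<integral>x. list_sup v ps x \<partial>L n) \<le> (\<integral>x. h n x \<partial>L n)"
      by (intro integral_mono bounded_continuous_integrable[OF L pc b])
    then show ?case using elim by simp
  qed
qed

text \<open>Integrands and laws vary together, linked to hl by continuous convergence alone. The
  one-sided bound is applied to h and to -h after an affine rescaling to [0, 1].\<close>

theorem extended_continuous_mapping:
  fixes h :: "nat \<Rightarrow> 'a::first_countable_topology \<Rightarrow> real"
  assumes ap: "\<And>A :: 'a set. open A \<Longrightarrow> approx_open A"
    and L: "\<And>n. prob_space (L n)" "\<And>n. sets (L n) = sets borel" and l: "prob_space l" "sets l = sets borel"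
    and conv: "wconv L l"
    and h: "\<And>n. h n \<in> borel_measurable borel" "\<And>n x. \<bar>h n x\<bar> \<le> C"
    and hl: "hl \<in> borel_measurable borel" "\<And>x. \<bar>hl x\<bar> \<le> C"
    and cc: "\<And>z zs. zs \<longlonglongrightarrow> z \<Longrightarrow> (\<lambda>n. h n (zs n)) \<longlonglongrightarrow> hl z"
  shows "(\<lambda>n. \<integral>x. h n x \<partial>L n) \<longlonglongrightarrow> (\<integral>x. hl x \<partial>l)"
proof (rule LIMSEQ_I)
  fix r :: real assume r: "0 < r"
  \<comment> \<open>The added 1 keeps the scale positive when C is 0.\<close>
  define B where "B = \<bar>C\<bar> + 1"
  have B: "0 < B" "\<And>n x. \<bar>h n x\<bar> \<le> B" "\<And>x. \<bar>hl x\<bar> \<le> B"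
  proof -
    show "0 < B" by (simp add: B_def)
    show "\<bar>h n x\<bar> \<le> B" for n x using h(2)[of n x] unfolding B_def by linarith
    show "\<bar>hl x\<bar> \<le> B" for x using hl(2)[of x] unfolding B_def by linarith
  qed
  define \<epsilon> where "\<epsilon> = r / (2 * B)"
  have \<epsilon>: "0 < \<epsilon>" using r B by (simp add: \<epsilon>_def)
  have int: "(\<integral>x. (s * g x + B) / (2 * B) \<partial>\<nu>) = (s * (\<integral>x. g x \<partial>\<nu>) + B) / (2 * B)"
    if "prob_space \<nu>" "sets \<nu> = sets borel" "g \<in> borel_measurable borel" "\<And>x. \<bar>g x\<bar> \<le> B" for \<nu> g s
  proof -
    interpret prob_space \<nu> by fact
    have "g \<in> borel_measurable \<nu>" using that by (simp cong: measurable_cong_sets)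
    then have "integrable \<nu> g" using that by (intro integrable_const_bound[where B=B]) auto
    then show ?thesis using prob_space by simp
  qed
  have bb: "0 \<le> (s * y + B) / (2 * B)" "(s * y + B) / (2 * B) \<le> 1" if "\<bar>y\<bar> \<le> B" "s = 1 \<or> s = -1" for s y
    using that B(1) by (auto simp: field_simps abs_le_iff)
  have ev: "eventually (\<lambda>n. (s * (\<integral>x. hl x \<partial>l) + B) / (2 * B) - \<epsilon> < (s * (\<integral>x. h n x \<partial>L n) + B) / (2 * B)) sequentially"
    if s: "s = 1 \<or> s = -1" for s
  proof -
    have "eventually (\<lambda>n. (\<integral>x. (s * hl x + B) / (2 * B) \<partial>l) - \<epsilon> < (\<integral>x. (s * h n x + B) / (2 * B) \<partial>L n)) sequentially"
    proof (rule continuous_convergence_lower[OF ap L l conv])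
      show "(\<lambda>n. (s * h n (zs n) + B) / (2 * B)) \<longlonglongrightarrow> (s * hl z + B) / (2 * B)" if "zs \<longlonglongrightarrow> z" for zs z
        using B(1) by (intro tendsto_intros cc that) auto
    qed (use bb[OF B(2) s] bb[OF B(3) s] h(1) hl(1) \<epsilon> in auto)
    then show ?thesis unfolding int[OF l hl(1) B(3)] int[OF L h(1) B(2)] .
  qed
  have "eventually (\<lambda>n. norm ((\<integral>x. h n x \<partial>L n) - (\<integral>x. hl x \<partial>l)) < r) sequentially"
    using ev[OF disjI1[OF refl]] ev[OF disjI2[OF refl]]
  proof eventually_elim
    case (elim n)
    have key: "i - j < r" if "(i + B) / (2 * B) - \<epsilon> < (j + B) / (2 * B)" for i j
    proof -
      have "(i - j) / (2 * B) < \<epsilon>" using that by (simp add: diff_divide_distrib add_divide_distrib)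
      then have "i - j < \<epsilon> * (2 * B)" using B(1) by (simp only: pos_divide_less_eq)
      then show ?thesis using B(1) by (simp add: \<epsilon>_def)
    qed
    show ?case using key[OF elim(1)] key[OF elim(2)] by (simp add: abs_less_iff)
  qed
  then show "\<exists>no. \<forall>n\<ge>no. norm ((\<integral>x. h n x \<partial>L n) - (\<integral>x. hl x \<partial>l)) < r"
    by (simp add: eventually_sequentially)
qed

section \<open>Coding by ternary expansions and Prokhorov's theorem\<close>

definition ternary :: "(nat \<Rightarrow> 'a set) \<Rightarrow> 'a \<Rightarrow> real" where
  "ternary B x = (\<Sum>i. 2 * (1 / 3) ^ Suc i * indicator (B i) x)"

lemma summable_ternary: "summable (\<lambda>i. 2 * (1 / 3) ^ Suc i * (w i :: real))" if "\<And>i. \<bar>w i\<bar> \<le> 1"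
proof (rule summable_comparison_test')
  show "summable (\<lambda>i. 2 * (1 / 3 :: real) ^ Suc i)"
    by (intro summable_mult summable_ignore_initial_segment[of _ 1, simplified] summable_geometric) auto
  show "norm (2 * (1 / 3) ^ Suc i * w i) \<le> 2 * (1 / 3) ^ Suc i" if "0 \<le> i" for i
    using \<open>\<And>i. \<bar>w i\<bar> \<le> 1\<close>[of i] by (simp add: abs_mult mult_left_le)
qed

lemma ternary_tail: "(\<Sum>i. 2 * (1 / 3 :: real) ^ Suc i) = 1" "(\<Sum>i. 2 * (1 / 3 :: real) ^ Suc (i + k)) = (1 / 3) ^ k"
proof -
  have g: "(\<Sum>i. (1 / 3 :: real) ^ i) = 3 / 2" by (subst suminf_geometric) auto
  have s: "summable (\<lambda>i. (1 / 3 :: real) ^ i)" by (intro summable_geometric) auto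
  have e: "2 * (1 / 3 :: real) ^ Suc (i + k) = (2 / 3 * (1 / 3) ^ k) * (1 / 3) ^ i" for i k
    by (simp add: power_add)
  show *: "(\<Sum>i. 2 * (1 / 3 :: real) ^ Suc (i + k)) = (1 / 3) ^ k" for k
    unfolding e suminf_mult[OF s] g by simp
  show "(\<Sum>i. 2 * (1 / 3 :: real) ^ Suc i) = 1" using *[of 0] by simp
qed

lemma ternary_bounds: "0 \<le> ternary B x" "ternary B x \<le> 1"
proof -
  have s: "summable (\<lambda>i. 2 * (1 / 3) ^ Suc i * (indicator (B i) x :: real))"
    by (rule summable_ternary) (auto split: split_indicator)
  show "0 \<le> ternary B x" unfolding ternary_def by (intro suminf_nonneg s) auto
  have "ternary B x \<le> (\<Sum>i. 2 * (1 / 3 :: real) ^ Suc i * 1)"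
    unfolding ternary_def by (intro suminf_le s summable_ternary) (auto split: split_indicator)
  then show "ternary B x \<le> 1" using ternary_tail(1) by simp
qed

text \<open>Digits 0 and 2 in base 3, as for the Cantor set: at the first differing digit j the
  difference is 2/3^(j+1), and all later digits together undo at most half of it.\<close>

lemma ternary_separates:
  assumes "x \<in> B i" "x' \<notin> B i"
  shows "(1 / 3) ^ Suc i \<le> \<bar>ternary B x - ternary B x'\<bar>"
proof -
  define d where "d k = (indicator (B k) x - indicator (B k) x' :: real)" for k
  define j where "j = (LEAST j. d j \<noteq> 0)"
  have di: "d i \<noteq> 0" using assms by (simp add: d_def)
  have j: "d j \<noteq> 0" "j \<le> i" unfolding j_def by (rule LeastI[of _ i] Least_le, rule di)+
  have j3: "d k = 0" if "k < j" for k using not_less_Least[of k "\<lambda>j. d j \<noteq> 0"] that unfolding j_def by blast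
  have d1: "\<bar>d k\<bar> \<le> 1" for k unfolding d_def by (auto split: split_indicator)
  have dj: "\<bar>d j\<bar> = 1" using j(1) unfolding d_def by (auto split: split_indicator split_indicator_asm)
  let ?t = "\<lambda>i. 2 * (1 / 3 :: real) ^ Suc i * d i"
  have s: "summable ?t" by (rule summable_ternary[OF d1])
  have "ternary B x - ternary B x' = (\<Sum>i. ?t i)"
    unfolding ternary_def d_def right_diff_distrib
    by (intro suminf_diff summable_ternary) (auto split: split_indicator)
  also have "\<dots> = (\<Sum>i. ?t (i + Suc j)) + (\<Sum>i<Suc j. ?t i)" by (rule suminf_split_initial_segment[OF s])
  also have "(\<Sum>i<Suc j. ?t i) = ?t j" using j3 by simp
  finally have e: "ternary B x - ternary B x' = (\<Sum>i. ?t (i + Suc j)) + ?t j" .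
  have "\<bar>\<Sum>i. ?t (i + Suc j)\<bar> \<le> (\<Sum>i. 2 * (1 / 3 :: real) ^ Suc (i + Suc j))"
  proof (rule summable_norm[where 'a=real, THEN order.trans, unfolded real_norm_def])
    have n: "\<bar>?t i\<bar> = 2 * (1 / 3) ^ Suc i * \<bar>d i\<bar>" for i by (simp add: abs_mult)
    have sn: "summable (\<lambda>i. 2 * (1 / 3 :: real) ^ Suc i * \<bar>d i\<bar>)" using d1 by (intro summable_ternary) simp
    show sa: "summable (\<lambda>i. \<bar>?t (i + Suc j)\<bar>)"
      unfolding n using summable_ignore_initial_segment[OF sn, of "Suc j"] by simp
    have "summable (\<lambda>i. 2 * (1 / 3 :: real) ^ Suc i * 1)" by (rule summable_ternary) simp
    then have sb: "summable (\<lambda>i. 2 * (1 / 3 :: real) ^ Suc (i + Suc j))"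
      using summable_ignore_initial_segment[of _ "Suc j"] by force
    show "(\<Sum>i. \<bar>?t (i + Suc j)\<bar>) \<le> (\<Sum>i. 2 * (1 / 3 :: real) ^ Suc (i + Suc j))"
      using d1 by (intro suminf_le sa sb) (simp add: abs_mult mult_left_le)
  qed
  also have "\<dots> = (1 / 3) ^ Suc j" by (rule ternary_tail(2))
  finally have "\<bar>\<Sum>i. ?t (i + Suc j)\<bar> \<le> (1 / 3) ^ Suc j" .
  moreover have "\<bar>?t j\<bar> = 2 * (1 / 3) ^ Suc j" using dj by (simp add: abs_mult)
  ultimately have "(1 / 3) ^ Suc j \<le> \<bar>ternary B x - ternary B x'\<bar>" unfolding e by linarith
  moreover have "(1 / 3 :: real) ^ Suc i \<le> (1 / 3) ^ Suc j" using j(2) by (intro power_decreasing) auto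
  ultimately show ?thesis by linarith
qed

lemma ternary_measurable:
  fixes B :: "nat \<Rightarrow> 'a::topological_space set"
  assumes "\<And>i. open (B i)"
  shows "ternary B \<in> borel_measurable borel"
proof -
  have [measurable]: "B i \<in> sets borel" for i using assms by simp
  show ?thesis unfolding ternary_def[abs_def] by measurable
qed

text \<open>
  Points are coded by reals so that Helly's selection theorem applies to the image measures. On the
  closure of the code of a compact set the coding has a continuous left inverse, through which the limit
  is pulled back.
\<close>

locale ternary_code =
  fixes B :: "nat \<Rightarrow> 'a::{t2_space, second_countable_topology} set" and K :: "nat \<Rightarrow> 'a set"
  assumes basis: "topological_basis (range B)"
    and K: "\<And>m. compact (K m)" "\<And>m. K m \<subseteq> K (Suc m)" "K 0 \<noteq> {}"
begin

text \<open>Half the separation in \<open>ternary_separates\<close>: two codes within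
  \<open>eps i\<close> of the same real cannot disagree about membership in B i.\<close>

definition eps :: "nat \<Rightarrow> real" where "eps i = (1 / 3) ^ Suc i / 2"

lemma eps: "0 < eps i" by (simp add: eps_def)

definition C :: "nat \<Rightarrow> real set" where "C m = closure (ternary B ` K m)"

text \<open>Decoding as a relation, meaningful also for limits of codes: every basic neighbourhood
  of x must contain all points whose code is close enough to y.\<close>

definition codes :: "real \<Rightarrow> 'a \<Rightarrow> bool" where
  "codes y x \<longleftrightarrow> (\<forall>i. x \<in> B i \<longrightarrow> (\<forall>x'. \<bar>ternary B x' - y\<bar> < eps i \<longrightarrow> x' \<in> B i))"

lemma B_open: "open (B i)" using topological_basis_open[OF basis] by auto

lemma codes_self: "codes (ternary B x) x"
  unfolding codes_def
proof (intro allI impI, rule ccontr)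
  fix i x' assume "x \<in> B i" "\<bar>ternary B x' - ternary B x\<bar> < eps i" "x' \<notin> B i"
  moreover have "eps i \<le> (1 / 3) ^ Suc i" by (simp add: eps_def)
  ultimately show False using ternary_separates[of x B i x'] by (simp add: abs_minus_commute)
qed

lemma compact_C: "compact (C m)"
  unfolding C_def
proof (rule compact_closure[THEN iffD2])
  show "bounded (ternary B ` K m)" using ternary_bounds[of B] by (intro boundedI[of _ 1]) auto
qed

lemma C_approx: "y \<in> C m \<Longrightarrow> 0 < e \<Longrightarrow> \<exists>x\<in>K m. \<bar>ternary B x - y\<bar> < e"
  unfolding C_def closure_approachable by (auto simp: dist_real_def)

text \<open>Points of \<open>K m\<close> whose codes approach y have a cluster point by compactness.
  Infinitely many of them lie in any basic set around that point, and codes near y agree with theirs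
  about this set.\<close>

lemma codes_exists:
  assumes "y \<in> C m" shows "\<exists>x\<in>K m. codes y x"
proof -
  have "\<forall>n. \<exists>x\<in>K m. \<bar>ternary B x - y\<bar> < 1 / real (Suc n)" using C_approx[OF assms] by simp
  then obtain s where s: "\<And>n. s n \<in> K m" "\<And>n. \<bar>ternary B (s n) - y\<bar> < 1 / real (Suc n)" by metis
  have "seq_compact (K m)" using K(1) by (rule compact_imp_seq_compact)
  then obtain x r where x: "x \<in> K m" "strict_mono r" "(s \<circ> r) \<longlonglongrightarrow> x"
    using s(1) unfolding seq_compact_def by blast
  have "codes y x"
    unfolding codes_def
  proof (intro allI impI, rule ccontr)
    fix i x' assume i: "x \<in> B i" "\<bar>ternary B x' - y\<bar> < eps i" "x' \<notin> B i"
    have "eventually (\<lambda>n. (s \<circ> r) n \<in> B i) sequentially"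
      using topological_tendstoD[OF x(3) B_open i(1)] .
    moreover have "eventually (\<lambda>n. 1 / real (Suc n) < eps i) sequentially"
      using LIMSEQ_inverse_real_of_nat eps[of i] by (auto dest!: order_tendstoD(2) simp: inverse_eq_divide)
    ultimately have "eventually (\<lambda>n. (s \<circ> r) n \<in> B i \<and> 1 / real (Suc n) < eps i) sequentially"
      by (rule eventually_conj)
    then obtain n where n: "s (r n) \<in> B i" "1 / real (Suc n) < eps i" by (auto simp: eventually_sequentially)
    have "1 / real (Suc (r n)) \<le> 1 / real (Suc n)" using seq_suble[OF x(2), of n] by (intro divide_left_mono) auto
    then have "\<bar>ternary B (s (r n)) - y\<bar> < eps i" using s(2)[of "r n"] n(2) by linarith
    moreover have "(1 / 3) ^ Suc i \<le> \<bar>ternary B (s (r n)) - ternary B x'\<bar>"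
      using n(1) i(3) by (rule ternary_separates)
    moreover have "(1 / 3) ^ Suc i = 2 * eps i" by (simp add: eps_def)
    ultimately show False using i(2) by linarith
  qed
  then show ?thesis using x(1) by blast
qed

lemma separate:
  assumes "x \<noteq> x'" obtains i j where "x \<in> B i" "x' \<in> B j" "B i \<inter> B j = {}"
proof -
  obtain U V where UV: "open U" "open V" "x \<in> U" "x' \<in> V" "U \<inter> V = {}" using hausdorff[OF assms] by blast
  obtain i where "x \<in> B i" "B i \<subseteq> U" using topological_basisE[OF basis UV(1,3)] by auto
  moreover obtain j where "x' \<in> B j" "B j \<subseteq> V" using topological_basisE[OF basis UV(2,4)] by auto
  ultimately show thesis using UV(5) by (intro that[of i j]) auto
qed

text \<open>A point with code very close to y would have to lie in two disjoint basic sets.\<close>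

lemma codes_unique:
  assumes y: "y \<in> C m" and x: "codes y x" "codes y x'"
  shows "x = x'"
proof (rule ccontr)
  assume "x \<noteq> x'"
  then obtain i j where ij: "x \<in> B i" "x' \<in> B j" "B i \<inter> B j = {}" by (rule separate)
  have "0 < min (eps i) (eps j)" using eps[of i] eps[of j] by simp
  from C_approx[OF y this] obtain z where z: "\<bar>ternary B z - y\<bar> < eps i" "\<bar>ternary B z - y\<bar> < eps j" by auto
  have "z \<in> B i" using x(1) ij(1) z(1) unfolding codes_def by blast
  moreover have "z \<in> B j" using x(2) ij(2) z(2) unfolding codes_def by blast
  ultimately show False using ij(3) by auto
qed

text \<open>Off all \<open>C m\<close> the value is an arbitrary fixed point of \<open>K 0\<close>;
  the limit law on the line gives that region mass 0.\<close>

definition dec :: "real \<Rightarrow> 'a" where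
  "dec y = (if y \<in> (\<Union>m. C m) then (THE x. codes y x) else (SOME x. x \<in> K 0))"

lemma dec:
  assumes "y \<in> C m" shows "codes y (dec y)" "dec y \<in> K m"
proof -
  obtain x where x: "x \<in> K m" "codes y x" using codes_exists[OF assms] by blast
  then have "(THE x. codes y x) = x" using codes_unique[OF assms] by (intro the_equality) auto
  then have "dec y = x" using assms by (auto simp: dec_def)
  then show "codes y (dec y)" "dec y \<in> K m" using x by auto
qed

lemma code_in_C: "x \<in> K m \<Longrightarrow> ternary B x \<in> C m"
  unfolding C_def by (meson closure_subset image_eqI subsetD)

lemma dec_code: "x \<in> K m \<Longrightarrow> dec (ternary B x) = x"
  using codes_unique[OF code_in_C dec(1)[OF code_in_C] codes_self] .

text \<open>The compact part of \<open>K m\<close> outside U is covered by finitely many basic sets,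
  each disjoint from some basic neighbourhood of dec y; reals of \<open>C m\<close> close to y
  cannot decode into any of them.\<close>

lemma continuous_dec: "continuous_on (C m) dec"
  unfolding continuous_on_topological
proof (intro ballI allI impI)
  fix y U assume y: "y \<in> C m" and U: "open U" "dec y \<in> U"
  have comp: "compact (K m - U)" using K(1) U(1) by (rule compact_diff)
  have "\<forall>p\<in>K m - U. \<exists>ij. dec y \<in> B (fst ij) \<and> p \<in> B (snd ij) \<and> B (fst ij) \<inter> B (snd ij) = {}"
  proof
    fix p assume "p \<in> K m - U"
    then have "dec y \<noteq> p" using U(2) by auto
    then obtain i j where "dec y \<in> B i" "p \<in> B j" "B i \<inter> B j = {}" by (rule separate)
    then show "\<exists>ij. dec y \<in> B (fst ij) \<and> p \<in> B (snd ij) \<and> B (fst ij) \<inter> B (snd ij) = {}"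
      by (intro exI[of _ "(i, j)"]) simp
  qed
  from bchoice[OF this] obtain ij where ij: "\<And>p. p \<in> K m - U \<Longrightarrow> dec y \<in> B (fst (ij p))"
    "\<And>p. p \<in> K m - U \<Longrightarrow> p \<in> B (snd (ij p))" "\<And>p. p \<in> K m - U \<Longrightarrow> B (fst (ij p)) \<inter> B (snd (ij p)) = {}"
    by blast
  obtain T where T: "T \<subseteq> K m - U" "finite T" "K m - U \<subseteq> (\<Union>p\<in>T. B (snd (ij p)))"
  proof (rule compactE_image[OF comp, of "K m - U" "\<lambda>p. B (snd (ij p))"])
    show "K m - U \<subseteq> (\<Union>p\<in>K m - U. B (snd (ij p)))" using ij(2) by blast
  qed (rule B_open)
  define \<delta> where "\<delta> = Min (insert 1 ((\<lambda>p. eps (fst (ij p))) ` T))"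
  have \<delta>: "0 < \<delta>" "\<And>p. p \<in> T \<Longrightarrow> \<delta> \<le> eps (fst (ij p))"
    unfolding \<delta>_def using T(2) eps by (auto simp: Min_gr_iff intro!: Min_le)
  show "\<exists>A. open A \<and> y \<in> A \<and> (\<forall>y'\<in>C m. y' \<in> A \<longrightarrow> dec y' \<in> U)"
  proof (intro exI[of _ "ball y \<delta>"] conjI ballI impI)
    fix y' assume y': "y' \<in> C m" "y' \<in> ball y \<delta>"
    show "dec y' \<in> U"
    proof (rule ccontr)
      assume "dec y' \<notin> U"
      then have "dec y' \<in> K m - U" using dec(2)[OF y'(1)] by simp
      then obtain p where p: "p \<in> T" "dec y' \<in> B (snd (ij p))" using T(3) by blast
      have "0 < min (eps (snd (ij p))) (\<delta> - \<bar>y' - y\<bar>)"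
        using y'(2) eps by (simp add: dist_real_def abs_minus_commute)
      from C_approx[OF y'(1) this] obtain z
        where z: "\<bar>ternary B z - y'\<bar> < eps (snd (ij p))" "\<bar>ternary B z - y'\<bar> < \<delta> - \<bar>y' - y\<bar>" by auto
      have "z \<in> B (snd (ij p))" using dec(1)[OF y'(1)] p(2) z(1) unfolding codes_def by blast
      moreover have "\<bar>ternary B z - y\<bar> < eps (fst (ij p))" using z(2) \<delta>(2)[OF p(1)] by linarith
      then have "z \<in> B (fst (ij p))" using dec(1)[OF y] ij(1) p(1) T(1) unfolding codes_def by blast
      ultimately show False using ij(3) p(1) T(1) by blast
    qed
  qed (use \<delta> in auto)
qed

lemma dec_measurable: "dec \<in> borel_measurable borel"
proof (rule borel_measurableI)
  fix U :: "'a set" assume U: "open U"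
  have C_borel: "C m \<in> sets borel" for m using compact_C by (intro borel_closed compact_imp_closed)
  have "{y\<in>C m. dec y \<in> U} \<in> sets borel" for m
  proof -
    obtain V where V: "open V" "V \<inter> C m = dec -` U \<inter> C m"
      using continuous_dec[of m] U unfolding continuous_on_open_invariant by blast
    have "{y\<in>C m. dec y \<in> U} = V \<inter> C m" using V(2) by blast
    then show ?thesis using V(1) C_borel[of m] by simp
  qed
  then have "(\<Union>m. {y\<in>C m. dec y \<in> U}) \<in> sets borel" by blast
  moreover have "(- (\<Union>m. C m)) \<in> sets borel"
    using C_borel by (intro borel_comp sets.countable_UN) auto
  ultimately have "(\<Union>m. {y\<in>C m. dec y \<in> U}) \<union> (if (SOME x. x \<in> K 0) \<in> U then - (\<Union>m. C m) else {}) \<in> sets borel"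
    by (intro sets.Un) simp_all
  moreover have "dec -` U \<inter> space borel = (\<Union>m. {y\<in>C m. dec y \<in> U}) \<union> (if (SOME x. x \<in> K 0) \<in> U then - (\<Union>m. C m) else {})"
  proof -
    have d0: "dec y = (SOME x. x \<in> K 0)" if "y \<notin> (\<Union>m. C m)" for y
      using that unfolding dec_def by (simp only: if_False)
    have "y \<in> dec -` U \<longleftrightarrow> y \<in> (\<Union>m. {y\<in>C m. dec y \<in> U}) \<union> (if (SOME x. x \<in> K 0) \<in> U then - (\<Union>m. C m) else {})" for y
    proof (cases "y \<in> (\<Union>m. C m)")
      case False
      show ?thesis using False unfolding vimage_eq d0[OF False] by auto
    qed auto
    then show ?thesis unfolding space_borel Int_UNIV_right by (rule set_eqI)
  qed
  ultimately show "dec -` U \<inter> space borel \<in> sets borel" by (simp only:)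
qed

end

theorem Prokhorov:
  fixes M :: "nat \<Rightarrow> 'a::{t2_space, second_countable_topology} measure"
  assumes M: "\<And>n. prob_space (M n)" "\<And>n. sets (M n) = sets borel"
    and K: "\<And>m. compact (K m)" "\<And>n m. 1 - 1 / real (Suc m) \<le> measure (M n) (K m)"
  obtains r l where "strict_mono (r :: nat \<Rightarrow> nat)" "prob_space l" "sets l = sets borel" "wconv (M \<circ> r) l"
proof -
  obtain \<B> :: "'a set set" where \<B>: "countable \<B>" "topological_basis \<B>" using ex_countable_basis by auto
  have "\<B> \<noteq> {}" using \<B>(2) topological_basisE[of \<B> UNIV] by blast
  then have "range (from_nat_into \<B>) = \<B>" using \<B>(1) by (rule range_from_nat_into)
  then obtain B :: "nat \<Rightarrow> 'a set" where B: "topological_basis (range B)" using \<B>(2) by metis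
  \<comment> \<open>The bound for \<open>K 0\<close> is 0 and says nothing. Unions up to index m + 1
    are increasing, and \<open>K' 0\<close> is nonempty because \<open>K 1\<close> has mass at least
    1/2.\<close>
  define K' where "K' m = (\<Union>i\<le>Suc m. K i)" for m
  have Kc: "K i \<in> sets borel" for i using K(1) by (intro borel_closed compact_imp_closed)
  have K'c: "compact (K' m)" for m unfolding K'_def using K(1) by (intro compact_UN) auto
  have K'm: "1 - 1 / real (Suc m) \<le> measure (M n) (K' m)" for m n
  proof -
    have "measure (M n) (K m) \<le> measure (M n) (K' m)"
      using Kc M(2) unfolding K'_def
      by (intro finite_measure.finite_measure_mono prob_space.finite_measure M) (auto intro!: bexI[of _ m])
    then show ?thesis using K(2)[of m n] by simp
  qed
  have "K' 0 \<noteq> {}"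
  proof
    assume "K' 0 = {}"
    then have "K 1 = {}" unfolding K'_def by auto
    then show False using K(2)[of 1 0] by simp
  qed
  then interpret ternary_code B K'
    by unfold_locales (use B K'c in \<open>auto simp: K'_def\<close>)
  have cm: "ternary B \<in> borel_measurable borel" by (rule ternary_measurable[OF B_open])
  have cmM: "ternary B \<in> borel_measurable (M n)" for n using cm M(2) by (simp cong: measurable_cong_sets)
  define M' where "M' n = distr (M n) borel (ternary B)" for n
  have M'rd: "real_distribution (M' n)" for n
    unfolding M'_def by (intro prob_space.real_distribution_distr M cmM)
  \<comment> \<open>Trivial on the line, since all codes lie in [0, 1]; the compact sets matter for
    decoding the limit.\<close>
  have "tight M'"
    unfolding tight_def
  proof (intro conjI allI impI)
    fix \<epsilon> :: real assume "0 < \<epsilon>"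
    have "measure (M' n) {-1<..1} = 1" for n
    proof -
      have "ternary B -` {-1<..1} \<inter> space (M n) = space (M n)"
      proof -
        have "- 1 < ternary B x" for x using ternary_bounds(1)[of B x] by linarith
        then show ?thesis using ternary_bounds(2)[of B] by auto
      qed
      then show ?thesis
        unfolding M'_def by (subst measure_distr) (auto simp: cmM prob_space.prob_space[OF M(1)])
    qed
    then show "\<exists>a b. a < b \<and> (\<forall>n. 1 - \<epsilon> < measure (M' n) {a<..b})"
      using \<open>0 < \<epsilon>\<close> by (intro exI[of _ "-1"] exI[of _ 1]) auto
  qed (rule M'rd)
  from tight_imp_convergent_subsubsequence[OF this strict_mono_id]
  obtain r l' where r: "strict_mono r" and l': "real_distribution l'" "weak_conv_m (M' \<circ> id \<circ> r) l'" by blast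
  interpret l': real_distribution l' by fact
  have conv': "(\<lambda>n. \<integral>y. f y \<partial>M' (r n)) \<longlonglongrightarrow> (\<integral>y. f y \<partial>l')" if "continuous_on UNIV f" "\<And>y. \<bar>f y\<bar> \<le> c" for f :: "real \<Rightarrow> real" and c
  proof -
    have "isCont f y" for y using that(1) by (simp add: continuous_on_eq_continuous_at)
    then show ?thesis
      using weak_conv_imp_integral_bdd_continuous_conv[of "M' \<circ> id \<circ> r" l' f c] M'rd l' that(2) by simp
  qed
  have wc': "wconv (\<lambda>n. M' (r n)) l'"
    unfolding wconv_def
  proof (intro allI impI)
    fix f :: "real \<Rightarrow> real" assume f: "continuous_on UNIV f" "bounded (range f)"
    then obtain c where "\<And>y. \<bar>f y\<bar> \<le> c" unfolding bounded_pos by auto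
    then show "(\<lambda>n. \<integral>y. f y \<partial>M' (r n)) \<longlonglongrightarrow> (\<integral>y. f y \<partial>l')" using conv' f(1) by blast
  qed
  have C_borel: "C m \<in> sets borel" for m using compact_C by (intro borel_closed compact_imp_closed)
  have M'C: "1 - 1 / real (Suc m) \<le> measure (M' n) (C m)" for n m
  proof -
    have "measure (M n) (K' m) \<le> measure (M n) (ternary B -` C m \<inter> space (M n))"
      using code_in_C[of _ m] cmM C_borel M(2) sets_eq_imp_space_eq[OF M(2)[of n]]
      by (intro finite_measure.finite_measure_mono prob_space.finite_measure M measurable_sets[OF cmM]) auto
    then show ?thesis using K'm[of m n] C_borel[of m] cmM unfolding M'_def by (subst measure_distr) auto
  qed
  have l'C: "1 - 1 / real (Suc m) \<le> measure l' (C m)" for m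
    by (rule wconv_closed[OF _ _ _ _ wc' approx_open_metric _ M'C])
      (use M'rd compact_imp_closed[OF compact_C[of m]] l'.prob_space_axioms in
        \<open>auto simp: real_distribution_def real_distribution_axioms_def open_Compl\<close>)
  define l where "l = distr l' borel dec"
  have dm: "dec \<in> borel_measurable l'" using dec_measurable by simp
  show thesis
  proof (rule that[of r l])
    show "strict_mono r" by (rule r)
    show "prob_space l" unfolding l_def by (rule l'.prob_space_distr[OF dm])
    show "sets l = sets borel" by (simp add: l_def)
    show "wconv (M \<circ> r) l"
      unfolding wconv_def
    proof (intro allI impI LIMSEQ_I)
      fix f :: "'a \<Rightarrow> real" and \<epsilon> :: real assume f: "continuous_on UNIV f" "bounded (range f)" and \<epsilon>: "0 < \<epsilon>"
      obtain c where c: "0 < c" "\<And>x. \<bar>f x\<bar> \<le> c" using f(2) unfolding bounded_pos by auto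
      have fm: "f \<in> borel_measurable borel" using f(1) by (rule borel_measurable_continuous_onI)
      have "0 < \<epsilon> / (6 * c)" using \<epsilon> c by simp
      \<comment> \<open>Replacing f by a function of the code costs at most 2c/(m + 1) <
        \<epsilon>/3 under M n and again under the limit; the last third is weak convergence on the
        line.\<close>
      then obtain m where m: "1 / real (Suc m) < \<epsilon> / (6 * c)" using nat_approx_posE by blast
      have "continuous_on (C m) (\<lambda>y. f (dec y))"
        using continuous_on_compose2[OF f(1) continuous_dec] by auto
      \<comment> \<open>f composed with \<open>dec\<close> is continuous on the compact set
        \<open>C m\<close>; its Tietze extension with the same bound is a test function on the whole
        line.\<close>
      then obtain H where H: "continuous_on UNIV H" "\<And>y. y \<in> C m \<Longrightarrow> H y = f (dec y)" "\<And>y. \<bar>H y\<bar> \<le> c"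
        using Tietze[of "C m" "\<lambda>y. f (dec y)" UNIV c] c compact_imp_closed[OF compact_C] by auto
      have Hm: "H \<in> borel_measurable borel" using H(1) by (rule borel_measurable_continuous_onI)
      have close: "\<bar>(\<integral>x. a x \<partial>\<nu>) - (\<integral>x. b x \<partial>\<nu>)\<bar> \<le> 2 * c / real (Suc m)"
        if \<nu>: "prob_space \<nu>" and [measurable]: "a \<in> borel_measurable \<nu>" "b \<in> borel_measurable \<nu>" and D[measurable]: "D \<in> sets \<nu>"
          and ab: "\<And>x. \<bar>a x\<bar> \<le> c" "\<And>x. \<bar>b x\<bar> \<le> c" "\<And>x. x \<in> D \<Longrightarrow> a x = b x" and Dm: "1 - 1 / real (Suc m) \<le> measure \<nu> D"
        for \<nu> :: "'x measure" and a b D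
      proof -
        interpret prob_space \<nu> by fact
        have ia: "integrable \<nu> a" and ib: "integrable \<nu> b"
          using ab by (auto intro!: integrable_const_bound[where B=c])
        have "\<bar>(\<integral>x. a x \<partial>\<nu>) - (\<integral>x. b x \<partial>\<nu>)\<bar> = \<bar>\<integral>x. a x - b x \<partial>\<nu>\<bar>" using ia ib by simp
        also have "\<dots> \<le> (\<integral>x. \<bar>a x - b x\<bar> \<partial>\<nu>)" by (rule integral_abs_bound)
        also have "\<dots> \<le> (\<integral>x. 2 * c * indicator (space \<nu> - D) x \<partial>\<nu>)"
        proof (rule integral_mono)
          fix x assume "x \<in> space \<nu>"
          then show "\<bar>a x - b x\<bar> \<le> 2 * c * indicator (space \<nu> - D) x"
            using ab(1)[of x] ab(2)[of x] ab(3)[of x] by (auto split: split_indicator)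
        next
          show "integrable \<nu> (\<lambda>x. \<bar>a x - b x\<bar>)" using ia ib by simp
          show "integrable \<nu> (\<lambda>x. 2 * c * indicator (space \<nu> - D) x)"
            by (intro integrable_mult_right integrable_real_indicator) (auto simp: emeasure_eq_measure)
        qed
        also have "\<dots> = 2 * c * (1 - measure \<nu> D)" using prob_compl[OF D] by simp
        also have "\<dots> \<le> 2 * c * (1 / real (Suc m))" using c Dm by (intro mult_left_mono) auto
        finally show ?thesis by simp
      qed
      obtain n0 where n0: "\<And>n. n \<ge> n0 \<Longrightarrow> norm ((\<integral>y. H y \<partial>M' (r n)) - (\<integral>y. H y \<partial>l')) < \<epsilon> / 3"
        using LIMSEQ_D[OF conv'[OF H(1,3)], of "\<epsilon> / 3"] \<epsilon> by auto
      have small: "2 * c / real (Suc m) < \<epsilon> / 3" using m c by (simp add: field_simps)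
      have A: "\<bar>(\<integral>x. f x \<partial>M n) - (\<integral>y. H y \<partial>M' n)\<bar> \<le> 2 * c / real (Suc m)" for n
      proof -
        have "(\<integral>y. H y \<partial>M' n) = (\<integral>x. H (ternary B x) \<partial>M n)"
          unfolding M'_def by (rule integral_distr[OF cmM Hm])
        moreover have "\<bar>(\<integral>x. f x \<partial>M n) - (\<integral>x. H (ternary B x) \<partial>M n)\<bar> \<le> 2 * c / real (Suc m)"
        proof (rule close[OF M(1)])
          show "f \<in> borel_measurable (M n)" using fm M(2) by (simp cong: measurable_cong_sets)
          show "(\<lambda>x. H (ternary B x)) \<in> borel_measurable (M n)" using cmM Hm by measurable
          show "K' m \<in> sets (M n)" using M(2) K'c[of m] by (auto intro: borel_closed compact_imp_closed)
          show "f x = H (ternary B x)" if "x \<in> K' m" for x using that by (simp add: H(2) code_in_C dec_code)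
        qed (use c H K'm in auto)
        ultimately show ?thesis by simp
      qed
      have Bd: "\<bar>(\<integral>x. f x \<partial>l) - (\<integral>y. H y \<partial>l')\<bar> \<le> 2 * c / real (Suc m)"
      proof -
        have "(\<integral>x. f x \<partial>l) = (\<integral>y. f (dec y) \<partial>l')" unfolding l_def by (rule integral_distr[OF dm fm])
        moreover have "\<bar>(\<integral>y. f (dec y) \<partial>l') - (\<integral>y. H y \<partial>l')\<bar> \<le> 2 * c / real (Suc m)"
        proof (rule close[OF l'.prob_space_axioms])
          show "(\<lambda>y. f (dec y)) \<in> borel_measurable l'" using dm fm by measurable
          show "C m \<in> sets l'" using C_borel by simp
        qed (use c H Hm l'C in auto)
        ultimately show ?thesis by simp
      qed
      have "norm ((\<integral>x. f x \<partial>(M \<circ> r) n) - (\<integral>x. f x \<partial>l)) < \<epsilon>" if "n \<ge> n0" for n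
        using n0[OF that] A[of "r n"] Bd small unfolding real_norm_def o_def by linarith
      then show "\<exists>no. \<forall>n\<ge>no. norm ((\<integral>x. f x \<partial>(M \<circ> r) n) - (\<integral>x. f x \<partial>l)) < \<epsilon>" by blast
    qed
  qed
qed

text \<open>Prokhorov's theorem gives convergent subsequences, the inequalities persist by
  \<open>wconv_closed\<close>, and second countability upgrades sequential compactness.\<close>

theorem compact_tight_set:
  fixes K :: "nat \<Rightarrow> 'a::polish_space set"
  assumes K: "\<And>m. compact (K m)"
  shows "compact {\<nu>. \<forall>m. 1 - 1 / real (Suc m) \<le> measure (meas_of \<nu>) (K m)}" (is "compact ?S")
proof -
  have "seq_compact ?S"
    unfolding seq_compact_def
  proof (intro allI impI)
    fix \<nu>s :: "nat \<Rightarrow> 'a prob_meas" assume \<nu>s: "\<forall>n. \<nu>s n \<in> ?S"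
    obtain r l where r: "strict_mono (r :: nat \<Rightarrow> nat)" and l: "prob_space l" "sets l = sets borel"
        and conv: "wconv ((\<lambda>n. meas_of (\<nu>s n)) \<circ> r) l"
      by (rule Prokhorov[of "\<lambda>n. meas_of (\<nu>s n)" K]) (use \<nu>s K in \<open>auto simp: prob_meas_D\<close>)
    define \<nu> where "\<nu> = prob_meas_of l"
    have \<nu>: "meas_of \<nu> = l" unfolding \<nu>_def using l by (intro prob_meas_of_inverse) simp
    have "(\<nu>s \<circ> r) \<longlonglongrightarrow> \<nu>"
      unfolding tendsto_prob_meas_iff using conv by (auto simp: wconv_def \<nu>)
    moreover have "1 - 1 / real (Suc m) \<le> measure l (K m)" for m
      using \<nu>s compact_imp_closed[OF K] by (intro wconv_closed[OF _ _ l conv approx_open_metric]) (auto simp: prob_meas_D)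
    ultimately show "\<exists>l\<in>?S. \<exists>r. strict_mono r \<and> (\<nu>s \<circ> r) \<longlonglongrightarrow> l"
      using r by (intro bexI[of _ \<nu>] exI[of _ r]) (auto simp: \<nu>)
  qed
  then show ?thesis
    by (intro countably_compact_imp_compact_second_countable seq_compact_imp_countably_compact)
qed

section \<open>The transition kernel of the filter\<close>

lemma fmeas_prob: "prob_space \<nu> \<Longrightarrow> sets \<nu> = sets borel \<Longrightarrow> fmeas \<nu>"
  by (simp add: fmeas_def prob_space.finite_measure)

lemma fmeas_meas_of: "fmeas (meas_of \<nu>)"
  by (rule fmeas_prob[OF prob_meas_D(1,2)])

lemma measure_meas_of_UNIV: "measure (meas_of \<nu>) UNIV = 1" "emeasure (meas_of \<nu>) UNIV = 1"
  using prob_space.prob_space[OF prob_meas_D(1), of \<nu>] prob_space.emeasure_space_1[OF prob_meas_D(1), of \<nu>]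
  by (simp_all add: prob_meas_D)

lemma meas_of_prob_meas_of: "prob_space \<nu> \<Longrightarrow> sets \<nu> = sets borel \<Longrightarrow> meas_of (prob_meas_of \<nu>) = \<nu>"
  by (intro prob_meas_of_inverse) simp

context filter_model
begin

lemma push_prob: "prob_space (push (meas_of \<nu>))" "sets (push (meas_of \<nu>)) = sets borel"
proof -
  note f = fmeas_push[OF fmeas_meas_of[of \<nu>]]
  show "sets (push (meas_of \<nu>)) = sets borel" using fmeasD[OF f] by simp
  show "prob_space (push (meas_of \<nu>))"
    using push_UNIV[OF fmeas_meas_of[of \<nu>]] measure_meas_of_UNIV(2)[of \<nu>] fmeasD(3)[OF f] by (intro prob_spaceI) simp
qed

lemma meas_of_kernel_step: "meas_of (kernel_step P \<nu>) = push (meas_of \<nu>)"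
  unfolding kernel_step_def push_def[symmetric] by (rule meas_of_prob_meas_of[OF push_prob])

text \<open>Correction without prediction. Applied to \<mu> itself it is the update at time 0,
  applied after \<open>push\<close> it is \<open>step\<close>.\<close>

definition dn :: "'e measure \<Rightarrow> 'f \<Rightarrow> 'e measure" where
  "dn \<sigma> y = density \<sigma> (\<lambda>x. ennreal (\<Upsilon> x y))"

lemma step_dn: "step \<sigma> y = dn (push \<sigma>) y"
  by (simp add: step_def dn_def)

lemma nn_integral_dn:
  assumes "fmeas \<sigma>" "g \<in> borel_measurable borel"
  shows "(\<integral>\<^sup>+x. g x \<partial>dn \<sigma> y) = (\<integral>\<^sup>+x. ennreal (\<Upsilon> x y) * g x \<partial>\<sigma>)"
  unfolding dn_def using assms(2) by (intro nn_integral_density) (auto simp: measurable_fmeas[OF assms(1)])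

definition Zn :: "'e measure \<Rightarrow> 'f \<Rightarrow> ennreal" where
  "Zn \<sigma> y = (\<integral>\<^sup>+x. ennreal (\<Upsilon> x y) \<partial>\<sigma>)"

lemma Zn_measurable: "fmeas \<sigma> \<Longrightarrow> Zn \<sigma> \<in> borel_measurable borel"
  unfolding Zn_def[abs_def] by (rule nn_integral_fmeas_measurable) auto

lemma Zn_phi: "fmeas \<sigma> \<Longrightarrow> (\<integral>\<^sup>+y. Zn \<sigma> y \<partial>\<phi>) = emeasure \<sigma> UNIV"
  unfolding Zn_def by (subst swap_phi) (auto simp: Ups_norm fmeasD)

lemma AE_Zn_finite: "fmeas \<sigma> \<Longrightarrow> AE y in \<phi>. Zn \<sigma> y < \<infinity>"
  using nn_integral_PInf_AE[of "Zn \<sigma>" \<phi>] Zn_phi[of \<sigma>] Zn_measurable[of \<sigma>] fmeasD(4)[of \<sigma> UNIV]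
  by (auto simp: less_top[symmetric] cong: measurable_cong_sets)

lemma fmeas_dn: "fmeas \<sigma> \<Longrightarrow> Zn \<sigma> y < \<infinity> \<Longrightarrow> fmeas (dn \<sigma> y)"
  unfolding dn_def Zn_def by (intro fmeas_density) auto

lemma Zn_pos:
  assumes "prob_space \<sigma>" "sets \<sigma> = sets borel" shows "0 < Zn \<sigma> y"
proof (rule ccontr)
  assume "\<not> ?thesis"
  then have "(\<integral>\<^sup>+x. ennreal (\<Upsilon> x y) \<partial>\<sigma>) = 0" by (simp add: Zn_def)
  then have "AE x in \<sigma>. ennreal (\<Upsilon> x y) = 0"
    by (subst (asm) nn_integral_0_iff_AE) (auto simp: measurable_fmeas[OF fmeas_prob[OF assms]])
  then have "AE x in \<sigma>. False" using Ups_pos[of _ y] by (auto elim!: eventually_mono simp: ennreal_eq_0_iff not_le[symmetric])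
  then show False using prob_space.AE_const[OF assms(1)] by auto
qed

lemma emeasure_dn: "fmeas \<sigma> \<Longrightarrow> emeasure (dn \<sigma> y) UNIV = Zn \<sigma> y"
  unfolding dn_def Zn_def by (subst emeasure_density) (auto simp: fmeasD measurable_fmeas)

lemma meas_of_bayes:
  assumes "Zn (meas_of \<rho>) y < \<infinity>"
  shows "meas_of (bayes_update \<Upsilon> y \<rho>) = density (meas_of \<rho>) (\<lambda>x. ennreal (\<Upsilon> x y) / Zn (meas_of \<rho>) y)"
proof -
  note f = fmeas_meas_of[of \<rho>]
  let ?Z = "Zn (meas_of \<rho>) y"
  have Z: "0 < ?Z" "?Z < \<infinity>" using Zn_pos[OF prob_meas_D(1,2)] assms by auto
  have "(\<integral>\<^sup>+x. ennreal (\<Upsilon> x y) / ?Z \<partial>meas_of \<rho>) = (\<integral>\<^sup>+x. ennreal (\<Upsilon> x y) \<partial>meas_of \<rho>) / ?Z"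
    by (intro nn_integral_divide) (auto simp: measurable_fmeas[OF f])
  also have "\<dots> = 1" using Z by (simp add: Zn_def ennreal_divide_self)
  finally have n: "(\<integral>\<^sup>+x. ennreal (\<Upsilon> x y) / ?Z \<partial>meas_of \<rho>) = 1" .
  have "prob_space (density (meas_of \<rho>) (\<lambda>x. ennreal (\<Upsilon> x y) / ?Z))"
    using n by (intro prob_spaceI) (auto simp: emeasure_density prob_meas_D measurable_fmeas[OF f])
  then show ?thesis
    using assms unfolding bayes_update_def Zn_def Let_def by (simp add: meas_of_prob_meas_of prob_meas_D)
qed

text \<open>Normalisation is multiplication by a positive constant, to which \<open>q\<close> is
  insensitive. This links the normalised filter to the unnormalised recursion.\<close>

lemma bayes_scaled:
  assumes "Zn (meas_of \<rho>) y < \<infinity>"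
  shows "is_scaled (1 / enn2real (Zn (meas_of \<rho>) y)) (meas_of (bayes_update \<Upsilon> y \<rho>)) (dn (meas_of \<rho>) y)"
    and "0 < 1 / enn2real (Zn (meas_of \<rho>) y)"
proof -
  note f = fmeas_meas_of[of \<rho>]
  let ?Z = "Zn (meas_of \<rho>) y"
  have Z: "0 < ?Z" "?Z < \<infinity>" using Zn_pos[OF prob_meas_D(1,2)] assms by auto
  then have rz: "0 < enn2real ?Z" by (simp add: enn2real_positive_iff)
  then show "0 < 1 / enn2real ?Z" by simp
  have inv: "a / ?Z = ennreal (1 / enn2real ?Z) * a" for a
  proof -
    have "?Z = ennreal (enn2real ?Z)" using Z by simp
    then have "inverse ?Z = ennreal (1 / enn2real ?Z)" using rz by (metis inverse_ennreal inverse_eq_divide)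
    then show ?thesis by (simp add: divide_ennreal_def mult.commute)
  qed
  show "is_scaled (1 / enn2real ?Z) (meas_of (bayes_update \<Upsilon> y \<rho>)) (dn (meas_of \<rho>) y)"
    unfolding meas_of_bayes[OF assms] inv dn_def using rz by (intro is_scaled_density f) auto
qed

lemma bayes_measurable: "(\<lambda>y. bayes_update \<Upsilon> y \<rho>) \<in> borel \<rightarrow>\<^sub>M borel"
proof (rule measurable_prob_measI)
  fix g :: "'e \<Rightarrow> real" assume g: "continuous_on UNIV g" "bounded (range g)"
  note f = fmeas_meas_of[of \<rho>]
  have [measurable]: "g \<in> borel_measurable borel" using g(1) by (rule borel_measurable_continuous_onI)
  note [measurable] = Zn_measurable[OF f]
  have eq: "(\<integral>x. g x \<partial>meas_of (bayes_update \<Upsilon> y \<rho>)) =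
     (if Zn (meas_of \<rho>) y < \<infinity> then (\<integral>x. g x * (\<Upsilon> x y / enn2real (Zn (meas_of \<rho>) y)) \<partial>meas_of \<rho>) else (\<integral>x. g x \<partial>meas_of \<rho>))" for y
  proof (cases "Zn (meas_of \<rho>) y < \<infinity>")
    case True
    have pos: "0 < Zn (meas_of \<rho>) y" by (rule Zn_pos[OF prob_meas_D(1,2)])
    have e: "ennreal (\<Upsilon> x y) / Zn (meas_of \<rho>) y = ennreal (\<Upsilon> x y / enn2real (Zn (meas_of \<rho>) y))" for x
    proof -
      have "Zn (meas_of \<rho>) y = ennreal (enn2real (Zn (meas_of \<rho>) y))" using True by simp
      then show ?thesis using Ups_pos[of x y] pos True
        by (metis divide_ennreal enn2real_positive_iff infinity_ennreal_def less_imp_le)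
    qed
    show ?thesis
      using True Ups_pos unfolding meas_of_bayes[OF True] e
      by (subst integral_density) (auto simp: measurable_fmeas[OF f] mult.commute less_imp_le divide_nonneg_nonneg)
  qed (simp add: bayes_update_def Zn_def)
  have "sets (borel \<Otimes>\<^sub>M meas_of \<rho>) = sets (borel \<Otimes>\<^sub>M borel)" by (intro sets_pair_measure_cong refl prob_meas_D)
  moreover have "(\<lambda>(y, x). g x * (\<Upsilon> x y / enn2real (Zn (meas_of \<rho>) y))) \<in> borel_measurable (borel \<Otimes>\<^sub>M borel)"
    by measurable
  ultimately have "(\<lambda>(y, x). g x * (\<Upsilon> x y / enn2real (Zn (meas_of \<rho>) y))) \<in> borel_measurable (borel \<Otimes>\<^sub>M meas_of \<rho>)"
    using measurable_cong_sets by blast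
  then have "(\<lambda>y. \<integral>x. g x * (\<Upsilon> x y / enn2real (Zn (meas_of \<rho>) y)) \<partial>meas_of \<rho>) \<in> borel_measurable borel"
    by (rule sigma_finite_measure.borel_measurable_lebesgue_integral[OF sf_fmeas[OF f]])
  then show "(\<lambda>y. \<integral>x. g x \<partial>meas_of (bayes_update \<Upsilon> y \<rho>)) \<in> borel_measurable borel"
    unfolding eq by measurable
qed

lemma update_map_measurable:
  "(\<lambda>(x, y). (x, bayes_update \<Upsilon> y \<rho>)) \<in> borel \<Otimes>\<^sub>M borel \<rightarrow>\<^sub>M (borel :: ('e \<times> 'e prob_meas) measure)"
proof -
  note [measurable] = bayes_measurable[of \<rho>]
  have "(\<lambda>(x, y). (x, bayes_update \<Upsilon> y \<rho>)) \<in> borel \<Otimes>\<^sub>M borel \<rightarrow>\<^sub>M (borel \<Otimes>\<^sub>M borel :: ('e \<times> 'e prob_meas) measure)"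
    by measurable
  then show ?thesis by (simp add: borel_prod)
qed

lemma nn_integral_update_law:
  assumes \<nu>: "prob_space \<nu>" "sets \<nu> = sets borel" and [measurable]: "F \<in> borel_measurable borel"
  shows "(\<integral>\<^sup>+z. F z \<partial>update_law \<Upsilon> \<phi> \<nu> \<rho>) = (\<integral>\<^sup>+y. \<integral>\<^sup>+x. ennreal (\<Upsilon> x y) * F (x, bayes_update \<Upsilon> y \<rho>) \<partial>\<nu> \<partial>\<phi>)"
proof -
  interpret pair_sigma_finite \<nu> \<phi>
    using sf_phi sf_fmeas[OF fmeas_prob[OF \<nu>]] by (intro pair_sigma_finite.intro)
  have [measurable_cong]: "sets (\<nu> \<Otimes>\<^sub>M \<phi>) = sets (borel \<Otimes>\<^sub>M borel)"
    by (intro sets_pair_measure_cong \<nu> sets_phi)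
  note [measurable] = update_map_measurable[of \<rho>]
  have [measurable]: "(\<lambda>z. F (case z of (x, y) \<Rightarrow> (x, bayes_update \<Upsilon> y \<rho>))) \<in> borel_measurable (borel \<Otimes>\<^sub>M borel)"
    by (rule measurable_compose[OF update_map_measurable assms(3)])
  have "(\<integral>\<^sup>+z. F z \<partial>update_law \<Upsilon> \<phi> \<nu> \<rho>) =
    (\<integral>\<^sup>+z. F (case z of (x, y) \<Rightarrow> (x, bayes_update \<Upsilon> y \<rho>)) \<partial>density (\<nu> \<Otimes>\<^sub>M \<phi>) (\<lambda>(x, y). ennreal (\<Upsilon> x y)))"
    unfolding update_law_def by (subst nn_integral_distr) auto
  also have "\<dots> = (\<integral>\<^sup>+z. (case z of (x, y) \<Rightarrow> ennreal (\<Upsilon> x y)) * F (case z of (x, y) \<Rightarrow> (x, bayes_update \<Upsilon> y \<rho>)) \<partial>(\<nu> \<Otimes>\<^sub>M \<phi>))"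
    by (subst nn_integral_density) auto
  also have "\<dots> = (\<integral>\<^sup>+(x, y). ennreal (\<Upsilon> x y) * F (x, bayes_update \<Upsilon> y \<rho>) \<partial>(\<nu> \<Otimes>\<^sub>M \<phi>))"
    by (simp add: split_beta')
  also have "\<dots> = (\<integral>\<^sup>+y. \<integral>\<^sup>+x. ennreal (\<Upsilon> x y) * F (x, bayes_update \<Upsilon> y \<rho>) \<partial>\<nu> \<partial>\<phi>)"
  proof -
    have "(\<lambda>z. (case z of (x, y) \<Rightarrow> ennreal (\<Upsilon> x y)) * F (case z of (x, y) \<Rightarrow> (x, bayes_update \<Upsilon> y \<rho>))) \<in> borel_measurable (\<nu> \<Otimes>\<^sub>M \<phi>)"
      by measurable
    then show ?thesis by (subst nn_integral_snd[symmetric]) (auto simp: split_beta')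
  qed
  finally show ?thesis .
qed

lemma prob_update_law:
  assumes \<nu>: "prob_space \<nu>" "sets \<nu> = sets borel"
  shows "prob_space (update_law \<Upsilon> \<phi> \<nu> \<rho>)" "sets (update_law \<Upsilon> \<phi> \<nu> \<rho>) = sets borel"
proof -
  show s: "sets (update_law \<Upsilon> \<phi> \<nu> \<rho>) = sets borel" by (simp add: update_law_def)
  note f = fmeas_prob[OF \<nu>]
  have "emeasure (update_law \<Upsilon> \<phi> \<nu> \<rho>) (space (update_law \<Upsilon> \<phi> \<nu> \<rho>)) = (\<integral>\<^sup>+z. 1 \<partial>update_law \<Upsilon> \<phi> \<nu> \<rho>)" by simp
  also have "\<dots> = (\<integral>\<^sup>+y. Zn \<nu> y \<partial>\<phi>)" by (subst nn_integral_update_law[OF \<nu>]) (auto simp: Zn_def[abs_def])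
  also have "\<dots> = 1" using Zn_phi[OF f] prob_space.emeasure_space_1[OF \<nu>(1)] fmeasD(3)[OF f] by simp
  finally show "prob_space (update_law \<Upsilon> \<phi> \<nu> \<rho>)" by (rule prob_spaceI)
qed

end

section \<open>Iterates of the exact kernel on the quadratic test function\<close>

context filter_test
begin

text \<open>\<open>Fm\<close> is built from the two moments with (g, k) = (1, 2) and (f, 1). Kept
  apart as nonnegative integrals they allow Tonelli without integrability conditions.\<close>

definition W :: "nat \<Rightarrow> ('e \<Rightarrow> ennreal) \<Rightarrow> nat \<Rightarrow> 'e \<Rightarrow> 'e measure \<Rightarrow> ennreal" where
  "W m g k x \<nu> = (\<integral>\<^sup>+s. u m g x s * ennreal ((q m \<nu> s) ^ k) \<partial>S)"

lemma q_nonneg: "0 \<le> q m \<nu> s" by (simp add: q_def)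

lemma AE_q_pow:
  assumes "fmeas \<nu>" shows "AE s in S. ennreal ((q m \<nu> s) ^ k) \<le> 1"
  using q_bounds[OF assms, of m]
proof eventually_elim
  case (elim s)
  then show ?case by (simp add: power_le_one)
qed

lemma W_le_1:
  assumes \<nu>: "fmeas \<nu>" and g: "\<And>x. g x \<le> 1"
  shows "W m g k x \<nu> \<le> 1"
proof -
  have "W m g k x \<nu> \<le> (\<integral>\<^sup>+s. u m (\<lambda>_. 1) x s \<partial>S)"
    unfolding W_def using AE_q_pow[OF \<nu>, of m k]
  proof (intro nn_integral_mono_AE, eventually_elim)
    case (elim s)
    show ?case using mult_mono[OF u_mono[of g "\<lambda>_. 1" m x s, OF g] elim(2)] elim by simp
  qed
  also have "\<dots> = 1" using U_mass[OF fmeas_return, of m x] by (simp add: U_return)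
  finally show ?thesis .
qed

lemma Fm_W:
  assumes \<nu>: "fmeas \<nu>"
  shows "Fm m x \<nu> = enn2real (W m (\<lambda>_. 1) 2 x \<nu>) - 2 * enn2real (W m f 1 x \<nu>)"
proof -
  have [measurable]: "(\<lambda>s. q m \<nu> s) \<in> borel_measurable S" using \<nu> by measurable
  have fin: "AE s in S. u m (\<lambda>_. 1) x s < \<infinity>" using AE_U_finite[OF fmeas_return, of m x] by (simp add: U_return)
  have W: "W m g k x \<nu> = (\<integral>\<^sup>+s. ennreal (enn2real (u m g x s) * (q m \<nu> s) ^ k) \<partial>S)" if g: "\<And>x. g x \<le> 1" for g k
    unfolding W_def
  proof (rule nn_integral_cong_AE, use fin in eventually_elim)
    case (elim s)
    then have "u m g x s < \<top>" using u_mono[of g "\<lambda>_. 1" m x s, OF g] by (auto intro: order.strict_trans1)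
    then show ?case by (simp add: ennreal_mult q_nonneg)
  qed
  have i: "integrable S (\<lambda>s. enn2real (u m g x s) * (q m \<nu> s) ^ k)"
      "(\<integral>s. enn2real (u m g x s) * (q m \<nu> s) ^ k \<partial>S) = enn2real (W m g k x \<nu>)"
    if g: "\<And>x. g x \<le> 1" and [measurable]: "g \<in> borel_measurable borel" for g k
  proof -
    show "integrable S (\<lambda>s. enn2real (u m g x s) * (q m \<nu> s) ^ k)"
      using W_le_1[of \<nu> g m k x, OF \<nu> g] unfolding W[OF g]
      by (intro integrableI_nonneg) (auto simp: q_nonneg intro: order.strict_trans1)
    show "(\<integral>s. enn2real (u m g x s) * (q m \<nu> s) ^ k \<partial>S) = enn2real (W m g k x \<nu>)"
      unfolding W[OF g] by (intro integral_eq_nn_integral) (auto simp: q_nonneg)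
  qed
  have 1: "integrable S (\<lambda>s. enn2real (u m (\<lambda>_. 1) x s) * (q m \<nu> s)\<^sup>2)"
     "(\<integral>s. enn2real (u m (\<lambda>_. 1) x s) * (q m \<nu> s)\<^sup>2 \<partial>S) = enn2real (W m (\<lambda>_. 1) 2 x \<nu>)"
    using i[of "\<lambda>_. 1" 2] by auto
  have 2: "integrable S (\<lambda>s. enn2real (u m f x s) * q m \<nu> s)"
     "(\<integral>s. enn2real (u m f x s) * q m \<nu> s \<partial>S) = enn2real (W m f 1 x \<nu>)"
    using i[of f 1] f_le_1 by auto
  show ?thesis
    unfolding Fm_def 1(2)[symmetric] 2(2)[symmetric] using 1(1) 2(1)
    by (simp add: mult.assoc Bochner_Integration.integral_diff)
qed

lemma W_bounds: "fmeas \<nu> \<Longrightarrow> (\<And>x. g x \<le> 1) \<Longrightarrow> enn2real (W m g k x \<nu>) \<le> 1"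
  using enn2real_mono[OF W_le_1[of \<nu> g m k x]] by simp

lemma Fm_bounded:
  assumes "fmeas \<nu>" shows "\<bar>Fm m x \<nu>\<bar> \<le> 2"
  unfolding Fm_W[OF assms]
  using W_bounds[of \<nu> "\<lambda>_. 1" m 2 x, OF assms order_refl] W_bounds[of \<nu> f m 1 x, OF assms f_le_1]
    enn2real_nonneg[of "W m (\<lambda>_. 1) 2 x \<nu>"] enn2real_nonneg[of "W m f 1 x \<nu>"]
  by linarith

lemma q_scaled:
  assumes "is_scaled c \<sigma>' \<sigma>" "0 < c"
  shows "q m \<sigma>' s = q m \<sigma> s"
  unfolding q_def using assms by (simp add: U_scaled[OF assms(1)] enn2real_mult)

lemma q_bayes:
  assumes "Zn (meas_of \<rho>) y < \<infinity>"
  shows "q m (meas_of (bayes_update \<Upsilon> y \<rho>)) s = q m (dn (meas_of \<rho>) y) s"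
  using q_scaled[OF bayes_scaled[OF assms]] .

lemma U_meas_of_measurable:
  assumes [measurable]: "g \<in> borel_measurable borel"
  shows "(\<lambda>(\<nu>, s). U m g (meas_of \<nu>) s) \<in> borel_measurable (borel \<Otimes>\<^sub>M S)"
proof -
  note [measurable] = measurable_prob_algebraD[OF meas_of_measurable]
  have "(\<lambda>z. \<integral>\<^sup>+x. u m g x (snd z) \<partial>meas_of (fst z)) \<in> borel_measurable (borel \<Otimes>\<^sub>M S)"
    by (rule nn_integral_measurable_subprob_algebra2[where N=borel]) measurable
  then show ?thesis by (simp add: U_def split_beta')
qed

lemma W_measurable:
  assumes [measurable]: "g \<in> borel_measurable borel"
  shows "(\<lambda>z. W m g k (fst z) (meas_of (snd z))) \<in> borel_measurable borel"
proof -
  interpret S: sigma_finite_measure S by (rule sf_S)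
  have [measurable]: "(\<lambda>w. U m h (meas_of (snd (fst w))) (snd w)) \<in> borel_measurable ((borel \<Otimes>\<^sub>M borel :: ('e \<times> 'e prob_meas) measure) \<Otimes>\<^sub>M S)"
    if "h \<in> borel_measurable borel" for h
    using measurable_compose[OF _ U_meas_of_measurable[OF that, of m], of "\<lambda>w. (snd (fst w), snd w)" "(borel \<Otimes>\<^sub>M borel :: ('e \<times> 'e prob_meas) measure) \<Otimes>\<^sub>M S"]
    by simp
  have "(\<lambda>z. W m g k (fst z) (meas_of (snd z))) \<in> borel_measurable (borel \<Otimes>\<^sub>M borel)"
    unfolding W_def q_def by (rule S.borel_measurable_nn_integral) (simp add: split_beta')
  then show ?thesis by (simp add: borel_prod)
qed

text \<open>Tonelli moves the average over the new state inside the stream integral, where it turns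
  \<open>u\<close> into \<open>U\<close> of the corrected law; by \<open>q_bayes\<close> the updated
  filter may be replaced by its unnormalised form.\<close>

lemma W_update_law:
  assumes \<nu>: "prob_space \<nu>" "sets \<nu> = sets borel" and [measurable]: "g \<in> borel_measurable borel"
  shows "(\<integral>\<^sup>+z. W m g k (fst z) (meas_of (snd z)) \<partial>update_law \<Upsilon> \<phi> \<nu> \<rho>) =
    (\<integral>\<^sup>+y. \<integral>\<^sup>+s. U m g (dn \<nu> y) s * ennreal ((q m (dn (meas_of \<rho>) y) s) ^ k) \<partial>S \<partial>\<phi>)"
proof -
  have f: "fmeas \<nu>" by (rule fmeas_prob[OF \<nu>])
  have "(\<integral>\<^sup>+z. W m g k (fst z) (meas_of (snd z)) \<partial>update_law \<Upsilon> \<phi> \<nu> \<rho>) =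
    (\<integral>\<^sup>+y. \<integral>\<^sup>+x. ennreal (\<Upsilon> x y) * W m g k x (meas_of (bayes_update \<Upsilon> y \<rho>)) \<partial>\<nu> \<partial>\<phi>)"
    by (subst nn_integral_update_law[OF \<nu> W_measurable]) auto
  also have "\<dots> = (\<integral>\<^sup>+y. \<integral>\<^sup>+s. U m g (dn \<nu> y) s * ennreal ((q m (dn (meas_of \<rho>) y) s) ^ k) \<partial>S \<partial>\<phi>)"
  proof (rule nn_integral_cong_AE, use AE_Zn_finite[OF fmeas_meas_of[of \<rho>]] in eventually_elim)
    case (elim y)
    let ?q = "\<lambda>s. ennreal ((q m (dn (meas_of \<rho>) y) s) ^ k)"
    have [measurable]: "?q \<in> borel_measurable S"
      using fmeas_dn[OF fmeas_meas_of elim] by measurable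
    have "(\<integral>\<^sup>+x. ennreal (\<Upsilon> x y) * W m g k x (meas_of (bayes_update \<Upsilon> y \<rho>)) \<partial>\<nu>) =
      (\<integral>\<^sup>+x. \<integral>\<^sup>+s. ennreal (\<Upsilon> x y) * u m g x s * ?q s \<partial>S \<partial>\<nu>)"
      unfolding W_def q_bayes[OF elim] by (simp add: nn_integral_cmult[symmetric] mult.assoc)
    also have "\<dots> = (\<integral>\<^sup>+s. \<integral>\<^sup>+x. ennreal (\<Upsilon> x y) * u m g x s * ?q s \<partial>\<nu> \<partial>S)"
      by (rule swap_S[OF f, symmetric]) measurable
    also have "\<dots> = (\<integral>\<^sup>+s. U m g (dn \<nu> y) s * ?q s \<partial>S)"
    proof (rule nn_integral_cong)
      fix s
      have "U m g (dn \<nu> y) s = (\<integral>\<^sup>+x. ennreal (\<Upsilon> x y) * u m g x s \<partial>\<nu>)"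
        unfolding U_def by (rule nn_integral_dn[OF f]) measurable
      then show "(\<integral>\<^sup>+x. ennreal (\<Upsilon> x y) * u m g x s * ?q s \<partial>\<nu>) = U m g (dn \<nu> y) s * ?q s"
        by (simp add: nn_integral_multc measurable_fmeas[OF f])
    qed
    finally show ?case .
  qed
  finally show ?thesis .
qed

text \<open>The observation generated by the kernel becomes the head of the stream, so m grows by
  one.\<close>

lemma W_filter_kernel:
  assumes [measurable]: "g \<in> borel_measurable borel"
  shows "(\<integral>\<^sup>+z. W m g k (fst z) (meas_of (snd z)) \<partial>filter_kernel \<Upsilon> \<phi> P (x, \<nu>)) = W (Suc m) g k x (meas_of \<nu>)"
proof -
  note f = fmeas_meas_of[of \<nu>]
  have U: "U m g (dn (P x) y) s = u (Suc m) g x (y ## s)" for y s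
    unfolding U_def by (subst nn_integral_dn[OF fmeas_P]) auto
  have q: "q m (dn (push (meas_of \<nu>)) y) s = q (Suc m) (meas_of \<nu>) (y ## s)" for y s
    unfolding q_def step_dn[symmetric] by (simp add: U_Suc[OF f])
  have [measurable]: "(\<lambda>s. q (Suc m) (meas_of \<nu>) s) \<in> borel_measurable S" using f by measurable
  have "(\<integral>\<^sup>+z. W m g k (fst z) (meas_of (snd z)) \<partial>filter_kernel \<Upsilon> \<phi> P (x, \<nu>)) =
    (\<integral>\<^sup>+y. \<integral>\<^sup>+s. u (Suc m) g x (y ## s) * ennreal ((q (Suc m) (meas_of \<nu>) (y ## s)) ^ k) \<partial>S \<partial>\<phi>)"
    unfolding filter_kernel_def by (simp only: prod.case) (subst W_update_law[OF P_prob(1,2)], auto simp: U q meas_of_kernel_step simp del: u.simps)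
  also have "\<dots> = W (Suc m) g k x (meas_of \<nu>)"
    unfolding W_def by (subst nn_integral_S) (auto simp del: u.simps)
  finally show ?thesis .
qed

definition Fp :: "nat \<Rightarrow> 'e \<times> 'e prob_meas \<Rightarrow> real" where
  "Fp m z = Fm m (fst z) (meas_of (snd z))"

lemma Fp_W: "Fp m z = enn2real (W m (\<lambda>_. 1) 2 (fst z) (meas_of (snd z))) - 2 * enn2real (W m f 1 (fst z) (meas_of (snd z)))"
  unfolding Fp_def by (rule Fm_W[OF fmeas_meas_of])

lemma Fp_bounded: "\<bar>Fp m z\<bar> \<le> 2"
  unfolding Fp_def by (rule Fm_bounded[OF fmeas_meas_of])

lemma Fp_measurable[measurable]: "Fp m \<in> borel_measurable borel"
proof -
  note [measurable] = W_measurable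
  show ?thesis unfolding Fp_W[abs_def] by measurable
qed

lemma integral_Fp:
  assumes \<nu>: "prob_space L" "sets L = sets borel"
  shows "(\<integral>z. Fp m z \<partial>L) = enn2real (\<integral>\<^sup>+z. W m (\<lambda>_. 1) 2 (fst z) (meas_of (snd z)) \<partial>L) - 2 * enn2real (\<integral>\<^sup>+z. W m f 1 (fst z) (meas_of (snd z)) \<partial>L)"
proof -
  interpret prob_space L by fact
  have i: "integrable L (\<lambda>z. enn2real (W m g k (fst z) (meas_of (snd z))))"
    "(\<integral>z. enn2real (W m g k (fst z) (meas_of (snd z))) \<partial>L) = enn2real (\<integral>\<^sup>+z. W m g k (fst z) (meas_of (snd z)) \<partial>L)"
    if g: "\<And>x. g x \<le> 1" "g \<in> borel_measurable borel" for g k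
  proof -
    have m: "(\<lambda>z. W m g k (fst z) (meas_of (snd z))) \<in> borel_measurable L"
      using W_measurable[OF g(2)] \<nu>(2) by (simp cong: measurable_cong_sets)
    show "integrable L (\<lambda>z. enn2real (W m g k (fst z) (meas_of (snd z))))"
      using m W_bounds[OF fmeas_meas_of, of g, OF g(1)] by (intro integrable_const_bound[where B=1]) auto
    have "ennreal (enn2real (W m g k (fst z) (meas_of (snd z)))) = W m g k (fst z) (meas_of (snd z))" for z
      using W_le_1[OF fmeas_meas_of, of g m k "fst z" "snd z", OF g(1)]
      by (metis ennreal_enn2real_if ennreal_one_neq_top top.extremum_unique)
    then show "(\<integral>z. enn2real (W m g k (fst z) (meas_of (snd z))) \<partial>L) = enn2real (\<integral>\<^sup>+z. W m g k (fst z) (meas_of (snd z)) \<partial>L)"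
      using m by (subst integral_eq_nn_integral) auto
  qed
  show ?thesis
    unfolding Fp_W i(2)[of "\<lambda>_. 1", OF order_refl borel_measurable_const, symmetric] i(2)[of f, OF f_le_1 f_meas, symmetric]
    using i(1)[of "\<lambda>_. 1" 2] i(1)[of f 1] f_le_1 by (subst Bochner_Integration.integral_diff) auto
qed

text \<open>Both moments of \<open>Fp m\<close> advance by \<open>W_filter_kernel\<close>; hence
  \<open>Fp m\<close> is the m-th iterate of the exact kernel applied to
  \<open>Fp 0\<close>.\<close>

lemma Fp_Suc: "(\<integral>z. Fp m z \<partial>filter_kernel \<Upsilon> \<phi> P (x, \<nu>)) = Fp (Suc m) (x, \<nu>)"
proof -
  have "prob_space (filter_kernel \<Upsilon> \<phi> P (x, \<nu>))" "sets (filter_kernel \<Upsilon> \<phi> P (x, \<nu>)) = sets borel"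
    unfolding filter_kernel_def using prob_update_law[OF P_prob(1,2), of x "kernel_step P \<nu>"] by auto
  then show ?thesis
    by (subst integral_Fp) (auto simp: W_filter_kernel Fp_W)
qed

text \<open>Expected square of the exact filter's estimate at time m, with the observation at time 0
  entering through \<open>dn\<close>; see \<open>r_square\<close>.\<close>

definition R :: "'e prob_meas \<Rightarrow> nat \<Rightarrow> real" where
  "R \<mu> m = (\<integral>y. Im m (dn (meas_of \<mu>) y) \<partial>\<phi>)"

lemma nn_integral_Im_dn:
  shows "(\<integral>\<^sup>+y. \<integral>\<^sup>+s. ennreal (rt (Uf m (dn (meas_of \<mu>) y) s) (U1 m (dn (meas_of \<mu>) y) s)) \<partial>S \<partial>\<phi>) = ennreal (R \<mu> m)"
    and "integrable \<phi> (\<lambda>y. Im m (dn (meas_of \<mu>) y))"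
proof -
  note f = fmeas_meas_of[of \<mu>]
  have [measurable]: "(\<lambda>w. U m h (dn (meas_of \<mu>) (fst w)) (snd w)) \<in> borel_measurable (borel \<Otimes>\<^sub>M S)"
    if [measurable]: "h \<in> borel_measurable borel" for h
  proof -
    have "U m h (dn (meas_of \<mu>) y) s = (\<integral>\<^sup>+x. ennreal (\<Upsilon> x y) * u m h x s \<partial>meas_of \<mu>)" for y s
      unfolding U_def by (rule nn_integral_dn[OF f]) measurable
    then show ?thesis by (simp add: nn_integral_fmeas_measurable[OF f])
  qed
  have m0: "(\<lambda>y. \<integral>s. rt (Uf m (dn (meas_of \<mu>) y) s) (U1 m (dn (meas_of \<mu>) y) s) \<partial>S) \<in> borel_measurable borel"
    by (rule sigma_finite_measure.borel_measurable_lebesgue_integral[OF sf_S]) (simp add: split_beta')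
  then have m1[measurable]: "(\<lambda>y. Im m (dn (meas_of \<mu>) y)) \<in> borel_measurable \<phi>"
    unfolding Im_def by (simp cong: measurable_cong_sets)
  have le: "AE y in \<phi>. ennreal (Im m (dn (meas_of \<mu>) y)) \<le> Zn (meas_of \<mu>) y"
    using AE_Zn_finite[OF f]
  proof eventually_elim
    case (elim y)
    note fd = fmeas_dn[OF f elim]
    have "ennreal (Im m (dn (meas_of \<mu>) y)) \<le> ennreal (measure (dn (meas_of \<mu>) y) UNIV)"
      by (intro ennreal_leI Im_le fd)
    also have "\<dots> = Zn (meas_of \<mu>) y"
      using finite_measure.emeasure_eq_measure[OF fmeasD(1)[OF fd], of UNIV] emeasure_dn[OF f] by simp
    finally show ?case .
  qed
  have "(\<integral>\<^sup>+y. ennreal (Im m (dn (meas_of \<mu>) y)) \<partial>\<phi>) \<le> (\<integral>\<^sup>+y. Zn (meas_of \<mu>) y \<partial>\<phi>)"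
    using le by (rule nn_integral_mono_AE)
  also have "\<dots> = 1" using Zn_phi[OF f] measure_meas_of_UNIV by simp
  finally show i: "integrable \<phi> (\<lambda>y. Im m (dn (meas_of \<mu>) y))"
    using Im_nonneg by (intro integrableI_nonneg) (auto intro: order.strict_trans1)
  have "(\<integral>\<^sup>+y. \<integral>\<^sup>+s. ennreal (rt (Uf m (dn (meas_of \<mu>) y) s) (U1 m (dn (meas_of \<mu>) y) s)) \<partial>S \<partial>\<phi>) = (\<integral>\<^sup>+y. ennreal (Im m (dn (meas_of \<mu>) y)) \<partial>\<phi>)"
    using AE_Zn_finite[OF f] by (intro nn_integral_cong_AE) (auto elim!: eventually_mono simp: ennreal_Im fmeas_dn f)
  also have "\<dots> = ennreal (R \<mu> m)"
    unfolding R_def by (rule nn_integral_eq_integral[OF i]) (simp add: Im_nonneg)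
  finally show "(\<integral>\<^sup>+y. \<integral>\<^sup>+s. ennreal (rt (Uf m (dn (meas_of \<mu>) y) s) (U1 m (dn (meas_of \<mu>) y) s)) \<partial>S \<partial>\<phi>) = ennreal (R \<mu> m)" .
qed

lemma R_nonneg: "0 \<le> R \<mu> m"
  unfolding R_def by (intro integral_nonneg_AE) (simp add: Im_nonneg)

text \<open>Under its own initial law the filter estimate is q = a/b, so both moments equal the
  integral of a^2/b and the result is R - 2R.\<close>

lemma integral_Fp_init: "(\<integral>z. Fp m z \<partial>meas_of (filter_init \<Upsilon> \<phi> \<mu>)) = - R \<mu> m"
proof -
  note f = fmeas_meas_of[of \<mu>]
  note p = prob_update_law[OF prob_meas_D(1,2), of \<mu> \<mu>]
  have e: "meas_of (filter_init \<Upsilon> \<phi> \<mu>) = update_law \<Upsilon> \<phi> (meas_of \<mu>) \<mu>"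
    unfolding filter_init_def by (rule meas_of_prob_meas_of[OF p])
  have *: "(\<integral>\<^sup>+z. W m g k (fst z) (meas_of (snd z)) \<partial>update_law \<Upsilon> \<phi> (meas_of \<mu>) \<mu>) = ennreal (R \<mu> m)"
    if g: "(g = (\<lambda>_. 1) \<and> k = 2) \<or> (g = f \<and> k = 1)" for g k
  proof -
    have "g \<in> borel_measurable borel" using g by auto
    then have "(\<integral>\<^sup>+z. W m g k (fst z) (meas_of (snd z)) \<partial>update_law \<Upsilon> \<phi> (meas_of \<mu>) \<mu>) =
       (\<integral>\<^sup>+y. \<integral>\<^sup>+s. U m g (dn (meas_of \<mu>) y) s * ennreal ((q m (dn (meas_of \<mu>) y) s) ^ k) \<partial>S \<partial>\<phi>)"
      by (rule W_update_law[OF prob_meas_D(1,2)])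
    also have "\<dots> = (\<integral>\<^sup>+y. \<integral>\<^sup>+s. ennreal (rt (Uf m (dn (meas_of \<mu>) y) s) (U1 m (dn (meas_of \<mu>) y) s)) \<partial>S \<partial>\<phi>)"
    proof (rule nn_integral_cong_AE, use AE_Zn_finite[OF f] in eventually_elim)
      case (elim y)
      note fd = fmeas_dn[OF f elim]
      show ?case
      proof (rule nn_integral_cong_AE, use AE_Uf_U1[OF fd, of m] in eventually_elim)
        case (elim s)
        define a b where "a = enn2real (Uf m (dn (meas_of \<mu>) y) s)" and "b = enn2real (U1 m (dn (meas_of \<mu>) y) s)"
        have ab: "0 \<le> a" "a \<le> b" "Uf m (dn (meas_of \<mu>) y) s = ennreal a" "U1 m (dn (meas_of \<mu>) y) s = ennreal b"
          using elim by (auto simp: a_def b_def)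
        have "b * (a / b)\<^sup>2 = sqr a b" "a * (a / b) = sqr a b"
          using ab(1,2) by (cases "b = 0"; simp add: sqr_def power2_eq_square)+
        then show ?case using g ab(1,2) unfolding q_def a_def[symmetric] b_def[symmetric] ab(3,4)
          by (auto simp: ab(3,4) simp flip: ennreal_mult)
      qed
    qed
    also have "\<dots> = ennreal (R \<mu> m)" by (rule nn_integral_Im_dn)
    finally show ?thesis .
  qed
  show ?thesis
    unfolding e by (subst integral_Fp[OF p]) (auto simp: * R_nonneg simp del: power_one_right)
qed

end

text \<open>\<open>Im_tendsto\<close> averaged over the observation at time 0: the limits are
  proportional to the masses \<open>Zn\<close>, which integrate to 1.\<close>

lemma (in filter_ergodic) R_tendsto: "(\<lambda>m. R \<mu> m) \<longlonglongrightarrow> c_lim"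
proof -
  note f = fmeas_meas_of[of \<mu>]
  have AEf: "AE y in \<phi>. fmeas (dn (meas_of \<mu>) y)"
    using AE_Zn_finite[OF f] by eventually_elim (rule fmeas_dn[OF f])
  have mz: "AE y in \<phi>. measure (dn (meas_of \<mu>) y) UNIV = enn2real (Zn (meas_of \<mu>) y)"
    by (simp add: measure_def emeasure_dn f)
  have Zm[measurable]: "Zn (meas_of \<mu>) \<in> borel_measurable \<phi>" using Zn_measurable[OF f] by (simp cong: measurable_cong_sets)
  have Zr: "(\<integral>\<^sup>+y. ennreal (enn2real (Zn (meas_of \<mu>) y)) \<partial>\<phi>) = 1"
    using Zn_phi[OF f] measure_meas_of_UNIV(2)[of \<mu>] AE_Zn_finite[OF f]
    by (subst nn_integral_cong_AE[of _ "Zn (meas_of \<mu>)"]) (auto elim!: eventually_mono)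
  have Zi: "integrable \<phi> (\<lambda>y. enn2real (Zn (meas_of \<mu>) y))"
    using Zr by (intro integrableI_nonneg) auto
  have Z1: "(\<integral>y. enn2real (Zn (meas_of \<mu>) y) \<partial>\<phi>) = 1"
    using Zr by (subst integral_eq_nn_integral) auto
  have "(\<lambda>m. \<integral>y. Im m (dn (meas_of \<mu>) y) \<partial>\<phi>) \<longlonglongrightarrow> (\<integral>y. c_lim * enn2real (Zn (meas_of \<mu>) y) \<partial>\<phi>)"
  proof (rule integral_dominated_convergence[where w="\<lambda>y. enn2real (Zn (meas_of \<mu>) y)"])
    show "AE y in \<phi>. (\<lambda>m. Im m (dn (meas_of \<mu>) y)) \<longlonglongrightarrow> c_lim * enn2real (Zn (meas_of \<mu>) y)"
      using AEf mz by eventually_elim (metis Im_tendsto)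
    show "AE y in \<phi>. norm (Im m (dn (meas_of \<mu>) y)) \<le> enn2real (Zn (meas_of \<mu>) y)" for m
      using AEf mz by eventually_elim (metis Im_le Im_nonneg abs_of_nonneg real_norm_def)
  qed (use Zi nn_integral_Im_dn(2) in auto)
  then show ?thesis using Z1 by (simp add: R_def)
qed

primrec iter :: "('z \<Rightarrow> 'z measure) \<Rightarrow> ('z \<Rightarrow> real) \<Rightarrow> nat \<Rightarrow> 'z \<Rightarrow> real" where
  "iter K h 0 = h"
| "iter K h (Suc m) = (\<lambda>z. \<integral>z'. iter K h m z' \<partial>K z)"

lemma iter_measurable_bounded:
  fixes K :: "'z::topological_space \<Rightarrow> 'z measure"
  assumes K: "K \<in> borel \<rightarrow>\<^sub>M prob_algebra borel" and h: "h \<in> borel_measurable borel" "\<And>z. \<bar>h z\<bar> \<le> C"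
  shows "iter K h m \<in> borel_measurable borel" "\<bar>iter K h m z\<bar> \<le> C"
proof (induction m arbitrary: z)
  case (Suc m)
  note [measurable] = measurable_prob_algebraD[OF K]
  {
    case 1
    show ?case
      unfolding iter.simps
      by (rule measurable_compose[OF measurable_prob_algebraD[OF K] integral_measurable_subprob_algebra[OF Suc(1)]])
  next
    case 2
    have p: "prob_space (K z)" "sets (K z) = sets borel"
      using measurable_space[OF K, of z] by (auto simp: space_prob_algebra)
    interpret prob_space "K z" by (rule p)
    have m: "iter K h m \<in> borel_measurable (K z)" using Suc(1) p(2) by (simp cong: measurable_cong_sets)
    have i: "integrable (K z) (iter K h m)" using m Suc(2) by (intro integrable_const_bound[where B=C]) auto
    have "\<bar>\<integral>z'. iter K h m z' \<partial>K z\<bar> \<le> (\<integral>z'. \<bar>iter K h m z'\<bar> \<partial>K z)" by (rule integral_abs_bound)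
    also have "\<dots> \<le> (\<integral>z'. C \<partial>K z)" using i Suc(2) by (intro integral_mono) auto
    finally show ?case using prob_space by simp
  }
qed (use h in auto)

locale filter_real_test = filter_test P \<phi> \<Upsilon> "\<lambda>x. ennreal (fr x)"
  for P :: "'e::polish_space \<Rightarrow> 'e measure" and \<phi> :: "'f::polish_space measure"
    and \<Upsilon> :: "'e \<Rightarrow> 'f \<Rightarrow> real" and fr :: "'e \<Rightarrow> real" +
  assumes fr_cont: "continuous_on UNIV fr" and fr_bounds: "\<And>x. 0 \<le> fr x" "\<And>x. fr x \<le> 1"
begin

lemma fr_measurable[measurable]: "fr \<in> borel_measurable borel"
  using fr_cont by (rule borel_measurable_continuous_onI)

lemma Fp_0: "Fp 0 z = (\<integral>x. fr x \<partial>meas_of (snd z))\<^sup>2 - 2 * fr (fst z) * (\<integral>x. fr x \<partial>meas_of (snd z))"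
proof -
  have "enn2real (\<integral>\<^sup>+x. ennreal (fr x) \<partial>meas_of \<nu>) = (\<integral>x. fr x \<partial>meas_of \<nu>)" for \<nu>
    using fr_bounds by (subst integral_eq_nn_integral) (auto simp: measurable_fmeas[OF fmeas_meas_of])
  then have "q 0 (meas_of \<nu>) s = (\<integral>x. fr x \<partial>meas_of \<nu>)" for \<nu> s
    by (simp add: q_def U_def prob_meas_D measure_meas_of_UNIV(2))
  then show ?thesis
    using prob_space.prob_space[OF prob_S] by (simp add: Fp_def Fm_def fr_bounds)
qed

lemma Fp_0_continuous: "continuous_on UNIV (Fp 0)"
proof -
  have 1: "continuous_on UNIV (\<lambda>z :: 'e \<times> 'e prob_meas. \<integral>x. fr x \<partial>meas_of (snd z))"
    using fr_bounds by (intro continuous_on_compose2[OF continuous_integral[OF fr_cont, where B=1]] continuous_on_snd continuous_on_id) auto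
  have 2: "continuous_on UNIV (\<lambda>z :: 'e \<times> 'e prob_meas. fr (fst z))"
    by (intro continuous_on_compose2[OF fr_cont] continuous_on_fst continuous_on_id) auto
  show ?thesis unfolding Fp_0[abs_def] by (intro continuous_intros 1 2)
qed

text \<open>Continuity is established for \<open>Fp 0\<close> alone; the later \<open>Fp m\<close>
  arise as limits under continuous convergence. This suffices for the induction, in which
  \<open>extended_continuous_mapping\<close> is used with the laws
  \<open>K n (zs n)\<close>.\<close>

lemma iterates_continuous_convergence:
  assumes K: "\<And>n. K n \<in> borel \<rightarrow>\<^sub>M prob_algebra borel"
    and one_step: "\<And>(F :: 'e \<times> 'e prob_meas \<Rightarrow> real) zs z. continuous_on UNIV F \<Longrightarrow> bounded (range F) \<Longrightarrow> zs \<longlonglongrightarrow> z \<Longrightarrow>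
       (\<lambda>n. \<integral>w. F w \<partial>K n (zs n)) \<longlonglongrightarrow> (\<integral>w. F w \<partial>filter_kernel \<Upsilon> \<phi> P z)"
  shows "zs \<longlonglongrightarrow> z \<Longrightarrow> (\<lambda>n. iter (K n) (Fp 0) m (zs n)) \<longlonglongrightarrow> Fp m z"
proof (induction m arbitrary: zs z)
  case 0
  have "isCont (Fp 0) z" using Fp_0_continuous unfolding continuous_on_eq_continuous_at[OF open_UNIV] by blast
  then show ?case using isCont_tendsto_compose[OF _ 0] by simp
next
  case (Suc m)
  obtain x \<nu> where z: "z = (x, \<nu>)" by (cases z)
  have k: "prob_space (filter_kernel \<Upsilon> \<phi> P z)" "sets (filter_kernel \<Upsilon> \<phi> P z) = sets borel"
    unfolding filter_kernel_def z using prob_update_law[OF P_prob(1,2), of x "kernel_step P \<nu>"] by auto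
  have Kp: "prob_space (K n w)" "sets (K n w) = sets borel" for n w
    using measurable_space[OF K, of w n] by (auto simp: space_prob_algebra)
  have "(\<lambda>n. \<integral>w. iter (K n) (Fp 0) m w \<partial>K n (zs n)) \<longlonglongrightarrow> (\<integral>w. Fp m w \<partial>filter_kernel \<Upsilon> \<phi> P z)"
  proof (rule extended_continuous_mapping[OF approx_open_pair Kp k])
    show "wconv (\<lambda>n. K n (zs n)) (filter_kernel \<Upsilon> \<phi> P z)"
      unfolding wconv_def using one_step Suc.prems by blast
    show "iter (K n) (Fp 0) m \<in> borel_measurable borel" "\<bar>iter (K n) (Fp 0) m w\<bar> \<le> 2" for n w
      using iter_measurable_bounded[OF K Fp_measurable Fp_bounded] by auto
  qed (use Fp_bounded Suc.IH in auto)
  then show ?case by (simp add: z Fp_Suc)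
qed

end

section \<open>Conditional laws in the hidden Markov model\<close>

lemma space_sigma_gen: "space (sigma_gen \<Omega> Z I) = space \<Omega>"
  unfolding sigma_gen_def by (rule space_measure_of) auto

lemma sets_sigma_gen:
  "sets (sigma_gen \<Omega> Z I) = sigma_sets (space \<Omega>) (\<Union>i\<in>I. {Z i -` A \<inter> space \<Omega> | A. A \<in> sets borel})"
  unfolding sigma_gen_def by (rule sets_measure_of) auto

lemma measurable_sigma_gen: "i \<in> I \<Longrightarrow> Z i \<in> borel_measurable (sigma_gen \<Omega> Z I)"
  unfolding measurable_def space_sigma_gen sets_sigma_gen by (auto intro: sigma_sets.Basic)

lemma sets_sigma_gen_subset:
  assumes "\<And>i. i \<in> I \<Longrightarrow> Z i \<in> borel_measurable M" "space M = space \<Omega>"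
  shows "sets (sigma_gen \<Omega> Z I) \<subseteq> sets M"
  unfolding sets_sigma_gen assms(2)[symmetric]
  using assms(1) by (intro sets.sigma_sets_subset) (auto dest: measurable_sets)

lemma subalgebra_sigma_gen: "(\<And>i. Z i \<in> borel_measurable \<Omega>) \<Longrightarrow> subalgebra \<Omega> (sigma_gen \<Omega> Z I)"
  unfolding subalgebra_def space_sigma_gen using sets_sigma_gen_subset[of I Z \<Omega> \<Omega>] by auto

lemma measurable_mono_sets:
  "f \<in> M \<rightarrow>\<^sub>M N \<Longrightarrow> sets M \<subseteq> sets M' \<Longrightarrow> space M' = space M \<Longrightarrow> f \<in> M' \<rightarrow>\<^sub>M N"
  by (auto simp: measurable_def)

text \<open>Tests a conditional probability against W and replaces it by an explicit version V that
  lies in [0, 1] everywhere.\<close>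

lemma integral_times_cprob:
  assumes "prob_space \<Omega>" "subalgebra \<Omega> \<F>" "B \<in> sets \<Omega>"
    and W: "W \<in> borel_measurable \<F>" "\<And>w. 0 \<le> W w" "\<And>w. W w \<le> (1::real)"
    and AE: "AE w in \<Omega>. cprob \<Omega> \<F> B w = V w" and V: "V \<in> borel_measurable \<Omega>" "\<And>w. 0 \<le> V w" "\<And>w. V w \<le> 1"
  shows "(\<integral>\<^sup>+w. ennreal (W w) * indicator B w \<partial>\<Omega>) = (\<integral>\<^sup>+w. ennreal (W w) * ennreal (V w) \<partial>\<Omega>)"
proof -
  interpret prob_space \<Omega> by fact
  interpret finite_measure_subalgebra \<Omega> \<F> by unfold_locales fact
  have [measurable]: "W \<in> borel_measurable \<Omega>" by (rule measurable_from_subalg[OF assms(2) W(1)])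
  note [measurable] = V(1) assms(3)
  have i1: "integrable \<Omega> (\<lambda>w. W w * indicator B w)"
    using W by (intro integrable_const_bound[where B=1]) (auto split: split_indicator)
  have i2: "integrable \<Omega> (\<lambda>w. W w * V w)"
    using W V by (intro integrable_const_bound[where B=1] AE_I2) (auto intro!: mult_le_one)
  have "(\<integral>w. W w * V w \<partial>\<Omega>) = (\<integral>w. W w * cprob \<Omega> \<F> B w \<partial>\<Omega>)"
    using AE by (intro integral_cong_AE) (auto simp: cprob_def)
  also have "\<dots> = (\<integral>w. W w * indicator B w \<partial>\<Omega>)"
    unfolding cprob_def by (rule real_cond_exp_intg(2)[OF i1 W(1)]) auto
  finally have "ennreal (\<integral>w. W w * V w \<partial>\<Omega>) = ennreal (\<integral>w. W w * indicator B w \<partial>\<Omega>)" by simp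
  moreover have "ennreal (\<integral>w. W w * V w \<partial>\<Omega>) = (\<integral>\<^sup>+w. ennreal (W w) * ennreal (V w) \<partial>\<Omega>)"
    using i2 W V by (subst nn_integral_eq_integral[symmetric]) (auto simp: ennreal_mult)
  moreover have "ennreal (\<integral>w. W w * indicator B w \<partial>\<Omega>) = (\<integral>\<^sup>+w. ennreal (W w) * indicator B w \<partial>\<Omega>)"
    using i1 W by (subst nn_integral_eq_integral[symmetric]) (auto simp: ennreal_mult ennreal_indicator)
  ultimately show ?thesis by simp
qed

text \<open>The Markov property is given for events. Read as an equality of two measures, the
  W-weighted law of Z (k + 1) and the kernel applied to that of Z k, it covers every nonnegative h
  at once.\<close>

lemma markov_chain_step:
  fixes Z :: "nat \<Rightarrow> 'o \<Rightarrow> 'z::topological_space"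
  assumes \<Omega>: "prob_space \<Omega>" and mc: "markov_chain \<Omega> \<mu> K Z" and K: "K \<in> borel \<rightarrow>\<^sub>M prob_algebra borel"
    and W: "W \<in> borel_measurable (sigma_gen \<Omega> Z {..k})" "\<And>w. 0 \<le> W w" "\<And>w. W w \<le> (1::real)"
    and h: "h \<in> borel_measurable borel"
  shows "(\<integral>\<^sup>+w. ennreal (W w) * h (Z (Suc k) w) \<partial>\<Omega>) = (\<integral>\<^sup>+w. ennreal (W w) * (\<integral>\<^sup>+z. h z \<partial>K (Z k w)) \<partial>\<Omega>)"
proof -
  interpret prob_space \<Omega> by fact
  have Z[measurable]: "\<And>i. Z i \<in> borel_measurable \<Omega>" using mc by (simp add: markov_chain_def)
  have sub: "subalgebra \<Omega> (sigma_gen \<Omega> Z {..k})" by (rule subalgebra_sigma_gen[OF Z])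
  have [measurable]: "W \<in> borel_measurable \<Omega>" by (rule measurable_from_subalg[OF sub W(1)])
  note Ks[measurable] = measurable_prob_algebraD[OF K] and [measurable] = h
  have Kp: "prob_space (K z)" "sets (K z) = sets borel" for z
    using measurable_space[OF K, of z] by (auto simp: space_prob_algebra)
  let ?D = "density \<Omega> (\<lambda>w. ennreal (W w))"
  let ?N1 = "distr ?D borel (Z (Suc k))" and ?Nk = "distr ?D borel (Z k)"
  have "?N1 = ?Nk \<bind> K"
  proof (rule measure_eqI)
    have sb: "sets (?Nk \<bind> K) = sets borel" by (rule sets_bind) (auto simp: Kp)
    then show "sets ?N1 = sets (?Nk \<bind> K)" by simp
    fix A assume "A \<in> sets ?N1"
    then have A[measurable]: "A \<in> sets borel" by simp
    have B: "{w\<in>space \<Omega>. Z (Suc k) w \<in> A} \<in> sets \<Omega>" by measurable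
    have Vm: "(\<lambda>w. measure (K (Z k w)) A) \<in> borel_measurable \<Omega>"
      by (rule measurable_compose[OF Z]) (rule measure_measurable_prob_algebra2[where N=borel], measurable, rule K)
    have "emeasure ?N1 A = (\<integral>\<^sup>+w. ennreal (W w) * indicator {w\<in>space \<Omega>. Z (Suc k) w \<in> A} w \<partial>\<Omega>)"
      by (subst emeasure_distr, simp, simp, subst emeasure_density) (auto intro!: nn_integral_cong split: split_indicator)
    also have "\<dots> = (\<integral>\<^sup>+w. ennreal (W w) * ennreal (measure (K (Z k w)) A) \<partial>\<Omega>)"
      using mc A Vm unfolding markov_chain_def
      by (intro integral_times_cprob[OF \<Omega> sub B W]) (auto simp: prob_space.prob_le_1[OF Kp(1)])
    also have "\<dots> = (\<integral>\<^sup>+w. ennreal (W w) * emeasure (K (Z k w)) A \<partial>\<Omega>)"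
      by (simp add: finite_measure.emeasure_eq_measure[OF prob_space.finite_measure[OF Kp(1)]])
    also have "\<dots> = (\<integral>\<^sup>+z. emeasure (K z) A \<partial>?Nk)"
      by (subst nn_integral_distr, simp, measurable, subst nn_integral_density) auto
    also have "\<dots> = emeasure (?Nk \<bind> K) A"
      by (rule emeasure_bind[symmetric, where N=borel]) auto
    finally show "emeasure ?N1 A = emeasure (?Nk \<bind> K) A" .
  qed
  then have "(\<integral>\<^sup>+z. h z \<partial>?N1) = (\<integral>\<^sup>+z. h z \<partial>(?Nk \<bind> K))" by simp
  also have "\<dots> = (\<integral>\<^sup>+z. (\<integral>\<^sup>+z'. h z' \<partial>K z) \<partial>?Nk)" by (rule nn_integral_bind[where B=borel]) auto
  also have "\<dots> = (\<integral>\<^sup>+w. ennreal (W w) * (\<integral>\<^sup>+z. h z \<partial>K (Z k w)) \<partial>\<Omega>)"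
    by (subst nn_integral_distr, simp, measurable, subst nn_integral_density) auto
  also have "(\<integral>\<^sup>+z. h z \<partial>?N1) = (\<integral>\<^sup>+w. ennreal (W w) * h (Z (Suc k) w) \<partial>\<Omega>)"
    by (subst nn_integral_distr, simp, simp, subst nn_integral_density) auto
  finally show ?thesis .
qed

lemma markov_chain_distr:
  fixes Z :: "nat \<Rightarrow> 'o \<Rightarrow> 'z::topological_space"
  assumes \<Omega>: "prob_space \<Omega>" and mc: "markov_chain \<Omega> \<mu> K Z" and K: "K \<in> borel \<rightarrow>\<^sub>M prob_algebra borel"
  shows "distr \<Omega> borel (Z (Suc k)) = distr \<Omega> borel (Z k) \<bind> K"
proof (rule measure_eqI)
  have Z[measurable]: "\<And>i. Z i \<in> borel_measurable \<Omega>" using mc by (simp add: markov_chain_def)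
  note [measurable] = measurable_prob_algebraD[OF K]
  have Ks: "sets (K z) = sets borel" for z
    using measurable_space[OF K, of z] by (auto simp: space_prob_algebra)
  interpret prob_space \<Omega> by fact
  have sb: "sets (distr \<Omega> borel (Z k) \<bind> K) = sets borel" by (rule sets_bind) (auto simp: Ks not_empty)
  then show "sets (distr \<Omega> borel (Z (Suc k))) = sets (distr \<Omega> borel (Z k) \<bind> K)" by simp
  fix A assume "A \<in> sets (distr \<Omega> borel (Z (Suc k)))"
  then have A[measurable]: "A \<in> sets borel" by simp
  have "emeasure (distr \<Omega> borel (Z (Suc k))) A = (\<integral>\<^sup>+x. indicator A x \<partial>distr \<Omega> borel (Z (Suc k)))" by simp
  also have "\<dots> = (\<integral>\<^sup>+w. ennreal 1 * indicator A (Z (Suc k) w) \<partial>\<Omega>)" by (subst nn_integral_distr) auto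
  also have "\<dots> = (\<integral>\<^sup>+w. ennreal 1 * (\<integral>\<^sup>+x. indicator A x \<partial>K (Z k w)) \<partial>\<Omega>)"
    by (rule markov_chain_step[OF \<Omega> mc K]) auto
  also have "\<dots> = (\<integral>\<^sup>+z. emeasure (K z) A \<partial>distr \<Omega> borel (Z k))" by (subst nn_integral_distr) (auto simp: Ks)
  also have "\<dots> = emeasure (distr \<Omega> borel (Z k) \<bind> K) A"
    by (rule emeasure_bind[symmetric, where N=borel]) (auto simp: not_empty)
  finally show "emeasure (distr \<Omega> borel (Z (Suc k))) A = emeasure (distr \<Omega> borel (Z k) \<bind> K) A" .
qed

lemma markov_chain_iter:
  fixes Z :: "nat \<Rightarrow> 'o \<Rightarrow> 'z::topological_space"
  assumes \<Omega>: "prob_space \<Omega>" and mc: "markov_chain \<Omega> \<mu> K Z" and K: "K \<in> borel \<rightarrow>\<^sub>M prob_algebra borel"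
    and h: "h \<in> borel_measurable borel" "\<And>z. \<bar>h z\<bar> \<le> C"
  shows "(\<integral>w. h (Z (k + m) w) \<partial>\<Omega>) = (\<integral>w. iter K h m (Z k w) \<partial>\<Omega>)"
proof -
  interpret prob_space \<Omega> by fact
  have Z[measurable]: "\<And>i. Z i \<in> borel_measurable \<Omega>" using mc by (simp add: markov_chain_def)
  have Kp: "prob_space (K z)" for z using measurable_space[OF K, of z] by (auto simp: space_prob_algebra)
  note im = iter_measurable_bounded[OF K h]
  have step: "(\<integral>w. g (Z (Suc k) w) \<partial>\<Omega>) = (\<integral>w. (\<integral>z. g z \<partial>K (Z k w)) \<partial>\<Omega>)"
    if g: "g \<in> borel_measurable borel" "\<And>z. \<bar>g z\<bar> \<le> C" for g k
  proof -
    interpret D: prob_space "distr \<Omega> borel (Z k)" by (rule prob_space_distr[OF Z])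
    have Ki: "(\<lambda>z. \<integral>z'. g z' \<partial>K z) \<in> borel_measurable borel"
      by (rule measurable_compose[OF measurable_prob_algebraD[OF K] integral_measurable_subprob_algebra[OF g(1)]])
    have "(\<integral>w. g (Z (Suc k) w) \<partial>\<Omega>) = (\<integral>z. g z \<partial>(distr \<Omega> borel (Z k) \<bind> K))"
      unfolding markov_chain_distr[OF \<Omega> mc K, symmetric] by (rule integral_distr[symmetric, OF Z g(1)])
    also have "\<dots> = (\<integral>z. (\<integral>z'. g z' \<partial>K z) \<partial>distr \<Omega> borel (Z k))"
      using g measurable_prob_algebraD[OF K]
      by (intro integral_bind[where K=borel and B=C and B'=1]) (auto simp: D.emeasure_space_1 D.finite_measure_axioms prob_space.emeasure_space_1[OF Kp])
    finally show ?thesis by (simp add: integral_distr[OF Z Ki])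
  qed
  show ?thesis
  proof (induction m arbitrary: k)
    case (Suc m)
    show ?case
      using Suc[of "Suc k"] step[OF im(1)[of m] im(2)[of m], of k] by simp
  qed simp
qed

section \<open>Joint law of signal and observations, compared with the reference law\<close>

locale hmm_model = filter_model P \<phi> \<Upsilon>
  for P :: "'e::polish_space \<Rightarrow> 'e measure" and \<phi> :: "'f::polish_space measure" and \<Upsilon> :: "'e \<Rightarrow> 'f \<Rightarrow> real" +
  fixes \<Omega> :: "'o measure" and X :: "nat \<Rightarrow> 'o \<Rightarrow> 'e" and Y :: "nat \<Rightarrow> 'o \<Rightarrow> 'f" and \<mu> :: "'e prob_meas"
    and \<Phi> :: "'e \<Rightarrow> 'f measure"
  assumes prob_Omega: "prob_space \<Omega>"
    and hmm: "hidden_markov_model \<Omega> \<mu> P \<Phi> X Y"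
    and Phi_kernel: "\<Phi> \<in> borel \<rightarrow>\<^sub>M prob_algebra borel"
    and Phi_density: "\<And>x A. A \<in> sets borel \<Longrightarrow> emeasure (\<Phi> x) A = (\<integral>\<^sup>+y\<in>A. ennreal (\<Upsilon> x y) \<partial>\<phi>)"
begin

lemma mcX: "markov_chain \<Omega> \<mu> P X"
  using hmm by (simp add: hidden_markov_model_def)

lemma X_meas[measurable]: "X k \<in> borel_measurable \<Omega>"
  using mcX by (simp add: markov_chain_def)

lemma Y_meas[measurable]: "Y k \<in> borel_measurable \<Omega>"
  using hmm by (simp add: hidden_markov_model_def)

lemma distr_X0: "distr \<Omega> borel (X 0) = meas_of \<mu>"
  using mcX by (simp add: markov_chain_def)

definition p\<Phi> :: "'f set \<Rightarrow> 'e \<Rightarrow> real" where "p\<Phi> A x = measure (\<Phi> x) A"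

lemma Phi_prob: "prob_space (\<Phi> x)" "sets (\<Phi> x) = sets borel"
  using measurable_space[OF Phi_kernel, of x] by (auto simp: space_prob_algebra)

lemma pPhi_bounds: "0 \<le> p\<Phi> A x" "p\<Phi> A x \<le> 1"
  unfolding p\<Phi>_def using prob_space.prob_le_1[OF Phi_prob(1)] by auto

lemma pPhi_measurable[measurable]:
  assumes [measurable]: "A \<in> sets borel" shows "p\<Phi> A \<in> borel_measurable borel"
  unfolding p\<Phi>_def[abs_def] by (rule measure_measurable_prob_algebra2[OF _ Phi_kernel]) measurable

lemma ennreal_pPhi: "A \<in> sets borel \<Longrightarrow> ennreal (p\<Phi> A x) = (\<integral>\<^sup>+y. indicator A y * ennreal (\<Upsilon> x y) \<partial>\<phi>)"
  unfolding p\<Phi>_def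
  by (subst finite_measure.emeasure_eq_measure[OF prob_space.finite_measure[OF Phi_prob(1)], symmetric])
     (simp add: Phi_density mult.commute)

text \<open>For the chain started at x: the expectation of h(X_k) on the event that the observations
  at times 1 to k lie in A 0, ..., A (k - 1). It is the meeting point of \<open>X_side\<close> and
  \<open>S_side\<close>.\<close>

primrec b :: "nat \<Rightarrow> (nat \<Rightarrow> 'f set) \<Rightarrow> ('e \<Rightarrow> ennreal) \<Rightarrow> 'e \<Rightarrow> ennreal" where
  "b 0 A h = h"
| "b (Suc k) A h = (\<lambda>x. \<integral>\<^sup>+x'. ennreal (p\<Phi> (A 0) x') * b k (\<lambda>i. A (Suc i)) h x' \<partial>P x)"

lemma b_measurable[measurable]:
  "h \<in> borel_measurable borel \<Longrightarrow> (\<And>i. A i \<in> sets borel) \<Longrightarrow> b k A h \<in> borel_measurable borel"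
  by (induction k arbitrary: A) simp_all

text \<open>W carries the past: absorbing the factor at time j + 1 into W leaves the same statement
  with j + 1 and one factor less.\<close>

lemma X_side:
  assumes h: "h \<in> borel_measurable borel"
  shows "W \<in> borel_measurable (sigma_gen \<Omega> X {..j}) \<Longrightarrow> (\<And>w. 0 \<le> W w) \<Longrightarrow> (\<And>w. W w \<le> (1::real)) \<Longrightarrow>
    (\<And>i. A i \<in> sets borel) \<Longrightarrow>
    (\<integral>\<^sup>+w. ennreal (W w) * ((\<Prod>i<k. ennreal (p\<Phi> (A i) (X (Suc (j + i)) w))) * h (X (j + k) w)) \<partial>\<Omega>) =
    (\<integral>\<^sup>+w. ennreal (W w) * b k A h (X j w) \<partial>\<Omega>)"
proof (induction k arbitrary: j W A)
  case (Suc k)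
  note [measurable] = h Suc.prems(4)
  let ?W = "\<lambda>w. W w * p\<Phi> (A 0) (X (Suc j) w)"
  have sub: "sets (sigma_gen \<Omega> X {..j}) \<subseteq> sets (sigma_gen \<Omega> X {..Suc j})"
    by (intro sets_sigma_gen_subset measurable_sigma_gen) (auto simp: space_sigma_gen)
  have Wm: "W \<in> borel_measurable (sigma_gen \<Omega> X {..Suc j})"
    by (rule measurable_mono_sets[OF Suc.prems(1) sub]) (simp add: space_sigma_gen)
  have Xm: "X (Suc j) \<in> borel_measurable (sigma_gen \<Omega> X {..Suc j})" by (rule measurable_sigma_gen) simp
  have "(\<integral>\<^sup>+w. ennreal (W w) * ((\<Prod>i<Suc k. ennreal (p\<Phi> (A i) (X (Suc (j + i)) w))) * h (X (j + Suc k) w)) \<partial>\<Omega>) =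
    (\<integral>\<^sup>+w. ennreal (?W w) * ((\<Prod>i<k. ennreal (p\<Phi> (A (Suc i)) (X (Suc (Suc j + i)) w))) * h (X (Suc j + k) w)) \<partial>\<Omega>)"
    using Suc.prems(2) pPhi_bounds(1)
    by (intro nn_integral_cong) (simp add: prod.lessThan_Suc_shift ennreal_mult mult.assoc del: prod.lessThan_Suc)
  also have "\<dots> = (\<integral>\<^sup>+w. ennreal (?W w) * b k (\<lambda>i. A (Suc i)) h (X (Suc j) w) \<partial>\<Omega>)"
  proof (rule Suc.IH)
    show "?W \<in> borel_measurable (sigma_gen \<Omega> X {..Suc j})" using Wm Xm by measurable
    show "?W w \<le> 1" for w using Suc.prems(2,3) pPhi_bounds by (intro mult_le_one) auto
  qed (use Suc.prems pPhi_bounds in auto)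
  also have "\<dots> = (\<integral>\<^sup>+w. ennreal (W w) * (ennreal (p\<Phi> (A 0) (X (Suc j) w)) * b k (\<lambda>i. A (Suc i)) h (X (Suc j) w)) \<partial>\<Omega>)"
    using Suc.prems(2) pPhi_bounds(1) by (intro nn_integral_cong) (simp add: ennreal_mult mult.assoc)
  also have "\<dots> = (\<integral>\<^sup>+w. ennreal (W w) * b (Suc k) A h (X j w) \<partial>\<Omega>)"
    by (subst markov_chain_step[OF prob_Omega mcX P_kernel Suc.prems(1-3), of "\<lambda>x. ennreal (p\<Phi> (A 0) x) * b k (\<lambda>i. A (Suc i)) h x"]) auto
  finally show ?case .
qed simp

text \<open>Given the whole signal the observations are independent with laws \<Phi>(X_i), and the
  weight is a function of the signal.\<close>

lemma Y_side:
  assumes hr: "hr \<in> borel_measurable borel" "\<And>x. 0 \<le> hr x" "\<And>x. hr x \<le> (1::real)" and A: "\<And>i. A i \<in> sets borel"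
  shows "(\<integral>\<^sup>+w. ennreal (hr (X k w)) * indicator {w\<in>space \<Omega>. \<forall>i\<in>{..k}. Y i w \<in> A i} w \<partial>\<Omega>) =
    (\<integral>\<^sup>+w. ennreal (hr (X k w)) * ennreal (\<Prod>i\<le>k. p\<Phi> (A i) (X i w)) \<partial>\<Omega>)"
proof (rule integral_times_cprob[OF prob_Omega, where \<F>="sigma_gen \<Omega> X UNIV"])
  note [measurable] = A hr(1)
  show "subalgebra \<Omega> (sigma_gen \<Omega> X UNIV)" by (rule subalgebra_sigma_gen) simp
  show "{w \<in> space \<Omega>. \<forall>i\<in>{..k}. Y i w \<in> A i} \<in> sets \<Omega>" by measurable
  have "X k \<in> borel_measurable (sigma_gen \<Omega> X UNIV)" by (rule measurable_sigma_gen) simp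
  then show "(\<lambda>w. hr (X k w)) \<in> borel_measurable (sigma_gen \<Omega> X UNIV)" by measurable
  have ind: "\<And>J A. finite J \<Longrightarrow> (\<forall>i\<in>J. A i \<in> sets borel) \<Longrightarrow> AE w in \<Omega>. cprob \<Omega> (sigma_gen \<Omega> X UNIV) {w \<in> space \<Omega>. \<forall>i\<in>J. Y i w \<in> A i} w
             = (\<Prod>i\<in>J. cprob \<Omega> (sigma_gen \<Omega> X UNIV) {w \<in> space \<Omega>. Y i w \<in> A i} w)"
    and one: "\<And>n A. A \<in> sets borel \<Longrightarrow> AE w in \<Omega>. cprob \<Omega> (sigma_gen \<Omega> X UNIV) {w \<in> space \<Omega>. Y n w \<in> A} w = measure (\<Phi> (X n w)) A"
    using hmm unfolding hidden_markov_model_def by blast+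
  have "AE w in \<Omega>. \<forall>i\<in>{..k}. cprob \<Omega> (sigma_gen \<Omega> X UNIV) {w \<in> space \<Omega>. Y i w \<in> A i} w = measure (\<Phi> (X i w)) (A i)"
    by (intro AE_finite_allI one A) simp
  moreover have "AE w in \<Omega>. cprob \<Omega> (sigma_gen \<Omega> X UNIV) {w \<in> space \<Omega>. \<forall>i\<in>{..k}. Y i w \<in> A i} w
             = (\<Prod>i\<in>{..k}. cprob \<Omega> (sigma_gen \<Omega> X UNIV) {w \<in> space \<Omega>. Y i w \<in> A i} w)"
    by (rule ind) (auto simp: A)
  ultimately show "AE w in \<Omega>. cprob \<Omega> (sigma_gen \<Omega> X UNIV) {w \<in> space \<Omega>. \<forall>i\<in>{..k}. Y i w \<in> A i} w = (\<Prod>i\<le>k. p\<Phi> (A i) (X i w))"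
    by eventually_elim (simp add: p\<Phi>_def)
  show "(\<lambda>w. \<Prod>i\<le>k. p\<Phi> (A i) (X i w)) \<in> borel_measurable \<Omega>" by measurable
  show "0 \<le> (\<Prod>i\<le>k. p\<Phi> (A i) (X i w))" "(\<Prod>i\<le>k. p\<Phi> (A i) (X i w)) \<le> 1" for w
    by (auto intro!: prod_nonneg prod_le_1 simp: pPhi_bounds)
qed (use hr in auto)

lemma XY_joint:
  assumes hr: "hr \<in> borel_measurable borel" "\<And>x. 0 \<le> hr x" "\<And>x. hr x \<le> (1::real)" and A: "\<And>i. A i \<in> sets borel"
  shows "(\<integral>\<^sup>+w. ennreal (hr (X k w)) * indicator {w\<in>space \<Omega>. \<forall>i\<in>{..k}. Y i w \<in> A i} w \<partial>\<Omega>) =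
    (\<integral>\<^sup>+x. ennreal (p\<Phi> (A 0) x) * b k (\<lambda>i. A (Suc i)) (\<lambda>x. ennreal (hr x)) x \<partial>meas_of \<mu>)"
proof -
  note [measurable] = A hr(1)
  have "(\<integral>\<^sup>+w. ennreal (hr (X k w)) * ennreal (\<Prod>i\<le>k. p\<Phi> (A i) (X i w)) \<partial>\<Omega>) =
    (\<integral>\<^sup>+w. ennreal (p\<Phi> (A 0) (X 0 w)) * ((\<Prod>i<k. ennreal (p\<Phi> (A (Suc i)) (X (Suc (0 + i)) w))) * ennreal (hr (X (0 + k) w))) \<partial>\<Omega>)"
  proof (rule nn_integral_cong)
    fix w
    have "ennreal (\<Prod>i\<le>k. p\<Phi> (A i) (X i w)) = (\<Prod>i\<le>k. ennreal (p\<Phi> (A i) (X i w)))"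
      by (rule prod_ennreal[symmetric]) (simp add: pPhi_bounds)
    also have "\<dots> = ennreal (p\<Phi> (A 0) (X 0 w)) * (\<Prod>i<k. ennreal (p\<Phi> (A (Suc i)) (X (Suc i) w)))"
      unfolding lessThan_Suc_atMost[symmetric] by (rule prod.lessThan_Suc_shift)
    finally show "ennreal (hr (X k w)) * ennreal (\<Prod>i\<le>k. p\<Phi> (A i) (X i w)) =
      ennreal (p\<Phi> (A 0) (X 0 w)) * ((\<Prod>i<k. ennreal (p\<Phi> (A (Suc i)) (X (Suc (0 + i)) w))) * ennreal (hr (X (0 + k) w)))"
      by (simp add: mult_ac)
  qed
  also have "\<dots> = (\<integral>\<^sup>+w. ennreal (p\<Phi> (A 0) (X 0 w)) * b k (\<lambda>i. A (Suc i)) (\<lambda>x. ennreal (hr x)) (X 0 w) \<partial>\<Omega>)"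
  proof (rule X_side)
    have "X 0 \<in> borel_measurable (sigma_gen \<Omega> X {..0})" by (rule measurable_sigma_gen) simp
    then show "(\<lambda>w. p\<Phi> (A 0) (X 0 w)) \<in> borel_measurable (sigma_gen \<Omega> X {..0})" by measurable
  qed (auto simp: pPhi_bounds)
  also have "\<dots> = (\<integral>\<^sup>+x. ennreal (p\<Phi> (A 0) x) * b k (\<lambda>i. A (Suc i)) (\<lambda>x. ennreal (hr x)) x \<partial>meas_of \<mu>)"
    unfolding distr_X0[symmetric] by (subst nn_integral_distr) auto
  finally show ?thesis unfolding Y_side[OF hr A] .
qed

text \<open>Under \<open>S\<close> the unnormalised filter satisfies the recursion of
  \<open>b\<close> that also governs the hidden Markov model. Comparing the two makes likelihoods
  densities of the true observations.\<close>

lemma S_side: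
  assumes h[measurable]: "h \<in> borel_measurable borel"
  shows "fmeas \<sigma> \<Longrightarrow> (\<And>i. A i \<in> sets borel) \<Longrightarrow>
    (\<integral>\<^sup>+s. (\<Prod>i<k. indicator (A i) (s !! i)) * U k h \<sigma> s \<partial>S) = (\<integral>\<^sup>+x. b k A h x \<partial>\<sigma>)"
proof (induction k arbitrary: \<sigma> A)
  case 0
  then show ?case using prob_space.emeasure_space_1[OF prob_S] by (simp add: U_def)
next
  case (Suc k)
  note [measurable] = Suc.prems(2)
  note \<sigma> = Suc.prems(1)
  note p = fmeas_push[OF \<sigma>]
  have [measurable]: "U (Suc k) h \<sigma> \<in> borel_measurable S" using U_measurable[OF h, of "\<lambda>s. s" S \<sigma>] \<sigma> by simp
  have m2: "(\<lambda>s. U k h (step \<sigma> y) s) \<in> borel_measurable S" for y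
    unfolding U_Suc[OF \<sigma> h, symmetric] by (rule U_measurable[OF h _ \<sigma>]) measurable
  have "(\<integral>\<^sup>+s. (\<Prod>i<Suc k. indicator (A i) (s !! i)) * U (Suc k) h \<sigma> s \<partial>S) =
    (\<integral>\<^sup>+y. \<integral>\<^sup>+s. (\<Prod>i<Suc k. indicator (A i) ((y ## s) !! i)) * U (Suc k) h \<sigma> (y ## s) \<partial>S \<partial>\<phi>)"
    by (rule nn_integral_S) measurable
  also have "\<dots> = (\<integral>\<^sup>+y. indicator (A 0) y * (\<integral>\<^sup>+s. (\<Prod>i<k. indicator (A (Suc i)) (s !! i)) * U k h (step \<sigma> y) s \<partial>S) \<partial>\<phi>)"
  proof (rule nn_integral_cong)
    fix y
    note [measurable] = m2[of y]
    have "(\<integral>\<^sup>+s. (\<Prod>i<Suc k. indicator (A i) ((y ## s) !! i)) * U (Suc k) h \<sigma> (y ## s) \<partial>S) =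
      (\<integral>\<^sup>+s. indicator (A 0) y * ((\<Prod>i<k. indicator (A (Suc i)) (s !! i)) * U k h (step \<sigma> y) s) \<partial>S)"
      by (simp add: prod.lessThan_Suc_shift U_Suc[OF \<sigma>] mult.assoc del: prod.lessThan_Suc)
    also have "\<dots> = indicator (A 0) y * (\<integral>\<^sup>+s. (\<Prod>i<k. indicator (A (Suc i)) (s !! i)) * U k h (step \<sigma> y) s \<partial>S)"
      by (rule nn_integral_cmult) measurable
    finally show "(\<integral>\<^sup>+s. (\<Prod>i<Suc k. indicator (A i) ((y ## s) !! i)) * U (Suc k) h \<sigma> (y ## s) \<partial>S) = \<dots>" .
  qed
  also have "\<dots> = (\<integral>\<^sup>+y. indicator (A 0) y * (\<integral>\<^sup>+x. b k (\<lambda>i. A (Suc i)) h x \<partial>step \<sigma> y) \<partial>\<phi>)"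
    using AE_fmeas_step[OF \<sigma>] by (intro nn_integral_cong_AE) (auto elim!: eventually_mono simp: Suc.IH)
  also have "\<dots> = (\<integral>\<^sup>+y. (\<integral>\<^sup>+x. indicator (A 0) y * (ennreal (\<Upsilon> x y) * b k (\<lambda>i. A (Suc i)) h x) \<partial>push \<sigma>) \<partial>\<phi>)"
    by (intro nn_integral_cong, subst nn_integral_step[OF \<sigma>])
       (auto simp: nn_integral_cmult measurable_fmeas[OF p])
  also have "\<dots> = (\<integral>\<^sup>+x. (\<integral>\<^sup>+y. indicator (A 0) y * (ennreal (\<Upsilon> x y) * b k (\<lambda>i. A (Suc i)) h x) \<partial>\<phi>) \<partial>push \<sigma>)"
    by (rule swap_phi[OF p]) measurable
  also have "\<dots> = (\<integral>\<^sup>+x. ennreal (p\<Phi> (A 0) x) * b k (\<lambda>i. A (Suc i)) h x \<partial>push \<sigma>)"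
  proof (rule nn_integral_cong)
    fix x
    have "(\<integral>\<^sup>+y. indicator (A 0) y * (ennreal (\<Upsilon> x y) * b k (\<lambda>i. A (Suc i)) h x) \<partial>\<phi>) =
      (\<integral>\<^sup>+y. indicator (A 0) y * ennreal (\<Upsilon> x y) \<partial>\<phi>) * b k (\<lambda>i. A (Suc i)) h x"
      by (subst nn_integral_multc[symmetric]) (auto simp: mult.assoc)
    then show "(\<integral>\<^sup>+y. indicator (A 0) y * (ennreal (\<Upsilon> x y) * b k (\<lambda>i. A (Suc i)) h x) \<partial>\<phi>) = ennreal (p\<Phi> (A 0) x) * b k (\<lambda>i. A (Suc i)) h x"
      by (simp add: ennreal_pPhi)
  qed
  also have "\<dots> = (\<integral>\<^sup>+x. b (Suc k) A h x \<partial>\<sigma>)"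
    by (simp add: nn_integral_push[OF \<sigma>])
  finally show ?case .
qed

text \<open>Unnormalised filter from \<mu> with the observation at time 0 as head of the stream.
  With h = 1 it is the likelihood of the k + 1 observations at times 0 to k.\<close>

definition num :: "nat \<Rightarrow> ('e \<Rightarrow> ennreal) \<Rightarrow> 'f stream \<Rightarrow> ennreal" where
  "num k h s = (\<integral>\<^sup>+x. ennreal (\<Upsilon> x (shd s)) * u k h x (stl s) \<partial>meas_of \<mu>)"

lemma num_measurable[measurable (raw)]:
  assumes [measurable]: "h \<in> borel_measurable borel" "g \<in> M \<rightarrow>\<^sub>M S"
  shows "(\<lambda>z. num k h (g z)) \<in> borel_measurable M"
  unfolding num_def by (rule nn_integral_fmeas_measurable[OF fmeas_meas_of]) measurable

lemma num_dn:
  assumes [measurable]: "h \<in> borel_measurable borel"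
  shows "num k h (y ## s) = U k h (dn (meas_of \<mu>) y) s"
proof -
  have "(\<lambda>x. u k h x s) \<in> borel_measurable borel" by measurable
  from nn_integral_dn[OF fmeas_meas_of this] show ?thesis unfolding num_def U_def by simp
qed

lemma S_joint:
  assumes h[measurable]: "h \<in> borel_measurable borel" and A[measurable]: "\<And>i. A i \<in> sets borel"
  shows "(\<integral>\<^sup>+s. (\<Prod>i\<le>k. indicator (A i) (s !! i)) * num k h s \<partial>S) =
    (\<integral>\<^sup>+x. ennreal (p\<Phi> (A 0) x) * b k (\<lambda>i. A (Suc i)) h x \<partial>meas_of \<mu>)"
proof -
  note f = fmeas_meas_of[of \<mu>]
  have "(\<integral>\<^sup>+s. (\<Prod>i\<le>k. indicator (A i) (s !! i)) * num k h s \<partial>S) =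
    (\<integral>\<^sup>+y. \<integral>\<^sup>+s. (\<Prod>i\<le>k. indicator (A i) ((y ## s) !! i)) * num k h (y ## s) \<partial>S \<partial>\<phi>)"
    by (rule nn_integral_S) measurable
  also have "\<dots> = (\<integral>\<^sup>+y. indicator (A 0) y * (\<integral>\<^sup>+s. (\<Prod>i<k. indicator (A (Suc i)) (s !! i)) * U k h (dn (meas_of \<mu>) y) s \<partial>S) \<partial>\<phi>)"
  proof (rule nn_integral_cong)
    fix y
    have [measurable]: "(\<lambda>s. U k h (dn (meas_of \<mu>) y) s) \<in> borel_measurable S"
      unfolding num_dn[OF h, symmetric] by measurable
    have e: "(\<Prod>i\<le>k. indicator (A i) ((y ## s) !! i)) = (indicator (A 0) y * (\<Prod>i<k. indicator (A (Suc i)) (s !! i)) :: ennreal)" for s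
      unfolding lessThan_Suc_atMost[symmetric] by (subst prod.lessThan_Suc_shift) simp
    show "(\<integral>\<^sup>+s. (\<Prod>i\<le>k. indicator (A i) ((y ## s) !! i)) * num k h (y ## s) \<partial>S) =
       indicator (A 0) y * (\<integral>\<^sup>+s. (\<Prod>i<k. indicator (A (Suc i)) (s !! i)) * U k h (dn (meas_of \<mu>) y) s \<partial>S)"
      unfolding e num_dn[OF h] by (subst nn_integral_cmult[symmetric]) (auto simp: mult.assoc)
  qed
  also have "\<dots> = (\<integral>\<^sup>+y. indicator (A 0) y * (\<integral>\<^sup>+x. b k (\<lambda>i. A (Suc i)) h x \<partial>dn (meas_of \<mu>) y) \<partial>\<phi>)"
    using AE_Zn_finite[OF f] by (intro nn_integral_cong_AE) (auto elim!: eventually_mono simp: S_side fmeas_dn f)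
  also have "\<dots> = (\<integral>\<^sup>+y. (\<integral>\<^sup>+x. indicator (A 0) y * (ennreal (\<Upsilon> x y) * b k (\<lambda>i. A (Suc i)) h x) \<partial>meas_of \<mu>) \<partial>\<phi>)"
    by (intro nn_integral_cong, subst nn_integral_dn[OF f])
       (auto simp: nn_integral_cmult measurable_fmeas[OF f])
  also have "\<dots> = (\<integral>\<^sup>+x. (\<integral>\<^sup>+y. indicator (A 0) y * (ennreal (\<Upsilon> x y) * b k (\<lambda>i. A (Suc i)) h x) \<partial>\<phi>) \<partial>meas_of \<mu>)"
    by (rule swap_phi[OF f]) measurable
  also have "\<dots> = (\<integral>\<^sup>+x. ennreal (p\<Phi> (A 0) x) * b k (\<lambda>i. A (Suc i)) h x \<partial>meas_of \<mu>)"
  proof (rule nn_integral_cong)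
    fix x
    have "(\<integral>\<^sup>+y. indicator (A 0) y * (ennreal (\<Upsilon> x y) * b k (\<lambda>i. A (Suc i)) h x) \<partial>\<phi>) =
      (\<integral>\<^sup>+y. indicator (A 0) y * ennreal (\<Upsilon> x y) \<partial>\<phi>) * b k (\<lambda>i. A (Suc i)) h x"
      by (subst nn_integral_multc[symmetric]) (auto simp: mult.assoc)
    then show "(\<integral>\<^sup>+y. indicator (A 0) y * (ennreal (\<Upsilon> x y) * b k (\<lambda>i. A (Suc i)) h x) \<partial>\<phi>) = ennreal (p\<Phi> (A 0) x) * b k (\<lambda>i. A (Suc i)) h x"
      by (simp add: ennreal_pPhi)
  qed
  finally show ?thesis .
qed

end

context filter_model
begin

lemma u_cong_stream: "(\<And>i. i < m \<Longrightarrow> s !! i = s' !! i) \<Longrightarrow> u m f x s = u m f x s'"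
proof (induction m arbitrary: x s s')
  case (Suc m)
  have "shd s = shd s'" using Suc.prems[of 0] by simp
  moreover have "u m f x' (stl s) = u m f x' (stl s')" for x'
    using Suc.prems[of "Suc i" for i] by (intro Suc.IH) simp
  ultimately show ?case by simp
qed simp

text \<open>\<open>u\<close> recurses on the earliest observation, the filter on the latest one;
  this identity reconciles them.\<close>

lemma u_snoc: "u (Suc k) g x s = u k (\<lambda>x'. \<integral>\<^sup>+x''. ennreal (\<Upsilon> x'' (s !! k)) * g x'' \<partial>P x') x s"
proof (induction k arbitrary: x s)
  case (Suc k)
  show ?case
    by (subst u.simps(2), subst Suc, simp)
qed simp

lemma u_pos: "0 < u m (\<lambda>_. 1) x s"
proof (induction m arbitrary: x s)
  case (Suc m)
  show ?case
  proof (rule ccontr)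
    assume "\<not> ?thesis"
    then have z: "(\<integral>\<^sup>+x'. ennreal (\<Upsilon> x' (shd s)) * u m (\<lambda>_. 1) x' (stl s) \<partial>P x) = 0" by simp
    have "(\<lambda>x'. ennreal (\<Upsilon> x' (shd s)) * u m (\<lambda>_. 1) x' (stl s)) \<in> borel_measurable (P x)"
      by (simp add: measurable_fmeas[OF fmeas_P])
    then have "AE x' in P x. ennreal (\<Upsilon> x' (shd s)) * u m (\<lambda>_. 1) x' (stl s) = 0"
      using z by (simp add: nn_integral_0_iff_AE)
    then have "AE x' in P x. False"
      using Ups_pos Suc by (auto elim!: eventually_mono simp: ennreal_eq_0_iff not_le[symmetric])
    then show False using prob_space.AE_const[OF P_prob(1)] by auto
  qed
qed simp

end

section \<open>The exact filter as a ratio of unnormalised integrals\<close>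

context hmm_model
begin

definition Ys :: "'o \<Rightarrow> 'f stream" where "Ys w = to_stream (\<lambda>i. Y i w)"

lemma Ys_snth: "Ys w !! i = Y i w"
  by (simp add: Ys_def to_stream_def)

lemma measurable_into_S:
  assumes "\<And>i. (\<lambda>z. g z !! i) \<in> borel_measurable M" shows "g \<in> M \<rightarrow>\<^sub>M S"
  unfolding S_def
proof (rule measurable_stream_space2)
  show "(\<lambda>z. g z !! i) \<in> M \<rightarrow>\<^sub>M \<phi>" for i using assms[of i] sets_phi by (simp cong: measurable_cong_sets)
qed

lemma Ys_measurable[measurable]: "Ys \<in> \<Omega> \<rightarrow>\<^sub>M S"
  by (rule measurable_into_S) (simp add: Ys_snth)

text \<open>Invariance under \<open>trunc k\<close> expresses dependence on the observations at
  times 0 to k only; the constant tail lets such functions factor through a finite product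
  space.\<close>

definition trunc :: "nat \<Rightarrow> 'f stream \<Rightarrow> 'f stream" where
  "trunc k s = to_stream (\<lambda>i. if i \<le> k then s !! i else undefined)"

lemma trunc_snth: "i \<le> k \<Longrightarrow> trunc k s !! i = s !! i"
  by (simp add: trunc_def to_stream_def)

lemma num_trunc: "num k h (trunc k s) = num k h s"
proof -
  have "shd (trunc k s) = shd s" using trunc_snth[of 0 k s] by simp
  moreover have "u k h x (stl (trunc k s)) = u k h x (stl s)" for x
  proof (rule u_cong_stream)
    fix i assume "i < k"
    then show "stl (trunc k s) !! i = stl s !! i" using trunc_snth[of "Suc i" k s] by simp
  qed
  ultimately show ?thesis by (simp add: num_def)
qed

lemma num_snoc: "num (Suc k) g s = num k (\<lambda>x'. \<integral>\<^sup>+x''. ennreal (\<Upsilon> x'' (s !! Suc k)) * g x'' \<partial>P x') s"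
  unfolding num_def by (subst u_snoc) simp

text \<open>The laws of the first k + 1 observations, with weight hr(X_k) under \<Omega> and with
  weight \<open>num k\<close> under \<open>S\<close>, agree on rectangles by \<open>XY_joint\<close>
  and \<open>S_joint\<close>, hence on the finite product space.\<close>

lemma observation_law:
  assumes hr: "hr \<in> borel_measurable borel" "\<And>x. 0 \<le> hr x" "\<And>x. hr x \<le> (1::real)"
    and G[measurable]: "G \<in> borel_measurable S" and Gt: "\<And>s. G (trunc k s) = G s"
  shows "(\<integral>\<^sup>+\<omega>. ennreal (hr (X k \<omega>)) * G (Ys \<omega>) \<partial>\<Omega>) = (\<integral>\<^sup>+s. num k (\<lambda>x. ennreal (hr x)) s * G s \<partial>S)"
proof -
  note [measurable] = hr(1)
  interpret prob_space \<Omega> by (rule prob_Omega)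
  let ?\<Pi> = "\<Pi>\<^sub>M i\<in>{..k}. (borel :: 'f measure)"
  let ?Y = "\<lambda>\<omega>. \<lambda>i\<in>{..k}. Y i \<omega>" and ?s = "\<lambda>s :: 'f stream. \<lambda>i\<in>{..k}. s !! i"
  let ?h = "\<lambda>x. ennreal (hr x)"
  have hm[measurable]: "?h \<in> borel_measurable borel" by measurable
  have Ym[measurable]: "?Y \<in> \<Omega> \<rightarrow>\<^sub>M ?\<Pi>" by measurable
  have sm[measurable]: "?s \<in> S \<rightarrow>\<^sub>M ?\<Pi>" by measurable
  define N1 where "N1 = distr (density \<Omega> (\<lambda>\<omega>. ?h (X k \<omega>))) ?\<Pi> ?Y"
  define N2 where "N2 = distr (density S (num k ?h)) ?\<Pi> ?s"
  have "N1 = N2"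
  proof (rule measure_eqI_PiM_finite[of "{..k}"])
    fix A :: "nat \<Rightarrow> 'f set" assume "\<And>i. i \<in> {..k} \<Longrightarrow> A i \<in> sets borel"
    define B where "B i = (if i \<le> k then A i else UNIV)" for i
    have B[measurable]: "B i \<in> sets borel" for i
      using \<open>\<And>i. i \<in> {..k} \<Longrightarrow> A i \<in> sets borel\<close> by (simp add: B_def)
    have AB: "Pi\<^sub>E {..k} A = Pi\<^sub>E {..k} B" by (intro PiE_cong) (simp add: B_def)
    have ABm: "Pi\<^sub>E {..k} B \<in> sets ?\<Pi>" by (intro sets_PiM_I_finite) auto
    have "emeasure N1 (Pi\<^sub>E {..k} B) = (\<integral>\<^sup>+\<omega>. ?h (X k \<omega>) * indicator {\<omega>\<in>space \<Omega>. \<forall>i\<in>{..k}. Y i \<omega> \<in> B i} \<omega> \<partial>\<Omega>)"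
      unfolding N1_def using ABm
      by (subst emeasure_distr, simp, simp, subst emeasure_density)
         (auto intro!: nn_integral_cong measurable_sets[OF Ym] split: split_indicator simp: PiE_iff)
    also have "\<dots> = (\<integral>\<^sup>+s. (\<Prod>i\<le>k. indicator (B i) (s !! i)) * num k ?h s \<partial>S)"
      using XY_joint[of hr B k, OF hr B] S_joint[of ?h B k, OF hm B] by simp
    also have "\<dots> = (\<integral>\<^sup>+s. num k ?h s * indicator (?s -` Pi\<^sub>E {..k} B \<inter> space S) s \<partial>S)"
    proof (rule nn_integral_cong)
      fix s
      have "(\<Prod>i\<le>k. indicator (B i) (s !! i)) = (indicator (?s -` Pi\<^sub>E {..k} B \<inter> space S) s :: ennreal)"
      proof (cases "\<forall>i\<le>k. s !! i \<in> B i")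
        case False
        then obtain i where "i \<le> k" "s !! i \<notin> B i" by auto
        then have "(\<Prod>i\<le>k. indicator (B i) (s !! i)) = (0::ennreal)" by (intro prod_zero) (auto intro!: bexI[of _ i])
        moreover have "s \<notin> ?s -` Pi\<^sub>E {..k} B \<inter> space S" using False by (auto simp: PiE_iff)
        ultimately show ?thesis by simp
      qed (auto simp: PiE_iff)
      then show "(\<Prod>i\<le>k. indicator (B i) (s !! i)) * num k ?h s = num k ?h s * indicator (?s -` Pi\<^sub>E {..k} B \<inter> space S) s"
        by (simp add: mult.commute)
    qed
    also have "\<dots> = emeasure N2 (Pi\<^sub>E {..k} B)"
      unfolding N2_def using ABm measurable_sets[OF sm ABm]
      by (subst emeasure_distr, simp, simp, subst emeasure_density) auto
    finally show "emeasure N1 (Pi\<^sub>E {..k} A) = emeasure N2 (Pi\<^sub>E {..k} A)" unfolding AB .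
  next
    show "range (\<lambda>_::nat. Pi\<^sub>E {..k} (\<lambda>_. UNIV :: 'f set)) \<subseteq> prod_algebra {..k} (\<lambda>_. borel)"
      by (auto intro!: prod_algebraI_finite)
    show "(\<Union>n::nat. Pi\<^sub>E {..k} (\<lambda>_. UNIV :: 'f set)) = space ?\<Pi>" by (simp add: space_PiM)
    let ?D = "density \<Omega> (\<lambda>\<omega>. ?h (X k \<omega>))"
    have "emeasure N1 (space ?\<Pi>) \<le> emeasure ?D (space ?D)"
      unfolding N1_def by (subst emeasure_distr) (auto intro!: emeasure_mono)
    also have "\<dots> = (\<integral>\<^sup>+\<omega>. ?h (X k \<omega>) \<partial>\<Omega>)"
      by (subst emeasure_density) (auto intro!: nn_integral_cong)
    also have "\<dots> \<le> (\<integral>\<^sup>+\<omega>. 1 \<partial>\<Omega>)" using hr(3) by (intro nn_integral_mono) simp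
    finally have "emeasure N1 (space ?\<Pi>) \<le> (\<integral>\<^sup>+\<omega>. 1 \<partial>\<Omega>)" .
    then show "emeasure N1 (Pi\<^sub>E {..k} (\<lambda>_. UNIV)) \<noteq> \<infinity>"
      using emeasure_space_1 by (auto simp: space_PiM top_unique)
  qed (simp_all add: N1_def N2_def)
  define e where "e w = to_stream (\<lambda>i. if i \<le> k then w i else undefined)" for w :: "nat \<Rightarrow> 'f"
  have [measurable]: "e \<in> ?\<Pi> \<rightarrow>\<^sub>M S"
  proof (rule measurable_into_S)
    fix i show "(\<lambda>w. e w !! i) \<in> borel_measurable ?\<Pi>"
      by (cases "i \<le> k") (auto simp: e_def to_stream_def intro: measurable_component_singleton)
  qed
  have e1: "e (?Y \<omega>) = trunc k (Ys \<omega>)" for \<omega>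
    unfolding e_def trunc_def by (intro arg_cong[where f=to_stream]) (auto simp: Ys_snth)
  have e2: "e (?s s) = trunc k s" for s
    unfolding e_def trunc_def by (intro arg_cong[where f=to_stream]) auto
  have Ge[measurable]: "(\<lambda>w. G (e w)) \<in> borel_measurable ?\<Pi>" by measurable
  have "(\<integral>\<^sup>+w. G (e w) \<partial>N1) = (\<integral>\<^sup>+\<omega>. ?h (X k \<omega>) * G (Ys \<omega>) \<partial>\<Omega>)"
    unfolding N1_def by (subst nn_integral_distr, simp, simp, subst nn_integral_density) (auto simp: e1 Gt)
  moreover have "(\<integral>\<^sup>+w. G (e w) \<partial>N2) = (\<integral>\<^sup>+s. num k ?h s * G s \<partial>S)"
    unfolding N2_def by (subst nn_integral_distr, simp, simp, subst nn_integral_density) (auto simp: e2 Gt)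
  ultimately show ?thesis using \<open>N1 = N2\<close> by simp
qed

lemma num_mass: "(\<integral>\<^sup>+s. num k (\<lambda>_. 1) s \<partial>S) = 1"
  using observation_law[of "\<lambda>_. 1" "\<lambda>_. 1" k] prob_space.emeasure_space_1[OF prob_Omega] by simp

lemma AE_S_num_finite: "AE s in S. num k (\<lambda>_. 1) s < \<infinity>"
  using nn_integral_PInf_AE[of "num k (\<lambda>_. 1)" S] num_mass by (auto simp: less_top[symmetric])

text \<open>An infinite likelihood is a null event under \<open>S\<close>, and the first k + 1 true
  observations have a density with respect to \<open>S\<close>.\<close>

lemma AE_num_finite: "AE w in \<Omega>. \<forall>k. num k (\<lambda>_. 1) (Ys w) < \<infinity>"
  unfolding AE_all_countable
proof
  fix k
  let ?G = "\<lambda>s. indicator {s\<in>space S. num k (\<lambda>_. 1) s = \<infinity>} s :: ennreal"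
  have "(\<integral>\<^sup>+w. ennreal 1 * ?G (Ys w) \<partial>\<Omega>) = (\<integral>\<^sup>+s. num k (\<lambda>x. ennreal 1) s * ?G s \<partial>S)"
    by (rule observation_law) (auto simp: num_trunc split: split_indicator)
  also have "\<dots> = (\<integral>\<^sup>+s. 0 \<partial>S)"
    using AE_S_num_finite[of k] by (intro nn_integral_cong_AE) (auto elim!: eventually_mono split: split_indicator)
  finally have "(\<integral>\<^sup>+w. ?G (Ys w) \<partial>\<Omega>) = 0" by simp
  then have "AE w in \<Omega>. ?G (Ys w) = 0" by (subst (asm) nn_integral_0_iff_AE) auto
  then show "AE w in \<Omega>. num k (\<lambda>_. 1) (Ys w) < \<infinity>"
    by (auto elim!: eventually_mono simp: less_top[symmetric] split: split_indicator_asm)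
qed

lemma num_pos: "0 < num k (\<lambda>_. 1) s"
proof (rule ccontr)
  note f = fmeas_meas_of[of \<mu>]
  assume "\<not> ?thesis"
  then have "(\<integral>\<^sup>+x. ennreal (\<Upsilon> x (shd s)) * u k (\<lambda>_. 1) x (stl s) \<partial>meas_of \<mu>) = 0" by (simp add: num_def)
  then have "AE x in meas_of \<mu>. ennreal (\<Upsilon> x (shd s)) * u k (\<lambda>_. 1) x (stl s) = 0"
    by (subst (asm) nn_integral_0_iff_AE) (auto simp: measurable_fmeas[OF f])
  then have "AE x in meas_of \<mu>. False"
    using Ups_pos u_pos[of k _ "stl s"] by (auto elim!: eventually_mono simp: ennreal_eq_0_iff not_le[symmetric])
  then show False using prob_space.AE_const[OF prob_meas_D(1)] by auto
qed

text \<open>Induction over the newest observation (\<open>num_snoc\<close>). Finite likelihoods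
  exclude the default branch of \<open>bayes_update\<close>, so every update changes the constant
  only.\<close>

lemma filter_scaled:
  assumes fin: "\<And>k. num k (\<lambda>_. 1) (Ys w) < \<infinity>"
  shows "\<exists>c>0. \<forall>g\<in>borel_measurable borel. (\<integral>\<^sup>+x. g x \<partial>meas_of (nonlinear_filter \<Upsilon> P \<mu> Y k w)) = ennreal c * num k g (Ys w)"
proof (induction k)
  case 0
  have y: "shd (Ys w) = Y 0 w" using Ys_snth[of w 0] by simp
  have "Zn (meas_of \<mu>) (Y 0 w) < \<infinity>" using fin[of 0] by (simp add: num_def y Zn_def)
  note b = bayes_scaled[OF this]
  show ?case
  proof (intro exI[of _ "1 / enn2real (Zn (meas_of \<mu>) (Y 0 w))"] conjI ballI)
    fix g :: "'e \<Rightarrow> ennreal" assume g: "g \<in> borel_measurable borel"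
    then have "(\<integral>\<^sup>+x. g x \<partial>meas_of (bayes_update \<Upsilon> (Y 0 w) \<mu>)) = ennreal (1 / enn2real (Zn (meas_of \<mu>) (Y 0 w))) * (\<integral>\<^sup>+x. g x \<partial>dn (meas_of \<mu>) (Y 0 w))"
      using b(1) unfolding is_scaled_def by blast
    also have "(\<integral>\<^sup>+x. g x \<partial>dn (meas_of \<mu>) (Y 0 w)) = num 0 g (Ys w)"
      by (subst nn_integral_dn[OF fmeas_meas_of g]) (simp add: num_def y)
    finally show "(\<integral>\<^sup>+x. g x \<partial>meas_of (nonlinear_filter \<Upsilon> P \<mu> Y 0 w)) = ennreal (1 / enn2real (Zn (meas_of \<mu>) (Y 0 w))) * num 0 g (Ys w)"
      by simp
  qed (rule b(2))
next
  case (Suc k)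
  then obtain c where c: "c > 0" "\<And>g. g \<in> borel_measurable borel \<Longrightarrow>
      (\<integral>\<^sup>+x. g x \<partial>meas_of (nonlinear_filter \<Upsilon> P \<mu> Y k w)) = ennreal c * num k g (Ys w)" by blast
  define \<pi> where "\<pi> = nonlinear_filter \<Upsilon> P \<mu> Y k w"
  define y where "y = Y (Suc k) w"
  have dn: "(\<integral>\<^sup>+x. ennreal (\<Upsilon> x y) * g x \<partial>meas_of (kernel_step P \<pi>)) = ennreal c * num (Suc k) g (Ys w)"
    if [measurable]: "g \<in> borel_measurable borel" for g
  proof -
    have "(\<integral>\<^sup>+x. ennreal (\<Upsilon> x y) * g x \<partial>meas_of (kernel_step P \<pi>)) = (\<integral>\<^sup>+x. \<integral>\<^sup>+x'. ennreal (\<Upsilon> x' y) * g x' \<partial>P x \<partial>meas_of \<pi>)"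
      unfolding meas_of_kernel_step by (rule nn_integral_push[OF fmeas_meas_of]) measurable
    also have "\<dots> = ennreal c * num k (\<lambda>x. \<integral>\<^sup>+x'. ennreal (\<Upsilon> x' y) * g x' \<partial>P x) (Ys w)"
      unfolding \<pi>_def by (rule c(2)) measurable
    finally show ?thesis unfolding num_snoc Ys_snth y_def .
  qed
  have "Zn (meas_of (kernel_step P \<pi>)) y < \<infinity>"
    using dn[of "\<lambda>_. 1"] fin[of "Suc k"] by (simp add: Zn_def ennreal_mult_less_top)
  note b = bayes_scaled[OF this]
  show ?case
  proof (intro exI[of _ "1 / enn2real (Zn (meas_of (kernel_step P \<pi>)) y) * c"] conjI ballI)
    show "0 < 1 / enn2real (Zn (meas_of (kernel_step P \<pi>)) y) * c" using b(2) c(1) by simp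
    fix g :: "'e \<Rightarrow> ennreal" assume g: "g \<in> borel_measurable borel"
    then have "(\<integral>\<^sup>+x. g x \<partial>meas_of (bayes_update \<Upsilon> y (kernel_step P \<pi>))) = ennreal (1 / enn2real (Zn (meas_of (kernel_step P \<pi>)) y)) * (\<integral>\<^sup>+x. g x \<partial>dn (meas_of (kernel_step P \<pi>)) y)"
      using b(1) unfolding is_scaled_def by blast
    also have "(\<integral>\<^sup>+x. g x \<partial>dn (meas_of (kernel_step P \<pi>)) y) = ennreal c * num (Suc k) g (Ys w)"
      by (subst nn_integral_dn[OF fmeas_meas_of g]) (rule dn[OF g])
    finally show "(\<integral>\<^sup>+x. g x \<partial>meas_of (nonlinear_filter \<Upsilon> P \<mu> Y (Suc k) w)) = ennreal (1 / enn2real (Zn (meas_of (kernel_step P \<pi>)) y) * c) * num (Suc k) g (Ys w)"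
      using b(2) c(1) by (simp add: \<pi>_def y_def ennreal_mult mult.assoc del: times_divide_eq_left)
  qed
qed

text \<open>An explicit version of the conditional expectation of h(X_k) as a function of the
  observations. For h in [0, 1] it lies in [0, 1] on every stream, since \<open>enn2real\<close> of
  infinity and x/0 are both 0.\<close>

definition r :: "nat \<Rightarrow> ('e \<Rightarrow> real) \<Rightarrow> 'f stream \<Rightarrow> real" where
  "r k h s = enn2real (num k (\<lambda>x. ennreal (h x)) s) / enn2real (num k (\<lambda>_. 1) s)"

text \<open>The exceptional set is that of \<open>AE_num_finite\<close>, so it serves all k and all
  h at once.\<close>

lemma AE_filter_eq:
  "AE w in \<Omega>. \<forall>k h. h \<in> borel_measurable borel \<longrightarrow> (\<forall>x. 0 \<le> h x \<and> h x \<le> 1) \<longrightarrow>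
     (\<integral>x. h x \<partial>meas_of (nonlinear_filter \<Upsilon> P \<mu> Y k w)) = r k h (Ys w)"
  using AE_num_finite
proof eventually_elim
  case (elim w)
  show ?case
  proof (intro allI impI)
    fix k and h :: "'e \<Rightarrow> real" assume h[measurable]: "h \<in> borel_measurable borel" and hb: "\<forall>x. 0 \<le> h x \<and> h x \<le> 1"
    obtain c where c: "c > 0" "\<And>g. g \<in> borel_measurable borel \<Longrightarrow>
      (\<integral>\<^sup>+x. g x \<partial>meas_of (nonlinear_filter \<Upsilon> P \<mu> Y k w)) = ennreal c * num k g (Ys w)"
      using filter_scaled[of w k] elim by blast
    have 1: "ennreal c * num k (\<lambda>_. 1) (Ys w) = 1"
      using c(2)[of "\<lambda>_. 1"] by (simp add: prob_meas_D measure_meas_of_UNIV(2))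
    have "enn2real (ennreal c * num k (\<lambda>_. 1) (Ys w)) = 1" unfolding 1 by simp
    then have ceq: "c * enn2real (num k (\<lambda>_. 1) (Ys w)) = 1" using c(1) by (simp add: enn2real_mult)
    have "(\<integral>x. h x \<partial>meas_of (nonlinear_filter \<Upsilon> P \<mu> Y k w)) = enn2real (\<integral>\<^sup>+x. ennreal (h x) \<partial>meas_of (nonlinear_filter \<Upsilon> P \<mu> Y k w))"
      using hb by (intro integral_eq_nn_integral) (auto simp: measurable_fmeas[OF fmeas_meas_of])
    also have "\<dots> = c * enn2real (num k (\<lambda>x. ennreal (h x)) (Ys w))"
      using c by (simp add: enn2real_mult)
    also have "\<dots> = r k h (Ys w)"
    proof -
      have "enn2real (num k (\<lambda>_. 1) (Ys w)) \<noteq> 0" using ceq by auto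
      then have "c = 1 / enn2real (num k (\<lambda>_. 1) (Ys w))" using ceq by (simp add: field_simps)
      then show ?thesis by (simp add: r_def)
    qed
    finally show "(\<integral>x. h x \<partial>meas_of (nonlinear_filter \<Upsilon> P \<mu> Y k w)) = r k h (Ys w)" .
  qed
qed

end

section \<open>Conditioning on observations and independent randomness\<close>

context hmm_model
begin

lemma r_bounds:
  assumes "\<And>x. 0 \<le> h x" "\<And>x. h x \<le> 1"
  shows "0 \<le> r k h s" "r k h s \<le> 1"
proof -
  show "0 \<le> r k h s" by (simp add: r_def)
  have le: "num k (\<lambda>x. ennreal (h x)) s \<le> num k (\<lambda>_. 1) s"
    unfolding num_def using assms by (intro nn_integral_mono mult_left_mono u_mono) auto
  show "r k h s \<le> 1"
  proof (cases "num k (\<lambda>_. 1) s < \<infinity>")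
    case True
    then have "enn2real (num k (\<lambda>x. ennreal (h x)) s) \<le> enn2real (num k (\<lambda>_. 1) s)" using le by (intro enn2real_mono) auto
    then show ?thesis unfolding r_def by (cases "enn2real (num k (\<lambda>_. 1) s) = 0") (auto simp: divide_le_eq_1 less_le)
  next
    case False
    then have "num k (\<lambda>_. 1) s = \<infinity>" by (simp add: less_top[symmetric])
    then show ?thesis by (simp add: r_def)
  qed
qed

lemma r_measurable[measurable (raw)]:
  assumes [measurable]: "h \<in> borel_measurable borel" "g \<in> M \<rightarrow>\<^sub>M S"
  shows "(\<lambda>z. r k h (g z)) \<in> borel_measurable M"
  unfolding r_def by measurable

lemma r_trunc: "r k h (trunc k s) = r k h s"
  by (simp add: r_def num_trunc)

lemma num_r:
  assumes "\<And>x. h x \<le> 1"  "num k (\<lambda>_. 1) s < \<infinity>"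
  shows "num k (\<lambda>_. 1) s * ennreal (r k h s) = num k (\<lambda>x. ennreal (h x)) s"
proof -
  have le: "num k (\<lambda>x. ennreal (h x)) s \<le> num k (\<lambda>_. 1) s"
    unfolding num_def using assms(1) by (intro nn_integral_mono mult_left_mono u_mono) auto
  then obtain a where a: "num k (\<lambda>x. ennreal (h x)) s = ennreal a" "0 \<le> a"
    using assms(2) by (cases "num k (\<lambda>x. ennreal (h x)) s") auto
  obtain b where b: "num k (\<lambda>_. 1) s = ennreal b" "0 < b"
    using assms(2) num_pos[of k s] by (cases "num k (\<lambda>_. 1) s") auto
  show ?thesis using a b by (simp add: r_def ennreal_mult[symmetric])
qed

text \<open>\<open>num k h\<close> is r times \<open>num k 1\<close>, so
  \<open>observation_law\<close> can be applied with h in one direction and with the constant 1 in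
  the other.\<close>

lemma r_law:
  assumes h[measurable]: "h \<in> borel_measurable borel" and hb: "\<And>x. 0 \<le> h x" "\<And>x. h x \<le> 1"
    and A[measurable]: "\<And>i. A i \<in> sets borel"
  shows "(\<integral>\<^sup>+w. ennreal (h (X k w)) * indicator {w\<in>space \<Omega>. \<forall>i\<le>k. Y i w \<in> A i} w \<partial>\<Omega>) =
    (\<integral>\<^sup>+w. ennreal (r k h (Ys w)) * indicator {w\<in>space \<Omega>. \<forall>i\<le>k. Y i w \<in> A i} w \<partial>\<Omega>)"
proof -
  define G where "G = (\<lambda>s :: 'f stream. indicator {s\<in>space S. \<forall>i\<in>{..k}. s !! i \<in> A i} s :: ennreal)"
  have [measurable]: "G \<in> borel_measurable S" unfolding G_def by measurable
  have Gt: "G (trunc k s) = G s" for s by (auto simp: G_def trunc_snth split: split_indicator)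
  have GI: "indicator {w\<in>space \<Omega>. \<forall>i\<le>k. Y i w \<in> A i} w = G (Ys w)" if "w \<in> space \<Omega>" for w
    using that by (auto simp: G_def Ys_snth split: split_indicator)
  have "(\<integral>\<^sup>+w. ennreal (h (X k w)) * indicator {w\<in>space \<Omega>. \<forall>i\<le>k. Y i w \<in> A i} w \<partial>\<Omega>) = (\<integral>\<^sup>+w. ennreal (h (X k w)) * G (Ys w) \<partial>\<Omega>)"
    by (intro nn_integral_cong) (simp add: GI)
  also have "\<dots> = (\<integral>\<^sup>+s. num k (\<lambda>x. ennreal (h x)) s * G s \<partial>S)"
    using hb Gt by (intro observation_law) auto
  also have "\<dots> = (\<integral>\<^sup>+s. num k (\<lambda>x. ennreal 1) s * (ennreal (r k h s) * G s) \<partial>S)"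
    using AE_S_num_finite[of k] hb
    by (intro nn_integral_cong_AE) (auto elim!: eventually_mono simp: num_r mult.assoc[symmetric])
  also have "\<dots> = (\<integral>\<^sup>+w. ennreal 1 * (ennreal (r k h (Ys w)) * G (Ys w)) \<partial>\<Omega>)"
    using Gt by (intro observation_law[symmetric]) (auto simp: r_trunc)
  also have "\<dots> = (\<integral>\<^sup>+w. ennreal (r k h (Ys w)) * indicator {w\<in>space \<Omega>. \<forall>i\<le>k. Y i w \<in> A i} w \<partial>\<Omega>)"
    by (intro nn_integral_cong) (simp add: GI)
  finally show ?thesis .
qed

end

lemma (in prob_space) nn_integral_indep_indicator:
  assumes "indep_set (sets \<G>) (sets \<D>)" "space \<D> = space M" "C \<in> sets \<G>" and W: "W \<in> borel_measurable \<D>"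
  shows "(\<integral>\<^sup>+w. W w * indicator C w \<partial>M) = emeasure M C * (\<integral>\<^sup>+w. W w \<partial>M)"
proof -
  have C[measurable]: "C \<in> sets M" and D: "sets \<D> \<subseteq> sets M"
    using indep_setD_ev1[OF assms(1)] indep_setD_ev2[OF assms(1)] assms(3) by auto
  have idm[measurable]: "(\<lambda>x. x) \<in> M \<rightarrow>\<^sub>M \<D>" using D assms(2) by (intro measurableI) auto
  have [measurable]: "W \<in> borel_measurable M" by (rule measurable_compose[OF idm W])
  let ?N1 = "distr (density M (indicator C)) \<D> (\<lambda>x. x)" and ?N2 = "density (distr M \<D> (\<lambda>x. x)) (\<lambda>_. emeasure M C)"
  have "?N1 = ?N2"
  proof (rule measure_eqI)
    fix A assume "A \<in> sets ?N1"
    then have A: "A \<in> sets \<D>" by simp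
    then have [measurable]: "A \<in> sets M" using D by auto
    have AM: "A \<inter> space M = A" using sets.sets_into_space[OF \<open>A \<in> sets M\<close>] by auto
    have "emeasure ?N1 A = (\<integral>\<^sup>+w. indicator C w * indicator A w \<partial>M)"
      using A by (subst emeasure_distr, simp, simp, subst emeasure_density) (auto simp: AM)
    also have "\<dots> = emeasure M (C \<inter> A)" by (simp add: indicator_inter_arith[symmetric])
    also have "\<dots> = emeasure M C * emeasure M A"
      using indep_setD[OF assms(1,3) A] by (simp add: emeasure_eq_measure ennreal_mult)
    also have "\<dots> = emeasure ?N2 A"
      using A by (subst emeasure_density) (auto simp: emeasure_distr AM nn_integral_cmult_indicator)
    finally show "emeasure ?N1 A = emeasure ?N2 A" .
  qed simp
  then have "(\<integral>\<^sup>+w. W w \<partial>?N1) = (\<integral>\<^sup>+w. W w \<partial>?N2)" by simp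
  also have "(\<integral>\<^sup>+w. W w \<partial>?N1) = (\<integral>\<^sup>+w. W w * indicator C w \<partial>M)"
    using W by (subst nn_integral_distr, simp, simp, subst nn_integral_density) (auto simp: mult.commute)
  also have "(\<integral>\<^sup>+w. W w \<partial>?N2) = emeasure M C * (\<integral>\<^sup>+w. W w \<partial>M)"
    using W by (subst nn_integral_density, simp, simp, subst nn_integral_distr) (auto simp: nn_integral_cmult)
  finally show ?thesis .
qed

context hmm_model
begin

text \<open>Events that fix Y_0, ..., Y_k to Borel sets, intersected with a set C of the independent
  field, form a generator stable under intersections. On it C factors out by independence and
  \<open>r_law\<close> remains.\<close>

lemma conditional_law:
  assumes h[measurable]: "h \<in> borel_measurable borel" and hb: "\<And>x. 0 \<le> h x" "\<And>x. h x \<le> 1"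
    and sub: "subalgebra \<Omega> \<G>"
    and ind: "prob_space.indep_set \<Omega> (sets \<G>) (sets (sigma_gen \<Omega> (\<lambda>k w. (X k w, Y k w)) UNIV))"
    and V: "V \<in> borel_measurable (sigma (space \<Omega>) (sets (sigma_gen \<Omega> Y {..k}) \<union> sets \<G>))"
    and Vb: "\<And>w. 0 \<le> V w" "\<And>w. V w \<le> (1::real)"
  shows "(\<integral>w. h (X k w) * V w \<partial>\<Omega>) = (\<integral>w. r k h (Ys w) * V w \<partial>\<Omega>)"
    and "V \<in> borel_measurable \<Omega>"
proof -
  interpret prob_space \<Omega> by (rule prob_Omega)
  let ?D = "sigma_gen \<Omega> (\<lambda>k w. (X k w, Y k w)) UNIV"
  define H where "H = sigma (space \<Omega>) (sets (sigma_gen \<Omega> Y {..k}) \<union> sets \<G>)"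
  define B where "B A = {w\<in>space \<Omega>. \<forall>i\<le>k. Y i w \<in> A i}" for A :: "nat \<Rightarrow> 'f set"
  define E where "E = {B A \<inter> C | A C. (\<forall>i. A i \<in> sets borel) \<and> C \<in> sets \<G>}"
  note YM = measurable_sigma_gen[of _ "{..k}" Y \<Omega>]
  have sY: "space (sigma_gen \<Omega> Y {..k}) = space \<Omega>" "space \<G> = space \<Omega>" "sets \<G> \<subseteq> sets \<Omega>"
    using sub by (simp_all add: space_sigma_gen subalgebra_def)
  have BY: "B A \<in> sets (sigma_gen \<Omega> Y {..k})" if "\<forall>i. A i \<in> sets borel" for A
  proof -
    have "B A = {w\<in>space (sigma_gen \<Omega> Y {..k}). \<forall>i\<in>{..k}. Y i w \<in> A i}" by (auto simp: B_def sY)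
    also have "\<dots> \<in> sets (sigma_gen \<Omega> Y {..k})"
      using that by (intro sets.sets_Collect_finite_All') (auto intro: measurable_sets_Collect[OF YM])
    finally show ?thesis .
  qed
  have subY: "sets (sigma_gen \<Omega> Y {..k}) \<subseteq> sets \<Omega>"
    by (rule sets_sigma_gen_subset) auto
  have Pow: "sets (sigma_gen \<Omega> Y {..k}) \<union> sets \<G> \<subseteq> Pow (space \<Omega>)"
    using subY sY(3) sets.space_closed[of \<Omega>] by blast
  have setsH0: "sets H = sigma_sets (space \<Omega>) (sets (sigma_gen \<Omega> Y {..k}) \<union> sets \<G>)" and spH: "space H = space \<Omega>"
    unfolding H_def using Pow by (auto simp: sets_measure_of space_measure_of)
  have HO: "sets H \<subseteq> sets \<Omega>"
    unfolding setsH0 using subY sY(3) by (intro sets.sigma_sets_subset) auto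
  have EPow: "E \<subseteq> Pow (space \<Omega>)" by (auto simp: E_def B_def)
  have UE: "B A \<in> E" if "\<forall>i. A i \<in> sets borel" for A
    unfolding E_def using that sets.top[of \<G>] by (auto simp: sY B_def intro!: exI[of _ A] exI[of _ "space \<Omega>"])
  have setsH: "sets H = sigma_sets (space \<Omega>) E"
  proof (intro antisym)
    show "sigma_sets (space \<Omega>) E \<subseteq> sets H"
      unfolding spH[symmetric]
    proof (rule sets.sigma_sets_subset, rule subsetI)
      fix Z assume "Z \<in> E"
      then obtain A C where Z: "Z = B A \<inter> C" "\<forall>i. A i \<in> sets borel" "C \<in> sets \<G>" by (auto simp: E_def)
      then have "B A \<in> sets H" "C \<in> sets H" unfolding setsH0 using BY by (auto intro: sigma_sets.Basic)
      then show "Z \<in> sets H" unfolding Z(1) by auto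
    qed
    have "sets (sigma_gen \<Omega> Y {..k}) \<subseteq> sigma_sets (space \<Omega>) E"
      unfolding sets_sigma_gen
    proof (rule sigma_sets_mono, clarsimp)
      fix i A assume i: "i \<le> k" and A: "A \<in> sets (borel :: 'f measure)"
      have "Y i -` A \<inter> space \<Omega> = B (\<lambda>j. if j = i then A else UNIV)" using i by (auto simp: B_def)
      also have "\<dots> \<in> E" using A by (intro UE) auto
      finally show "Y i -` A \<inter> space \<Omega> \<in> sigma_sets (space \<Omega>) E" by (rule sigma_sets.Basic)
    qed
    moreover have "sets \<G> \<subseteq> sigma_sets (space \<Omega>) E"
    proof
      fix C assume C: "C \<in> sets \<G>"
      have "C = B (\<lambda>_. UNIV) \<inter> C" using sets.sets_into_space[OF C] by (auto simp: B_def sY)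
      then have "C \<in> E" unfolding E_def using C by (auto intro!: exI[of _ "\<lambda>_. UNIV"] exI[of _ C])
      then show "C \<in> sigma_sets (space \<Omega>) E" by (rule sigma_sets.Basic)
    qed
    ultimately show "sets H \<subseteq> sigma_sets (space \<Omega>) E" unfolding setsH0 by (intro sigma_sets_mono) auto
  qed
  have Int: "Int_stable E"
  proof (rule Int_stableI)
    fix a b assume "a \<in> E" "b \<in> E"
    then obtain A C A' C' where a: "a = B A \<inter> C" "\<forall>i. A i \<in> sets borel" "C \<in> sets \<G>"
      and b: "b = B A' \<inter> C'" "\<forall>i. A' i \<in> sets borel" "C' \<in> sets \<G>" unfolding E_def by auto
    have "a \<inter> b = B (\<lambda>i. A i \<inter> A' i) \<inter> (C \<inter> C')" unfolding a b by (auto simp: B_def)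
    moreover have "\<forall>i. A i \<inter> A' i \<in> sets borel" "C \<inter> C' \<in> sets \<G>" using a b by auto
    ultimately show "a \<inter> b \<in> E" unfolding E_def by blast
  qed
  have spE: "space \<Omega> \<in> E" using UE[of "\<lambda>_. UNIV"] by (simp add: B_def)
  have idm[measurable]: "(\<lambda>x. x) \<in> \<Omega> \<rightarrow>\<^sub>M H" using HO spH by (intro measurableI) auto
  show VM[measurable]: "V \<in> borel_measurable \<Omega>" using measurable_compose[OF idm V[folded H_def]] .
  have XY: "(\<lambda>w. (X i w, Y i w)) \<in> borel_measurable ?D" for i
    using measurable_sigma_gen[of i UNIV "\<lambda>k w. (X k w, Y k w)"] by simp
  have XD[measurable]: "X i \<in> borel_measurable ?D" for i
    using measurable_compose[OF XY[of i] borel_measurable_continuous_onI[OF continuous_on_fst[OF continuous_on_id]]] by simp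
  have YD[measurable]: "Y i \<in> borel_measurable ?D" for i
    using measurable_compose[OF XY[of i] borel_measurable_continuous_onI[OF continuous_on_snd[OF continuous_on_id]]] by simp
  have YsD[measurable]: "Ys \<in> ?D \<rightarrow>\<^sub>M S" by (rule measurable_into_S) (simp add: Ys_snth)
  let ?N1 = "distr (density \<Omega> (\<lambda>w. ennreal (h (X k w)))) H (\<lambda>x. x)"
  let ?N2 = "distr (density \<Omega> (\<lambda>w. ennreal (r k h (Ys w)))) H (\<lambda>x. x)"
  have em: "emeasure (distr (density \<Omega> (\<lambda>w. ennreal (g w))) H (\<lambda>x. x)) Z = (\<integral>\<^sup>+w. ennreal (g w) * indicator Z w \<partial>\<Omega>)"
    if [measurable]: "g \<in> borel_measurable \<Omega>" and Z: "Z \<in> sets H" for g Z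
  proof -
    have ZO: "Z \<in> sets \<Omega>" using Z HO by auto
    then have "Z \<inter> space \<Omega> = Z" using sets.sets_into_space by auto
    then show ?thesis using Z ZO by (subst emeasure_distr, simp, simp, subst emeasure_density) auto
  qed
  have "?N1 = ?N2"
  proof (rule measure_eqI_generator_eq[OF Int EPow])
    show "sets ?N1 = sigma_sets (space \<Omega>) E" "sets ?N2 = sigma_sets (space \<Omega>) E" by (simp_all add: setsH)
    show "range (\<lambda>i::nat. space \<Omega>) \<subseteq> E" "(\<Union>i::nat. space \<Omega>) = space \<Omega>" using spE by auto
    have spH': "space \<Omega> \<in> sets H" using spE by (simp add: setsH sigma_sets.Basic)
    have "emeasure ?N1 (space \<Omega>) = (\<integral>\<^sup>+w. ennreal (h (X k w)) * indicator (space \<Omega>) w \<partial>\<Omega>)"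
      using spH' by (subst em) auto
    also have "\<dots> \<le> (\<integral>\<^sup>+w. 1 \<partial>\<Omega>)"
      using hb by (intro nn_integral_mono) (auto split: split_indicator)
    finally have "emeasure ?N1 (space \<Omega>) \<le> (\<integral>\<^sup>+w. 1 \<partial>\<Omega>)" .
    then show "emeasure ?N1 (space \<Omega>) \<noteq> \<infinity>" by (auto simp: emeasure_space_1 top_unique)
    fix Z assume "Z \<in> E"
    then obtain A C where Z: "Z = B A \<inter> C" "\<forall>i. A i \<in> sets borel" "C \<in> sets \<G>" by (auto simp: E_def)
    have ZH: "Z \<in> sets H" unfolding setsH using \<open>Z \<in> E\<close> by (rule sigma_sets.Basic)
    have [measurable]: "A i \<in> sets borel" for i using Z(2) by simp
    have BD[measurable]: "B A \<in> sets ?D"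
    proof -
      have "B A = {w\<in>space ?D. \<forall>i\<in>{..k}. Y i w \<in> A i}" by (auto simp: B_def space_sigma_gen)
      also have "\<dots> \<in> sets ?D" by measurable
      finally show ?thesis .
    qed
    note indep = nn_integral_indep_indicator[OF ind space_sigma_gen Z(3)]
    have "emeasure ?N1 Z = (\<integral>\<^sup>+w. (ennreal (h (X k w)) * indicator (B A) w) * indicator C w \<partial>\<Omega>)"
      using ZH by (subst em) (auto simp: Z(1) indicator_inter_arith mult.assoc)
    also have "\<dots> = emeasure \<Omega> C * (\<integral>\<^sup>+w. ennreal (h (X k w)) * indicator (B A) w \<partial>\<Omega>)"
      by (rule indep) measurable
    also have "(\<integral>\<^sup>+w. ennreal (h (X k w)) * indicator (B A) w \<partial>\<Omega>) = (\<integral>\<^sup>+w. ennreal (r k h (Ys w)) * indicator (B A) w \<partial>\<Omega>)"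
      unfolding B_def by (rule r_law[OF h hb]) simp
    also have "emeasure \<Omega> C * \<dots> = (\<integral>\<^sup>+w. (ennreal (r k h (Ys w)) * indicator (B A) w) * indicator C w \<partial>\<Omega>)"
      by (rule indep[symmetric]) measurable
    also have "\<dots> = emeasure ?N2 Z"
      using ZH by (subst em) (auto simp: Z(1) indicator_inter_arith mult.assoc)
    finally show "emeasure ?N1 Z = emeasure ?N2 Z" .
  qed
  then have "(\<integral>\<^sup>+w. ennreal (V w) \<partial>?N1) = (\<integral>\<^sup>+w. ennreal (V w) \<partial>?N2)" by simp
  moreover have "(\<integral>\<^sup>+w. ennreal (V w) \<partial>distr (density \<Omega> (\<lambda>w. ennreal (g w))) H (\<lambda>x. x)) = ennreal (\<integral>w. g w * V w \<partial>\<Omega>)"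
    if [measurable]: "g \<in> borel_measurable \<Omega>" and g: "\<And>w. 0 \<le> g w" "\<And>w. g w \<le> 1" for g
  proof -
    have [measurable]: "V \<in> borel_measurable H" using V by (simp add: H_def)
    have "(\<integral>\<^sup>+w. ennreal (V w) \<partial>distr (density \<Omega> (\<lambda>w. ennreal (g w))) H (\<lambda>x. x)) = (\<integral>\<^sup>+w. ennreal (g w) * ennreal (V w) \<partial>\<Omega>)"
      by (subst nn_integral_distr, simp, simp, subst nn_integral_density) auto
    also have "\<dots> = (\<integral>\<^sup>+w. ennreal (g w * V w) \<partial>\<Omega>)" using g Vb by (simp add: ennreal_mult)
    also have "\<dots> = ennreal (\<integral>w. g w * V w \<partial>\<Omega>)"
    proof (rule nn_integral_eq_integral)
      show "integrable \<Omega> (\<lambda>w. g w * V w)"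
      proof (intro integrable_const_bound[where B=1] AE_I2)
        fix w show "norm (g w * V w) \<le> 1" using mult_le_one[OF g(2) Vb(1) Vb(2), of w w] g(1)[of w] Vb(1)[of w] by simp
      qed measurable
    qed (use g Vb in auto)
    finally show ?thesis .
  qed
  note eq = this
  have e1: "(\<integral>\<^sup>+w. ennreal (V w) \<partial>?N1) = ennreal (\<integral>w. h (X k w) * V w \<partial>\<Omega>)" by (rule eq) (auto simp: hb)
  have e2: "(\<integral>\<^sup>+w. ennreal (V w) \<partial>?N2) = ennreal (\<integral>w. r k h (Ys w) * V w \<partial>\<Omega>)" by (rule eq) (auto simp: r_bounds[OF hb])
  have n: "0 \<le> (\<integral>w. h (X k w) * V w \<partial>\<Omega>)" "0 \<le> (\<integral>w. r k h (Ys w) * V w \<partial>\<Omega>)"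
    using hb Vb r_bounds[OF hb] by (auto intro!: integral_nonneg_AE)
  show "(\<integral>w. h (X k w) * V w \<partial>\<Omega>) = (\<integral>w. r k h (Ys w) * V w \<partial>\<Omega>)"
    using \<open>?N1 = ?N2\<close> e1 e2 n by simp
qed

end

section \<open>Mean square error for one test function\<close>

locale hmm_test = hmm_model P \<phi> \<Upsilon> \<Omega> X Y \<mu> \<Phi> + filter_real_test P \<phi> \<Upsilon> fr
  for P :: "'e::polish_space \<Rightarrow> 'e measure" and \<phi> :: "'f::polish_space measure" and \<Upsilon> :: "'e \<Rightarrow> 'f \<Rightarrow> real"
    and \<Omega> :: "'o measure" and X :: "nat \<Rightarrow> 'o \<Rightarrow> 'e" and Y :: "nat \<Rightarrow> 'o \<Rightarrow> 'f" and \<mu> :: "'e prob_meas"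
    and \<Phi> :: "'e \<Rightarrow> 'f measure" and fr :: "'e \<Rightarrow> real"
begin

lemma r_square: "(\<integral>w. (r k fr (Ys w))\<^sup>2 \<partial>\<Omega>) = R \<mu> k"
proof -
  interpret prob_space \<Omega> by (rule prob_Omega)
  note rb = r_bounds[of fr, OF fr_bounds]
  have "(\<integral>\<^sup>+w. ennreal 1 * ennreal ((r k fr (Ys w))\<^sup>2) \<partial>\<Omega>) = (\<integral>\<^sup>+s. num k (\<lambda>_. ennreal 1) s * ennreal ((r k fr s)\<^sup>2) \<partial>S)"
    by (rule observation_law) (auto simp: r_trunc)
  also have "\<dots> = (\<integral>\<^sup>+s. ennreal (rt (num k (\<lambda>x. ennreal (fr x)) s) (num k (\<lambda>_. 1) s)) \<partial>S)"
    using AE_S_num_finite[of k]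
  proof (intro nn_integral_cong_AE, eventually_elim)
    case (elim s)
    obtain b where b: "num k (\<lambda>_. 1) s = ennreal b" "0 < b"
      using elim num_pos[of k s] by (cases "num k (\<lambda>_. 1) s") auto
    then show ?case by (simp add: r_def sqr_def ennreal_mult[symmetric] power2_eq_square)
  qed
  also have "\<dots> = (\<integral>\<^sup>+y. \<integral>\<^sup>+s. ennreal (rt (num k (\<lambda>x. ennreal (fr x)) (y ## s)) (num k (\<lambda>_. 1) (y ## s))) \<partial>S \<partial>\<phi>)"
    by (rule nn_integral_S) measurable
  also have "\<dots> = ennreal (R \<mu> k)"
    by (simp add: num_dn nn_integral_Im_dn(1))
  finally have "(\<integral>\<^sup>+w. ennreal ((r k fr (Ys w))\<^sup>2) \<partial>\<Omega>) = ennreal (R \<mu> k)" by simp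
  moreover have "(\<integral>w. (r k fr (Ys w))\<^sup>2 \<partial>\<Omega>) = enn2real (\<integral>\<^sup>+w. ennreal ((r k fr (Ys w))\<^sup>2) \<partial>\<Omega>)"
    by (rule integral_eq_nn_integral) auto
  ultimately show ?thesis using R_nonneg by simp
qed

lemma integral_fr_bounds: "0 \<le> (\<integral>x. fr x \<partial>meas_of \<nu>)" "(\<integral>x. fr x \<partial>meas_of \<nu>) \<le> 1"
proof -
  interpret p: prob_space "meas_of \<nu>" by (rule prob_meas_D)
  show "0 \<le> (\<integral>x. fr x \<partial>meas_of \<nu>)" using fr_bounds by (intro integral_nonneg_AE) auto
  show "(\<integral>x. fr x \<partial>meas_of \<nu>) \<le> 1" using fr_bounds
    by (intro p.integral_le_const p.integrable_const_bound[where B=1]) (auto simp: measurable_fmeas[OF fmeas_meas_of])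
qed

text \<open>The approximate estimate is measurable with respect to the observations and the
  independent field, so in the cross term the exact estimate may be replaced by fr(X_k). Apart from
  \<open>R\<close> only the pair (X_k, p_k) remains, and this pair is a Markov process.\<close>

lemma mean_square_error:
  assumes ap: "approximate_filter \<Omega> X Y \<G> p m K"
  shows "(\<integral>w. ((\<integral>x. fr x \<partial>meas_of (p k w)) - r k fr (Ys w))\<^sup>2 \<partial>\<Omega>) = (\<integral>w. Fp 0 (X k w, p k w) \<partial>\<Omega>) + R \<mu> k"
    and "(\<lambda>w. \<integral>x. fr x \<partial>meas_of (p k w)) \<in> borel_measurable \<Omega>"
proof -
  interpret prob_space \<Omega> by (rule prob_Omega)
  note rb = r_bounds[of fr, OF fr_bounds]
  define a where "a w = (\<integral>x. fr x \<partial>meas_of (p k w))" for w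
  have ab: "0 \<le> a w" "a w \<le> 1" for w
    unfolding a_def by (rule integral_fr_bounds)+
  have pH: "p k \<in> borel_measurable (sigma (space \<Omega>) (sets (sigma_gen \<Omega> Y {..k}) \<union> sets \<G>))"
    and sub: "subalgebra \<Omega> \<G>"
    and ind: "prob_space.indep_set \<Omega> (sets \<G>) (sets (sigma_gen \<Omega> (\<lambda>k w. (X k w, Y k w)) UNIV))"
    using ap by (auto simp: approximate_filter_def)
  have "(\<lambda>\<nu>. \<integral>x. fr x \<partial>meas_of \<nu>) \<in> borel_measurable borel"
    using fr_bounds by (intro borel_measurable_continuous_onI continuous_integral[OF fr_cont, where B=1]) auto
  then have aH: "a \<in> borel_measurable (sigma (space \<Omega>) (sets (sigma_gen \<Omega> Y {..k}) \<union> sets \<G>))"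
    unfolding a_def[abs_def] by (rule measurable_compose[OF pH])
  note cl = conditional_law[OF fr_measurable fr_bounds sub ind aH ab]
  note [measurable] = cl(2)
  show "(\<lambda>w. \<integral>x. fr x \<partial>meas_of (p k w)) \<in> borel_measurable \<Omega>" using cl(2) by (simp add: a_def[abs_def])
  have i: "integrable \<Omega> g" if [measurable]: "g \<in> borel_measurable \<Omega>" and "\<And>w. 0 \<le> g w \<and> g w \<le> 1" for g :: "'o \<Rightarrow> real"
    using that(2) by (intro integrable_const_bound[where B=1]) auto
  have ia: "integrable \<Omega> (\<lambda>w. (a w)\<^sup>2)" using ab by (intro i) (auto simp: power_le_one)
  have ir: "integrable \<Omega> (\<lambda>w. (r k fr (Ys w))\<^sup>2)" using rb by (intro i) (auto simp: power_le_one)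
  have iar: "integrable \<Omega> (\<lambda>w. r k fr (Ys w) * a w)" using rb ab by (intro i) (auto intro: mult_le_one)
  have iaf: "integrable \<Omega> (\<lambda>w. fr (X k w) * a w)" using fr_bounds ab by (intro i) (auto intro: mult_le_one)
  have "(\<integral>w. (a w - r k fr (Ys w))\<^sup>2 \<partial>\<Omega>) = (\<integral>w. ((a w)\<^sup>2 - 2 * (r k fr (Ys w) * a w)) + (r k fr (Ys w))\<^sup>2 \<partial>\<Omega>)"
    by (intro Bochner_Integration.integral_cong) (auto simp: power2_diff)
  also have "\<dots> = ((\<integral>w. (a w)\<^sup>2 \<partial>\<Omega>) - 2 * (\<integral>w. r k fr (Ys w) * a w \<partial>\<Omega>)) + (\<integral>w. (r k fr (Ys w))\<^sup>2 \<partial>\<Omega>)"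
    using ia ir iar by simp
  also have "\<dots> = ((\<integral>w. (a w)\<^sup>2 \<partial>\<Omega>) - 2 * (\<integral>w. fr (X k w) * a w \<partial>\<Omega>)) + R \<mu> k"
    unfolding r_square cl(1) ..
  also have "(\<integral>w. (a w)\<^sup>2 \<partial>\<Omega>) - 2 * (\<integral>w. fr (X k w) * a w \<partial>\<Omega>) = (\<integral>w. (a w)\<^sup>2 - 2 * (fr (X k w) * a w) \<partial>\<Omega>)"
    using ia iaf by simp
  also have "\<dots> = (\<integral>w. Fp 0 (X k w, p k w) \<partial>\<Omega>)"
    by (simp add: Fp_0 a_def mult.assoc)
  finally show "(\<integral>w. ((\<integral>x. fr x \<partial>meas_of (p k w)) - r k fr (Ys w))\<^sup>2 \<partial>\<Omega>) = (\<integral>w. Fp 0 (X k w, p k w) \<partial>\<Omega>) + R \<mu> k"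
    by (simp add: a_def)
qed

end

text \<open>
  Replacing \<open>\<phi>\<close> by an equivalent probability measure and dividing \<open>\<Upsilon>\<close> by its density changes
  neither the filter nor its transition kernel.
\<close>

lemma nondegenerate_prob:
  fixes \<Phi> :: "'e::polish_space \<Rightarrow> 'f::polish_space measure"
  assumes nd: "nondegenerate_observations \<Phi> \<phi> \<Upsilon>"
    and P: "P \<in> borel \<rightarrow>\<^sub>M prob_algebra borel" and \<Phi>: "\<Phi> \<in> borel \<rightarrow>\<^sub>M prob_algebra borel"
  obtains \<phi>' \<Upsilon>' where "filter_model P \<phi>' \<Upsilon>'"
    "\<And>x A. A \<in> sets borel \<Longrightarrow> emeasure (\<Phi> x) A = (\<integral>\<^sup>+y\<in>A. ennreal (\<Upsilon>' x y) \<partial>\<phi>')"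
    "bayes_update \<Upsilon>' = (bayes_update \<Upsilon> :: 'f \<Rightarrow> 'e prob_meas \<Rightarrow> 'e prob_meas)"
    "filter_kernel \<Upsilon>' \<phi>' P = filter_kernel \<Upsilon> \<phi> P"
    "\<And>\<mu>. filter_init \<Upsilon>' \<phi>' \<mu> = filter_init \<Upsilon> \<phi> \<mu>"
proof -
  have s\<phi>[measurable_cong]: "sets \<phi> = sets borel" and sf: "sigma_finite_measure \<phi>"
    and Um[measurable]: "(\<lambda>(x, y). \<Upsilon> x y) \<in> borel_measurable (borel \<Otimes>\<^sub>M borel)"
    and Up: "\<And>x y. \<Upsilon> x y > 0"
    and \<Phi>d: "\<And>x A. A \<in> sets borel \<Longrightarrow> emeasure (\<Phi> x) A = (\<integral>\<^sup>+y\<in>A. ennreal (\<Upsilon> x y) \<partial>\<phi>)"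
    using nd unfolding nondegenerate_observations_def by auto
  interpret sigma_finite_measure \<phi> by fact
  have sp: "space \<phi> = UNIV" using sets_eq_imp_space_eq[OF s\<phi>] by simp
  \<comment> \<open>Sigma-finiteness provides a strictly positive integrable function; normalised,
    it becomes the density p of the new reference law.\<close>
  obtain h where h: "h \<in> borel_measurable \<phi>" "integral\<^sup>N \<phi> h \<noteq> \<infinity>" "\<And>y. 0 < h y \<and> h y < \<infinity>"
    using Ex_finite_integrable_function sp by auto
  note [measurable] = h(1)
  have \<Phi>p: "prob_space (\<Phi> x)" "sets (\<Phi> x) = sets borel" for x
    using measurable_space[OF \<Phi>, of x] by (auto simp: space_prob_algebra)
  have \<Phi>1: "(\<integral>\<^sup>+y. ennreal (\<Upsilon> x y) \<partial>\<phi>) = 1" for x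
  proof -
    have "emeasure (\<Phi> x) UNIV = 1"
      using prob_space.emeasure_space_1[OF \<Phi>p(1)[of x]] sets_eq_imp_space_eq[OF \<Phi>p(2)[of x]] by simp
    then show ?thesis using \<Phi>d[of UNIV x] by simp
  qed
  \<comment> \<open>\<open>\<phi>\<close> cannot be the zero measure, because \<Upsilon> x
    integrates to 1 against it.\<close>
  have h0: "integral\<^sup>N \<phi> h \<noteq> 0"
  proof
    assume "integral\<^sup>N \<phi> h = 0"
    then have "AE y in \<phi>. h y = 0" by (subst (asm) nn_integral_0_iff_AE) auto
    then have F: "AE y in \<phi>. False"
    proof eventually_elim
      case (elim y) then show False using h(3)[of y] by simp
    qed
    have "(\<integral>\<^sup>+y. ennreal (\<Upsilon> undefined y) \<partial>\<phi>) = (\<integral>\<^sup>+y. 0 \<partial>\<phi>)" by (rule nn_integral_cong_AE) (use F in eventually_elim, simp)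
    then show False using \<Phi>1[of undefined] by simp
  qed
  define c where "c = enn2real (integral\<^sup>N \<phi> h)"
  have c: "c > 0" "ennreal c = integral\<^sup>N \<phi> h"
    using h(2) h0 by (auto simp: c_def enn2real_positive_iff less_top[symmetric] zero_less_iff_neq_zero)
  define p where "p y = enn2real (h y) / c" for y
  have p0: "p y > 0" for y using h(3)[of y] c by (simp add: p_def enn2real_positive_iff)
  have pm[measurable]: "p \<in> borel_measurable borel" unfolding p_def using measurable_cong_sets[OF s\<phi> refl, of borel] h(1) by measurable
  have pi: "(\<integral>\<^sup>+y. ennreal (p y) \<partial>\<phi>) = 1"
  proof -
    have e: "ennreal (p y) = h y * ennreal (1 / c)" for y
      using h(3)[of y] c unfolding p_def by (cases "h y") (auto simp: ennreal_mult[symmetric])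
    have "(\<integral>\<^sup>+y. ennreal (p y) \<partial>\<phi>) = integral\<^sup>N \<phi> h * ennreal (1 / c)"
      unfolding e by (rule nn_integral_multc) measurable
    also have "\<dots> = 1" using c by (simp add: c(2)[symmetric] ennreal_mult[symmetric])
    finally show ?thesis .
  qed
  define \<phi>' where "\<phi>' = density \<phi> (\<lambda>y. ennreal (p y))"
  define \<Upsilon>' where "\<Upsilon>' x y = \<Upsilon> x y / p y" for x y
  have s\<phi>'[measurable_cong]: "sets \<phi>' = sets borel" by (simp add: \<phi>'_def s\<phi>)
  have sp': "space \<phi>' = UNIV" using sets_eq_imp_space_eq[OF s\<phi>'] by simp
  have prob': "prob_space \<phi>'"
  proof (rule prob_spaceI)
    have "emeasure \<phi>' UNIV = (\<integral>\<^sup>+y. ennreal (p y) \<partial>\<phi>)"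
      unfolding \<phi>'_def by (subst emeasure_density) (auto simp: s\<phi>)
    then show "emeasure \<phi>' (space \<phi>') = 1" using pi sp' by simp
  qed
  have Um'[measurable]: "(\<lambda>(x, y). \<Upsilon>' x y) \<in> borel_measurable (borel \<Otimes>\<^sub>M borel)"
    unfolding \<Upsilon>'_def[abs_def] split_beta' using Um by (simp add: split_beta')
  have Up': "\<Upsilon>' x y > 0" for x y using Up p0 by (simp add: \<Upsilon>'_def)
  have mult: "ennreal (p y) * ennreal (\<Upsilon>' x y) = ennreal (\<Upsilon> x y)" for x y
    using p0[of y] Up[of x y] by (simp add: \<Upsilon>'_def ennreal_mult[symmetric])
  have Umx[measurable]: "\<Upsilon>' x \<in> borel_measurable borel" for x
    using measurable_compose[OF _ Um', of "\<lambda>y. (x, y)"] by simp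
  have d: "emeasure (\<Phi> x) A = (\<integral>\<^sup>+y\<in>A. ennreal (\<Upsilon>' x y) \<partial>\<phi>')" if [measurable]: "A \<in> sets borel" for x A
    unfolding \<Phi>d[OF that] \<phi>'_def
    by (subst nn_integral_density) (auto simp: mult[symmetric] mult.assoc s\<phi> cong: measurable_cong_sets)
  have norm: "(\<integral>\<^sup>+y. ennreal (\<Upsilon>' x y) \<partial>\<phi>') = 1" for x
    unfolding \<phi>'_def by (subst nn_integral_density) (auto simp: mult \<Phi>1 cong: measurable_cong_sets)
  have b: "bayes_update \<Upsilon>' y \<pi> = bayes_update \<Upsilon> y \<pi>" for y and \<pi> :: "'e prob_meas"
  proof -
    note m = measurable_cong_sets[OF prob_meas_D(2) refl, of \<pi> borel]
    have Uy: "(\<lambda>x. \<Upsilon> x y) \<in> borel_measurable borel"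
      using measurable_compose[OF _ Um, of "\<lambda>x. (x, y)"] by simp
    have e: "ennreal (\<Upsilon>' x y) = ennreal (\<Upsilon> x y) * ennreal (1 / p y)" for x
      using p0[of y] Up[of x y] by (simp add: \<Upsilon>'_def ennreal_mult[symmetric])
    let ?Z = "\<integral>\<^sup>+x. ennreal (\<Upsilon> x y) \<partial>meas_of \<pi>"
    have Z: "(\<integral>\<^sup>+x. ennreal (\<Upsilon>' x y) \<partial>meas_of \<pi>) = ?Z * ennreal (1 / p y)"
      unfolding e using Uy by (intro nn_integral_multc) (simp add: m)
    have pos: "0 < ennreal (1 / p y)" "ennreal (1 / p y) < \<infinity>" using p0[of y] by auto
    have fin: "?Z * ennreal (1 / p y) < \<infinity> \<longleftrightarrow> ?Z < \<infinity>"
      using pos p0[of y] by (auto simp: ennreal_mult_less_top)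
    have q: "a * ennreal (1 / p y) / (?Z * ennreal (1 / p y)) = a / ?Z" for a
      using pos by (intro divide_mult_eq) auto
    show ?thesis unfolding bayes_update_def Let_def Z fin unfolding e q ..
  qed
  have u: "update_law \<Upsilon>' \<phi>' \<nu> \<rho> = update_law \<Upsilon> \<phi> \<nu> \<rho>" if \<nu>: "prob_space \<nu>" "sets \<nu> = sets borel" for \<nu> and \<rho> :: "'e prob_meas"
  proof -
    have [measurable_cong]: "sets \<nu> = sets borel" by (rule \<nu>)
    have "\<nu> \<Otimes>\<^sub>M \<phi>' = density \<nu> (\<lambda>_. 1) \<Otimes>\<^sub>M density \<phi> (\<lambda>y. ennreal (p y))" by (simp add: \<phi>'_def density_1)
    also have "\<dots> = density (\<nu> \<Otimes>\<^sub>M \<phi>) (\<lambda>(x, y). 1 * ennreal (p y))"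
      using prob_space_imp_sigma_finite[OF prob'] by (intro pair_measure_density sf) (auto simp: \<phi>'_def)
    finally have "density (\<nu> \<Otimes>\<^sub>M \<phi>') (\<lambda>(x, y). ennreal (\<Upsilon>' x y)) =
      density (density (\<nu> \<Otimes>\<^sub>M \<phi>) (\<lambda>(x, y). ennreal (p y))) (\<lambda>(x, y). ennreal (\<Upsilon>' x y))" by simp
    also have "\<dots> = density (\<nu> \<Otimes>\<^sub>M \<phi>) (\<lambda>(x, y). ennreal (\<Upsilon> x y))"
      by (subst density_density_eq) (auto simp: mult split_beta')
    finally show ?thesis unfolding update_law_def b by simp
  qed
  have Pp: "prob_space (P x)" "sets (P x) = sets borel" for x
    using measurable_space[OF P, of x] by (auto simp: space_prob_algebra)
  show ?thesis
  proof
    show "filter_model P \<phi>' \<Upsilon>'"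
      by (rule filter_model.intro) (fact P prob' s\<phi>' Um' Up' norm)+
    show "bayes_update \<Upsilon>' = bayes_update \<Upsilon>" using b by (intro ext)
    show "filter_kernel \<Upsilon>' \<phi>' P = filter_kernel \<Upsilon> \<phi> P"
      unfolding filter_kernel_def by (simp add: u[OF Pp] split_beta')
    show "filter_init \<Upsilon>' \<phi>' \<mu> = filter_init \<Upsilon> \<phi> \<mu>" for \<mu>
      unfolding filter_init_def by (simp add: u prob_meas_D)
  qed (rule d)
qed

lemma tv_dist_ge:
  fixes \<nu> :: "'a::topological_space prob_meas"
  assumes f: "f \<in> borel_measurable borel" "\<And>x. \<bar>f x\<bar> \<le> (1::real)"
  shows "\<bar>(\<integral>x. f x \<partial>meas_of \<nu>) - (\<integral>x. f x \<partial>meas_of \<nu>')\<bar> \<le> tv_dist \<nu> \<nu>'"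
  unfolding tv_dist_def
proof (rule cSUP_upper)
  have b: "\<bar>\<integral>x. g x \<partial>meas_of \<nu>\<bar> \<le> 1" if g: "g \<in> borel_measurable borel" "\<And>x. \<bar>g x\<bar> \<le> 1" for g :: "'a \<Rightarrow> real" and \<nu> :: "'a prob_meas"
  proof -
    interpret prob_space "meas_of \<nu>" by (rule prob_meas_D)
    have "g \<in> borel_measurable (meas_of \<nu>)" using g(1) by (simp add: measurable_fmeas[OF fmeas_meas_of])
    then have i: "integrable (meas_of \<nu>) g" using g(2) by (intro integrable_const_bound[where B=1] AE_I2) auto
    have "\<bar>\<integral>x. g x \<partial>meas_of \<nu>\<bar> \<le> (\<integral>x. \<bar>g x\<bar> \<partial>meas_of \<nu>)" by (rule integral_abs_bound)
    also have "\<dots> \<le> 1" using i g by (intro integral_le_const) auto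
    finally show ?thesis .
  qed
  show "bdd_above ((\<lambda>f. \<bar>(\<integral>x. f x \<partial>meas_of \<nu>) - (\<integral>x. f x \<partial>meas_of \<nu>')\<bar>) ` {f \<in> borel_measurable borel. \<forall>x. \<bar>f x\<bar> \<le> (1::real)})"
  proof (rule bdd_aboveI2)
    fix g assume g: "g \<in> {f \<in> borel_measurable (borel :: 'a measure). \<forall>x. \<bar>f x\<bar> \<le> (1::real)}"
    show "\<bar>(\<integral>x. g x \<partial>meas_of \<nu>) - (\<integral>x. g x \<partial>meas_of \<nu>')\<bar> \<le> 2"
      using b[of g \<nu>] b[of g \<nu>'] g by auto
  qed
qed (use f in auto)

lemma (in filter_model) ergodic_tv:
  assumes "ergodic_kernel P"
  obtains lam where "fmeas lam" "measure lam UNIV = 1" "push lam = lam"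
    "\<And>\<rho>. fmeas \<rho> \<Longrightarrow> measure \<rho> UNIV = 1 \<Longrightarrow> \<exists>\<delta>. \<delta> \<longlonglongrightarrow> 0 \<and> (\<forall>j. tvle (\<delta> j) ((push ^^ j) \<rho>) lam)"
proof -
  obtain l where l: "kernel_step P l = l" "\<And>\<nu>. (\<lambda>k. tv_dist ((kernel_step P ^^ k) \<nu>) l) \<longlonglongrightarrow> 0"
    using assms unfolding ergodic_kernel_def by blast
  show ?thesis
  proof
    show "fmeas (meas_of l)" "measure (meas_of l) UNIV = 1" by (simp_all add: fmeas_meas_of measure_meas_of_UNIV)
    show "push (meas_of l) = meas_of l" using meas_of_kernel_step[of l] l(1) by simp
    fix \<rho> :: "'e measure" assume \<rho>: "fmeas \<rho>" "measure \<rho> UNIV = 1"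
    have p: "prob_space \<rho>" using fmeasD[OF \<rho>(1)] \<rho>(2)
      by (intro prob_spaceI) (simp add: finite_measure.emeasure_eq_measure)
    define \<nu> where "\<nu> = prob_meas_of \<rho>"
    have \<nu>: "meas_of \<nu> = \<rho>" unfolding \<nu>_def by (rule meas_of_prob_meas_of[OF p fmeasD(2)[OF \<rho>(1)]])
    have pw: "meas_of ((kernel_step P ^^ k) \<nu>) = (push ^^ k) \<rho>" for k
      by (induction k) (simp_all add: \<nu> meas_of_kernel_step)
    have "tvle (tv_dist ((kernel_step P ^^ k) \<nu>) l) ((push ^^ k) \<rho>) (meas_of l)" for k
      unfolding tvle_def pw[symmetric] by (auto intro!: tv_dist_ge)
    then show "\<exists>\<delta>. \<delta> \<longlonglongrightarrow> 0 \<and> (\<forall>j. tvle (\<delta> j) ((push ^^ j) \<rho>) (meas_of l))"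
      using l(2)[of \<nu>] by blast
  qed
qed

section \<open>Occupation laws of approximate filters\<close>

lemma Ulam:
  fixes \<rho> :: "'a::polish_space measure"
  assumes "prob_space \<rho>" "sets \<rho> = sets borel" "0 < \<eta>"
  obtains C where "compact C" "1 - \<eta> < measure \<rho> C"
proof -
  interpret prob_space \<rho> by fact
  have s: "space \<rho> = UNIV" using sets_eq_imp_space_eq[OF assms(2)] by simp
  have "ennreal (1 - \<eta>) < 1" using \<open>0 < \<eta>\<close> by simp
  also have "1 = emeasure \<rho> UNIV" using emeasure_space_1 s by simp
  also have "\<dots> = (SUP K \<in> {K. K \<subseteq> UNIV \<and> compact K}. emeasure \<rho> K)"
    by (rule inner_regular[OF assms(2)]) auto
  finally obtain K where K: "compact K" "ennreal (1 - \<eta>) < emeasure \<rho> K" by (auto simp: less_SUP_iff)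
  then have "1 - \<eta> < measure \<rho> K" by (simp add: emeasure_eq_measure ennreal_less_iff ennreal_lessI less_le_trans) 
      (metis ennreal_leI leD measure_nonneg not_le)
  then show ?thesis using that K(1) by blast
qed

context hmm_model
begin

lemma distr_X: "distr \<Omega> borel (X k) = (push ^^ k) (meas_of \<mu>)"
  by (induction k) (simp_all add: distr_X0 push_def markov_chain_distr[OF prob_Omega mcX P_kernel])

text \<open>From some k0 on the law of X_k is so close to \<open>lam\<close> in total variation that
  one compact set for \<open>lam\<close> serves; the finitely many earlier laws contribute compact
  sets of their own.\<close>

lemma X_tight:
  assumes lam: "fmeas lam" "measure lam UNIV = 1"
    and tv: "\<delta> \<longlonglongrightarrow> 0" "\<And>j. tvle (\<delta> j) ((push ^^ j) (meas_of \<mu>)) lam" and "0 < \<eta>"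
  obtains C where "compact C" "C \<noteq> {}" "\<And>k. 1 - \<eta> \<le> measure (distr \<Omega> borel (X k)) C"
proof -
  interpret prob_space \<Omega> by (rule prob_Omega)
  have lp: "prob_space lam" using fmeasD[OF lam(1)] lam(2)
    by (intro prob_spaceI) (simp add: finite_measure.emeasure_eq_measure)
  have Xp: "prob_space (distr \<Omega> borel (X k))" for k by (rule prob_space_distr) simp
  obtain C0 where C0: "compact C0" "1 - \<eta> / 2 < measure lam C0"
    using Ulam[OF lp fmeasD(2)[OF lam(1)], of "\<eta> / 2"] \<open>0 < \<eta>\<close> by auto
  obtain k0 where k0: "\<And>k. k \<ge> k0 \<Longrightarrow> \<delta> k < \<eta> / 2"
    using order_tendstoD(2)[OF tv(1), of "\<eta> / 2"] \<open>0 < \<eta>\<close> by (auto simp: eventually_sequentially)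
  have "\<forall>k. \<exists>C. compact C \<and> 1 - \<eta> < measure (distr \<Omega> borel (X k)) C"
    using Ulam[OF Xp _ \<open>0 < \<eta>\<close>] by (metis sets_distr)
  then obtain C where C: "\<And>k. compact (C k)" "\<And>k. 1 - \<eta> < measure (distr \<Omega> borel (X k)) (C k)" by metis
  \<comment> \<open>The point \<open>undefined\<close> makes K nonempty, as
    \<open>bl_dist_net\<close> requires.\<close>
  define K where "K = insert undefined (C0 \<union> (\<Union>k<k0. C k))"
  have K: "compact K" unfolding K_def using C0 C by (intro compact_insert compact_Un compact_UN) auto
  then have Kb: "K \<in> sets borel" by (intro borel_compact)
  have C0b: "C0 \<in> sets borel" using C0(1) by (intro borel_compact)
  show ?thesis
  proof
    fix k
    interpret Xk: prob_space "distr \<Omega> borel (X k)" by (rule Xp)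
    show "1 - \<eta> \<le> measure (distr \<Omega> borel (X k)) K"
    proof (cases "k < k0")
      case True
      then have "measure (distr \<Omega> borel (X k)) (C k) \<le> measure (distr \<Omega> borel (X k)) K"
        using Kb by (intro Xk.finite_measure_mono) (auto simp: K_def)
      then show ?thesis using C(2)[of k] by simp
    next
      case False
      have i: "(\<integral>x. indicator C0 x \<partial>\<rho>) = measure \<rho> C0" if "sets \<rho> = sets borel" for \<rho> :: "'e measure"
        using C0b sets_eq_imp_space_eq[OF that] by simp
      have "\<bar>(\<integral>x. indicator C0 x \<partial>(push ^^ k) (meas_of \<mu>)) - (\<integral>x. indicator C0 x \<partial>lam)\<bar> \<le> \<delta> k"
        using tv(2)[of k] unfolding tvle_def
        by (rule bspec[of _ _ "indicator C0", THEN mp]) (auto intro: borel_measurable_indicator C0b split: split_indicator)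
      then have "\<bar>measure (distr \<Omega> borel (X k)) C0 - measure lam C0\<bar> \<le> \<delta> k"
        unfolding distr_X[symmetric] i[OF fmeasD(2)[OF lam(1)]] i[OF sets_distr] .
      moreover have "measure (distr \<Omega> borel (X k)) C0 \<le> measure (distr \<Omega> borel (X k)) K"
        using Kb by (intro Xk.finite_measure_mono) (auto simp: K_def)
      ultimately show ?thesis using k0[of k] C0(2) False by linarith
    qed
  qed (use K in \<open>auto simp: K_def\<close>)
qed

end

locale approx_filters = hmm_model P \<phi> \<Upsilon> \<Omega> X Y \<mu> \<Phi>
  for P :: "'e::polish_space \<Rightarrow> 'e measure" and \<phi> :: "'f::polish_space measure" and \<Upsilon> :: "'e \<Rightarrow> 'f \<Rightarrow> real"
    and \<Omega> :: "'o measure" and X :: "nat \<Rightarrow> 'o \<Rightarrow> 'e" and Y :: "nat \<Rightarrow> 'o \<Rightarrow> 'f" and \<mu> :: "'e prob_meas"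
    and \<Phi> :: "'e \<Rightarrow> 'f measure" +
  fixes lam :: "'e measure" and \<G> :: "nat \<Rightarrow> 'o measure" and piN :: "nat \<Rightarrow> nat \<Rightarrow> 'o \<Rightarrow> 'e prob_meas"
    and MN :: "nat \<Rightarrow> ('e \<times> 'e prob_meas) prob_meas" and KN :: "nat \<Rightarrow> 'e \<times> 'e prob_meas \<Rightarrow> ('e \<times> 'e prob_meas) measure"
  assumes lam: "fmeas lam" "measure lam UNIV = 1" "push lam = lam"
    and tv_conv: "\<And>\<rho>. fmeas \<rho> \<Longrightarrow> measure \<rho> UNIV = 1 \<Longrightarrow> \<exists>\<delta>. \<delta> \<longlonglongrightarrow> 0 \<and> (\<forall>j. tvle (\<delta> j) ((push ^^ j) \<rho>) lam)"
    and approx: "\<And>N. approximate_filter \<Omega> X Y (\<G> N) (piN N) (MN N) (KN N)"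
    and one_step: "\<And>(F :: 'e \<times> 'e prob_meas \<Rightarrow> real) zs z. continuous_on UNIV F \<Longrightarrow> bounded (range F) \<Longrightarrow> zs \<longlonglongrightarrow> z \<Longrightarrow>
       (\<lambda>N. \<integral>w. F w \<partial>KN N (zs N)) \<longlonglongrightarrow> (\<integral>w. F w \<partial>filter_kernel \<Upsilon> \<phi> P z)"
    and initial: "MN \<longlonglongrightarrow> filter_init \<Upsilon> \<phi> \<mu>"
    and tight: "\<And>T :: nat \<Rightarrow> nat. mono T \<Longrightarrow> (\<And>N. T N \<ge> 1) \<Longrightarrow> filterlim T at_top sequentially \<Longrightarrow>
       tight_family (range (\<lambda>N. mean_occupation \<Omega> (piN N) (T N)))"
begin

abbreviation Z :: "nat \<Rightarrow> nat \<Rightarrow> 'o \<Rightarrow> 'e \<times> 'e prob_meas" where "Z N k w \<equiv> (X k w, piN N k w)"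

lemma mcZ: "markov_chain \<Omega> (MN N) (KN N) (Z N)"
  using approx[of N] by (simp add: approximate_filter_def)

lemma K_kernel: "KN N \<in> borel \<rightarrow>\<^sub>M prob_algebra borel"
  using approx[of N] by (simp add: approximate_filter_def)

lemma Z_measurable[measurable]: "Z N k \<in> borel_measurable \<Omega>"
  using mcZ[of N] by (simp add: markov_chain_def)

text \<open>The law of the pair at an independent time uniform on {1, ..., T}, which turns a time
  average into an integral under a single law.\<close>

definition occ :: "nat \<Rightarrow> nat \<Rightarrow> ('e \<times> 'e prob_meas) measure" where
  "occ N T = distr (measure_pmf (pmf_of_set {1..T}) \<Otimes>\<^sub>M \<Omega>) borel (\<lambda>(k, w). Z N k w)"

lemma occ_map_measurable:
  "(\<lambda>(k, w). Z N k w) \<in> measure_pmf (pmf_of_set {1..T}) \<Otimes>\<^sub>M \<Omega> \<rightarrow>\<^sub>M borel"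
proof -
  have "(\<lambda>(k, w). Z N k w) \<in> count_space UNIV \<Otimes>\<^sub>M \<Omega> \<rightarrow>\<^sub>M borel"
    by (rule measurable_pair_measure_countable1) (auto intro: Z_measurable)
  then show ?thesis by (subst measurable_cong_sets[OF sets_pair_measure_cong refl]) auto
qed

lemma occ_prob: "prob_space (occ N T)" "sets (occ N T) = sets borel"
proof -
  interpret prob_space \<Omega> by (rule prob_Omega)
  interpret pp: pair_prob_space "measure_pmf (pmf_of_set {1..T})" \<Omega> ..
  show "prob_space (occ N T)" unfolding occ_def by (rule pp.prob_space_distr[OF occ_map_measurable])
qed (simp add: occ_def)

lemma integral_occ:
  assumes g[measurable]: "g \<in> borel_measurable borel" and gb: "\<And>z. \<bar>g z\<bar> \<le> (C::real)" and T: "1 \<le> T"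
  shows "(\<integral>z. g z \<partial>occ N T) = (\<Sum>k=1..T. \<integral>\<omega>. g (Z N k \<omega>) \<partial>\<Omega>) / real T"
proof -
  interpret prob_space \<Omega> by (rule prob_Omega)
  interpret pp: pair_prob_space "measure_pmf (pmf_of_set {1..T})" \<Omega> ..
  have m: "(\<lambda>w. g ((\<lambda>(k, \<omega>). Z N k \<omega>) w)) \<in> borel_measurable (measure_pmf (pmf_of_set {1..T}) \<Otimes>\<^sub>M \<Omega>)"
    by (rule measurable_compose[OF occ_map_measurable g])
  have "(\<integral>z. g z \<partial>occ N T) = (\<integral>w. g ((\<lambda>(k, \<omega>). Z N k \<omega>) w) \<partial>(measure_pmf (pmf_of_set {1..T}) \<Otimes>\<^sub>M \<Omega>))"
    unfolding occ_def by (rule integral_distr[OF occ_map_measurable g])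
  also have "\<dots> = (\<integral>k. (\<integral>\<omega>. g ((\<lambda>(k, \<omega>). Z N k \<omega>) (k, \<omega>)) \<partial>\<Omega>) \<partial>measure_pmf (pmf_of_set {1..T}))"
    using gb m by (intro pp.integral_fst'[symmetric] pp.P.integrable_const_bound[where B=C] AE_I2) (auto simp: split_beta')
  also have "\<dots> = (\<Sum>k=1..T. \<integral>\<omega>. g (Z N k \<omega>) \<partial>\<Omega>) / real T"
    using T by (subst integral_pmf_of_set) auto
  finally show ?thesis .
qed

end

lemma measure_meas_of_measurable:
  fixes D :: "'a::polish_space set"
  assumes "D \<in> sets borel"
  shows "(\<lambda>\<nu>. measure (meas_of \<nu>) D) \<in> borel_measurable borel"
  by (rule measure_measurable_prob_algebra2[OF _ meas_of_measurable]) (use assms in measurable)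

context approx_filters
begin

lemma snd_measure_measurable:
  assumes "D \<in> sets borel"
  shows "(\<lambda>z :: 'e \<times> 'e prob_meas. measure (meas_of (snd z)) D) \<in> borel_measurable borel"
  by (rule measurable_compose[OF borel_measurable_continuous_onI[OF continuous_on_snd[OF continuous_on_id]] measure_meas_of_measurable[OF assms]])

lemma meas_of_le_1: "measure (meas_of \<nu>) D \<le> 1"
  using prob_space.prob_le_1[OF prob_meas_D(1)] .

text \<open>\<open>measure_of\<close> yields the zero measure if its set function is not countably
  additive. A positive value excludes this default, so countable additivity follows from the
  tightness hypothesis, which provides positive values.\<close>

lemma integral_occ_measure:
  assumes D: "D \<in> sets borel" and T: "1 \<le> T" and pos: "0 < measure (mean_occupation \<Omega> (piN N) T) D"
  shows "(\<integral>z. measure (meas_of (snd z)) D \<partial>occ N T) = measure (mean_occupation \<Omega> (piN N) T) D"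
proof -
  interpret prob_space \<Omega> by (rule prob_Omega)
  have m: "(\<lambda>w. measure (meas_of (piN N k w)) D) \<in> borel_measurable \<Omega>" for k
    using measurable_compose[OF Z_measurable snd_measure_measurable[OF D], of k N] by simp
  have i: "integrable \<Omega> (\<lambda>w. measure (meas_of (piN N k w)) D)" for k
    using m meas_of_le_1 by (intro integrable_const_bound[where B=1] AE_I2) auto
  have "(\<integral>z. measure (meas_of (snd z)) D \<partial>occ N T) = (\<Sum>k=1..T. \<integral>w. measure (meas_of (piN N k w)) D \<partial>\<Omega>) / real T"
    using meas_of_le_1 by (subst integral_occ[OF snd_measure_measurable[OF D] _ T, of 1]) auto
  also have "\<dots> = (\<integral>w. (1 / real T) * (\<Sum>k=1..T. measure (meas_of (piN N k w)) D) \<partial>\<Omega>)"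
    using i by simp
  finally have e: "(\<integral>z. measure (meas_of (snd z)) D \<partial>occ N T) = (\<integral>w. (1 / real T) * (\<Sum>k=1..T. measure (meas_of (piN N k w)) D) \<partial>\<Omega>)" .
  let ?v = "\<lambda>A. ennreal (\<integral>w. (1 / real T) * (\<Sum>k=1..T. measure (meas_of (piN N k w)) A) \<partial>\<Omega>)"
  have "emeasure (mean_occupation \<Omega> (piN N) T) D = ?v D \<or> emeasure (mean_occupation \<Omega> (piN N) T) D = 0"
    unfolding mean_occupation_def by (subst (1 2) emeasure_measure_of_conv) auto
  then have "emeasure (mean_occupation \<Omega> (piN N) T) D = ?v D" using pos by (auto simp: measure_def)
  moreover have "0 \<le> (\<integral>w. (1 / real T) * (\<Sum>k=1..T. measure (meas_of (piN N k w)) D) \<partial>\<Omega>)"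
    by (intro integral_nonneg_AE AE_I2 mult_nonneg_nonneg sum_nonneg) auto
  ultimately show ?thesis unfolding e measure_def[of "mean_occupation \<Omega> (piN N) T"] by simp
qed

lemma occ_fst:
  assumes C: "C \<in> sets borel" and T: "1 \<le> T" and le: "\<And>k. 1 - \<eta> \<le> measure (distr \<Omega> borel (X k)) C"
  shows "measure (occ N T) {z. fst z \<notin> C} \<le> \<eta>"
proof -
  interpret prob_space \<Omega> by (rule prob_Omega)
  have fm: "(fst :: 'e \<times> 'e prob_meas \<Rightarrow> 'e) \<in> borel_measurable borel"
    by (intro borel_measurable_continuous_onI continuous_on_fst continuous_on_id)
  have "{z :: 'e \<times> 'e prob_meas. fst z \<notin> C} = fst -` (- C) \<inter> space borel" by auto
  also have "\<dots> \<in> sets borel" by (rule measurable_sets[OF fm]) (use C in auto)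
  finally have s: "{z :: 'e \<times> 'e prob_meas. fst z \<notin> C} \<in> sets borel" .
  have "measure (occ N T) {z. fst z \<notin> C} = (\<integral>z. indicator {z. fst z \<notin> C} z \<partial>occ N T)"
    using s sets_eq_imp_space_eq[OF occ_prob(2)[of N T]] by simp
  also have "\<dots> = (\<Sum>k=1..T. \<integral>w. indicator {z. fst z \<notin> C} (Z N k w) \<partial>\<Omega>) / real T"
    using s T by (intro integral_occ[of _ 1]) (auto split: split_indicator)
  also have "\<dots> \<le> (\<Sum>k=1..T. \<eta>) / real T"
  proof (intro divide_right_mono sum_mono)
    fix k
    interpret Xk: prob_space "distr \<Omega> borel (X k)" by (rule prob_space_distr) simp
    have "(\<integral>w. indicator {z. fst z \<notin> C} (Z N k w) \<partial>\<Omega>) = (\<integral>w. indicator (- C) (X k w) \<partial>\<Omega> :: real)"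
      by (intro Bochner_Integration.integral_cong) (auto split: split_indicator)
    also have "\<dots> = (\<integral>x. indicator (- C) x \<partial>distr \<Omega> borel (X k))"
      using C by (subst integral_distr) auto
    also have "\<dots> = measure (distr \<Omega> borel (X k)) (- C)" by simp
    also have "\<dots> = 1 - measure (distr \<Omega> borel (X k)) C"
      using Xk.prob_compl[of C] C by (simp add: Compl_eq_Diff_UNIV)
    finally show "(\<integral>w. indicator {z. fst z \<notin> C} (Z N k w) \<partial>\<Omega>) \<le> \<eta>" using le[of k] by simp
  qed simp
  also have "\<dots> = \<eta>" using T by simp
  finally show ?thesis .
qed

text \<open>Markov's inequality for 1 - \<nu>(D), whose mean under the occupation law is below
  \<epsilon>. It turns tightness of mean measures into tightness of laws of random measures.\<close>

lemma occ_snd: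
  assumes D: "D \<in> sets borel" and T: "1 \<le> T" and \<epsilon>: "\<epsilon> < 1" "1 - \<epsilon> < measure (mean_occupation \<Omega> (piN N) T) D"
  shows "{z. measure (meas_of (snd z)) D < 1 - 1 / real (Suc j)} \<in> sets (occ N T)"
    and "measure (occ N T) {z. measure (meas_of (snd z)) D < 1 - 1 / real (Suc j)} \<le> real (Suc j) * \<epsilon>"
proof -
  interpret prob_space "occ N T" by (rule occ_prob)
  note so = occ_prob(2)[of N T]
  let ?g = "\<lambda>z :: 'e \<times> 'e prob_meas. measure (meas_of (snd z)) D"
  let ?A = "{z. ?g z < 1 - 1 / real (Suc j)}"
  note [measurable] = snd_measure_measurable[OF D]
  have gm: "?g \<in> borel_measurable (occ N T)" using so by (simp cong: measurable_cong_sets)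
  have "?A = ?g -` {..< 1 - 1 / real (Suc j)} \<inter> space borel" by auto
  also have "\<dots> \<in> sets borel" by measurable
  finally show A: "?A \<in> sets (occ N T)" using so by simp
  have i: "integrable (occ N T) ?g" using gm meas_of_le_1 by (intro integrable_const_bound[where B=1] AE_I2) auto
  have "measure (occ N T) ?A = (\<integral>z. indicator ?A z \<partial>occ N T)"
    using A sets.sets_into_space[OF A] by (simp add: Int_absorb2)
  also have "\<dots> \<le> (\<integral>z. real (Suc j) * (1 - ?g z) \<partial>occ N T)"
  proof (rule integral_mono)
    fix z
    show "indicator ?A z \<le> real (Suc j) * (1 - ?g z)"
    proof (cases "z \<in> ?A")
      case True
      then have "1 / real (Suc j) \<le> 1 - ?g z" by simp
      then have "real (Suc j) * (1 / real (Suc j)) \<le> real (Suc j) * (1 - ?g z)" by (intro mult_left_mono) auto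
      then show ?thesis using True by simp
    next
      case False
      then show ?thesis using meas_of_le_1[of "snd z" D] by simp
    qed
  qed (use A i in \<open>auto simp: emeasure_eq_measure intro!: integrable_real_indicator\<close>)
  also have "\<dots> = real (Suc j) * (1 - (\<integral>z. ?g z \<partial>occ N T))" using i prob_space by simp
  also have "\<dots> \<le> real (Suc j) * \<epsilon>"
    using \<epsilon> by (intro mult_left_mono) (auto simp: integral_occ_measure[OF D T])
  finally show "measure (occ N T) ?A \<le> real (Suc j) * \<epsilon>" .
qed

text \<open>A compact set in P(E) needs a whole sequence of compact sets D m j
  (\<open>compact_tight_set\<close>), with errors summable in j. The signal coordinate is tight by
  ergodicity.\<close>

lemma occ_tight:
  assumes T: "mono T" "\<And>N. 1 \<le> T N" "filterlim T at_top sequentially"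
  obtains K where "\<And>m. compact (K m)" "\<And>N m. 1 - 1 / real (Suc m) \<le> measure (occ N (T N)) (K m)"
proof -
  obtain \<delta> where \<delta>: "\<delta> \<longlonglongrightarrow> 0" "\<And>j. tvle (\<delta> j) ((push ^^ j) (meas_of \<mu>)) lam"
    using tv_conv[OF fmeas_meas_of measure_meas_of_UNIV(1), of \<mu>] by blast
  have "\<exists>C. compact C \<and> (\<forall>k. 1 - 1 / (2 * real (Suc m)) \<le> measure (distr \<Omega> borel (X k)) C)" for m
    using X_tight[OF lam(1,2) \<delta>, of "1 / (2 * real (Suc m))"] by (metis divide_pos_pos mult_pos_pos of_nat_0_less_iff zero_less_Suc zero_less_numeral zero_less_one)
  then obtain C where C: "\<And>m. compact (C m)" "\<And>m k. 1 - 1 / (2 * real (Suc m)) \<le> measure (distr \<Omega> borel (X k)) (C m)" by metis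
  \<comment> \<open>Markov's inequality multiplies by j + 1, leaving 1/(4 (m + 1) 2^j) with sum 1/(2
    (m + 1)) over j; the signal takes the other half of 1/(m + 1).\<close>
  define \<epsilon> where "\<epsilon> m j = 1 / (4 * real (Suc m) * 2 ^ j * real (Suc j))" for m j :: nat
  have \<epsilon>: "0 < \<epsilon> m j" "\<epsilon> m j < 1" for m j
  proof -
    have "1 \<le> real (Suc m) * (2 ^ j * real (Suc j))" by (intro mult_ge1_I) auto
    then have "1 < 4 * real (Suc m) * 2 ^ j * real (Suc j)" by (simp only: mult.assoc)
    then show "0 < \<epsilon> m j" "\<epsilon> m j < 1" unfolding \<epsilon>_def by (auto simp del: of_nat_Suc)
  qed
  have "\<exists>D. compact D \<and> (\<forall>N. 1 - \<epsilon> m j < measure (mean_occupation \<Omega> (piN N) (T N)) D)" for m j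
    using tight[OF T] \<epsilon>(1)[of m j] unfolding tight_family_def by auto
  then obtain D where D: "\<And>m j. compact (D m j)" "\<And>m j N. 1 - \<epsilon> m j < measure (mean_occupation \<Omega> (piN N) (T N)) (D m j)" by metis
  define V where "V m = {\<nu> :: 'e prob_meas. \<forall>j. 1 - 1 / real (Suc j) \<le> measure (meas_of \<nu>) (D m j)}" for m
  have V: "compact (V m)" for m unfolding V_def by (rule compact_tight_set) (rule D)
  show ?thesis
  proof
    fix m show cK: "compact (C m \<times> V m)" by (intro compact_Times C V)
    fix N
    let ?O = "occ N (T N)"
    interpret prob_space ?O by (rule occ_prob)
    note so = occ_prob(2)[of N "T N"]
    let ?A = "\<lambda>j. {z. measure (meas_of (snd z)) (D m j) < 1 - 1 / real (Suc j)}"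
    have Db: "D m j \<in> sets borel" for j by (rule borel_compact[OF D(1)])
    note os = occ_snd[OF Db T(2) \<epsilon>(2) D(2)]
    have b: "measure ?O (?A j) \<le> 1 / (4 * real (Suc m)) * (1 / 2) ^ j" for j
    proof -
      have "measure ?O (?A j) \<le> real (Suc j) * \<epsilon> m j" by (rule os(2))
      also have "\<dots> = 1 / (4 * real (Suc m)) * (1 / 2) ^ j"
        unfolding \<epsilon>_def by (simp add: field_simps del: of_nat_Suc)
      finally show ?thesis .
    qed
    have sg: "summable (\<lambda>j. 1 / (4 * real (Suc m)) * (1 / 2) ^ j)" by (intro summable_mult summable_geometric) simp
    have s: "summable (\<lambda>j. measure ?O (?A j))"
      by (rule summable_comparison_test[OF _ sg]) (use b in auto)
    have "measure ?O (\<Union>j. ?A j) \<le> (\<Sum>j. measure ?O (?A j))"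
      using os(1) s by (intro finite_measure_subadditive_countably) auto
    also have "\<dots> \<le> (\<Sum>j. 1 / (4 * real (Suc m)) * (1 / 2) ^ j)" by (rule suminf_le[OF b s sg])
    also have "\<dots> = 1 / (4 * real (Suc m)) * 2" by (subst suminf_mult) (auto simp: suminf_geometric)
    finally have 2: "measure ?O (\<Union>j. ?A j) \<le> 1 / (2 * real (Suc m))" by (simp del: of_nat_Suc)
    have 1: "measure ?O {z. fst z \<notin> C m} \<le> 1 / (2 * real (Suc m))"
      by (rule occ_fst[OF borel_compact[OF C(1)] T(2) C(2)])
    have Kb: "C m \<times> V m \<in> sets ?O" using borel_compact[OF cK] so by simp
    have "space ?O = UNIV" using sets_eq_imp_space_eq[OF so] by simp
    then have "1 - measure ?O (C m \<times> V m) = measure ?O (- (C m \<times> V m))"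
      using prob_compl[OF Kb] by (simp add: Compl_eq_Diff_UNIV)
    also have "- (C m \<times> V m) = {z. fst z \<notin> C m} \<union> (\<Union>j. ?A j)" unfolding V_def not_less[symmetric] by (intro set_eqI, unfold mem_Times_iff Compl_iff Un_iff UN_iff mem_Collect_eq) blast
    also have "measure ?O ({z. fst z \<notin> C m} \<union> (\<Union>j. ?A j)) \<le> measure ?O {z. fst z \<notin> C m} + measure ?O (\<Union>j. ?A j)"
    proof (rule measure_Un_le)
      have fm: "(fst :: 'e \<times> 'e prob_meas \<Rightarrow> 'e) \<in> borel_measurable borel"
        by (intro borel_measurable_continuous_onI continuous_on_fst continuous_on_id)
      have "{z :: 'e \<times> 'e prob_meas. fst z \<notin> C m} = fst -` (- C m) \<inter> space borel" by auto
      also have "\<dots> \<in> sets borel" by (rule measurable_sets[OF fm]) (use borel_compact[OF C(1)] in auto)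
      finally show "{z. fst z \<notin> C m} \<in> events" using so by simp
    qed (use os(1) in auto)
    finally have 3: "1 - measure ?O (C m \<times> V m) \<le> measure ?O {z. fst z \<notin> C m} + measure ?O (\<Union>j. ?A j)" .
    have half: "1 / (2 * real (Suc m)) + 1 / (2 * real (Suc m)) = 1 / real (Suc m)" by (simp del: of_nat_Suc)
    have "1 - b \<le> x" if "a + a = b" "1 - x \<le> p + q" "p \<le> a" "q \<le> a" for a b x p q :: real using that by linarith
    from this[OF half 3 1 2] show "1 - 1 / real (Suc m) \<le> measure ?O (C m \<times> V m)" .
  qed
qed

end

lemma tendsto_subseqI:
  fixes b :: "nat \<Rightarrow> real"
  assumes "\<And>s :: nat \<Rightarrow> nat. strict_mono s \<Longrightarrow> \<exists>r. strict_mono (r :: nat \<Rightarrow> nat) \<and> (\<lambda>n. b (s (r n))) \<longlonglongrightarrow> c"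
  shows "b \<longlonglongrightarrow> c"
proof (rule ccontr)
  assume "\<not> b \<longlonglongrightarrow> c"
  then obtain e where e: "e > 0" "\<not> (\<forall>\<^sub>F n in sequentially. dist (b n) c < e)" by (auto simp: tendsto_iff)
  then have "infinite {n. \<not> dist (b n) c < e}"
    by (simp add: eventually_sequentially infinite_nat_iff_unbounded_le)
  then obtain s :: "nat \<Rightarrow> nat" where s: "strict_mono s" "\<And>n. s n \<in> {n. \<not> dist (b n) c < e}"
    using infinite_enumerate by blast
  obtain r where r: "strict_mono (r :: nat \<Rightarrow> nat)" "(\<lambda>n. b (s (r n))) \<longlonglongrightarrow> c" using assms[OF s(1)] by blast
  have "\<forall>\<^sub>F n in sequentially. dist (b (s (r n))) c < e" using r(2) e(1) by (auto simp: tendsto_iff)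
  then show False using s(2) by (auto simp: eventually_sequentially)
qed

lemma Cesaro:
  fixes x :: "nat \<Rightarrow> real" and T :: "nat \<Rightarrow> nat"
  assumes x: "x \<longlonglongrightarrow> c" and T: "filterlim T at_top sequentially"
  shows "(\<lambda>N. (\<Sum>k=1..T N. x k) / real (T N)) \<longlonglongrightarrow> c"
proof (rule LIMSEQ_I)
  fix e :: real assume e: "0 < e"
  obtain k0 where k0: "\<And>k. k \<ge> k0 \<Longrightarrow> \<bar>x k - c\<bar> < e / 2"
    using LIMSEQ_D[OF x, of "e / 2"] e by auto
  define B where "B = (\<Sum>k\<le>k0. \<bar>x k - c\<bar>)"
  have B: "0 \<le> B" unfolding B_def by (intro sum_nonneg) auto
  have "\<forall>\<^sub>F N in sequentially. T N \<ge> nat \<lceil>2 * B / e\<rceil> + 1" using T by (simp add: filterlim_at_top)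
  then obtain N0 where N0: "\<And>N. N \<ge> N0 \<Longrightarrow> T N \<ge> nat \<lceil>2 * B / e\<rceil> + 1" by (auto simp: eventually_sequentially)
  show "\<exists>N0. \<forall>N\<ge>N0. norm ((\<Sum>k=1..T N. x k) / real (T N) - c) < e"
  proof (intro exI allI impI)
    fix N assume "N \<ge> N0"
    from N0[OF this] have TN: "T N \<ge> 1" "2 * B / e < real (T N)" by linarith+
    have "\<bar>\<Sum>k=1..T N. x k - c\<bar> \<le> (\<Sum>k=1..T N. \<bar>x k - c\<bar>)" by (rule sum_abs)
    also have "\<dots> \<le> (\<Sum>k=1..T N. (if k \<le> k0 then \<bar>x k - c\<bar> else 0) + e / 2)"
      using k0 e by (intro sum_mono) (auto intro: less_imp_le)
    also have "\<dots> = (\<Sum>k\<in>{1..T N} \<inter> {..k0}. \<bar>x k - c\<bar>) + real (T N) * (e / 2)"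
      by (simp add: sum.distrib sum.inter_restrict atMost_def)
    also have "(\<Sum>k\<in>{1..T N} \<inter> {..k0}. \<bar>x k - c\<bar>) \<le> B" unfolding B_def by (intro sum_mono2) auto
    also have "B < real (T N) * (e / 2)" using TN e by (simp add: field_simps)
    finally have a: "\<bar>\<Sum>k=1..T N. x k - c\<bar> < real (T N) * e" by (simp add: field_simps)
    have "(\<Sum>k=1..T N. x k) / real (T N) - c = (\<Sum>k=1..T N. x k - c) / real (T N)"
      using TN(1) by (simp add: sum_subtractf field_simps)
    then show "norm ((\<Sum>k=1..T N. x k) / real (T N) - c) < e"
      using a TN(1) by (simp add: abs_divide pos_divide_less_eq mult.commute)
  qed
qed

text \<open>Each shift by one exchanges only two boundary terms.\<close>

lemma average_shift:
  fixes e :: "nat \<Rightarrow> real"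
  assumes "\<And>k. \<bar>e k\<bar> \<le> C"
  shows "\<bar>(\<Sum>k=1..T. e (k + m)) - (\<Sum>k=1..T. e k)\<bar> \<le> real m * (2 * C)"
proof (induction m)
  case (Suc m)
  have "(\<Sum>k=1..T. e (k + Suc m)) - (\<Sum>k=1..T. e (k + m)) = (\<Sum>k=1..T. e (Suc k + m) - e (k + m))"
    by (simp add: sum_subtractf)
  also have "\<dots> = e (Suc T + m) - e (1 + m)" by (subst sum_Suc_diff) auto
  finally have "(\<Sum>k=1..T. e (k + Suc m)) - (\<Sum>k=1..T. e (k + m)) = e (Suc T + m) - e (1 + m)" .
  then show ?case using Suc assms[of "Suc T + m"] assms[of "1 + m"] by (simp add: algebra_simps abs_le_iff)
qed simp

section \<open>Convergence of averaged errors for one test function\<close>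

locale approx_test = approx_filters P \<phi> \<Upsilon> \<Omega> X Y \<mu> \<Phi> lam \<G> piN MN KN + filter_real_test P \<phi> \<Upsilon> fr
  for P :: "'e::polish_space \<Rightarrow> 'e measure" and \<phi> :: "'f::polish_space measure" and \<Upsilon> :: "'e \<Rightarrow> 'f \<Rightarrow> real"
    and \<Omega> :: "'o measure" and X :: "nat \<Rightarrow> 'o \<Rightarrow> 'e" and Y :: "nat \<Rightarrow> 'o \<Rightarrow> 'f" and \<mu> :: "'e prob_meas"
    and \<Phi> :: "'e \<Rightarrow> 'f measure" and lam \<G> piN MN KN and fr :: "'e \<Rightarrow> real"

sublocale approx_test \<subseteq> hmm_test ..

sublocale approx_test \<subseteq> filter_ergodic P \<phi> \<Upsilon> "\<lambda>x. ennreal (fr x)" lam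
  by unfold_locales (fact lam tv_conv)+

context approx_test
begin

lemma iter_bounds: "iter (KN N) (Fp 0) m \<in> borel_measurable borel" "\<bar>iter (KN N) (Fp 0) m z\<bar> \<le> 2"
  by (rule iter_measurable_bounded[OF K_kernel Fp_measurable Fp_bounded])+

lemma integral_Fp_bounds: "\<bar>\<integral>w. Fp 0 (Z N k w) \<partial>\<Omega>\<bar> \<le> 2"
proof -
  interpret prob_space \<Omega> by (rule prob_Omega)
  have i: "integrable \<Omega> (\<lambda>w. Fp 0 (Z N k w))"
    using Fp_bounded measurable_compose[OF Z_measurable Fp_measurable] by (intro integrable_const_bound[where B=2] AE_I2) auto
  have "\<bar>\<integral>w. Fp 0 (Z N k w) \<partial>\<Omega>\<bar> \<le> (\<integral>w. \<bar>Fp 0 (Z N k w)\<bar> \<partial>\<Omega>)" by (rule integral_abs_bound)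
  also have "\<dots> \<le> 2" using i Fp_bounded by (intro integral_le_const) auto
  finally show ?thesis .
qed

text \<open>By the Markov property, applying the N-th kernel m times moves the averaging window by
  m.\<close>

lemma occ_iter:
  assumes "1 \<le> T"
  shows "\<bar>(\<integral>z. iter (KN N) (Fp 0) m z \<partial>occ N T) - (\<integral>z. Fp 0 z \<partial>occ N T)\<bar> \<le> real m * 4 / real T"
proof -
  define e where "e k = (\<integral>w. Fp 0 (Z N k w) \<partial>\<Omega>)" for k
  have "(\<integral>z. iter (KN N) (Fp 0) m z \<partial>occ N T) = (\<Sum>k=1..T. e (k + m)) / real T"
    unfolding e_def markov_chain_iter[OF prob_Omega mcZ K_kernel Fp_measurable Fp_bounded]
    by (rule integral_occ[OF iter_bounds assms])
  moreover have "(\<integral>z. Fp 0 z \<partial>occ N T) = (\<Sum>k=1..T. e k) / real T"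
    unfolding e_def by (rule integral_occ[OF Fp_measurable Fp_bounded assms])
  moreover have "\<bar>(\<Sum>k=1..T. e (k + m)) - (\<Sum>k=1..T. e k)\<bar> \<le> real m * (2 * 2)"
    by (rule average_shift) (simp add: e_def integral_Fp_bounds)
  ultimately show ?thesis by (simp add: diff_divide_distrib[symmetric] abs_divide divide_right_mono)
qed

text \<open>The one-step hypothesis concerns the full sequence in N; indices outside the subsequence
  are filled with the limit point.\<close>

lemma iterates_subseq:
  assumes s: "strict_mono s" and zs: "zs \<longlonglongrightarrow> z"
  shows "(\<lambda>n. iter (KN (s n)) (Fp 0) m (zs n)) \<longlonglongrightarrow> Fp m z"
proof (rule iterates_continuous_convergence[OF K_kernel _ zs])
  fix F :: "'e \<times> 'e prob_meas \<Rightarrow> real" and zs and z :: "'e \<times> 'e prob_meas"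
  assume F: "continuous_on UNIV F" "bounded (range F)" and zs: "zs \<longlonglongrightarrow> z"
  have inj: "inj s" using s by (rule strict_mono_imp_inj_on)
  define w where "w N = (if N \<in> range s then zs (inv s N) else z)" for N
  have ws: "w (s n) = zs n" for n using inj by (simp add: w_def)
  have "w \<longlonglongrightarrow> z"
  proof (rule topological_tendstoI)
    fix A assume A: "open A" "z \<in> A"
    obtain n0 where n0: "\<And>n. n \<ge> n0 \<Longrightarrow> zs n \<in> A"
      using topological_tendstoD[OF zs A] by (auto simp: eventually_sequentially)
    show "\<forall>\<^sub>F N in sequentially. w N \<in> A"
      unfolding eventually_sequentially
    proof (intro exI[of _ "s n0"] allI impI)
      fix N assume N: "s n0 \<le> N"
      show "w N \<in> A"
      proof (cases "N \<in> range s")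
        case True
        then obtain n where n: "N = s n" by auto
        then have "n0 \<le> n" using N s by (simp add: strict_mono_less_eq)
        then show ?thesis using n0 n ws by simp
      qed (use A(2) in \<open>simp add: w_def\<close>)
    qed
  qed
  from LIMSEQ_subseq_LIMSEQ[OF one_step[OF F this] s]
  show "(\<lambda>n. \<integral>w. F w \<partial>KN (s n) (zs n)) \<longlonglongrightarrow> (\<integral>w. F w \<partial>filter_kernel \<Upsilon> \<phi> P z)"
    by (simp add: o_def ws)
qed

text \<open>The limit law l is never identified: \<open>Fp m\<close> tends pointwise to a constant,
  so every l gives the same value and the whole sequence converges.\<close>

lemma occ_tendsto:
  assumes T: "mono T" "\<And>N. 1 \<le> T N" "filterlim T at_top sequentially"
  shows "(\<lambda>N. \<integral>z. Fp 0 z \<partial>occ N (T N)) \<longlonglongrightarrow> - c_lim"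
proof (rule tendsto_subseqI)
  fix s :: "nat \<Rightarrow> nat" assume s: "strict_mono s"
  obtain K where K: "\<And>m. compact (K m)" "\<And>N m. 1 - 1 / real (Suc m) \<le> measure (occ N (T N)) (K m)"
    using occ_tight[OF T] by blast
  obtain r l where r: "strict_mono (r :: nat \<Rightarrow> nat)" and l: "prob_space l" "sets l = sets borel"
      and conv: "wconv ((\<lambda>n. occ (s n) (T (s n))) \<circ> r) l"
    by (rule Prokhorov[of "\<lambda>n. occ (s n) (T (s n))" K]) (use K occ_prob in auto)
  interpret l: prob_space l by (rule l)
  define t where "t n = s (r n)" for n
  have t: "strict_mono t" using s r unfolding t_def strict_mono_def by blast
  have Tt: "filterlim (\<lambda>n. T (t n)) at_top sequentially"
    by (rule filterlim_compose[OF T(3) filterlim_subseq[OF t]])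
  define L where "L n = occ (t n) (T (t n))" for n
  have conv: "wconv L l" using conv by (simp add: L_def[abs_def] t_def o_def)
  have lim: "(\<lambda>n. \<integral>z. Fp 0 z \<partial>L n) \<longlonglongrightarrow> (\<integral>z. Fp m z \<partial>l)" for m
  proof -
    have 1: "(\<lambda>n. \<integral>z. iter (KN (t n)) (Fp 0) m z \<partial>L n) \<longlonglongrightarrow> (\<integral>z. Fp m z \<partial>l)"
      by (rule extended_continuous_mapping[OF approx_open_pair _ _ l conv iter_bounds Fp_measurable Fp_bounded iterates_subseq[OF t]])
         (simp_all add: L_def occ_prob)
    have "(\<lambda>n. real m * 4 / real (T (t n))) \<longlonglongrightarrow> 0"
      using filterlim_compose[OF filterlim_real_sequentially Tt] by (intro real_tendsto_divide_at_top[OF tendsto_const])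
    then have "(\<lambda>n. (\<integral>z. iter (KN (t n)) (Fp 0) m z \<partial>L n) - (\<integral>z. Fp 0 z \<partial>L n)) \<longlonglongrightarrow> 0"
      by (rule Lim_null_comparison[rotated]) (auto simp: L_def occ_iter[OF T(2)])
    from tendsto_diff[OF 1 this] show ?thesis by simp
  qed
  have Fm: "Fp m \<in> borel_measurable l" for m using l(2) by (simp cong: measurable_cong_sets)
  have "(\<lambda>m. \<integral>z. Fp m z \<partial>l) \<longlonglongrightarrow> (\<integral>z. - c_lim \<partial>l)"
  proof (intro integral_dominated_convergence[where w="\<lambda>_. 2"] AE_I2 Fm)
    show "norm (Fp m z) \<le> 2" for m z using Fp_bounded by simp
    show "(\<lambda>m. Fp m z) \<longlonglongrightarrow> - c_lim" for z
      unfolding Fp_def by (intro Fm_tendsto fmeas_meas_of measure_meas_of_UNIV)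
  qed auto
  \<comment> \<open>All these integrals are limits of the same averages of \<open>Fp 0\<close>, so
    they do not depend on m.\<close>
  moreover have "(\<lambda>m. \<integral>z. Fp m z \<partial>l) = (\<lambda>m. \<integral>z. Fp 0 z \<partial>l)"
    by (intro ext LIMSEQ_unique[OF lim lim])
  ultimately have "(\<integral>z. Fp 0 z \<partial>l) = - c_lim" using l.prob_space by (simp add: LIMSEQ_const_iff)
  then show "\<exists>r. strict_mono (r :: nat \<Rightarrow> nat) \<and> (\<lambda>n. \<integral>z. Fp 0 z \<partial>occ (s (r n)) (T (s (r n)))) \<longlonglongrightarrow> - c_lim"
    using lim[of 0] r by (intro exI[of _ r]) (simp add: L_def t_def)
qed

definition sq_err :: "nat \<Rightarrow> nat \<Rightarrow> real" where
  "sq_err N k = (\<integral>w. ((\<integral>x. fr x \<partial>meas_of (piN N k w)) - r k fr (Ys w))\<^sup>2 \<partial>\<Omega>)"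

lemma sq_err: "sq_err N k = (\<integral>w. Fp 0 (Z N k w) \<partial>\<Omega>) + R \<mu> k"
  unfolding sq_err_def by (rule mean_square_error[OF approx])

lemma sq_err_avg:
  assumes T: "mono T" "\<And>N. 1 \<le> T N" "filterlim T at_top sequentially"
  shows "(\<lambda>N. (\<Sum>k=1..T N. sq_err N k) / real (T N)) \<longlonglongrightarrow> 0"
proof -
  have "(\<Sum>k=1..T N. sq_err N k) / real (T N) = (\<integral>z. Fp 0 z \<partial>occ N (T N)) + (\<Sum>k=1..T N. R \<mu> k) / real (T N)" for N
    unfolding integral_occ[OF Fp_measurable Fp_bounded T(2)] sq_err by (simp add: sum.distrib add_divide_distrib)
  then show ?thesis using tendsto_add[OF occ_tendsto[OF T] Cesaro[OF R_tendsto T(3)], of \<mu>] by simp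
qed

text \<open>The pair at time k is k kernel steps away from its initial law, so continuous
  convergence gives the limit - R + R.\<close>

lemma sq_err_fixed: "(\<lambda>N. sq_err N k) \<longlonglongrightarrow> 0"
proof -
  have e: "(\<integral>\<omega>. Fp 0 (Z N k \<omega>) \<partial>\<Omega>) = (\<integral>z. iter (KN N) (Fp 0) k z \<partial>meas_of (MN N))" for N
  proof -
    have "(\<integral>\<omega>. Fp 0 (Z N (0 + k) \<omega>) \<partial>\<Omega>) = (\<integral>\<omega>. iter (KN N) (Fp 0) k (Z N 0 \<omega>) \<partial>\<Omega>)"
      by (rule markov_chain_iter[OF prob_Omega mcZ K_kernel Fp_measurable Fp_bounded])
    also have "\<dots> = (\<integral>z. iter (KN N) (Fp 0) k z \<partial>distr \<Omega> borel (Z N 0))"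
      by (rule integral_distr[symmetric, OF Z_measurable iter_bounds(1)])
    also have "distr \<Omega> borel (Z N 0) = meas_of (MN N)" using mcZ[of N] by (simp add: markov_chain_def)
    finally show ?thesis by simp
  qed
  have w: "wconv (\<lambda>N. meas_of (MN N)) (meas_of (filter_init \<Upsilon> \<phi> \<mu>))"
    using initial unfolding tendsto_prob_meas_iff wconv_def by auto
  have "(\<lambda>N. \<integral>z. iter (KN N) (Fp 0) k z \<partial>meas_of (MN N)) \<longlonglongrightarrow> (\<integral>z. Fp k z \<partial>meas_of (filter_init \<Upsilon> \<phi> \<mu>))"
    using iterates_subseq[of "\<lambda>n. n"]
    by (intro extended_continuous_mapping[OF approx_open_pair _ _ prob_meas_D(1,2) w iter_bounds Fp_measurable Fp_bounded])
       (auto simp: prob_meas_D strict_mono_def)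
  from tendsto_add[OF this tendsto_const[of "R \<mu> k"]] show ?thesis by (simp add: sq_err e integral_Fp_init)
qed

definition err :: "nat \<Rightarrow> nat \<Rightarrow> real" where
  "err N k = (\<integral>w. \<bar>(\<integral>x. fr x \<partial>meas_of (piN N k w)) - r k fr (Ys w)\<bar> \<partial>\<Omega>)"

lemma err_integrable: "integrable \<Omega> (\<lambda>w. \<bar>(\<integral>x. fr x \<partial>meas_of (piN N k w)) - r k fr (Ys w)\<bar>)"
proof -
  interpret prob_space \<Omega> by (rule prob_Omega)
  note [measurable] = mean_square_error(2)[OF approx, of N k]
  show ?thesis
  proof (intro integrable_const_bound[where B=1] AE_I2)
    fix w
    show "norm \<bar>(\<integral>x. fr x \<partial>meas_of (piN N k w)) - r k fr (Ys w)\<bar> \<le> 1"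
      using integral_fr_bounds[of "piN N k w"] r_bounds[of fr k "Ys w", OF fr_bounds] by auto
  qed measurable
qed

text \<open>|x| \<le> \<epsilon> + x^2/\<epsilon>, by comparing |x| with \<epsilon>. Being affine in
  the squared error, the bound passes directly to averages over k.\<close>

lemma err_le: "0 < \<epsilon> \<Longrightarrow> err N k \<le> \<epsilon> + sq_err N k / \<epsilon>"
proof -
  assume \<epsilon>: "0 < \<epsilon>"
  interpret prob_space \<Omega> by (rule prob_Omega)
  note [measurable] = mean_square_error(2)[OF approx, of N k]
  let ?d = "\<lambda>w. (\<integral>x. fr x \<partial>meas_of (piN N k w)) - r k fr (Ys w)"
  have i: "integrable \<Omega> (\<lambda>w. (?d w)\<^sup>2)"
  proof (intro integrable_const_bound[where B=1] AE_I2)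
    fix w
    have "\<bar>?d w\<bar> \<le> 1"
      using integral_fr_bounds[of "piN N k w"] r_bounds[of fr k "Ys w", OF fr_bounds] by auto
    then show "norm ((?d w)\<^sup>2) \<le> 1" by (simp add: abs_square_le_1)
  qed measurable
  have "\<bar>x\<bar> \<le> \<epsilon> + x\<^sup>2 / \<epsilon>" for x :: real
  proof (cases "\<bar>x\<bar> \<le> \<epsilon>")
    case False
    then have "\<bar>x\<bar> * \<epsilon> \<le> \<bar>x\<bar> * \<bar>x\<bar>" by (intro mult_left_mono) auto
    then have "\<bar>x\<bar> \<le> x\<^sup>2 / \<epsilon>" using \<epsilon> by (simp add: pos_le_divide_eq power2_eq_square)
    then show ?thesis using \<epsilon> by simp
  qed (use \<epsilon> in \<open>simp add: add_increasing2\<close>)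
  then have "err N k \<le> (\<integral>w. \<epsilon> + (?d w)\<^sup>2 / \<epsilon> \<partial>\<Omega>)"
    unfolding err_def using i err_integrable by (intro integral_mono) auto
  also have "\<dots> = \<epsilon> + sq_err N k / \<epsilon>" unfolding sq_err_def using i prob_space by simp
  finally show ?thesis .
qed

lemma err_avg:
  assumes T: "\<And>N. 1 \<le> T N" and sq: "(\<lambda>N. (\<Sum>k=1..T N. sq_err N k) / real (T N)) \<longlonglongrightarrow> 0"
  shows "(\<lambda>N. (\<Sum>k=1..T N. err N k) / real (T N)) \<longlonglongrightarrow> 0"
proof (rule LIMSEQ_I)
  fix e :: real assume e: "0 < e"
  \<comment> \<open>With \<epsilon> = e/3 in \<open>err_le\<close> this makes the averages at most
    e/3 + e/3.\<close>
  have "0 < e / 3 * (e / 3)" using e by simp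
  from LIMSEQ_D[OF sq this] obtain N0 where N0: "\<And>N. N \<ge> N0 \<Longrightarrow> \<bar>(\<Sum>k=1..T N. sq_err N k) / real (T N)\<bar> < e / 3 * (e / 3)" by auto
  show "\<exists>N0. \<forall>N\<ge>N0. norm ((\<Sum>k=1..T N. err N k) / real (T N) - 0) < e"
  proof (intro exI allI impI)
    fix N assume N: "N0 \<le> N"
    have nn: "0 \<le> (\<Sum>k=1..T N. err N k) / real (T N)"
      by (intro divide_nonneg_nonneg sum_nonneg) (auto simp: err_def)
    have "(\<Sum>k=1..T N. err N k) / real (T N) \<le> (\<Sum>k=1..T N. e / 3 + sq_err N k / (e / 3)) / real (T N)"
      using e by (intro divide_right_mono sum_mono err_le) auto
    also have "(\<Sum>k=1..T N. e / 3 + sq_err N k / (e / 3)) = real (T N) * (e / 3) + (\<Sum>k=1..T N. sq_err N k) / (e / 3)"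
      unfolding sum.distrib sum_divide_distrib by simp
    also have "\<dots> / real (T N) = e / 3 + ((\<Sum>k=1..T N. sq_err N k) / real (T N)) / (e / 3)"
      using T[of N] by (simp add: add_divide_distrib)
    also have "\<dots> \<le> e / 3 + (e / 3 * (e / 3)) / (e / 3)"
    proof (intro add_left_mono divide_right_mono)
      show "(\<Sum>k=1..T N. sq_err N k) / real (T N) \<le> e / 3 * (e / 3)" using N0[OF N] by linarith
    qed (use e in simp)
    also have "\<dots> < e" using e by simp
    finally show "norm ((\<Sum>k=1..T N. err N k) / real (T N) - 0) < e" using nn by simp
  qed
qed

end

section \<open>Uniformity in time and the bounded Lipschitz distance\<close>

text \<open>If the bound e' is exceeded for infinitely many N, at times \<tau> N, the fixed-time
  limits force these times to infinity. They may fail to be monotone, whereas \<open>diag\<close>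
  concerns nondecreasing sequences.\<close>

lemma SUP_tendsto_0:
  fixes a :: "nat \<Rightarrow> nat \<Rightarrow> real"
  assumes a: "\<And>N T. 0 \<le> a N T" "\<And>N T. a N T \<le> C"
    and fixed: "\<And>T. 1 \<le> T \<Longrightarrow> (\<lambda>N. a N T) \<longlonglongrightarrow> 0"
    and diag: "\<And>T. mono T \<Longrightarrow> (\<And>N. 1 \<le> T N) \<Longrightarrow> filterlim T at_top sequentially \<Longrightarrow> (\<lambda>N. a N (T N)) \<longlonglongrightarrow> 0"
  shows "(\<lambda>N. SUP T\<in>{1..}. a N T) \<longlonglongrightarrow> 0"
proof (rule LIMSEQ_I)
  fix e :: real assume "0 < e"
  define e' where "e' = e / 2"
  have e': "0 < e'" "e' < e" using \<open>0 < e\<close> by (auto simp: e'_def)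
  define B where "B = {N. \<exists>T\<ge>1. e' < a N T}"
  have small: "\<forall>\<^sub>F N in sequentially. f N < e'" if "f \<longlonglongrightarrow> 0" for f :: "nat \<Rightarrow> real"
    using order_tendstoD(2)[OF that e'(1)] .
  have "finite B"
  proof (rule ccontr)
    assume inf: "\<not> finite B"
    have "\<forall>N\<in>B. \<exists>T. 1 \<le> T \<and> e' < a N T" unfolding B_def by auto
    then obtain \<tau> where \<tau>: "\<And>N. N \<in> B \<Longrightarrow> 1 \<le> \<tau> N" "\<And>N. N \<in> B \<Longrightarrow> e' < a N (\<tau> N)" by metis
    define Q where "Q N t \<longleftrightarrow> (\<exists>N'\<ge>N. N' \<in> B \<and> \<tau> N' = t)" for N t
    \<comment> \<open>The minimum of \<tau> over the bad indices from N on: nondecreasing, still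
      unbounded, and equal to \<tau> at infinitely many bad indices.\<close>
    define T where "T N = (LEAST t. Q N t)" for N
    have "\<exists>t. Q N t" for N using inf unfolding Q_def by (metis infinite_nat_iff_unbounded_le)
    then have QT: "Q N (T N)" for N unfolding T_def by (rule LeastI_ex)
    have Tle: "T N \<le> t" if "Q N t" for N t unfolding T_def using that by (rule Least_le)
    have "mono T"
    proof (rule monoI)
      fix N M :: nat assume "N \<le> M"
      then have "Q N (T M)" using QT[of M] unfolding Q_def by (meson order_trans)
      then show "T N \<le> T M" by (rule Tle)
    qed
    have T1: "1 \<le> T N" for N using QT[of N] \<tau>(1) unfolding Q_def by metis
    have "filterlim T at_top sequentially"
      unfolding filterlim_at_top
    proof
      fix v
      have "\<forall>\<^sub>F N in sequentially. \<forall>t\<in>{1..<v}. a N t < e'"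
        by (intro eventually_ball_finite ballI small fixed) auto
      then obtain N0 where N0: "\<And>N t. N \<ge> N0 \<Longrightarrow> t \<in> {1..<v} \<Longrightarrow> a N t < e'" unfolding eventually_sequentially by blast
      have "v \<le> T N" if "N0 \<le> N" for N
      proof (rule ccontr)
        assume "\<not> v \<le> T N"
        obtain N' where "N \<le> N'" "N' \<in> B" "\<tau> N' = T N" using QT[of N] unfolding Q_def by auto
        then show False using N0[of N' "T N"] \<tau>(2)[of N'] T1[of N] that \<open>\<not> v \<le> T N\<close> by auto
      qed
      then show "\<forall>\<^sub>F N in sequentially. v \<le> T N" by (auto simp: eventually_sequentially)
    qed
    from small[OF diag[OF \<open>mono T\<close> T1 this]] obtain N0 where N0: "\<And>N. N \<ge> N0 \<Longrightarrow> a N (T N) < e'"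
      by (auto simp: eventually_sequentially)
    \<comment> \<open>Where the minimum from N0 on is attained, T and \<tau> coincide, and the error
      there contradicts the diagonal limit.\<close>
    obtain N' where N': "N0 \<le> N'" "N' \<in> B" "\<tau> N' = T N0" using QT[of N0] unfolding Q_def by auto
    have "T N' \<le> \<tau> N'" using N' by (intro Tle) (auto simp: Q_def)
    moreover have "T N0 \<le> T N'" using \<open>mono T\<close> N'(1) by (rule monoD)
    ultimately have "T N' = \<tau> N'" using N'(3) by simp
    then show False using N0[OF N'(1)] \<tau>(2)[OF N'(2)] by simp
  qed
  then obtain N0 where N0: "\<And>N. N \<in> B \<Longrightarrow> N < N0" by (auto simp: finite_nat_set_iff_bounded)
  show "\<exists>N0. \<forall>N\<ge>N0. norm ((SUP T\<in>{1..}. a N T) - 0) < e"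
  proof (intro exI allI impI)
    fix N assume "N0 \<le> N"
    then have "N \<notin> B" using N0[of N] by auto
    then have "(SUP T\<in>{1..}. a N T) \<le> e'" by (intro cSUP_least) (auto simp: B_def not_less)
    moreover have "0 \<le> (SUP T\<in>{1..}. a N T)"
      using a by (intro cSUP_upper2[of _ _ 1]) (auto intro!: bdd_aboveI2[where M=C])
    ultimately show "norm ((SUP T\<in>{1..}. a N T) - 0) < e" using e' by simp
  qed
qed

lemma integrable_meas_of:
  assumes "f \<in> borel_measurable borel" "\<And>x. \<bar>f x\<bar> \<le> (C::real)" shows "integrable (meas_of \<nu>) f"
proof -
  interpret prob_space "meas_of \<nu>" by (rule prob_meas_D)
  have "f \<in> borel_measurable (meas_of \<nu>)" using assms(1) by (simp add: measurable_fmeas[OF fmeas_meas_of])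
  then show ?thesis using assms(2) by (intro integrable_const_bound[where B=C] AE_I2) auto
qed

lemma integral_meas_of_const: "(\<integral>x. c \<partial>meas_of \<nu>) = (c :: real)"
  using prob_space.prob_space[OF prob_meas_D(1), of \<nu>] by simp

lemma integral_meas_of_abs_le:
  assumes "f \<in> borel_measurable borel" "\<And>x. \<bar>f x\<bar> \<le> (C::real)" shows "\<bar>\<integral>x. f x \<partial>meas_of \<nu>\<bar> \<le> C"
proof -
  have "\<bar>\<integral>x. f x \<partial>meas_of \<nu>\<bar> \<le> (\<integral>x. \<bar>f x\<bar> \<partial>meas_of \<nu>)" by (rule integral_abs_bound)
  also have "\<dots> \<le> (\<integral>x. C \<partial>meas_of \<nu>)"
    using assms(2) integrable_meas_of[OF assms] integrable_meas_of[of "\<lambda>_. C" "\<bar>C\<bar>" \<nu>] by (intro integral_mono) auto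
  finally show ?thesis unfolding integral_meas_of_const .
qed

lemma bl_dist_bounds:
  fixes \<nu> \<nu>' :: "'a::metric_space prob_meas"
  shows "0 \<le> bl_dist \<nu> \<nu>'" "bl_dist \<nu> \<nu>' \<le> 2"
proof -
  have b: "\<bar>(\<integral>x. f x \<partial>meas_of \<nu>) - (\<integral>x. f x \<partial>meas_of \<nu>')\<bar> \<le> 2"
    if "\<forall>x. \<bar>f x\<bar> \<le> 1" "lipschitz_on 1 UNIV f" for f :: "'a \<Rightarrow> real"
  proof -
    have m: "f \<in> borel_measurable borel"
      by (rule borel_measurable_continuous_onI[OF lipschitz_on_continuous_on[OF that(2)]])
    show ?thesis
      using integral_meas_of_abs_le[OF m, of 1 \<nu>] integral_meas_of_abs_le[OF m, of 1 \<nu>'] that(1) by auto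
  qed
  have 0: "(\<lambda>_. 0) \<in> {f :: 'a \<Rightarrow> real. (\<forall>x. \<bar>f x\<bar> \<le> 1) \<and> lipschitz_on 1 UNIV f}"
    by (auto intro!: lipschitz_onI)
  show "0 \<le> bl_dist \<nu> \<nu>'"
    unfolding bl_dist_def using b by (intro cSUP_upper2[OF _ 0]) (auto intro!: bdd_aboveI2[where M=2])
  show "bl_dist \<nu> \<nu>' \<le> 2"
    unfolding bl_dist_def
  proof (rule cSUP_least)
    show "{f :: 'a \<Rightarrow> real. (\<forall>x. \<bar>f x\<bar> \<le> 1) \<and> lipschitz_on 1 UNIV f} \<noteq> {}" using 0 by (metis empty_iff)
  qed (use b in auto)
qed

text \<open>
  \<open>1\<close>-Lipschitz functions whose values at an \<open>\<epsilon>\<close>-net of \<open>C\<close> agree after rounding are close near \<open>C\<close>;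
  \<open>\<kappa>\<close> controls the mass away from \<open>C\<close>.
\<close>

lemma bl_dist_net:
  fixes C :: "'a::polish_space set"
  assumes C: "compact C" "C \<noteq> {}" and \<epsilon>: "0 < \<epsilon>"
  obtains \<F> :: "('a \<Rightarrow> real) set" and \<kappa> :: "'a \<Rightarrow> real" where
    "finite \<F>" "\<And>g. g \<in> insert \<kappa> \<F> \<Longrightarrow> continuous_on UNIV g" "\<And>g x. g \<in> insert \<kappa> \<F> \<Longrightarrow> 0 \<le> g x \<and> g x \<le> 1"
    "\<And>\<nu> \<nu>'. bl_dist \<nu> \<nu>' \<le> 2 * (\<Sum>g\<in>\<F>. \<bar>(\<integral>x. g x \<partial>meas_of \<nu>) - (\<integral>x. g x \<partial>meas_of \<nu>')\<bar>) + 10 * \<epsilon> +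
       2 * \<bar>(\<integral>x. \<kappa> x \<partial>meas_of \<nu>) - (\<integral>x. \<kappa> x \<partial>meas_of \<nu>')\<bar> + 4 * measure (meas_of \<nu>') (- C)"
proof -
  define L where "L = {f :: 'a \<Rightarrow> real. (\<forall>x. \<bar>f x\<bar> \<le> 1) \<and> lipschitz_on 1 UNIV f}"
  have Lb: "\<bar>f x\<bar> \<le> 1" and Ll: "\<bar>f x - f y\<bar> \<le> dist x y" and Lc: "continuous_on UNIV f" if "f \<in> L" for f x y
    using that lipschitz_onD[of 1 UNIV f x y] lipschitz_on_continuous_on[of 1 UNIV f] by (auto simp: L_def dist_real_def)
  obtain I where I: "finite I" "C \<subseteq> (\<Union>x\<in>I. ball x \<epsilon>)"
    using C(1) \<epsilon> unfolding compact_eq_totally_bounded by blast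
  \<comment> \<open>Rounding to multiples of \<epsilon> leaves finitely many patterns on the net;
    one representative of each pattern is enough.\<close>
  define pat where "pat f = (\<lambda>x\<in>I. \<lfloor>f x / \<epsilon>\<rfloor>)" for f :: "'a \<Rightarrow> real"
  have "pat ` L \<subseteq> PiE I (\<lambda>_. {\<lfloor>- 1 / \<epsilon>\<rfloor>..\<lfloor>1 / \<epsilon>\<rfloor>})"
  proof (rule image_subsetI)
    fix f assume f: "f \<in> L"
    have "\<lfloor>- 1 / \<epsilon>\<rfloor> \<le> \<lfloor>f x / \<epsilon>\<rfloor> \<and> \<lfloor>f x / \<epsilon>\<rfloor> \<le> \<lfloor>1 / \<epsilon>\<rfloor>" for x
      using Lb[OF f, of x] \<epsilon> by (intro conjI floor_mono divide_right_mono) auto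
    then show "pat f \<in> PiE I (\<lambda>_. {\<lfloor>- 1 / \<epsilon>\<rfloor>..\<lfloor>1 / \<epsilon>\<rfloor>})" by (auto simp: pat_def)
  qed
  then have fin: "finite (pat ` L)" by (rule finite_subset) (intro finite_PiE I(1), simp)
  define rep where "rep = inv_into L pat"
  define H where "H = rep ` pat ` L"
  have H: "finite H" "H \<subseteq> L" using fin by (auto simp: H_def rep_def inv_into_into)
  \<comment> \<open>Moves a representative from [-1, 1] to [0, 1], the range required of test
    functions; this causes the factor 2 before the sum.\<close>
  define g where "g h x = (h x + 1) / 2" for h :: "'a \<Rightarrow> real" and x
  define \<kappa> where "\<kappa> x = min 1 (infdist x C / \<epsilon>)" for x
  have \<kappa>c: "continuous_on UNIV \<kappa>"
    unfolding \<kappa>_def using \<epsilon> by (intro continuous_on_min continuous_on_const continuous_on_divide continuous_on_infdist continuous_on_id) auto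
  have \<kappa>b: "0 \<le> \<kappa> x" "\<kappa> x \<le> 1" for x unfolding \<kappa>_def using \<epsilon> by (auto simp: infdist_nonneg)
  have mC: "continuous_on UNIV f \<Longrightarrow> f \<in> borel_measurable borel" for f :: "'a \<Rightarrow> real"
    by (rule borel_measurable_continuous_onI)
  \<comment> \<open>Near C a net point lies within 2\<epsilon>: 2\<epsilon> for each of the two
    Lipschitz functions and \<epsilon> from equal rounding. Away from C, \<kappa> is 1 and both
    functions are bounded by 1.\<close>
  have close: "\<bar>f x - rep (pat f) x\<bar> \<le> 5 * \<epsilon> + 2 * \<kappa> x" if f: "f \<in> L" for f x
  proof -
    define h where "h = rep (pat f)"
    have hL: "h \<in> L" using f by (auto simp: h_def rep_def intro!: inv_into_into)
    have hp: "pat h = pat f" unfolding h_def rep_def by (rule f_inv_into_f[OF imageI[OF f]])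
    show ?thesis
    proof (cases "infdist x C < \<epsilon>")
      case True
      then obtain y where y: "y \<in> C" "dist x y < \<epsilon>" 
        using cINF_less_iff[OF C(2), of "dist x" \<epsilon>] C(2) by (auto simp: infdist_notempty intro: bdd_belowI2[of _ 0])
      then obtain z where z: "z \<in> I" "dist z y < \<epsilon>" using I(2) by auto
      have "\<lfloor>h z / \<epsilon>\<rfloor> = \<lfloor>f z / \<epsilon>\<rfloor>" using fun_cong[OF hp, of z] z(1) by (simp add: pat_def)
      then have "\<bar>f z / \<epsilon> - h z / \<epsilon>\<bar> < 1" by linarith
      then have "\<bar>f z - h z\<bar> < \<epsilon>" using \<epsilon> by (simp add: diff_divide_distrib[symmetric] abs_divide)
      moreover have "dist x z < 2 * \<epsilon>" using y(2) z(2) dist_triangle[of x z y] by (simp add: dist_commute)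
      ultimately have "\<bar>f x - h x\<bar> \<le> 5 * \<epsilon>" using Ll[OF f, of x z] Ll[OF hL, of x z] by linarith
      then show ?thesis using \<kappa>b(1)[of x] by (simp add: h_def)
    next
      case False
      then have "\<kappa> x = 1" using \<epsilon> by (simp add: \<kappa>_def)
      then show ?thesis using Lb[OF f, of x] Lb[OF hL, of x] \<epsilon> by (simp add: h_def[symmetric] abs_le_iff)
    qed
  qed
  show ?thesis
  proof (rule that[of "g ` H" \<kappa>])
    show "finite (g ` H)" using H by simp
    show "continuous_on UNIV k" if "k \<in> insert \<kappa> (g ` H)" for k
      using that \<kappa>c H(2) Lc by (auto simp: g_def[abs_def] intro!: continuous_intros)
    show "0 \<le> k x \<and> k x \<le> 1" if "k \<in> insert \<kappa> (g ` H)" for k x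
    proof -
      have "0 \<le> g h x \<and> g h x \<le> 1" if "h \<in> H" for h using Lb[of h x] that H(2) by (auto simp: g_def abs_le_iff)
      then show ?thesis using that \<kappa>b by auto
    qed
    fix \<nu> \<nu>' :: "'a prob_meas"
    let ?D = "\<lambda>f :: 'a \<Rightarrow> real. \<bar>(\<integral>x. f x \<partial>meas_of \<nu>) - (\<integral>x. f x \<partial>meas_of \<nu>')\<bar>"
    have \<kappa>i: "integrable (meas_of \<rho>) \<kappa>" for \<rho> using \<kappa>b by (intro integrable_meas_of[of _ 1] mC \<kappa>c) auto
    have \<kappa>C: "(\<integral>x. \<kappa> x \<partial>meas_of \<nu>') \<le> measure (meas_of \<nu>') (- C)"
    proof -
      have Cb: "- C \<in> sets borel" using borel_compact[OF C(1)] by auto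
      have "(\<integral>x. \<kappa> x \<partial>meas_of \<nu>') \<le> (\<integral>x. indicator (- C) x \<partial>meas_of \<nu>')"
      proof (rule integral_mono[OF \<kappa>i])
        show "integrable (meas_of \<nu>') (indicator (- C) :: 'a \<Rightarrow> real)"
          using Cb by (intro integrable_meas_of[of _ 1] borel_measurable_indicator) (auto split: split_indicator)
        show "\<kappa> x \<le> indicator (- C) x" for x
          using \<kappa>b(2)[of x] by (cases "x \<in> C") (simp_all add: \<kappa>_def)
      qed
      also have "\<dots> = measure (meas_of \<nu>') (- C)" by (simp add: prob_meas_D)
      finally show ?thesis .
    qed
    show "bl_dist \<nu> \<nu>' \<le> 2 * (\<Sum>k\<in>g ` H. ?D k) + 10 * \<epsilon> + 2 * ?D \<kappa> + 4 * measure (meas_of \<nu>') (- C)"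
      unfolding bl_dist_def L_def[symmetric]
    proof (rule cSUP_least)
      show "L \<noteq> {}" unfolding L_def by (auto intro!: exI[of _ "\<lambda>_. 0"] lipschitz_onI)
      fix f assume f: "f \<in> L"
      define h where "h = rep (pat f)"
      have hH: "h \<in> H" using f by (simp add: h_def H_def)
      then have hL: "h \<in> L" using H by auto
      have i: "integrable (meas_of \<rho>) k" if "k \<in> L" for \<rho> k by (rule integrable_meas_of[OF mC[OF Lc[OF that]] Lb[OF that]])
      have d: "\<bar>(\<integral>x. f x \<partial>meas_of \<rho>) - (\<integral>x. h x \<partial>meas_of \<rho>)\<bar> \<le> 5 * \<epsilon> + 2 * (\<integral>x. \<kappa> x \<partial>meas_of \<rho>)" for \<rho>
      proof -
        have ic: "integrable (meas_of \<rho>) (\<lambda>x. 5 * \<epsilon>)" by (rule integrable_meas_of[of _ "\<bar>5 * \<epsilon>\<bar>"]) auto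
        have "(\<integral>x. f x \<partial>meas_of \<rho>) - (\<integral>x. h x \<partial>meas_of \<rho>) = (\<integral>x. f x - h x \<partial>meas_of \<rho>)" using i[OF f] i[OF hL] by simp
        also have "\<bar>\<dots>\<bar> \<le> (\<integral>x. \<bar>f x - h x\<bar> \<partial>meas_of \<rho>)" by (rule integral_abs_bound)
        also have "\<dots> \<le> (\<integral>x. 5 * \<epsilon> + 2 * \<kappa> x \<partial>meas_of \<rho>)"
          using close[OF f] i[OF f] i[OF hL] \<kappa>i ic by (intro integral_mono) (auto simp: h_def)
        also have "\<dots> = 5 * \<epsilon> + 2 * (\<integral>x. \<kappa> x \<partial>meas_of \<rho>)" using \<kappa>i ic prob_space.prob_space[OF prob_meas_D(1), of \<rho>] by simp
        finally show ?thesis .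
      qed
      have "?D h = 2 * ?D (g h)"
      proof -
        have "(\<integral>x. g h x \<partial>meas_of \<rho>) = ((\<integral>x. h x \<partial>meas_of \<rho>) + 1) / 2" for \<rho>
          unfolding g_def using i[OF hL, of \<rho>] integrable_meas_of[of "\<lambda>_. 1" 1 \<rho>] prob_space.prob_space[OF prob_meas_D(1), of \<rho>] by simp
        note e = this
        have "\<bar>a - b\<bar> = 2 * \<bar>(a + 1) / 2 - (b + 1) / 2\<bar>" for a b :: real by (simp add: diff_divide_distrib[symmetric])
        then show ?thesis unfolding e .
      qed
      also have "?D (g h) \<le> (\<Sum>k\<in>g ` H. ?D k)" by (rule member_le_sum) (use hH H in auto)
      finally have Dh: "?D h \<le> 2 * (\<Sum>k\<in>g ` H. ?D k)" by simp
      show "?D f \<le> 2 * (\<Sum>k\<in>g ` H. ?D k) + 10 * \<epsilon> + 2 * ?D \<kappa> + 4 * measure (meas_of \<nu>') (- C)"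
      proof -
        \<comment> \<open>2k + 2k' \<le> 2 |k - k'| + 4k', so off C only the mass under \<nu>' has
          to be controlled, which will be the exact filter.\<close>
        have "\<bar>a - a'\<bar> \<le> s + 10 * \<epsilon> + 2 * \<bar>k - k'\<bar> + 4 * c"
          if "\<bar>b - b'\<bar> \<le> s" "\<bar>a - b\<bar> \<le> 5 * \<epsilon> + 2 * k" "\<bar>a' - b'\<bar> \<le> 5 * \<epsilon> + 2 * k'" "k' \<le> c"
          for a a' b b' s k k' c :: real using that by (smt (verit))
        from this[OF Dh d[of \<nu>] d[of \<nu>'] \<kappa>C] show ?thesis .
      qed
    qed
  qed
qed

section \<open>Error in the bounded Lipschitz distance\<close>

context approx_filters
begin

lemma approx_testI:
  assumes "continuous_on UNIV g" "\<And>x. 0 \<le> g x \<and> g x \<le> 1"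
  shows "approx_test P \<phi> \<Upsilon> \<Omega> X Y \<mu> \<Phi> lam \<G> piN MN KN g"
proof -
  have "(\<lambda>x. ennreal (g x)) \<in> borel_measurable borel"
    using borel_measurable_continuous_onI[OF assms(1)] by measurable
  then show ?thesis using assms by unfold_locales (auto simp: ennreal_le_1)
qed

definition bl_err :: "nat \<Rightarrow> nat \<Rightarrow> real" where
  "bl_err N T = (\<integral>w. (1 / real T) * (\<Sum>k=1..T. bl_dist (piN N k w) (nonlinear_filter \<Upsilon> P \<mu> Y k w)) \<partial>\<Omega>)"

text \<open>A nonintegrable integrand has integral 0, so an integrable nonnegative majorant bounds
  the integral without a measurability proof for \<open>bl_dist\<close>.\<close>

lemma bl_err_bounds: "0 \<le> bl_err N T" "bl_err N T \<le> 2"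
proof -
  interpret prob_space \<Omega> by (rule prob_Omega)
  show "0 \<le> bl_err N T"
    unfolding bl_err_def by (intro integral_nonneg_AE AE_I2 mult_nonneg_nonneg sum_nonneg bl_dist_bounds) auto
  have "bl_err N T \<le> (\<integral>w. 2 \<partial>\<Omega>)"
    unfolding bl_err_def
  proof (intro integral_mono_AE' AE_I2)
    fix w
    have "(\<Sum>k=1..T. bl_dist (piN N k w) (nonlinear_filter \<Upsilon> P \<mu> Y k w)) \<le> (\<Sum>k=1..T. 2)"
      by (intro sum_mono bl_dist_bounds)
    then show "(1 / real T) * (\<Sum>k=1..T. bl_dist (piN N k w) (nonlinear_filter \<Upsilon> P \<mu> Y k w)) \<le> 2"
      by (cases "T = 0") (auto simp: field_simps)
  qed auto
  then show "bl_err N T \<le> 2" using prob_space by simp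
qed

definition test_err :: "('e \<Rightarrow> real) \<Rightarrow> nat \<Rightarrow> nat \<Rightarrow> real" where
  "test_err g N k = (\<integral>w. \<bar>(\<integral>x. g x \<partial>meas_of (piN N k w)) - r k g (Ys w)\<bar> \<partial>\<Omega>)"

text \<open>\<open>r_law\<close> on the whole space: the mean of the exact filter's mass on C is the
  probability of X_k in C, so tightness of the signal bounds the exact filter off compact
  sets.\<close>

lemma integral_r_indicator:
  assumes C[measurable]: "C \<in> sets borel"
  shows "(\<integral>w. r k (indicator C) (Ys w) \<partial>\<Omega>) = measure (distr \<Omega> borel (X k)) C"
    and "integrable \<Omega> (\<lambda>w. r k (indicator C) (Ys w))"
proof -
  interpret prob_space \<Omega> by (rule prob_Omega)
  let ?h = "indicator C :: 'e \<Rightarrow> real"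
  have hb: "\<And>x. 0 \<le> ?h x" "\<And>x. ?h x \<le> 1" by (auto split: split_indicator)
  have "(\<integral>\<^sup>+w. ennreal (?h (X k w)) \<partial>\<Omega>) = (\<integral>\<^sup>+w. ennreal (r k ?h (Ys w)) \<partial>\<Omega>)"
    using r_law[of ?h "\<lambda>_. UNIV" k, OF _ hb] by simp
  moreover have "(\<integral>w. r k ?h (Ys w) \<partial>\<Omega>) = enn2real (\<integral>\<^sup>+w. ennreal (r k ?h (Ys w)) \<partial>\<Omega>)"
    using r_bounds[OF hb] by (intro integral_eq_nn_integral) auto
  moreover have "(\<integral>w. ?h (X k w) \<partial>\<Omega>) = enn2real (\<integral>\<^sup>+w. ennreal (?h (X k w)) \<partial>\<Omega>)"
    by (intro integral_eq_nn_integral) auto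
  moreover have "(\<integral>w. ?h (X k w) \<partial>\<Omega>) = (\<integral>x. ?h x \<partial>distr \<Omega> borel (X k))"
    by (subst integral_distr) auto
  ultimately show "(\<integral>w. r k ?h (Ys w) \<partial>\<Omega>) = measure (distr \<Omega> borel (X k)) C" by simp
  show "integrable \<Omega> (\<lambda>w. r k ?h (Ys w))"
    using r_bounds[OF hb] by (intro integrable_const_bound[where B=1] AE_I2) auto
qed

text \<open>The net is chosen once for all N and k, since the laws of X_k are uniformly tight;
  almost surely \<open>bl_dist_net\<close> then bounds the distance by finitely many test
  errors.\<close>

lemma bl_err_tendsto:
  assumes T: "\<And>N. 1 \<le> T N"
    and te: "\<And>g. continuous_on UNIV g \<Longrightarrow> (\<And>x. 0 \<le> g x \<and> g x \<le> 1) \<Longrightarrow> (\<lambda>N. (\<Sum>k=1..T N. test_err g N k) / real (T N)) \<longlonglongrightarrow> 0"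
  shows "(\<lambda>N. bl_err N (T N)) \<longlonglongrightarrow> 0"
proof (rule LIMSEQ_I)
  fix e :: real assume e: "0 < e"
  interpret prob_space \<Omega> by (rule prob_Omega)
  \<comment> \<open>14\<epsilon> = e/2: 10\<epsilon> from the net and 4 times the mean mass off C,
    which is at most \<epsilon>.\<close>
  define \<epsilon> where "\<epsilon> = e / 28"
  have \<epsilon>: "0 < \<epsilon>" using e by (simp add: \<epsilon>_def)
  obtain \<delta> where \<delta>: "\<delta> \<longlonglongrightarrow> 0" "\<And>j. tvle (\<delta> j) ((push ^^ j) (meas_of \<mu>)) lam"
    using tv_conv[OF fmeas_meas_of measure_meas_of_UNIV(1), of \<mu>] by blast
  obtain C where C: "compact C" "C \<noteq> {}" "\<And>k. 1 - \<epsilon> \<le> measure (distr \<Omega> borel (X k)) C"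
    using X_tight[OF lam(1,2) \<delta> \<epsilon>] by metis
  have Cb[measurable]: "- C \<in> sets borel" using borel_compact[OF C(1)] by auto
  obtain \<F> :: "('e \<Rightarrow> real) set" and \<kappa> :: "'e \<Rightarrow> real" where F: "finite \<F>" and
    c: "\<And>g. g \<in> insert \<kappa> \<F> \<Longrightarrow> continuous_on UNIV g" and b: "\<And>g x. g \<in> insert \<kappa> \<F> \<Longrightarrow> 0 \<le> g x \<and> g x \<le> 1" and
    net: "\<And>\<nu> \<nu>'. bl_dist \<nu> \<nu>' \<le> 2 * (\<Sum>g\<in>\<F>. \<bar>(\<integral>x. g x \<partial>meas_of \<nu>) - (\<integral>x. g x \<partial>meas_of \<nu>')\<bar>) + 10 * \<epsilon> +
       2 * \<bar>(\<integral>x. \<kappa> x \<partial>meas_of \<nu>) - (\<integral>x. \<kappa> x \<partial>meas_of \<nu>')\<bar> + 4 * measure (meas_of \<nu>') (- C)"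
    by (rule bl_dist_net[OF C(1,2) \<epsilon>]) (rule that)
  define d where "d g N k w = \<bar>(\<integral>x. g x \<partial>meas_of (piN N k w)) - r k g (Ys w)\<bar>" for g N k w
  have di: "integrable \<Omega> (d g N k)" if g: "g \<in> insert \<kappa> \<F>" for g N k
    using approx_test.err_integrable[OF approx_testI[OF c[OF g] b[OF g]], of N k] by (simp add: d_def[abs_def])
  have dt: "(\<integral>w. d g N k w \<partial>\<Omega>) = test_err g N k" for g N k by (simp add: d_def test_err_def)
  define B where "B N k w = 2 * (\<Sum>g\<in>\<F>. d g N k w) + 10 * \<epsilon> + 2 * d \<kappa> N k w + 4 * r k (indicator (- C)) (Ys w)" for N k w
  note ri = integral_r_indicator[OF Cb]
  have Bi: "integrable \<Omega> (B N k)" for N k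
    unfolding B_def[abs_def] using di ri(2)
    by (intro Bochner_Integration.integrable_add integrable_mult_right Bochner_Integration.integrable_sum) auto
  have BE: "(\<integral>w. B N k w \<partial>\<Omega>) \<le> 2 * (\<Sum>g\<in>\<F>. test_err g N k) + 14 * \<epsilon> + 2 * test_err \<kappa> N k" for N k
  proof -
    interpret Xk: prob_space "distr \<Omega> borel (X k)" by (rule prob_space_distr) simp
    have m: "measure (distr \<Omega> borel (X k)) (- C) \<le> \<epsilon>"
      using Xk.prob_compl[of C] C(3)[of k] borel_compact[OF C(1)] by (simp add: Compl_eq_Diff_UNIV)
    have s: "integrable \<Omega> (\<lambda>w. \<Sum>g\<in>\<F>. d g N k w)" "(\<integral>w. (\<Sum>g\<in>\<F>. d g N k w) \<partial>\<Omega>) = (\<Sum>g\<in>\<F>. test_err g N k)"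
      using di by (auto simp: dt intro!: Bochner_Integration.integrable_sum)
    have "(\<integral>w. B N k w \<partial>\<Omega>) = 2 * (\<Sum>g\<in>\<F>. test_err g N k) + 10 * \<epsilon> + 2 * test_err \<kappa> N k + 4 * measure (distr \<Omega> borel (X k)) (- C)"
      unfolding B_def using s di[of \<kappa> N k] ri prob_space by (simp add: dt)
    then show ?thesis using m by linarith
  qed
  have AE: "AE w in \<Omega>. \<forall>k. bl_dist (piN N k w) (nonlinear_filter \<Upsilon> P \<mu> Y k w) \<le> B N k w" for N
    using AE_filter_eq
  proof eventually_elim
    case (elim w)
    show ?case
    proof
      fix k
      let ?\<pi> = "nonlinear_filter \<Upsilon> P \<mu> Y k w"
      have g: "(\<integral>x. g x \<partial>meas_of ?\<pi>) = r k g (Ys w)" if "g \<in> insert \<kappa> \<F>" for g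
        using elim borel_measurable_continuous_onI[OF c[OF that]] b[OF that] by blast
      have "(\<integral>x. indicator (- C) x \<partial>meas_of ?\<pi>) = r k (indicator (- C)) (Ys w)"
        using elim[rule_format, of "indicator (- C)" k] Cb by (auto split: split_indicator)
      then have ind: "measure (meas_of ?\<pi>) (- C) = r k (indicator (- C)) (Ys w)"
        by (simp add: prob_meas_D)
      show "bl_dist (piN N k w) ?\<pi> \<le> B N k w"
        using net[of "piN N k w" ?\<pi>] unfolding ind B_def d_def by (simp add: g)
    qed
  qed
  have bound: "bl_err N (T N) \<le> 2 * (\<Sum>g\<in>\<F>. (\<Sum>k=1..T N. test_err g N k) / real (T N)) + 14 * \<epsilon> + 2 * ((\<Sum>k=1..T N. test_err \<kappa> N k) / real (T N))" for N
  proof -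
    have "bl_err N (T N) \<le> (\<integral>w. (1 / real (T N)) * (\<Sum>k=1..T N. B N k w) \<partial>\<Omega>)"
      unfolding bl_err_def
    proof (rule integral_mono_AE')
      show "integrable \<Omega> (\<lambda>w. (1 / real (T N)) * (\<Sum>k=1..T N. B N k w))"
        using Bi by (intro integrable_mult_right Bochner_Integration.integrable_sum)
      show "AE w in \<Omega>. (1 / real (T N)) * (\<Sum>k=1..T N. bl_dist (piN N k w) (nonlinear_filter \<Upsilon> P \<mu> Y k w)) \<le> (1 / real (T N)) * (\<Sum>k=1..T N. B N k w)"
        using AE[of N] by eventually_elim (auto intro!: divide_right_mono sum_mono)
      show "AE w in \<Omega>. 0 \<le> (1 / real (T N)) * (\<Sum>k=1..T N. B N k w)"
        using AE[of N]
      proof eventually_elim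
        case (elim w)
        have "0 \<le> B N k w" for k using elim bl_dist_bounds(1) order_trans by blast
        then show ?case by (intro mult_nonneg_nonneg sum_nonneg) auto
      qed
    qed
    also have "\<dots> = (\<Sum>k=1..T N. \<integral>w. B N k w \<partial>\<Omega>) / real (T N)" using Bi by simp
    also have "\<dots> \<le> (\<Sum>k=1..T N. 2 * (\<Sum>g\<in>\<F>. test_err g N k) + 14 * \<epsilon> + 2 * test_err \<kappa> N k) / real (T N)"
      by (intro divide_right_mono sum_mono BE) simp
    also have "(\<Sum>k=1..T N. 2 * (\<Sum>g\<in>\<F>. test_err g N k) + 14 * \<epsilon> + 2 * test_err \<kappa> N k) =
      2 * (\<Sum>g\<in>\<F>. \<Sum>k=1..T N. test_err g N k) + real (T N) * (14 * \<epsilon>) + 2 * (\<Sum>k=1..T N. test_err \<kappa> N k)"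
      unfolding sum.distrib sum_distrib_left[symmetric] by (subst sum.swap) simp
    also have "\<dots> / real (T N) = 2 * (\<Sum>g\<in>\<F>. (\<Sum>k=1..T N. test_err g N k) / real (T N)) + 14 * \<epsilon> + 2 * ((\<Sum>k=1..T N. test_err \<kappa> N k) / real (T N))"
      using T[of N] by (simp add: add_divide_distrib sum_divide_distrib[symmetric])
    finally show ?thesis .
  qed
  have "(\<lambda>N. 2 * (\<Sum>g\<in>\<F>. (\<Sum>k=1..T N. test_err g N k) / real (T N)) + 14 * \<epsilon> + 2 * ((\<Sum>k=1..T N. test_err \<kappa> N k) / real (T N)))
      \<longlonglongrightarrow> 2 * (\<Sum>g\<in>\<F>. 0) + 14 * \<epsilon> + 2 * 0"
    using c b by (intro tendsto_intros tendsto_sum te) auto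
  then have "\<forall>\<^sub>F N in sequentially. 2 * (\<Sum>g\<in>\<F>. (\<Sum>k=1..T N. test_err g N k) / real (T N)) + 14 * \<epsilon> + 2 * ((\<Sum>k=1..T N. test_err \<kappa> N k) / real (T N)) < e"
    by (rule order_tendstoD(2)) (use e in \<open>simp add: \<epsilon>_def\<close>)
  then obtain N0 where N0: "\<And>N. N \<ge> N0 \<Longrightarrow> 2 * (\<Sum>g\<in>\<F>. (\<Sum>k=1..T N. test_err g N k) / real (T N)) + 14 * \<epsilon> + 2 * ((\<Sum>k=1..T N. test_err \<kappa> N k) / real (T N)) < e"
    unfolding eventually_sequentially by blast
  show "\<exists>N0. \<forall>N\<ge>N0. norm (bl_err N (T N) - 0) < e"
    using bl_err_bounds(1) order.strict_trans1[OF bound N0] by (intro exI[of _ N0]) auto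
qed

lemma bl_err_SUP: "(\<lambda>N. SUP T\<in>{1..}. bl_err N T) \<longlonglongrightarrow> 0"
proof (rule SUP_tendsto_0[OF bl_err_bounds])
  fix T :: nat assume T: "1 \<le> T"
  show "(\<lambda>N. bl_err N T) \<longlonglongrightarrow> 0"
  proof (rule bl_err_tendsto)
    fix g :: "'e \<Rightarrow> real" assume g: "continuous_on UNIV g" "\<And>x. 0 \<le> g x \<and> g x \<le> 1"
    interpret approx_test P \<phi> \<Upsilon> \<Omega> X Y \<mu> \<Phi> lam \<G> piN MN KN g by (rule approx_testI[OF g])
    have "(\<lambda>N. (\<Sum>k=1..T. sq_err N k) / real T) \<longlonglongrightarrow> (\<Sum>k=1..T. 0) / real T"
      using T by (intro tendsto_divide tendsto_sum sq_err_fixed tendsto_const) auto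
    then show "(\<lambda>N. (\<Sum>k=1..T. test_err g N k) / real T) \<longlonglongrightarrow> 0"
      using err_avg[of "\<lambda>_. T"] T by (simp add: err_def test_err_def)
  qed (rule T)
next
  fix T :: "nat \<Rightarrow> nat" assume T: "mono T" "\<And>N. 1 \<le> T N" "filterlim T at_top sequentially"
  show "(\<lambda>N. bl_err N (T N)) \<longlonglongrightarrow> 0"
  proof (rule bl_err_tendsto[OF T(2)])
    fix g :: "'e \<Rightarrow> real" assume g: "continuous_on UNIV g" "\<And>x. 0 \<le> g x \<and> g x \<le> 1"
    interpret approx_test P \<phi> \<Upsilon> \<Omega> X Y \<mu> \<Phi> lam \<G> piN MN KN g by (rule approx_testI[OF g])
    show "(\<lambda>N. (\<Sum>k=1..T N. test_err g N k) / real (T N)) \<longlonglongrightarrow> 0"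
      using err_avg[OF T(2) sq_err_avg[OF T]] by (simp add: err_def test_err_def)
  qed
qed

end

text \<open>Extends a sequence given for N \<ge> 1 to all N; the value at 0 repeats, because 0 - 1 =
  0.\<close>

lemma tendsto_Suc_continuation:
  fixes zs :: "nat \<Rightarrow> 'a::topological_space"
  assumes "zs \<longlonglongrightarrow> z" shows "(\<lambda>N. zs (N - 1)) \<longlonglongrightarrow> z"
  using assms by (subst filterlim_sequentially_Suc[symmetric]) simp

theorem theorem2p2:
  fixes \<Omega> :: "'o measure"
    and P :: "'e::polish_space \<Rightarrow> 'e measure"
    and \<Phi> :: "'e \<Rightarrow> 'f::polish_space measure"
    and \<mu> :: "'e prob_meas"
    and X :: "nat \<Rightarrow> 'o \<Rightarrow> 'e"
    and Y :: "nat \<Rightarrow> 'o \<Rightarrow> 'f"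
    and \<phi> :: "'f measure"
    and \<Upsilon> :: "'e \<Rightarrow> 'f \<Rightarrow> real"
    and \<G> :: "nat \<Rightarrow> 'o measure"
    and piN :: "nat \<Rightarrow> nat \<Rightarrow> 'o \<Rightarrow> 'e prob_meas"
    and KN :: "nat \<Rightarrow> 'e \<times> 'e prob_meas \<Rightarrow> ('e \<times> 'e prob_meas) measure"
    and MN :: "nat \<Rightarrow> ('e \<times> 'e prob_meas) prob_meas"
  assumes "prob_space \<Omega>"
    and "P \<in> borel \<rightarrow>\<^sub>M prob_algebra borel"
    and "\<Phi> \<in> borel \<rightarrow>\<^sub>M prob_algebra borel"
    and hmm: "hidden_markov_model \<Omega> \<mu> P \<Phi> X Y"
    and nondegeneracy: "nondegenerate_observations \<Phi> \<phi> \<Upsilon>"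
    and ergodicity: "ergodic_kernel P"
    and approximation: "\<And>N. N \<ge> 1 \<Longrightarrow> approximate_filter \<Omega> X Y (\<G> N) (piN N) (MN N) (KN N)"
    and one_step: "\<And>(F :: 'e \<times> 'e prob_meas \<Rightarrow> real) xs x \<nu>s \<nu>.
          continuous_on UNIV F \<Longrightarrow> bounded (range F) \<Longrightarrow> xs \<longlonglongrightarrow> x \<Longrightarrow> \<nu>s \<longlonglongrightarrow> \<nu> \<Longrightarrow>
          (\<lambda>N. \<integral>z. F z \<partial>KN N (xs N, \<nu>s N)) \<longlonglongrightarrow> (\<integral>z. F z \<partial>filter_kernel \<Upsilon> \<phi> P (x, \<nu>))"
    and initial: "MN \<longlonglongrightarrow> filter_init \<Upsilon> \<phi> \<mu>"
    and tightness: "\<And>T :: nat \<Rightarrow> nat.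
          mono T \<Longrightarrow> (\<And>N. T N \<ge> 1) \<Longrightarrow> filterlim T at_top sequentially \<Longrightarrow>
          tight_family {mean_occupation \<Omega> (piN N) (T N) | N. N \<ge> 1}"
  shows "(\<lambda>N. SUP T\<in>{1..}.
            \<integral>\<omega>. (1 / real T) * (\<Sum>k=1..T. bl_dist (piN N k \<omega>) (nonlinear_filter \<Upsilon> P \<mu> Y k \<omega>)) \<partial>\<Omega>)
         \<longlonglongrightarrow> 0"
proof -
  obtain \<phi>' \<Upsilon>' where fm: "filter_model P \<phi>' \<Upsilon>'"
    and \<Phi>d: "\<And>x A. A \<in> sets borel \<Longrightarrow> emeasure (\<Phi> x) A = (\<integral>\<^sup>+y\<in>A. ennreal (\<Upsilon>' x y) \<partial>\<phi>')"
    and bu: "bayes_update \<Upsilon>' = (bayes_update \<Upsilon> :: 'f \<Rightarrow> 'e prob_meas \<Rightarrow> 'e prob_meas)"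
    and fk: "filter_kernel \<Upsilon>' \<phi>' P = filter_kernel \<Upsilon> \<phi> P"
    and fi: "\<And>\<mu>. filter_init \<Upsilon>' \<phi>' \<mu> = filter_init \<Upsilon> \<phi> \<mu>"
    by (rule nondegenerate_prob[OF nondegeneracy assms(2,3)]) blast
  interpret filter_model P \<phi>' \<Upsilon>' by (rule fm)
  have nf: "nonlinear_filter \<Upsilon>' P \<mu> Y k = nonlinear_filter \<Upsilon> P \<mu> Y k" for k
    by (induction k) (simp_all add: bu)
  obtain lam where lam: "fmeas lam" "measure lam UNIV = 1" "push lam = lam"
    and tv: "\<And>\<rho>. fmeas \<rho> \<Longrightarrow> measure \<rho> UNIV = 1 \<Longrightarrow> \<exists>\<delta>. \<delta> \<longlonglongrightarrow> 0 \<and> (\<forall>j. tvle (\<delta> j) ((push ^^ j) \<rho>) lam)"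
    by (rule ergodic_tv[OF ergodicity]) blast
  interpret hmm_model P \<phi>' \<Upsilon>' \<Omega> X Y \<mu> \<Phi>
    by (intro hmm_model.intro hmm_model_axioms.intro fm assms(1) hmm assms(3) \<Phi>d)
  \<comment> \<open>The approximation hypothesis holds for N \<ge> 1, hence the index
    \<open>Suc N\<close>.\<close>
  interpret approx_filters P \<phi>' \<Upsilon>' \<Omega> X Y \<mu> \<Phi> lam "\<lambda>N. \<G> (Suc N)" "\<lambda>N. piN (Suc N)" "\<lambda>N. MN (Suc N)" "\<lambda>N. KN (Suc N)"
  proof
    show "approximate_filter \<Omega> X Y (\<G> (Suc N)) (piN (Suc N)) (MN (Suc N)) (KN (Suc N))" for N
      by (rule approximation) simp
    show "(\<lambda>N. MN (Suc N)) \<longlonglongrightarrow> filter_init \<Upsilon>' \<phi>' \<mu>"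
      unfolding fi using initial by (rule filterlim_sequentially_Suc[THEN iffD2])
  next
    fix F :: "'e \<times> 'e prob_meas \<Rightarrow> real" and zs and z :: "'e \<times> 'e prob_meas"
    assume F: "continuous_on UNIV F" "bounded (range F)" and zs: "zs \<longlonglongrightarrow> z"
    have "(\<lambda>N. \<integral>w. F w \<partial>KN N (fst (zs (N - 1)), snd (zs (N - 1)))) \<longlonglongrightarrow> (\<integral>w. F w \<partial>filter_kernel \<Upsilon> \<phi> P (fst z, snd z))"
      by (intro one_step F tendsto_fst tendsto_snd tendsto_Suc_continuation zs)
    from filterlim_sequentially_Suc[THEN iffD2, OF this]
    show "(\<lambda>N. \<integral>w. F w \<partial>KN (Suc N) (zs N)) \<longlonglongrightarrow> (\<integral>w. F w \<partial>filter_kernel \<Upsilon>' \<phi>' P z)"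
      by (simp add: fk)
  next
    fix T :: "nat \<Rightarrow> nat" assume T: "mono T" "\<And>N. 1 \<le> T N" "filterlim T at_top sequentially"
    \<comment> \<open>Tightness is assumed in the original numbering, so T is shifted in the
      opposite direction and T 0 occurs twice.\<close>
    have "mono (\<lambda>N. T (N - 1))" using T(1) by (intro monoI) (auto intro!: monoD[OF T(1)])
    moreover have "filterlim (\<lambda>N. T (N - 1)) at_top sequentially"
      using T(3) by (subst filterlim_sequentially_Suc[symmetric]) simp
    ultimately have "tight_family {mean_occupation \<Omega> (piN N) (T (N - 1)) | N. N \<ge> 1}"
      using T(2) by (intro tightness) auto
    also have "{mean_occupation \<Omega> (piN N) (T (N - 1)) | N. N \<ge> 1} = range (\<lambda>N. mean_occupation \<Omega> (piN (Suc N)) (T N))"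
    proof (intro set_eqI iffI)
      fix m assume "m \<in> {mean_occupation \<Omega> (piN N) (T (N - 1)) | N. N \<ge> 1}"
      then obtain N where "m = mean_occupation \<Omega> (piN N) (T (N - 1))" "N \<ge> 1" by auto
      then show "m \<in> range (\<lambda>N. mean_occupation \<Omega> (piN (Suc N)) (T N))" by (intro image_eqI[of _ _ "N - 1"]) auto
    next
      fix m assume "m \<in> range (\<lambda>N. mean_occupation \<Omega> (piN (Suc N)) (T N))"
      then obtain N where "m = mean_occupation \<Omega> (piN (Suc N)) (T N)" by auto
      then show "m \<in> {mean_occupation \<Omega> (piN N) (T (N - 1)) | N. N \<ge> 1}" by (intro CollectI exI[of _ "Suc N"]) simp
    qed
    finally show "tight_family (range (\<lambda>N. mean_occupation \<Omega> (piN (Suc N)) (T N)))" .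
  qed (fact lam tv)+
  have "(\<lambda>N. SUP T\<in>{1..}.
            \<integral>\<omega>. (1 / real T) * (\<Sum>k=1..T. bl_dist (piN (Suc N) k \<omega>) (nonlinear_filter \<Upsilon> P \<mu> Y k \<omega>)) \<partial>\<Omega>)
         \<longlonglongrightarrow> 0"
    using bl_err_SUP unfolding bl_err_def nf .
  then show ?thesis by (rule filterlim_sequentially_Suc[THEN iffD1])
qed

end
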